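(* Let $m>1$ and $\iota\in\{\pm1\}$. The equation $(\partial_t^2-\Delta)u=\iota|u|^{2m}u$ on $\mathbb{R}^3$ is locally well-posed in $\mathcal{L}^m$: for any (radial) initial data $(u_0,u_1)\in\mathcal{L}^m$ there exists a unique solution $u$ of $$(\partial_t^2-\Delta)u=\iota|u|^{2m}u,\qquad (u,\partial_tu)|_{t=0}=(u_0,u_1),$$ defined on a maximal interval of existence $I_{\max}(u)=(T_-(u),T_+(u))$, such that $\vec u\in C^0(I_{\max}(u),\mathcal{L}^m)$ and $u\in S(J)$ for every compact interval $J\subset I_{\max}(u)$. Furthermore, $$T_+(u)<\infty\ \Longrightarrow\ \|u\|_{S([0,T_+(u)))}=+\infty.$$
   Context: All functions are radial in $x\in\mathbb{R}^3$, $r=|x|$, and $\vec u=(u,\partial_tu)$. The space $\mathcal{L}^m$ is the closure of the pairs of radial, smooth, compactly supported functions on $\mathbb{R}^3$ for the norm $$\|(u_0,u_1)\|_{\mathcal{L}^m}=\Big(\int_0^{+\infty}\big(|r\partial_ru_0|^m+|ru_1|^m\big)\,dr\Big)^{1/m}.$$ For a real interval $I$, $$\|f\|_{S(I)}=\Big(\int_I\Big(\int_0^{+\infty}|f(t,r)|^{(2m+1)m}\,r^m\,dr\Big)^{1/m}dt\Big)^{\frac{1}{2m+1}},$$ and $S(I)$ is the space defined by this norm. Solution means solution of the integral equation $u(t)=S_{\rm L}(t)(u_0,u_1)+\iota\int_0^t\frac{\sin((t-s)\sqrt{-\Delta})}{\sqrt{-\Delta}}\big(|u|^{2m}u\big)(s)\,ds$,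 where $S_{\rm L}(t)(w_0,w_1)=\cos(t\sqrt{-\Delta})w_0+\frac{\sin(t\sqrt{-\Delta})}{\sqrt{-\Delta}}w_1$ is the linear wave propagator. For radial $(w_0,w_1)\in\mathcal{L}^m$ it is given by $S_{\rm L}(t)(w_0,w_1)(r)=\frac1r\big(F(t+r)-F(t-r)\big)$, $F(\sigma)=\frac12\sigma w_0(|\sigma|)+\frac12\int_0^{|\sigma|}\rho\,w_1(\rho)\,d\rho$. *)

theory Defs
  imports "HOL-Analysis.Analysis"
begin

text \<open>
  A radial function on \<open>\<real>\<^sup>3\<close> is represented by its profile, a function of \<open>r = |x|\<close>; only the
  values at \<open>r > 0\<close> matter. All integrals are with respect to the Lebesgue (not merely Borel)
  measure, so that Lebesgue measurable representatives are handled correctly.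
\<close>

primrec Ck :: "nat \<Rightarrow> ('a::euclidean_space \<Rightarrow> real) \<Rightarrow> bool" where
  "Ck 0 f \<longleftrightarrow> continuous_on UNIV f"
| "Ck (Suc k) f \<longleftrightarrow> (\<forall>x. f differentiable (at x)) \<and>
     (\<forall>b\<in>Basis. Ck k (\<lambda>x. frechet_derivative f (at x) b))"

definition smooth :: "('a::euclidean_space \<Rightarrow> real) \<Rightarrow> bool" where
  "smooth f \<longleftrightarrow> (\<forall>k. Ck k f)"

definition radial_test :: "(real \<Rightarrow> real) \<Rightarrow> bool" where
  "radial_test \<phi> \<longleftrightarrow>
     smooth (\<lambda>x::real^3. \<phi> (norm x)) \<and> compact (closure {x::real^3. \<phi> (norm x) \<noteq> 0})"

text \<open>
  \<open>g\<close> is the (weak) radial derivative of \<open>w\<close>. Stated through the fundamental theorem of calculus,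
  this says that \<open>w\<close> is locally absolutely continuous on \<open>(0,\<infinity>)\<close>; in particular \<open>w\<close> is the
  continuous representative of its class. Such a \<open>g\<close> is unique up to null sets.
\<close>

definition has_radial_deriv :: "(real \<Rightarrow> real) \<Rightarrow> (real \<Rightarrow> real) \<Rightarrow> bool" where
  "has_radial_deriv w g \<longleftrightarrow>
     (\<forall>a b. 0 < a \<longrightarrow> a \<le> b \<longrightarrow>
        set_integrable lebesgue {a..b} g \<and> w b - w a = (LINT r:{a..b}|lebesgue. g r))"

definition radial_deriv :: "(real \<Rightarrow> real) \<Rightarrow> real \<Rightarrow> real" where
  "radial_deriv w = (SOME g. has_radial_deriv w g)"

text \<open>Powers with positive exponent on \<open>[0,\<infinity>]\<close>.\<close>

definition ennpowr :: "ennreal \<Rightarrow> real \<Rightarrow> ennreal" where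
  "ennpowr x p = (if x = \<infinity> then \<infinity> else ennreal (enn2real x powr p))"

definition Lm_norm :: "real \<Rightarrow> (real \<Rightarrow> real) \<Rightarrow> (real \<Rightarrow> real) \<Rightarrow> ennreal" where
  "Lm_norm m w0 w1 =
     ennpowr (\<integral>\<^sup>+r\<in>{0<..}. ennreal (\<bar>r * radial_deriv w0 r\<bar> powr m + \<bar>r * w1 r\<bar> powr m) \<partial>lebesgue)
       (1 / m)"

text \<open>
  The closure of the pairs of radial test functions. It is taken inside the pairs \<open>(w0, w1)\<close> with
  \<open>w0\<close> locally absolutely continuous on \<open>(0,\<infinity>)\<close> and vanishing at infinity: without the last
  condition, \<open>Lm_norm\<close> would only be a seminorm (it vanishes on constants). Nothing is lost, since
  by Hoelder's inequality (\<open>m > 1\<close>) a test function satisfies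
  \<open>r powr (1 / m) * \<bar>\<phi> r\<bar> \<le> C * Lm_norm m \<phi> \<psi>\<close>.
\<close>

definition Lm_space :: "real \<Rightarrow> ((real \<Rightarrow> real) \<times> (real \<Rightarrow> real)) set" where
  "Lm_space m = {(w0, w1).
     (\<exists>g. has_radial_deriv w0 g) \<and> (w0 \<longlongrightarrow> 0) at_top \<and>
     w1 \<in> borel_measurable (lebesgue_on {0<..}) \<and>
     (\<forall>\<epsilon>>0. \<exists>\<phi> \<psi>. radial_test \<phi> \<and> radial_test \<psi> \<and>
        Lm_norm m (\<lambda>r. w0 r - \<phi> r) (\<lambda>r. w1 r - \<psi> r) < \<epsilon>)}"

definition S_norm :: "real \<Rightarrow> real set \<Rightarrow> (real \<Rightarrow> real \<Rightarrow> real) \<Rightarrow> ennreal" where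
  "S_norm m I f =
     ennpowr
       (\<integral>\<^sup>+t\<in>I. ennpowr
          (\<integral>\<^sup>+r\<in>{0<..}. ennreal (\<bar>f t r\<bar> powr ((2 * m + 1) * m) * r powr m) \<partial>lebesgue)
          (1 / m) \<partial>lebesgue)
       (1 / (2 * m + 1))"

definition S_space :: "real \<Rightarrow> real set \<Rightarrow> (real \<Rightarrow> real \<Rightarrow> real) set" where
  "S_space m I = {f. (\<lambda>(t, r). f t r) \<in> borel_measurable (lebesgue_on (I \<times> {0<..})) \<and>
     S_norm m I f < \<infinity>}"

definition wave_profile :: "(real \<Rightarrow> real) \<Rightarrow> (real \<Rightarrow> real) \<Rightarrow> real \<Rightarrow> real" where
  "wave_profile w0 w1 \<sigma> =
     \<sigma> * w0 \<bar>\<sigma>\<bar> / 2 + (LINT \<rho>:{0..\<bar>\<sigma>\<bar>}|lebesgue. \<rho> * w1 \<rho>) / 2"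

definition S_L :: "real \<Rightarrow> (real \<Rightarrow> real) \<Rightarrow> (real \<Rightarrow> real) \<Rightarrow> real \<Rightarrow> real" where
  "S_L t w0 w1 r = (wave_profile w0 w1 (t + r) - wave_profile w0 w1 (t - r)) / r"

text \<open>
  The Duhamel operator \<open>sin ((t - s) \<surd>-\<Delta>) / \<surd>-\<Delta>\<close> is \<open>S_L (t - s)\<close> applied to data with
  vanishing first component; the time integral is oriented, so negative times are included.
\<close>

definition integral_equation ::
  "real \<Rightarrow> real \<Rightarrow> real set \<Rightarrow> (real \<Rightarrow> real) \<Rightarrow> (real \<Rightarrow> real) \<Rightarrow> (real \<Rightarrow> real \<Rightarrow> real) \<Rightarrow> bool" where
  "integral_equation m \<iota> I u0 u1 u \<longleftrightarrow>
     (\<forall>t\<in>I. \<forall>r>0. u t r = S_L t u0 u1 r +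
        \<iota> * interval_lebesgue_integral lebesgue (ereal 0) (ereal t)
              (\<lambda>s. S_L (t - s) (\<lambda>\<rho>. 0) (\<lambda>\<rho>. \<bar>u s \<rho>\<bar> powr (2 * m) * u s \<rho>) r))"

text \<open>
  \<open>v = \<partial>\<^sub>t u\<close> on \<open>I\<close> in the sense of distributions on \<open>\<real>\<^sup>3\<close> (\<open>r\<^sup>2\<close> is the radial volume density,
  up to a constant factor). For \<open>(u, v)\<close> continuous in time this is the same as the distributional
  time derivative on space-time.
\<close>

definition has_time_deriv ::
  "real set \<Rightarrow> (real \<Rightarrow> real \<Rightarrow> real) \<Rightarrow> (real \<Rightarrow> real \<Rightarrow> real) \<Rightarrow> bool" where
  "has_time_deriv I u v \<longleftrightarrow>
     (\<forall>\<phi>. radial_test \<phi> \<longrightarrow> (\<forall>t\<in>I.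
        ((\<lambda>t. LINT r:{0<..}|lebesgue. u t r * \<phi> r * r\<^sup>2) has_real_derivative
          (LINT r:{0<..}|lebesgue. v t r * \<phi> r * r\<^sup>2)) (at t within I)))"

definition Lm_continuous_on ::
  "real \<Rightarrow> real set \<Rightarrow> (real \<Rightarrow> real \<Rightarrow> real) \<Rightarrow> (real \<Rightarrow> real \<Rightarrow> real) \<Rightarrow> bool" where
  "Lm_continuous_on m I u v \<longleftrightarrow>
     (\<forall>t\<in>I. (u t, v t) \<in> Lm_space m) \<and>
     (\<forall>t0\<in>I. ((\<lambda>t. Lm_norm m (\<lambda>r. u t r - u t0 r) (\<lambda>r. v t r - v t0 r)) \<longlongrightarrow> 0)
        (at t0 within I))"

definition solution_on ::
  "real \<Rightarrow> real \<Rightarrow> real set \<Rightarrow> (real \<Rightarrow> real) \<Rightarrow> (real \<Rightarrow> real) \<Rightarrow> (real \<Rightarrow> real \<Rightarrow> real) \<Rightarrow> bool" where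
  "solution_on m \<iota> I u0 u1 u \<longleftrightarrow>
     integral_equation m \<iota> I u0 u1 u \<and>
     (\<exists>v. has_time_deriv I u v \<and> Lm_continuous_on m I u v \<and>
        (\<forall>r>0. u 0 r = u0 r) \<and> (AE r in lebesgue. 0 < r \<longrightarrow> v 0 r = u1 r)) \<and>
     (\<forall>a b. {a..b} \<subseteq> I \<longrightarrow> u \<in> S_space m {a..b})"

text \<open>
  \<open>u\<close> is the unique solution, with maximal interval of existence \<open>(T\<^sub>-, T\<^sub>+)\<close>: every solution with the
  same data, on any interval containing \<open>0\<close>, is a restriction of \<open>u\<close>.
\<close>

definition unique_maximal_solution ::
  "real \<Rightarrow> real \<Rightarrow> (real \<Rightarrow> real) \<Rightarrow> (real \<Rightarrow> real) \<Rightarrow> ereal \<Rightarrow> ereal \<Rightarrow> (real \<Rightarrow> real \<Rightarrow> real) \<Rightarrow> bool" where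
  "unique_maximal_solution m \<iota> u0 u1 Tminus Tplus u \<longleftrightarrow>
     Tminus < 0 \<and> 0 < Tplus \<and> solution_on m \<iota> (einterval Tminus Tplus) u0 u1 u \<and>
     (\<forall>J w. is_interval J \<longrightarrow> 0 \<in> J \<longrightarrow> solution_on m \<iota> J u0 u1 w \<longrightarrow>
        J \<subseteq> einterval Tminus Tplus \<and> (\<forall>t\<in>J. \<forall>r>0. w t r = u t r))"

end

theory Submission
  imports Defs "HOL-Computational_Algebra.Polynomial"
begin

text \<open>
  A radial solution is \<open>u (t, r) = (1 / r) \<integral> h\<^sub>t\<close>, the integral being over \<open>[t - r, t + r]\<close>. The free flow leaves
  the profile \<open>h\<close> unchanged, and the source acts by
  \<open>h\<^sub>t (y) = f (y) + \<iota> / 2 \<integral> F (s, y - s) ds\<close>, integrated over \<open>0 \<le> s \<le> t\<close>, where \<open>F (s, z) = z |u|\<^sup>2\<^sup>m u (s, |z|)\<close>.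
  By Hardy's inequality the norm of \<open>(u, \<partial>\<^sub>t u)\<close> is equivalent to the \<open>L\<^sup>m\<close> norm of the profile.

  The Strichartz estimate is then a mixed norm bound for sliding averages of an \<open>L\<^sup>m\<close> function; it is
  proved by splitting the function at height \<open>r powr (- 1 / m)\<close>. Since the mixed norm of the source
  \<open>F\<close> in \<open>L\<^sup>1\<^sub>t L\<^sup>m\<^sub>r\<close> is the power \<open>2 m + 1\<close> of the \<open>S\<close> norm of \<open>u\<close>, the integral equation is a
  contraction on every interval on which the free wave is small in \<open>S\<close>. Gluing such intervals gives
  uniqueness and the maximal solution; a solution with finite \<open>S\<close> norm has a limiting profile and
  can be continued. Negative times reduce to positive ones by \<open>f (y) \<mapsto> f (- y)\<close>.
\<close>

section \<open>Powers on the extended half line and integral inequalities\<close>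

text \<open>The exponents of S are invariant under the scaling of the equation, so a short time
  interval yields no power of its length. The only small quantity is the S norm of a given free wave
  or solution on a short interval; hence the existence time depends on the data themselves and not
  just on their size.

  Norms are kept as \<open>ennreal\<close> integrals, mostly before the final root. This removes
  integrability side conditions at the price of triangle inequalities with a constant, and the
  contraction ratio is chosen small enough to absorb that constant. Completeness of S is replaced by
  convergence of the iterates at every point with \<open>r > 0\<close>, which also suits an equation
  demanded for all \<open>t\<close> and \<open>r\<close>; Fatou's lemma then recovers the norms.

  A competing solution is given as a curve in the energy space. Pointwise decay like
  \<open>r powr (- 1 / m)\<close> makes it jointly continuous for \<open>r > 0\<close>, hence Borel.
  Fubini's theorem replaces differentiation under the integral: the velocity is shown to be a time
  derivative by integrating it.\<close>

abbreviation joint_borel :: "(real \<Rightarrow> real \<Rightarrow> 'a::topological_space) \<Rightarrow> bool" where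
  "joint_borel u \<equiv> case_prod u \<in> borel_measurable (borel \<Otimes>\<^sub>M borel)"

lemma ennreal_cases_pos:
  obtains (zero) "x = 0" | (inf) "x = top" | (pos) a where "0 < a" "x = ennreal a"
proof (cases x)
  case (real r)
  then show thesis using that by (cases "r = 0") auto
qed (use that in blast)

lemma ennpowr_ennreal: "0 \<le> a \<Longrightarrow> ennpowr (ennreal a) p = ennreal (a powr p)"
  by (simp add: ennpowr_def)

lemma ennpowr_top [simp]: "ennpowr top p = top"
  by (simp add: ennpowr_def)

lemma ennpowr_0 [simp]: "ennpowr 0 p = 0"
  by (simp add: ennpowr_def)

lemma ennpowr_1 [simp]: "ennpowr 1 p = 1"
  by (simp add: ennpowr_def)

lemma ennpowr_one [simp]: "ennpowr x 1 = x"
  by (cases x) (auto simp: ennpowr_ennreal)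

lemma ennpowr_mono: "x \<le> y \<Longrightarrow> 0 \<le> p \<Longrightarrow> ennpowr x p \<le> ennpowr y p"
  by (cases x; cases y) (auto simp: ennpowr_ennreal top_unique intro!: ennreal_leI powr_mono2)

lemma ennpowr_eq_0_iff [simp]: "ennpowr x p = 0 \<longleftrightarrow> x = 0"
  by (cases x) (auto simp: ennpowr_ennreal)

lemma ennpowr_eq_top_iff [simp]: "ennpowr x p = top \<longleftrightarrow> x = top"
  by (cases x) (auto simp: ennpowr_ennreal)

lemma ennpowr_less_top_iff [simp]: "ennpowr x p < top \<longleftrightarrow> x < top"
  by (simp add: less_top[symmetric])

lemma ennpowr_mult: "ennpowr (x * y) p = ennpowr x p * ennpowr y p"
proof -
  consider "x = 0" | "y = 0" | "x = top" "y \<noteq> 0" | "y = top" "x \<noteq> 0" | a b where "0 \<le> a" "0 \<le> b" "x = ennreal a" "y = ennreal b"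
    by (cases x; cases y) auto
  then show ?thesis
    by cases (auto simp: ennpowr_ennreal ennreal_mult[symmetric] powr_mult ennreal_top_mult ennreal_mult_top)
qed

lemma ennpowr_ennpowr: "ennpowr (ennpowr x p) q = ennpowr x (p * q)"
  by (cases x) (auto simp: ennpowr_ennreal powr_powr)

lemma ennpowr_add_exponent: "ennpowr x (p + q) = ennpowr x p * ennpowr x q"
  by (cases x) (auto simp: ennpowr_ennreal powr_add ennreal_mult)

lemma measurable_ennpowr [measurable]:
  assumes [measurable]: "f \<in> borel_measurable M"
  shows "(\<lambda>x. ennpowr (f x) p) \<in> borel_measurable M"
  unfolding ennpowr_def by measurable

text \<open>From \<open>x + y \<le> 2 * max x y\<close>. Unlike convexity this also covers exponents
  below 1, and the roots \<open>1 / m\<close> are treated by it too.\<close>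

lemma ennpowr_add_le:
  assumes "0 \<le> p"
  shows "ennpowr (x + y) p \<le> ennreal (2 powr p) * (ennpowr x p + ennpowr y p)"
proof -
  have "x + y \<le> ennreal 2 * max x y"
    by (simp add: mult_2 add_mono)
  then have "ennpowr (x + y) p \<le> ennreal (2 powr p) * ennpowr (max x y) p"
    using ennpowr_mono[OF _ assms] by (metis ennpowr_mult ennpowr_ennreal zero_le_numeral)
  also have "ennpowr (max x y) p \<le> ennpowr x p + ennpowr y p"
    by (auto simp: max_def)
  finally show ?thesis
    by (simp add: mult_left_mono)
qed

lemma ennpowr_le_iff: "0 < p \<Longrightarrow> ennpowr x p \<le> ennpowr y p \<longleftrightarrow> x \<le> y"
  using ennpowr_mono[of x y p] ennpowr_mono[of "ennpowr x p" "ennpowr y p" "1 / p"]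
  by (auto simp: ennpowr_ennpowr)

lemma ennpowr_SUP:
  assumes "0 < p"
  shows "ennpowr (SUP i\<in>I. X i) p = (SUP i\<in>I. ennpowr (X i) p)"
proof (rule antisym)
  have "X i \<le> ennpowr (SUP i\<in>I. ennpowr (X i) p) (1 / p)" if "i \<in> I" for i
  proof -
    have "ennpowr (ennpowr (X i) p) (1 / p) \<le> ennpowr (SUP i\<in>I. ennpowr (X i) p) (1 / p)"
      using assms that by (intro ennpowr_mono SUP_upper) auto
    then show ?thesis using assms by (simp add: ennpowr_ennpowr)
  qed
  then have "ennpowr (SUP i\<in>I. X i) p \<le> ennpowr (ennpowr (SUP i\<in>I. ennpowr (X i) p) (1 / p)) p"
    using assms by (intro ennpowr_mono SUP_least) auto
  then show "ennpowr (SUP i\<in>I. X i) p \<le> (SUP i\<in>I. ennpowr (X i) p)"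
    using assms by (simp add: ennpowr_ennpowr)
  show "(SUP i\<in>I. ennpowr (X i) p) \<le> ennpowr (SUP i\<in>I. X i) p"
    using assms by (intro SUP_least ennpowr_mono SUP_upper) auto
qed

text \<open>Lets Fatou's lemma pass through the inner root of the mixed norm.\<close>

lemma ennpowr_liminf_le:
  fixes X :: "nat \<Rightarrow> ennreal"
  assumes "0 < p"
  shows "ennpowr (liminf X) p \<le> liminf (\<lambda>n. ennpowr (X n) p)"
  unfolding liminf_SUP_INF ennpowr_SUP[OF assms] using assms
  by (intro SUP_mono) (auto intro!: INF_greatest ennpowr_mono INF_lower)

text \<open>
  Jensen's inequality for the weight \<open>a\<close>, up to the constant \<open>2 powr p\<close>: integrate
  \<open>f \<le> c a + c\<^sup>1\<^sup>-\<^sup>p a\<^sup>1\<^sup>-\<^sup>p f\<^sup>p\<close> and optimise over \<open>c > 0\<close>. Where \<open>a\<close> is \<open>0\<close> or \<open>\<infinity>\<close>, the \<open>ennreal\<close> convention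
  for \<open>inverse\<close> is what keeps the pointwise bound true.
\<close>

lemma weighted_jensen:
  fixes f a :: "'a \<Rightarrow> ennreal"
  assumes p: "1 < p" and [measurable]: "f \<in> borel_measurable M" "a \<in> borel_measurable M"
    and A: "0 < A" "(\<integral>\<^sup>+x. a x \<partial>M) \<le> ennreal A"
  shows "ennpowr (\<integral>\<^sup>+x. f x \<partial>M) p \<le> ennreal (2 powr p * A powr (p - 1)) *
    (\<integral>\<^sup>+x. inverse (ennpowr (a x) (p - 1)) * ennpowr (f x) p \<partial>M)"
proof -
  define B where "B = (\<integral>\<^sup>+x. inverse (ennpowr (a x) (p - 1)) * ennpowr (f x) p \<partial>M)"
  have pw: "f x \<le> ennreal c * a x + ennreal (c powr (1 - p)) * (inverse (ennpowr (a x) (p - 1)) * ennpowr (f x) p)"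
    if c: "0 < c" for c x
  proof -
    consider "a x = top" | "f x = 0" | "a x = 0" "f x \<noteq> 0" | "f x = top" "a x \<noteq> 0" "a x \<noteq> top"
      | \<alpha> \<phi> where "0 < \<alpha>" "0 < \<phi>" "a x = ennreal \<alpha>" "f x = ennreal \<phi>"
      by (cases "a x" rule: ennreal_cases_pos; cases "f x" rule: ennreal_cases_pos) auto
    then show ?thesis
    proof cases
      case 5
      have "\<phi> \<le> c * \<alpha> + c powr (1 - p) * (inverse (\<alpha> powr (p - 1)) * \<phi> powr p)"
      \<comment> \<open>Either the first summand dominates alone, or
        \<open>\<phi> / (c * \<alpha>)\<close> exceeds 1 and the second summand is \<phi> times a
        power of that ratio.\<close>
      proof (cases "\<phi> \<le> c * \<alpha>")
        case False
        have "c powr (1 - p) * (inverse (\<alpha> powr (p - 1)) * \<phi> powr p) = \<phi> * (\<phi> / (c * \<alpha>)) powr (p - 1)"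
          using 5 c p by (simp add: powr_divide powr_mult powr_diff field_simps)
        moreover have "1 \<le> (\<phi> / (c * \<alpha>)) powr (p - 1)"
          using False 5 c p by (intro ge_one_powr_ge_zero) auto
        ultimately have "\<phi> \<le> c powr (1 - p) * (inverse (\<alpha> powr (p - 1)) * \<phi> powr p)"
          using 5 by (simp add: mult_le_cancel_left1)
        then show ?thesis using c 5 by (smt (verit) mult_pos_pos)
      next
        case True
        moreover have "0 \<le> c powr (1 - p) * (inverse (\<alpha> powr (p - 1)) * \<phi> powr p)" by simp
        ultimately show ?thesis by linarith
      qed
      from ennreal_leI[OF this] show ?thesis
        using 5 c by (simp add: ennpowr_ennreal inverse_ennreal ennreal_mult)
    next
      case 1
      then show ?thesis using c by (simp add: ennreal_mult_top)
    next
      case 2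
      then show ?thesis by simp
    next
      case 3
      then show ?thesis using c by (simp add: ennreal_mult_top ennreal_top_mult)
    next
      case 4
      then have "inverse (ennpowr (a x) (p - 1)) \<noteq> 0" by simp
      with 4 c show ?thesis by (simp add: ennreal_mult_top)
    qed
  qed
  have int: "(\<integral>\<^sup>+x. f x \<partial>M) \<le> ennreal (c * A) + ennreal (c powr (1 - p)) * B" if c: "0 < c" for c
  proof -
    have "(\<integral>\<^sup>+x. f x \<partial>M) \<le> (\<integral>\<^sup>+x. ennreal c * a x + ennreal (c powr (1 - p)) * (inverse (ennpowr (a x) (p - 1)) * ennpowr (f x) p) \<partial>M)"
      by (intro nn_integral_mono pw c)
    also have "\<dots> = ennreal c * (\<integral>\<^sup>+x. a x \<partial>M) + ennreal (c powr (1 - p)) * B"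
      unfolding B_def by (simp add: nn_integral_add nn_integral_cmult)
    also have "\<dots> \<le> ennreal c * ennreal A + ennreal (c powr (1 - p)) * B"
      by (intro add_mono mult_left_mono A) auto
    finally show ?thesis using c A by (simp add: ennreal_mult)
  qed
  consider "B = top" | "B = 0" | b where "0 < b" "B = ennreal b"
    by (cases B rule: ennreal_cases_pos)
  then have "ennpowr (\<integral>\<^sup>+x. f x \<partial>M) p \<le> ennreal (2 powr p * A powr (p - 1)) * B"
  proof cases
    case 1
    then show ?thesis using A by (simp add: ennreal_mult_top)
  next
    case 2
    \<comment> \<open>With \<open>B = 0\<close> only the term \<open>c * A\<close> is left, and
      \<open>c\<close> is free: the choice \<open>e / A\<close> makes it arbitrarily small.\<close>
    have le: "(\<integral>\<^sup>+x. f x \<partial>M) \<le> 0 + ennreal e" if "0 < e" for e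
      using int[of "e / A"] that A 2 by simp
    have "(\<integral>\<^sup>+x. f x \<partial>M) \<le> 0"
      by (rule ennreal_le_epsilon) (rule le)
    then have "(\<integral>\<^sup>+x. f x \<partial>M) = 0" by simp
    then show ?thesis by (simp only: ennpowr_0 zero_le)
  next
    case 3
    \<comment> \<open>This value makes both terms of the bound equal to \<open>c * A\<close>, which
      explains the factor \<open>2 powr p\<close>.\<close>
    define c where "c = (b / A) powr (1 / p)"
    have c: "0 < c" using 3 A by (simp add: c_def)
    have e1: "c powr (1 - p) * b = c * A"
    proof -
      have "c powr p = b / A" using 3 A p by (simp add: c_def powr_powr)
      then show ?thesis using c A 3 by (simp add: powr_diff)
    qed
    have "(\<integral>\<^sup>+x. f x \<partial>M) \<le> ennreal (2 * (c * A))"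
    proof -
      have "ennreal (c powr (1 - p)) * B = ennreal (c * A)"
        unfolding e1[symmetric] using 3 by (simp add: ennreal_mult)
      then have "(\<integral>\<^sup>+x. f x \<partial>M) \<le> ennreal (c * A) + ennreal (c * A)"
        using int[OF c] by simp
      also have "\<dots> = ennreal (2 * (c * A))"
        using c A by (subst ennreal_plus[symmetric]) auto
      finally show ?thesis .
    qed
    then have "ennpowr (\<integral>\<^sup>+x. f x \<partial>M) p \<le> ennreal ((2 * (c * A)) powr p)"
      using ennpowr_mono[of _ "ennreal (2 * (c * A))" p] p c A by (simp add: ennpowr_ennreal)
    also have "(2 * (c * A)) powr p = 2 powr p * A powr (p - 1) * b"
      using 3 A p by (simp add: c_def powr_mult powr_powr powr_divide powr_diff)
    finally show ?thesis using 3 by (simp add: ennreal_mult)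
  qed
  then show ?thesis by (simp add: B_def)
qed

text \<open>Jensen in \<open>s\<close>, with the \<open>L\<^sup>m\<close> norm of the slice as
  weight, whose total mass is at most \<open>A\<close>. After Tonelli a slice contributes
  \<open>a powr (1 - m) * a powr m = a\<close>, so the classical inequality results with the
  constant 2 instead of 1.\<close>

lemma minkowski_integral:
  fixes h :: "real \<Rightarrow> real \<Rightarrow> ennreal"
  assumes m: "1 < m" and [measurable]: "joint_borel h"
    and A: "0 < A" "(\<integral>\<^sup>+s. ennpowr (\<integral>\<^sup>+x. ennpowr (h s x) m \<partial>lborel) (1 / m) \<partial>lborel) \<le> ennreal A"
  shows "(\<integral>\<^sup>+x. ennpowr (\<integral>\<^sup>+s. h s x \<partial>lborel) m \<partial>lborel) \<le> ennreal ((2 * A) powr m)"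
proof -
  define a where "a = (\<lambda>s. ennpowr (\<integral>\<^sup>+x. ennpowr (h s x) m \<partial>lborel) (1 / m))"
  have [measurable]: "a \<in> borel_measurable borel" unfolding a_def by measurable
  have "(\<integral>\<^sup>+x. ennpowr (\<integral>\<^sup>+s. h s x \<partial>lborel) m \<partial>lborel)
    \<le> (\<integral>\<^sup>+x. ennreal (2 powr m * A powr (m - 1)) * (\<integral>\<^sup>+s. inverse (ennpowr (a s) (m - 1)) * ennpowr (h s x) m \<partial>lborel) \<partial>lborel)"
    using A m by (intro nn_integral_mono weighted_jensen) (auto simp: a_def)
  also have "\<dots> = ennreal (2 powr m * A powr (m - 1)) * (\<integral>\<^sup>+x. \<integral>\<^sup>+s. inverse (ennpowr (a s) (m - 1)) * ennpowr (h s x) m \<partial>lborel \<partial>lborel)"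
    by (intro nn_integral_cmult) measurable
  also have "(\<integral>\<^sup>+x. \<integral>\<^sup>+s. inverse (ennpowr (a s) (m - 1)) * ennpowr (h s x) m \<partial>lborel \<partial>lborel)
    = (\<integral>\<^sup>+s. \<integral>\<^sup>+x. inverse (ennpowr (a s) (m - 1)) * ennpowr (h s x) m \<partial>lborel \<partial>lborel)"
    by (intro lborel_pair.Fubini') measurable
  also have "\<dots> = (\<integral>\<^sup>+s. inverse (ennpowr (a s) (m - 1)) * ennpowr (a s) m \<partial>lborel)"
    using m by (simp add: nn_integral_cmult) (simp add: a_def ennpowr_ennpowr)
  \<comment> \<open>Only an inequality: where \<open>a s\<close> is \<infinity>, its inverse is 0
    and so is the product on the left.\<close>
  also have "\<dots> \<le> (\<integral>\<^sup>+s. a s \<partial>lborel)"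
  proof (intro nn_integral_mono)
    fix s
    consider "a s = 0" | "a s = top" | \<alpha> where "0 < \<alpha>" "a s = ennreal \<alpha>"
      by (cases "a s" rule: ennreal_cases_pos)
    then show "inverse (ennpowr (a s) (m - 1)) * ennpowr (a s) m \<le> a s"
    proof cases
      case 3
      then have "inverse (\<alpha> powr (m - 1)) * \<alpha> powr m = \<alpha>"
        by (simp add: powr_diff)
      then show ?thesis
        using 3 by (simp add: ennpowr_ennreal inverse_ennreal ennreal_mult[symmetric])
    qed auto
  qed
  also have "\<dots> \<le> ennreal A" using A by (simp add: a_def)
  finally have "(\<integral>\<^sup>+x. ennpowr (\<integral>\<^sup>+s. h s x \<partial>lborel) m \<partial>lborel) \<le> ennreal (2 powr m * A powr (m - 1)) * ennreal A"
    by (simp add: mult_left_mono)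
  also have "\<dots> = ennreal ((2 * A) powr m)"
    using A by (simp add: ennreal_mult[symmetric] powr_mult powr_diff)
  finally show ?thesis .
qed

section \<open>Power integrals and sliding windows\<close>

lemma nn_integral_powr_from_0:
  assumes "-1 < e" "0 \<le> R"
  shows "(\<integral>\<^sup>+r\<in>{0<..R}. ennreal (r powr e) \<partial>lborel) = ennreal (R powr (e + 1) / (e + 1))"
proof -
  have "((\<lambda>x. if x \<in> {0..R} then x powr e else 0) has_integral (R powr (e + 1) / (e + 1))) UNIV"
    using has_integral_powr_from_0[OF assms] by (simp only: has_integral_restrict_UNIV)
  from nn_integral_has_integral_lborel[OF _ _ this]
  have "(\<integral>\<^sup>+x. ennreal (if x \<in> {0..R} then x powr e else 0) \<partial>lborel) = ennreal (R powr (e + 1) / (e + 1))"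
    by simp
  moreover have "ennreal (if x \<in> {0..R} then x powr e else 0) = ennreal (x powr e) * indicator {0<..R} x" for x :: real
    by (auto simp: indicator_def)
  ultimately show ?thesis by simp
qed

lemma nn_integral_powr_to_inf:
  assumes "e < -1" "0 < R"
  shows "(\<integral>\<^sup>+r\<in>{R<..}. ennreal (r powr e) \<partial>lborel) = ennreal (R powr (e + 1) / (- e - 1))"
proof -
  have "((\<lambda>x. if x \<in> {R..} then x powr e else 0) has_integral (- (R powr (e + 1)) / (e + 1))) UNIV"
    using has_integral_powr_to_inf[OF assms] by (simp only: has_integral_restrict_UNIV)
  from nn_integral_has_integral_lborel[OF _ _ this]
  have "(\<integral>\<^sup>+x. ennreal (if x \<in> {R..} then x powr e else 0) \<partial>lborel) = ennreal (R powr (e + 1) / (- e - 1))"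
    using assms by (simp add: field_simps)
  moreover have "(\<integral>\<^sup>+x. ennreal (if x \<in> {R..} then x powr e else 0) \<partial>lborel) = (\<integral>\<^sup>+r\<in>{R<..}. ennreal (r powr e) \<partial>lborel)"
  proof (rule nn_integral_cong_AE)
    show "AE x in lborel. ennreal (if x \<in> {R..} then x powr e else 0) = ennreal (x powr e) * indicator {R<..} x"
      using AE_lborel_singleton[of R] by eventually_elim (auto simp: indicator_def)
  qed
  ultimately show ?thesis by simp
qed

text \<open>Turns a moving interval into one centred at 0 and evaluated at a shifted point, a form
  in which joint measurability in \<open>t\<close> and \<open>y\<close> is found
  automatically.\<close>

lemma indicator_shift: "indicator {t - r..t + r} y = (indicator {- r..r} (y - t) :: 'a::zero_neq_one)" for t :: real
  by (auto simp: indicator_def)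

text \<open>Tonelli: a point \<open>y\<close> is seen by the windows with \<open>t\<close> in
  \<open>[y - r, y + r]\<close>, a set of length \<open>2 * r\<close>.\<close>

lemma nn_integral_sliding:
  fixes g :: "real \<Rightarrow> ennreal"
  assumes [measurable]: "g \<in> borel_measurable borel" and "0 \<le> r"
  shows "(\<integral>\<^sup>+t. (\<integral>\<^sup>+y\<in>{t - r..t + r}. g y \<partial>lborel) \<partial>lborel) = ennreal (2 * r) * (\<integral>\<^sup>+y. g y \<partial>lborel)"
proof -
  have "(\<integral>\<^sup>+t. (\<integral>\<^sup>+y\<in>{t - r..t + r}. g y \<partial>lborel) \<partial>lborel) = (\<integral>\<^sup>+y. \<integral>\<^sup>+t. g y * indicator {t - r..t + r} y \<partial>lborel \<partial>lborel)"
    unfolding indicator_shift by (intro lborel_pair.Fubini') measurable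
  also have "\<dots> = (\<integral>\<^sup>+y. g y * (\<integral>\<^sup>+t. indicator {y - r..y + r} t \<partial>lborel) \<partial>lborel)"
    by (subst nn_integral_cmult[symmetric]) (auto intro!: nn_integral_cong simp: indicator_def)
  also have "\<dots> = (\<integral>\<^sup>+y. ennreal (2 * r) * g y \<partial>lborel)"
    using assms by (simp add: mult.commute)
  finally show ?thesis by (simp add: nn_integral_cmult)
qed

section \<open>Sliding averages and the Strichartz estimate\<close>

definition slide :: "(real \<Rightarrow> ennreal) \<Rightarrow> real \<Rightarrow> real \<Rightarrow> ennreal" where
  "slide G t r = (\<integral>\<^sup>+y\<in>{t - r..t + r}. G y \<partial>lborel)"

text \<open>The S norm over the whole time line to the power \<open>2 * m + 1\<close>. Without the
  last root it is an iterated integral, and a restriction in time becomes an indicator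
  inside.\<close>

definition S_int :: "real \<Rightarrow> (real \<Rightarrow> real \<Rightarrow> ennreal) \<Rightarrow> ennreal" where
  "S_int m B = (\<integral>\<^sup>+t. ennpowr (\<integral>\<^sup>+r\<in>{0<..}. ennpowr (B t r) ((2 * m + 1) * m) * ennreal (r powr m) \<partial>lborel) (1 / m) \<partial>lborel)"

lemma measurable_slide [measurable]:
  assumes [measurable]: "G \<in> borel_measurable borel" "f \<in> borel_measurable M" "g \<in> borel_measurable M"
  shows "(\<lambda>x. slide G (f x) (g x)) \<in> borel_measurable M"
  unfolding slide_def indicator_def atLeastAtMost_iff by measurable

lemma slide_mono: "(\<And>y. G y \<le> H y) \<Longrightarrow> r \<le> s \<Longrightarrow> slide G t r \<le> slide H t s"
  unfolding slide_def by (intro nn_integral_mono mult_mono) (auto simp: indicator_def)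

lemma slide_le_nn_integral: "slide G t r \<le> (\<integral>\<^sup>+y. G y \<partial>lborel)"
  unfolding slide_def by (intro nn_integral_mono) (auto simp: indicator_def)

lemma nn_integral_slide:
  "G \<in> borel_measurable borel \<Longrightarrow> 0 \<le> r \<Longrightarrow> (\<integral>\<^sup>+t. slide G t r \<partial>lborel) = ennreal (2 * r) * (\<integral>\<^sup>+y. G y \<partial>lborel)"
  unfolding slide_def by (rule nn_integral_sliding)

lemma slide_cmult: "G \<in> borel_measurable borel \<Longrightarrow> slide (\<lambda>y. c * G y) t r = c * slide G t r"
  unfolding slide_def by (simp add: mult.assoc nn_integral_cmult)

lemma slide_add:
  "G \<in> borel_measurable borel \<Longrightarrow> H \<in> borel_measurable borel \<Longrightarrow> slide (\<lambda>y. G y + H y) t r = slide G t r + slide H t r"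
  unfolding slide_def by (simp add: distrib_right nn_integral_add)

text \<open>The weight in \<open>weighted_jensen\<close> is the indicator of the window, of mass
  \<open>2 * r\<close>. Outside the window its inverse is \<infinity>, but it meets the value
  0.\<close>

lemma slide_jensen:
  assumes p: "1 < p" and [measurable]: "G \<in> borel_measurable borel" and r: "0 < r"
  shows "ennpowr (slide G t r) p \<le> ennreal (2 powr p * (2 * r) powr (p - 1)) * slide (\<lambda>y. ennpowr (G y) p) t r"
proof -
  have "ennpowr (slide G t r) p \<le> ennreal (2 powr p * (2 * r) powr (p - 1)) *
    (\<integral>\<^sup>+y. inverse (ennpowr (indicator {t - r..t + r} y) (p - 1)) * ennpowr (G y * indicator {t - r..t + r} y) p \<partial>lborel)"
    unfolding slide_def using p r by (intro weighted_jensen) auto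
  also have "(\<integral>\<^sup>+y. inverse (ennpowr (indicator {t - r..t + r} y) (p - 1)) * ennpowr (G y * indicator {t - r..t + r} y) p \<partial>lborel)
    = slide (\<lambda>y. ennpowr (G y) p) t r"
    unfolding slide_def by (intro nn_integral_cong) (auto simp: indicator_def)
  finally show ?thesis .
qed

text \<open>The power of \<open>r\<close> is that of Hoelder's inequality on a window of length
  \<open>2 * r\<close>. Divided by \<open>r\<close> it is the pointwise decay
  \<open>r powr (- 1 / m)\<close> of waves, from which convergence at every point is
  obtained.\<close>

lemma slide_bound:
  assumes m: "1 < m" and [measurable]: "G \<in> borel_measurable borel" and r: "0 < r" and "0 < \<Lambda>"
    and G: "(\<integral>\<^sup>+y. ennpowr (G y) m \<partial>lborel) \<le> ennreal (\<Lambda> powr m)"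
  shows "slide G t r \<le> ennreal (4 * r powr (1 - 1 / m) * \<Lambda>)"
proof -
  have "ennpowr (slide G t r) m \<le> ennreal (2 powr m * (2 * r) powr (m - 1)) * ennreal (\<Lambda> powr m)"
    by (rule order_trans[OF slide_jensen[OF m _ r]])
      (auto intro!: mult_left_mono order_trans[OF slide_le_nn_integral G])
  also have "\<dots> = ennreal ((2 * (2 * r) powr (1 - 1 / m) * \<Lambda>) powr m)"
    using m r assms(4) by (simp add: powr_mult powr_powr ennreal_mult[symmetric] right_diff_distrib left_diff_distrib)
  also have "\<dots> = ennpowr (ennreal (2 * (2 * r) powr (1 - 1 / m) * \<Lambda>)) m"
    using assms(4) by (simp add: ennpowr_ennreal)
  finally have "slide G t r \<le> ennreal (2 * (2 * r) powr (1 - 1 / m) * \<Lambda>)"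
    using m by (subst (asm) ennpowr_le_iff) auto
  also have "2 * (2 * r) powr (1 - 1 / m) * \<Lambda> \<le> 4 * r powr (1 - 1 / m) * \<Lambda>"
  proof -
    have "(2::real) powr (1 - 1 / m) \<le> 2 powr 1" using m by (intro powr_mono) auto
    then show ?thesis using assms(4) r by (simp add: powr_mult mult_right_mono)
  qed
  finally show ?thesis by (simp add: ennreal_leI)
qed

text \<open>For \<open>r > 0\<close> the condition on \<gamma> means
  \<open>r > \<gamma> powr (- m)\<close>. The exponent \<open>1 / m - 2\<close> lies below -1
  because \<open>m > 1\<close>, so the tail integral converges, and scaling turns it into a multiple
  of \<open>\<gamma> powr m\<close>.\<close>

lemma level_integral_above:
  assumes "1 < m"
  shows "(\<integral>\<^sup>+r\<in>{0<..}. ennreal (r powr (1 / m - 2)) * (if ennreal (r powr (- 1 / m)) < \<gamma> then \<gamma> else 0) \<partial>lborel)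
    \<le> ennreal (m / (m - 1)) * ennpowr \<gamma> m"
proof (cases \<gamma> rule: ennreal_cases_pos)
  case (pos a)
  have iff: "r powr (- 1 / m) < a \<longleftrightarrow> a powr (- m) < r" if "0 < r" for r
  proof
    assume "r powr (- 1 / m) < a"
    then have "a powr (- m) < (r powr (- 1 / m)) powr (- m)"
      using assms that by (intro powr_less_mono2_neg) auto
    then show "a powr (- m) < r" using assms that by (simp add: powr_powr)
  next
    assume "a powr (- m) < r"
    then have "r powr (- 1 / m) < (a powr (- m)) powr (- 1 / m)"
      using assms pos by (intro powr_less_mono2_neg) auto
    then show "r powr (- 1 / m) < a" using assms pos by (simp add: powr_powr)
  qed
  have "(\<integral>\<^sup>+r\<in>{0<..}. ennreal (r powr (1 / m - 2)) * (if ennreal (r powr (- 1 / m)) < \<gamma> then \<gamma> else 0) \<partial>lborel)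
    = (\<integral>\<^sup>+r. ennreal a * (ennreal (r powr (1 / m - 2)) * indicator {a powr (- m)<..} r) \<partial>lborel)"
  proof (intro nn_integral_cong)
    fix r :: real
    have "a powr (- m) < r \<Longrightarrow> 0 < r" using pos by (smt (verit) powr_ge_zero)
    then show "ennreal (r powr (1 / m - 2)) * (if ennreal (r powr (- 1 / m)) < \<gamma> then \<gamma> else 0) * indicator {0<..} r
      = ennreal a * (ennreal (r powr (1 / m - 2)) * indicator {a powr (- m)<..} r)"
      using pos iff[of r] by (auto simp: indicator_def ennreal_less_iff mult.commute)
  qed
  also have "\<dots> = ennreal a * ennreal ((a powr (- m)) powr (1 / m - 2 + 1) / (- (1 / m - 2) - 1))"
  proof (subst nn_integral_cmult)
    have "1 / m - 2 < -1" "0 < a powr (- m)" using assms pos by (auto simp: field_simps)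
    from nn_integral_powr_to_inf[OF this]
    show "ennreal a * (\<integral>\<^sup>+r\<in>{a powr (- m)<..}. ennreal (r powr (1 / m - 2)) \<partial>lborel)
      = ennreal a * ennreal ((a powr (- m)) powr (1 / m - 2 + 1) / (- (1 / m - 2) - 1))" by simp
  qed measurable
  also have "\<dots> = ennreal (a * ((a powr (- m)) powr (1 / m - 2 + 1) / (- (1 / m - 2) - 1)))"
    using pos by (subst ennreal_mult') auto
  also have "a * ((a powr (- m)) powr (1 / m - 2 + 1) / (- (1 / m - 2) - 1)) = m / (m - 1) * a powr m"
  proof -
    have "(a powr (- m)) powr (1 / m - 2 + 1) = a powr (m - 1)"
      using assms by (simp add: powr_powr algebra_simps)
    moreover have "a * a powr (m - 1) = a powr m" using pos by (simp add: powr_diff)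
    moreover have "- (1 / m - 2) - 1 = (m - 1) / m" using assms by (simp add: field_simps)
    ultimately show ?thesis using assms by (simp add: field_simps)
  qed
  finally show ?thesis
    using pos assms by (simp add: ennpowr_ennreal ennreal_mult[symmetric])
qed (use assms in \<open>auto simp: ennreal_mult_top\<close>)

text \<open>The complementary radii are \<open>0 < r \<le> \<gamma> powr (- m)\<close>, where the
  exponent \<open>1 / m > -1\<close> gives convergence at the origin; the primitive brings a factor
  \<open>1 / (1 / m + 1) \<le> 1\<close>.\<close>

lemma level_integral_below:
  assumes "1 < m"
  shows "(\<integral>\<^sup>+r\<in>{0<..}. ennreal (r powr (1 / m)) * ennpowr (if ennreal (r powr (- 1 / m)) < \<gamma> then 0 else \<gamma>) (2 * m + 1) \<partial>lborel)
    \<le> ennpowr \<gamma> m"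
proof (cases \<gamma> rule: ennreal_cases_pos)
  case (pos a)
  have le: "r \<le> a powr (- m)" if "0 < r" "a \<le> r powr (- 1 / m)" for r
  proof -
    have "(r powr (- 1 / m)) powr (- m) \<le> a powr (- m)"
      using assms that pos by (intro powr_mono2') auto
    then show ?thesis using assms that by (simp add: powr_powr)
  qed
  have "(\<integral>\<^sup>+r\<in>{0<..}. ennreal (r powr (1 / m)) * ennpowr (if ennreal (r powr (- 1 / m)) < \<gamma> then 0 else \<gamma>) (2 * m + 1) \<partial>lborel)
    \<le> (\<integral>\<^sup>+r. ennreal (a powr (2 * m + 1)) * (ennreal (r powr (1 / m)) * indicator {0<..a powr (- m)} r) \<partial>lborel)"
  proof (intro nn_integral_mono)
    fix r :: real
    show "ennreal (r powr (1 / m)) * ennpowr (if ennreal (r powr (- 1 / m)) < \<gamma> then 0 else \<gamma>) (2 * m + 1) * indicator {0<..} r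
      \<le> ennreal (a powr (2 * m + 1)) * (ennreal (r powr (1 / m)) * indicator {0<..a powr (- m)} r)"
      using pos le[of r] by (auto simp: indicator_def ennreal_less_iff not_less ennpowr_ennreal mult.commute)
  qed
  also have "\<dots> = ennreal (a powr (2 * m + 1)) * ennreal ((a powr (- m)) powr (1 / m + 1) / (1 / m + 1))"
  proof (subst nn_integral_cmult)
    have "0 < 1 / m" using assms by simp
    then have "-1 < 1 / m" "0 \<le> a powr (- m)" by (linarith, simp)
    from nn_integral_powr_from_0[OF this]
    show "ennreal (a powr (2 * m + 1)) * (\<integral>\<^sup>+r\<in>{0<..a powr (- m)}. ennreal (r powr (1 / m)) \<partial>lborel)
      = ennreal (a powr (2 * m + 1)) * ennreal ((a powr (- m)) powr (1 / m + 1) / (1 / m + 1))" by simp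
  qed measurable
  also have "\<dots> = ennreal (a powr (2 * m + 1) * ((a powr (- m)) powr (1 / m + 1) / (1 / m + 1)))"
    using pos by (subst ennreal_mult') auto
  also have "\<dots> \<le> ennreal (a powr m)"
  proof (intro ennreal_leI)
    have "(a powr (- m)) powr (1 / m + 1) = a powr (- 1 - m)"
      using assms by (simp add: powr_powr algebra_simps)
    then have "a powr (2 * m + 1) * ((a powr (- m)) powr (1 / m + 1) / (1 / m + 1)) = a powr m / (1 / m + 1)"
      by (simp add: powr_add[symmetric])
    also have "\<dots> \<le> a powr m / 1"
      using assms by (intro divide_left_mono) (auto intro!: add_pos_pos)
    finally show "a powr (2 * m + 1) * ((a powr (- m)) powr (1 / m + 1) / (1 / m + 1)) \<le> a powr m" by simp
  qed
  finally show ?thesis using pos by (simp add: ennpowr_ennreal)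
qed (use assms in auto)

text \<open>
  The \<open>L\<^sup>m\<close> bound for the averages would follow from Young's inequality with a logarithmic loss;
  splitting \<open>G\<close> at height \<open>r powr (- 1 / m)\<close> and using \<open>L\<^sup>1\<close> above and \<open>L\<^sup>2\<^sup>m\<^sup>+\<^sup>1\<close> below makes the
  integral in \<open>r\<close> converge. This replaces the maximal function.
\<close>

lemma sliding_averages_unit:
  fixes m :: real
  assumes m: "1 < m" and G[measurable]: "G \<in> borel_measurable borel"
    and G1: "(\<integral>\<^sup>+y. ennpowr (G y) m \<partial>lborel) \<le> 1"
  shows "(\<integral>\<^sup>+t. (\<integral>\<^sup>+r\<in>{0<..}. ennpowr (slide G t r) (2 * m + 1) * ennreal (r powr (1 / m - 1 - 2 * m)) \<partial>lborel) \<partial>lborel)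
    \<le> ennreal (2 powr (2 * m + 1) * (2 + 4 powr (2 * m + 1)) * (m / (m - 1) + 1))"
proof -
  define q where "q = 2 * m + 1"
  define c where "c = 2 powr q * (2 + 4 powr q)"
  have q: "1 < q" using m by (simp add: q_def)
  have c: "0 \<le> c" by (simp add: c_def)
  define H1 where "H1 = (\<lambda>r y. if ennreal (r powr (- 1 / m)) < G y then G y else 0)"
  define H2 where "H2 = (\<lambda>r y. if ennreal (r powr (- 1 / m)) < G y then 0 else G y)"
  have [measurable]: "joint_borel H1" "joint_borel H2"
    unfolding H1_def H2_def by measurable
  have slice: "(\<integral>\<^sup>+t. ennpowr (slide G t r) q * ennreal (r powr (1 / m - q)) \<partial>lborel)
      \<le> ennreal c * (\<integral>\<^sup>+y. ennreal (r powr (1 / m - 2)) * H1 r y + ennreal (r powr (1 / m)) * ennpowr (H2 r y) q \<partial>lborel)"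
    if r: "0 < r" for r
  proof -
    define N where "N = (\<integral>\<^sup>+y. H1 r y \<partial>lborel)"
    define P where "P = (\<integral>\<^sup>+y. ennpowr (H2 r y) q \<partial>lborel)"
    \<comment> \<open>Where \<open>H1\<close> does not vanish, \<open>G y * r powr (1 / m)\<close>
      exceeds 1, so its power \<open>m - 1\<close> can be inserted: above the cut the
      \<open>L\<^sup>1\<close> mass is controlled by the \<open>L\<^sup>m\<close> norm.\<close>
    have "N \<le> (\<integral>\<^sup>+y. ennreal (r powr ((m - 1) / m)) * ennpowr (G y) m \<partial>lborel)"
      unfolding N_def
    proof (intro nn_integral_mono)
      fix y
      show "H1 r y \<le> ennreal (r powr ((m - 1) / m)) * ennpowr (G y) m"
      proof (cases "G y" rule: ennreal_cases_pos)
        case (pos a)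
        have "a \<le> r powr ((m - 1) / m) * a powr m" if "r powr (- 1 / m) < a"
        proof -
          have "1 \<le> (a / r powr (- 1 / m)) powr (m - 1)"
            using that r m by (intro ge_one_powr_ge_zero) auto
          also have "a / r powr (- 1 / m) = a * r powr (1 / m)"
            using r by (simp add: powr_minus_divide)
          also have "\<dots> powr (m - 1) = a powr (m - 1) * r powr ((m - 1) / m)"
            using r pos by (simp add: powr_mult powr_powr)
          finally have "a * 1 \<le> a * (a powr (m - 1) * r powr ((m - 1) / m))"
            using pos by (intro mult_left_mono) auto
          then show ?thesis using pos by (simp add: powr_diff mult.commute)
        qed
        then show ?thesis using pos
          by (auto simp: H1_def ennreal_less_iff ennpowr_ennreal ennreal_mult[symmetric] intro!: ennreal_leI)
      qed (use r in \<open>auto simp: H1_def ennreal_mult_top\<close>)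
    qed
    also have "\<dots> \<le> ennreal (r powr ((m - 1) / m)) * 1"
      using mult_left_mono[OF G1, of "ennreal (r powr ((m - 1) / m))"] by (subst nn_integral_cmult) auto
    finally have N: "N \<le> ennreal (r powr ((m - 1) / m))" by simp
    have N2: "ennpowr N (2 * m) \<le> ennreal (r powr (2 * m - 2))"
    proof -
      have "(m - 1) / m * (2 * m) = 2 * m - 2" using m by (simp add: field_simps)
      then have "(r powr ((m - 1) / m)) powr (2 * m) = r powr (2 * m - 2)"
        by (simp only: powr_powr)
      moreover have "ennpowr N (2 * m) \<le> ennreal ((r powr ((m - 1) / m)) powr (2 * m))"
        using ennpowr_mono[OF N, of "2 * m"] m by (subst ennpowr_ennreal[symmetric]) auto
      ultimately show ?thesis by (simp only:)
    qed
    \<comment> \<open>Of the \<open>2 * m + 1\<close> factors, \<open>2 * m\<close> are bounded by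
      the total mass \<open>N\<close>, and a single one is kept for the integration in
      \<open>t\<close>.\<close>
    have "ennpowr (slide (H1 r) t r) q \<le> ennreal (r powr (2 * m - 2)) * slide (H1 r) t r" for t
    proof -
      have "ennpowr (slide (H1 r) t r) (2 * m) \<le> ennpowr N (2 * m)"
        unfolding N_def using m by (intro ennpowr_mono slide_le_nn_integral) auto
      with N2 show ?thesis
        unfolding q_def ennpowr_add_exponent ennpowr_one by (intro mult_right_mono) auto
    qed
    then have "(\<integral>\<^sup>+t. ennpowr (slide (H1 r) t r) q \<partial>lborel) \<le> (\<integral>\<^sup>+t. ennreal (r powr (2 * m - 2)) * slide (H1 r) t r \<partial>lborel)"
      by (intro nn_integral_mono)
    also have "\<dots> = ennreal (r powr (2 * m - 2)) * (ennreal (2 * r) * N)"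
      using r by (subst nn_integral_cmult) (auto simp: N_def nn_integral_slide)
    also have "\<dots> = ennreal (2 * r powr (2 * m - 1)) * N"
    proof -
      have "r powr (2 * m - 2) * (2 * r) = 2 * r powr (2 * m - 1)"
        using r by (simp add: powr_diff power2_eq_square)
      from this[symmetric] show ?thesis using r by (simp only:) (simp add: ennreal_mult mult.assoc)
    qed
    finally have e1: "(\<integral>\<^sup>+t. ennpowr (slide (H1 r) t r) q \<partial>lborel) \<le> ennreal (2 * r powr (2 * m - 1)) * N" .
    have "(\<integral>\<^sup>+t. ennpowr (slide (H2 r) t r) q \<partial>lborel)
      \<le> (\<integral>\<^sup>+t. ennreal (2 powr q * (2 * r) powr (q - 1)) * slide (\<lambda>y. ennpowr (H2 r y) q) t r \<partial>lborel)"
      by (intro nn_integral_mono slide_jensen q r) measurable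
    also have "\<dots> = ennreal (2 powr q * (2 * r) powr (q - 1)) * (ennreal (2 * r) * P)"
      using r by (subst nn_integral_cmult) (auto simp: P_def nn_integral_slide)
    also have "\<dots> = ennreal (4 powr q * r powr q) * P"
    proof -
      have "2 powr q * (2 * r) powr (q - 1) * (2 * r) = (2 * 2) powr q * r powr q"
        using r by (simp only: powr_mult) (simp add: powr_diff powr_mult)
      then show ?thesis using r by (simp add: mult.assoc[symmetric] ennreal_mult[symmetric])
    qed
    finally have e2: "(\<integral>\<^sup>+t. ennpowr (slide (H2 r) t r) q \<partial>lborel) \<le> ennreal (4 powr q * r powr q) * P" .
    have "ennpowr (slide G t r) q \<le> ennreal (2 powr q) * (ennpowr (slide (H1 r) t r) q + ennpowr (slide (H2 r) t r) q)" for t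
    proof -
      have "slide G t r = slide (\<lambda>y. H1 r y + H2 r y) t r"
        by (auto simp: H1_def H2_def intro!: arg_cong[where f = "\<lambda>G. slide G t r"])
      also have "\<dots> = slide (H1 r) t r + slide (H2 r) t r"
        by (intro slide_add) measurable
      finally show ?thesis using q by (simp add: ennpowr_add_le)
    qed
    then have "(\<integral>\<^sup>+t. ennpowr (slide G t r) q * ennreal (r powr (1 / m - q)) \<partial>lborel)
      \<le> (\<integral>\<^sup>+t. ennreal (2 powr q) * (ennpowr (slide (H1 r) t r) q + ennpowr (slide (H2 r) t r) q) * ennreal (r powr (1 / m - q)) \<partial>lborel)"
      by (intro nn_integral_mono mult_right_mono) auto
    also have "\<dots> = ennreal (2 powr q) * ((\<integral>\<^sup>+t. ennpowr (slide (H1 r) t r) q \<partial>lborel) + (\<integral>\<^sup>+t. ennpowr (slide (H2 r) t r) q \<partial>lborel)) * ennreal (r powr (1 / m - q))"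
      by (simp add: nn_integral_multc nn_integral_cmult nn_integral_add)
    also have "\<dots> \<le> ennreal (2 powr q) * (ennreal (2 * r powr (2 * m - 1)) * N + ennreal (4 powr q * r powr q) * P) * ennreal (r powr (1 / m - q))"
      by (intro mult_right_mono mult_left_mono add_mono e1 e2) auto
    also have "\<dots> = ennreal (2 powr q * 2 * (r powr (2 * m - 1) * r powr (1 / m - q))) * N
        + ennreal (2 powr q * 4 powr q * (r powr q * r powr (1 / m - q))) * P"
      by (simp add: distrib_left distrib_right ennreal_mult mult_ac)
    also have "r powr (2 * m - 1) * r powr (1 / m - q) = r powr (1 / m - 2)"
      unfolding powr_add[symmetric] q_def by (simp add: algebra_simps)
    also have "r powr q * r powr (1 / m - q) = r powr (1 / m)"
      unfolding powr_add[symmetric] by simp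
    also have "ennreal (2 powr q * 2 * r powr (1 / m - 2)) * N + ennreal (2 powr q * 4 powr q * r powr (1 / m)) * P
      \<le> ennreal (c * r powr (1 / m - 2)) * N + ennreal (c * r powr (1 / m)) * P"
      unfolding c_def by (intro add_mono mult_right_mono ennreal_leI) (auto simp: distrib_left)
    also have "\<dots> = ennreal c * (\<integral>\<^sup>+y. ennreal (r powr (1 / m - 2)) * H1 r y + ennreal (r powr (1 / m)) * ennpowr (H2 r y) q \<partial>lborel)"
      using c by (subst nn_integral_add) (auto simp: nn_integral_cmult N_def P_def ennreal_mult distrib_left mult.assoc)
    finally show ?thesis .
  qed
  have "(\<integral>\<^sup>+t. (\<integral>\<^sup>+r\<in>{0<..}. ennpowr (slide G t r) q * ennreal (r powr (1 / m - q)) \<partial>lborel) \<partial>lborel)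
    = (\<integral>\<^sup>+r. (\<integral>\<^sup>+t. ennpowr (slide G t r) q * ennreal (r powr (1 / m - q)) * indicator {0<..} r \<partial>lborel) \<partial>lborel)"
    by (intro lborel_pair.Fubini') measurable
  also have "\<dots> \<le> (\<integral>\<^sup>+r. (\<integral>\<^sup>+y. ennreal c * ((ennreal (r powr (1 / m - 2)) * H1 r y + ennreal (r powr (1 / m)) * ennpowr (H2 r y) q) * indicator {0<..} r) \<partial>lborel) \<partial>lborel)"
  proof (rule nn_integral_mono)
    fix r :: real
    show "(\<integral>\<^sup>+t. ennpowr (slide G t r) q * ennreal (r powr (1 / m - q)) * indicator {0<..} r \<partial>lborel)
     \<le> (\<integral>\<^sup>+y. ennreal c * ((ennreal (r powr (1 / m - 2)) * H1 r y + ennreal (r powr (1 / m)) * ennpowr (H2 r y) q) * indicator {0<..} r) \<partial>lborel)"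
    proof (cases "0 < r")
      case True
      then show ?thesis
        using slice[OF True] by (subst nn_integral_cmult) auto
    qed auto
  qed
  \<comment> \<open>With \<open>r\<close> integrated first at fixed \<open>y\<close>, the cut
    becomes a condition on the radius, and the two level integrals apply with
    \<open>\<gamma> = G y\<close>.\<close>
  also have "\<dots> = (\<integral>\<^sup>+y. (\<integral>\<^sup>+r. ennreal c * ((ennreal (r powr (1 / m - 2)) * H1 r y + ennreal (r powr (1 / m)) * ennpowr (H2 r y) q) * indicator {0<..} r) \<partial>lborel) \<partial>lborel)"
    by (intro lborel_pair.Fubini'[symmetric]) measurable
  also have "\<dots> \<le> (\<integral>\<^sup>+y. ennreal c * (ennreal (m / (m - 1)) * ennpowr (G y) m + ennpowr (G y) m) \<partial>lborel)"
  proof (intro nn_integral_mono)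
    fix y
    have "(\<integral>\<^sup>+r. ennreal c * ((ennreal (r powr (1 / m - 2)) * H1 r y + ennreal (r powr (1 / m)) * ennpowr (H2 r y) q) * indicator {0<..} r) \<partial>lborel)
      = ennreal c * ((\<integral>\<^sup>+r\<in>{0<..}. ennreal (r powr (1 / m - 2)) * H1 r y \<partial>lborel) + (\<integral>\<^sup>+r\<in>{0<..}. ennreal (r powr (1 / m)) * ennpowr (H2 r y) q \<partial>lborel))"
      by (subst nn_integral_cmult) (auto simp: distrib_right nn_integral_add)
    also have "\<dots> \<le> ennreal c * (ennreal (m / (m - 1)) * ennpowr (G y) m + ennpowr (G y) m)"
      unfolding H1_def H2_def q_def
      by (intro mult_left_mono add_mono level_integral_above level_integral_below m) auto
    finally show "(\<integral>\<^sup>+r. ennreal c * ((ennreal (r powr (1 / m - 2)) * H1 r y + ennreal (r powr (1 / m)) * ennpowr (H2 r y) q) * indicator {0<..} r) \<partial>lborel)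
      \<le> ennreal c * (ennreal (m / (m - 1)) * ennpowr (G y) m + ennpowr (G y) m)" .
  qed
  also have "\<dots> = ennreal c * (ennreal (m / (m - 1)) * (\<integral>\<^sup>+y. ennpowr (G y) m \<partial>lborel) + (\<integral>\<^sup>+y. ennpowr (G y) m \<partial>lborel))"
    by (simp add: nn_integral_cmult nn_integral_add)
  also have "\<dots> \<le> ennreal c * (ennreal (m / (m - 1)) * 1 + 1)"
    by (intro mult_left_mono add_mono G1) auto
  also have "\<dots> = ennreal (c * (m / (m - 1) + 1))"
    using m c by (simp add: ennreal_mult)
  finally show ?thesis unfolding q_def c_def by (simp add: diff_diff_eq add.commute)
qed

text \<open>A reverse Hoelder inequality from monotonicity: on \<open>[r, 2 * r]\<close> the
  function is at least \<open>B r\<close>, so the integral on the right bounds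
  \<open>B r powr (2 * m + 1) * r powr (1 - \<kappa>)\<close> at every radius, and
  \<open>m - 1\<close> powers of this supremum are pulled out. Matching powers of \<open>r\<close>
  forces the value of \<kappa>. The mixed norm thus becomes a plain double integral, in which the
  order of integration can be exchanged.\<close>

lemma monotone_power_integral:
  fixes m :: real and B :: "real \<Rightarrow> ennreal"
  assumes m: "1 < m" and [measurable]: "B \<in> borel_measurable borel" and mono: "\<And>r s. r \<le> s \<Longrightarrow> B r \<le> B s"
  defines "\<kappa> \<equiv> 2 * m + 1 - 1 / m"
  shows "ennpowr (\<integral>\<^sup>+r\<in>{0<..}. ennpowr (B r * ennreal (1 / r)) ((2 * m + 1) * m) * ennreal (r powr m) \<partial>lborel) (1 / m)
    \<le> ennreal (2 powr \<kappa>) * (\<integral>\<^sup>+r\<in>{0<..}. ennpowr (B r) (2 * m + 1) * ennreal (r powr (- \<kappa>)) \<partial>lborel)"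
proof -
  define q where "q = 2 * m + 1"
  define J where "J = (\<integral>\<^sup>+r\<in>{0<..}. ennpowr (B r) q * ennreal (r powr (- \<kappa>)) \<partial>lborel)"
  have \<kappa>: "0 \<le> \<kappa>" using m by (simp add: \<kappa>_def) (smt (verit) divide_le_eq_1)
  have sup: "ennpowr (B r) q * ennreal (r powr (1 - \<kappa>)) \<le> ennreal (2 powr \<kappa>) * J" if r: "0 < r" for r
  proof -
    have "ennpowr (B r) q * ennreal ((2 * r) powr (- \<kappa>)) * ennreal r
      = (\<integral>\<^sup>+s. ennpowr (B r) q * ennreal ((2 * r) powr (- \<kappa>)) * indicator {r..2 * r} s \<partial>lborel)"
      using r by (subst nn_integral_cmult) auto
    also have "\<dots> \<le> J"
      unfolding J_def
    proof (intro nn_integral_mono)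
      fix s
      show "ennpowr (B r) q * ennreal ((2 * r) powr (- \<kappa>)) * indicator {r..2 * r} s
        \<le> ennpowr (B s) q * ennreal (s powr (- \<kappa>)) * indicator {0<..} s"
        using r \<kappa> m by (auto simp: indicator_def q_def intro!: mult_mono ennpowr_mono mono ennreal_leI powr_mono2')
    qed
    finally have "ennreal (2 powr \<kappa>) * (ennpowr (B r) q * ennreal ((2 * r) powr (- \<kappa>)) * ennreal r) \<le> ennreal (2 powr \<kappa>) * J"
      by (rule mult_left_mono) simp
    moreover have e: "2 powr \<kappa> * (2 * r) powr (- \<kappa>) * r = r powr (1 - \<kappa>)"
      using r by (simp add: powr_mult powr_minus powr_diff field_simps)
    have "ennreal (2 powr \<kappa>) * (ennpowr (B r) q * ennreal ((2 * r) powr (- \<kappa>)) * ennreal r) = ennpowr (B r) q * ennreal (r powr (1 - \<kappa>))"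
    proof -
      have "ennreal (2 powr \<kappa>) * (ennpowr (B r) q * ennreal ((2 * r) powr (- \<kappa>)) * ennreal r)
        = ennpowr (B r) q * ennreal (2 powr \<kappa> * (2 * r) powr (- \<kappa>) * r)"
        using r by (simp add: ennreal_mult mult_ac)
      with e show ?thesis by (simp only:)
    qed
    ultimately show ?thesis by simp
  qed
  have "(\<integral>\<^sup>+r\<in>{0<..}. ennpowr (B r * ennreal (1 / r)) (q * m) * ennreal (r powr m) \<partial>lborel)
    \<le> (\<integral>\<^sup>+r. (ennpowr (B r) q * ennreal (r powr (- \<kappa>)) * indicator {0<..} r) * ennpowr (ennreal (2 powr \<kappa>) * J) (m - 1) \<partial>lborel)"
  proof (intro nn_integral_mono)
    fix r :: real
    show "ennpowr (B r * ennreal (1 / r)) (q * m) * ennreal (r powr m) * indicator {0<..} r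
      \<le> (ennpowr (B r) q * ennreal (r powr (- \<kappa>)) * indicator {0<..} r) * ennpowr (ennreal (2 powr \<kappa>) * J) (m - 1)"
    proof (cases "0 < r")
      case True
      have "ennpowr (B r * ennreal (1 / r)) (q * m) * ennreal (r powr m)
        = ennpowr (B r) (q * m) * ennreal (r powr (m - q * m))"
        using True by (simp add: ennpowr_mult ennpowr_ennreal mult.assoc ennreal_mult[symmetric] powr_divide powr_diff)
      also have "\<dots> = ennpowr (B r) q * ennreal (r powr (- \<kappa>)) * ennpowr (ennpowr (B r) q * ennreal (r powr (1 - \<kappa>))) (m - 1)"
      proof -
        have "ennpowr (B r) (q * m) = ennpowr (B r) q * ennpowr (B r) (q * (m - 1))"
          by (subst ennpowr_add_exponent[symmetric]) (simp add: algebra_simps)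
        moreover have "r powr (m - q * m) = r powr (- \<kappa>) * (r powr (1 - \<kappa>)) powr (m - 1)"
          unfolding powr_powr powr_add[symmetric] using m
          by (intro arg_cong[where f = "\<lambda>x. r powr x"]) (simp add: \<kappa>_def q_def field_simps)
        ultimately show ?thesis
          by (simp add: ennpowr_mult ennpowr_ennpowr ennpowr_ennreal ennreal_mult mult_ac)
      qed
      also have "\<dots> \<le> ennpowr (B r) q * ennreal (r powr (- \<kappa>)) * ennpowr (ennreal (2 powr \<kappa>) * J) (m - 1)"
        using m by (intro mult_left_mono ennpowr_mono sup True) auto
      finally show ?thesis using True by simp
    qed simp
  qed
  also have "\<dots> = J * ennpowr (ennreal (2 powr \<kappa>) * J) (m - 1)"
    by (simp add: nn_integral_multc J_def)
  also have "\<dots> \<le> (ennreal (2 powr \<kappa>) * J) * ennpowr (ennreal (2 powr \<kappa>) * J) (m - 1)"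
  proof -
    have "1 * J \<le> ennreal (2 powr \<kappa>) * J"
      using \<kappa> by (intro mult_right_mono) (auto simp: ge_one_powr_ge_zero)
    then show ?thesis by (intro mult_right_mono) auto
  qed
  also have "\<dots> = ennpowr (ennreal (2 powr \<kappa>) * J) m"
    using ennpowr_add_exponent[of "ennreal (2 powr \<kappa>) * J" 1 "m - 1"] by simp
  finally have "ennpowr (\<integral>\<^sup>+r\<in>{0<..}. ennpowr (B r * ennreal (1 / r)) (q * m) * ennreal (r powr m) \<partial>lborel) (1 / m)
    \<le> ennpowr (ennpowr (ennreal (2 powr \<kappa>) * J) m) (1 / m)"
    using m by (intro ennpowr_mono) auto
  also have "\<dots> = ennreal (2 powr \<kappa>) * J" using m by (simp add: ennpowr_ennpowr)
  finally show ?thesis by (simp add: J_def q_def)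
qed

section \<open>The mixed norm as a functional, and the Strichartz estimate\<close>

lemma S_int_mono:
  assumes "0 < m" "\<And>t r. 0 < r \<Longrightarrow> A t r \<le> B t r"
  shows "S_int m A \<le> S_int m B"
proof -
  have "ennpowr (A t r) ((2 * m + 1) * m) * ennreal (r powr m) * indicator {0<..} r
    \<le> ennpowr (B t r) ((2 * m + 1) * m) * ennreal (r powr m) * indicator {0<..} r" for t r
    using assms by (cases "0 < r") (auto intro!: mult_right_mono ennpowr_mono)
  then show ?thesis
    unfolding S_int_def using assms(1) by (intro nn_integral_mono ennpowr_mono) auto
qed

lemma S_int_cmult:
  assumes "0 < m" and [measurable]: "joint_borel B"
  shows "S_int m (\<lambda>t r. c * B t r) = ennpowr c (2 * m + 1) * S_int m B"
proof -
  have "ennpowr (\<integral>\<^sup>+r\<in>{0<..}. ennpowr (c * B t r) ((2 * m + 1) * m) * ennreal (r powr m) \<partial>lborel) (1 / m)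
    = ennpowr c (2 * m + 1) * ennpowr (\<integral>\<^sup>+r\<in>{0<..}. ennpowr (B t r) ((2 * m + 1) * m) * ennreal (r powr m) \<partial>lborel) (1 / m)" for t
    using assms(1) by (simp add: ennpowr_mult mult.assoc nn_integral_cmult ennpowr_ennpowr)
  then show ?thesis unfolding S_int_def by (simp add: nn_integral_cmult)
qed

text \<open>By homogeneity \<open>G\<close> is normalised to unit \<open>L\<^sup>m\<close> norm, to
  which the cutting height \<open>r powr (- 1 / m)\<close> is adapted. The form for nonnegative
  \<open>G\<close> covers the free wave, with the absolute value of the profile, as well as the
  Duhamel term, with the source summed along characteristics.\<close>

theorem strichartz:
  fixes m :: real
  assumes m: "1 < m"
  shows "\<exists>C>0. \<forall>G \<Lambda>. G \<in> borel_measurable borel \<longrightarrow> 0 < \<Lambda> \<longrightarrow> (\<integral>\<^sup>+y. ennpowr (G y) m \<partial>lborel) \<le> ennreal (\<Lambda> powr m) \<longrightarrow>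
    S_int m (\<lambda>t r. slide G t r * ennreal (1 / r)) \<le> ennreal (C * \<Lambda> powr (2 * m + 1))"
proof -
  define \<kappa> where "\<kappa> = 2 * m + 1 - 1 / m"
  define C where "C = 2 powr \<kappa> * (2 powr (2 * m + 1) * (2 + 4 powr (2 * m + 1)) * (m / (m - 1) + 1))"
  have C: "0 < C" using m unfolding C_def by (intro mult_pos_pos add_pos_pos) auto
  show ?thesis
  proof (intro exI[of _ C] conjI C allI impI)
    fix G :: "real \<Rightarrow> ennreal" and \<Lambda> :: real
    assume G[measurable]: "G \<in> borel_measurable borel" and \<Lambda>: "0 < \<Lambda>"
      and G\<Lambda>: "(\<integral>\<^sup>+y. ennpowr (G y) m \<partial>lborel) \<le> ennreal (\<Lambda> powr m)"
    define G' where "G' = (\<lambda>y. ennreal (1 / \<Lambda>) * G y)"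
    have [measurable]: "G' \<in> borel_measurable borel" by (simp add: G'_def)
    have "(\<integral>\<^sup>+y. ennpowr (G' y) m \<partial>lborel) = ennreal ((1 / \<Lambda>) powr m) * (\<integral>\<^sup>+y. ennpowr (G y) m \<partial>lborel)"
      using \<Lambda> by (simp add: G'_def ennpowr_mult nn_integral_cmult ennpowr_ennreal)
    also have "\<dots> \<le> ennreal ((1 / \<Lambda>) powr m) * ennreal (\<Lambda> powr m)"
      by (intro mult_left_mono G\<Lambda>) auto
    also have "\<dots> = 1" using \<Lambda> by (simp add: ennreal_mult[symmetric] powr_divide)
    finally have G'1: "(\<integral>\<^sup>+y. ennpowr (G' y) m \<partial>lborel) \<le> 1" .
    have "S_int m (\<lambda>t r. slide G' t r * ennreal (1 / r)) \<le>
      (\<integral>\<^sup>+t. ennreal (2 powr \<kappa>) * (\<integral>\<^sup>+r\<in>{0<..}. ennpowr (slide G' t r) (2 * m + 1) * ennreal (r powr (1 / m - 1 - 2 * m)) \<partial>lborel) \<partial>lborel)"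
      unfolding S_int_def
    proof (intro nn_integral_mono)
      fix t
      have "- \<kappa> = 1 / m - 1 - 2 * m" by (simp add: \<kappa>_def)
      then show "ennpowr (\<integral>\<^sup>+r\<in>{0<..}. ennpowr (slide G' t r * ennreal (1 / r)) ((2 * m + 1) * m) * ennreal (r powr m) \<partial>lborel) (1 / m)
        \<le> ennreal (2 powr \<kappa>) * (\<integral>\<^sup>+r\<in>{0<..}. ennpowr (slide G' t r) (2 * m + 1) * ennreal (r powr (1 / m - 1 - 2 * m)) \<partial>lborel)"
        using monotone_power_integral[OF m, of "slide G' t", folded \<kappa>_def] by (simp only:) (simp add: slide_mono)
    qed
    also have "\<dots> = ennreal (2 powr \<kappa>) * (\<integral>\<^sup>+t. (\<integral>\<^sup>+r\<in>{0<..}. ennpowr (slide G' t r) (2 * m + 1) * ennreal (r powr (1 / m - 1 - 2 * m)) \<partial>lborel) \<partial>lborel)"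
      by (intro nn_integral_cmult) measurable
    also have "\<dots> \<le> ennreal (2 powr \<kappa>) * ennreal (2 powr (2 * m + 1) * (2 + 4 powr (2 * m + 1)) * (m / (m - 1) + 1))"
      by (intro mult_left_mono sliding_averages_unit[OF m _ G'1]) auto
    also have "\<dots> = ennreal C"
      unfolding C_def by (simp add: ennreal_mult')
    finally have S: "S_int m (\<lambda>t r. slide G' t r * ennreal (1 / r)) \<le> ennreal C" .
    have "slide G t r * ennreal (1 / r) = ennreal \<Lambda> * (slide G' t r * ennreal (1 / r))" for t r
      using \<Lambda> by (simp add: G'_def slide_cmult mult.assoc[symmetric] ennreal_mult[symmetric])
    then have "S_int m (\<lambda>t r. slide G t r * ennreal (1 / r)) = ennpowr (ennreal \<Lambda>) (2 * m + 1) * S_int m (\<lambda>t r. slide G' t r * ennreal (1 / r))"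
      using m by (simp add: S_int_cmult)
    also have "\<dots> \<le> ennpowr (ennreal \<Lambda>) (2 * m + 1) * ennreal C"
      by (intro mult_left_mono S) auto
    also have "\<dots> = ennreal (C * \<Lambda> powr (2 * m + 1))"
      using \<Lambda> C by (simp add: ennpowr_ennreal ennreal_mult[symmetric] mult.commute)
    finally show "S_int m (\<lambda>t r. slide G t r * ennreal (1 / r)) \<le> ennreal (C * \<Lambda> powr (2 * m + 1))" .
  qed
qed

section \<open>The nonlinearity\<close>

definition Lp_norm :: "real \<Rightarrow> (real \<Rightarrow> ennreal) \<Rightarrow> ennreal" where
  "Lp_norm m k = ennpowr (\<integral>\<^sup>+x. ennpowr (k x) m \<partial>lborel) (1 / m)"

lemma Lp_norm_mono: "0 < m \<Longrightarrow> (\<And>x. k x \<le> l x) \<Longrightarrow> Lp_norm m k \<le> Lp_norm m l"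
  unfolding Lp_norm_def by (intro ennpowr_mono nn_integral_mono) auto

lemma Lp_norm_cmult:
  "0 < m \<Longrightarrow> k \<in> borel_measurable borel \<Longrightarrow> Lp_norm m (\<lambda>x. c * k x) = c * Lp_norm m k"
  unfolding Lp_norm_def by (simp add: ennpowr_mult nn_integral_cmult ennpowr_ennpowr)

text \<open>\<open>ennpowr_add_le\<close> enters for the exponent \<open>m\<close> and again for
  \<open>1 / m\<close>; each use costs a factor of at most 2.\<close>

lemma Lp_norm_add:
  assumes m: "1 < m" and [measurable]: "k \<in> borel_measurable borel" "l \<in> borel_measurable borel"
  shows "Lp_norm m (\<lambda>x. k x + l x) \<le> 4 * (Lp_norm m k + Lp_norm m l)"
proof -
  let ?I = "\<lambda>k. \<integral>\<^sup>+x. ennpowr (k x) m \<partial>lborel"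
  have "?I (\<lambda>x. k x + l x) \<le> (\<integral>\<^sup>+x. ennreal (2 powr m) * (ennpowr (k x) m + ennpowr (l x) m) \<partial>lborel)"
    using m by (intro nn_integral_mono ennpowr_add_le) auto
  also have "\<dots> = ennreal (2 powr m) * (?I k + ?I l)"
    by (simp add: nn_integral_cmult nn_integral_add)
  finally have "Lp_norm m (\<lambda>x. k x + l x) \<le> ennpowr (ennreal (2 powr m) * (?I k + ?I l)) (1 / m)"
    unfolding Lp_norm_def using m by (intro ennpowr_mono) auto
  also have "\<dots> = 2 * ennpowr (?I k + ?I l) (1 / m)"
    using m by (simp add: ennpowr_mult ennpowr_ennreal powr_powr)
  also have "\<dots> \<le> 2 * (ennreal (2 powr (1 / m)) * (ennpowr (?I k) (1 / m) + ennpowr (?I l) (1 / m)))"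
    using m by (intro mult_left_mono ennpowr_add_le) auto
  also have "\<dots> \<le> 2 * (ennreal 2 * (ennpowr (?I k) (1 / m) + ennpowr (?I l) (1 / m)))"
  proof -
    have "(2::real) powr (1 / m) \<le> 2 powr 1" using m by (intro powr_mono) auto
    then show ?thesis by (intro mult_left_mono mult_right_mono ennreal_leI) auto
  qed
  also have "\<dots> = 4 * (Lp_norm m k + Lp_norm m l)"
    by (simp add: Lp_norm_def mult.assoc[symmetric])
  finally show ?thesis .
qed

lemma Lp_norm_shift:
  "k \<in> borel_measurable borel \<Longrightarrow> Lp_norm m (\<lambda>x. k (x - c)) = Lp_norm m k"
  unfolding Lp_norm_def
  by (subst (2) nn_integral_real_affine[where c = 1 and t = "- c"]) (auto simp: algebra_simps)

lemma Lp_norm_abs: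
  assumes "1 < m" and [measurable]: "k \<in> borel_measurable borel"
  shows "Lp_norm m (\<lambda>z. k \<bar>z\<bar>) \<le> 2 * Lp_norm m (\<lambda>z. k z * indicator {0..} z)"
proof -
  let ?P = "\<integral>\<^sup>+z. ennpowr (k z * indicator {0..} z) m \<partial>lborel"
  have "(\<integral>\<^sup>+z. ennpowr (k \<bar>z\<bar>) m \<partial>lborel)
    \<le> (\<integral>\<^sup>+z. ennpowr (k z * indicator {0..} z) m + ennpowr (k (- z) * indicator {0..} (- z)) m \<partial>lborel)"
    by (intro nn_integral_mono) (auto simp: indicator_def)
  also have "\<dots> = ?P + (\<integral>\<^sup>+z. ennpowr (k (- z) * indicator {0..} (- z)) m \<partial>lborel)"
    by (intro nn_integral_add) measurable
  also have "(\<integral>\<^sup>+z. ennpowr (k (- z) * indicator {0..} (- z)) m \<partial>lborel) = ?P"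
    by (subst (2) nn_integral_real_affine[where c = "-1" and t = 0]) auto
  finally have "Lp_norm m (\<lambda>z. k \<bar>z\<bar>) \<le> ennpowr (2 * ?P) (1 / m)"
    unfolding Lp_norm_def using assms(1) by (intro ennpowr_mono) (auto simp: mult_2)
  also have "\<dots> = ennreal (2 powr (1 / m)) * ennpowr ?P (1 / m)"
    using ennpowr_ennreal[of 2 "1 / m"] by (simp add: ennpowr_mult)
  also have "\<dots> \<le> ennreal 2 * ennpowr ?P (1 / m)"
  proof -
    have "(2::real) powr (1 / m) \<le> 2 powr 1" using assms by (intro powr_mono) auto
    then show ?thesis by (intro mult_right_mono ennreal_leI) auto
  qed
  finally show ?thesis by (simp add: Lp_norm_def)
qed

lemma measurable_Lp_norm [measurable]:
  assumes [measurable]: "case_prod k \<in> borel_measurable (M \<Otimes>\<^sub>M borel)"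
  shows "(\<lambda>s. Lp_norm m (k s)) \<in> borel_measurable M"
  unfolding Lp_norm_def by measurable

text \<open>The weight \<open>r powr m\<close> is the \<open>m\<close>-th power of \<open>r\<close>.
  Hence the S norm to the power \<open>2 * m + 1\<close> is the \<open>L\<^sup>1\<close> norm in
  time of the \<open>L\<^sup>m\<close> norm of \<open>r * B powr (2 * m + 1)\<close>, which is the
  size of the source. This ties the S norm to the nonlinearity.\<close>

lemma S_int_eq:
  assumes "1 < m"
  shows "S_int m B = (\<integral>\<^sup>+t. Lp_norm m (\<lambda>r. ennpowr (B t r) (2 * m + 1) * ennreal r * indicator {0..} r) \<partial>lborel)"
proof -
  have "ennpowr (ennpowr (B t r) (2 * m + 1) * ennreal r * indicator {0..} r) m
    = ennpowr (B t r) ((2 * m + 1) * m) * ennreal (r powr m) * indicator {0<..} r" for t r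
    using assms by (auto simp: indicator_def ennpowr_mult ennpowr_ennpowr ennpowr_ennreal)
  then show ?thesis by (simp add: S_int_def Lp_norm_def)
qed

lemma S_int_add:
  assumes m: "1 < m" and [measurable]: "joint_borel A" "joint_borel B"
  shows "S_int m (\<lambda>t r. A t r + B t r) \<le> ennreal (4 * 2 powr (2 * m + 1)) * (S_int m A + S_int m B)"
proof -
  let ?k = "\<lambda>A t r. ennpowr (A t r) (2 * m + 1) * ennreal r * indicator {0..} r"
  have "S_int m (\<lambda>t r. A t r + B t r) \<le> (\<integral>\<^sup>+t. ennreal (4 * 2 powr (2 * m + 1)) * (Lp_norm m (?k A t) + Lp_norm m (?k B t)) \<partial>lborel)"
    unfolding S_int_eq[OF m]
  proof (intro nn_integral_mono)
    fix t
    have "Lp_norm m (?k (\<lambda>t r. A t r + B t r) t) \<le> Lp_norm m (\<lambda>r. ennreal (2 powr (2 * m + 1)) * (?k A t r + ?k B t r))"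
    proof (rule Lp_norm_mono)
      fix r
      have "ennpowr (A t r + B t r) (2 * m + 1) * (ennreal r * indicator {0..} r)
        \<le> ennreal (2 powr (2 * m + 1)) * (ennpowr (A t r) (2 * m + 1) + ennpowr (B t r) (2 * m + 1)) * (ennreal r * indicator {0..} r)"
        using m by (intro mult_right_mono ennpowr_add_le) auto
      then show "?k (\<lambda>t r. A t r + B t r) t r \<le> ennreal (2 powr (2 * m + 1)) * (?k A t r + ?k B t r)"
        by (simp add: distrib_left distrib_right mult_ac)
    qed (use m in auto)
    also have "\<dots> = ennreal (2 powr (2 * m + 1)) * Lp_norm m (\<lambda>r. ?k A t r + ?k B t r)"
      using m by (intro Lp_norm_cmult) auto
    also have "\<dots> \<le> ennreal (2 powr (2 * m + 1)) * (4 * (Lp_norm m (?k A t) + Lp_norm m (?k B t)))"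
      using m by (intro mult_left_mono Lp_norm_add) auto
    also have "\<dots> = ennreal (4 * 2 powr (2 * m + 1)) * (Lp_norm m (?k A t) + Lp_norm m (?k B t))"
    proof -
      have "ennreal (4 * 2 powr (2 * m + 1)) = ennreal (2 powr (2 * m + 1)) * 4"
        by (simp add: ennreal_mult mult.commute)
      then show ?thesis by (simp only: mult.assoc)
    qed
    finally show "Lp_norm m (?k (\<lambda>t r. A t r + B t r) t) \<le> ennreal (4 * 2 powr (2 * m + 1)) * (Lp_norm m (?k A t) + Lp_norm m (?k B t))" .
  qed
  also have "\<dots> = ennreal (4 * 2 powr (2 * m + 1)) * (S_int m A + S_int m B)"
    unfolding S_int_eq[OF m] by (subst nn_integral_cmult) (auto simp: nn_integral_add)
  finally show ?thesis .
qed

section \<open>Lipschitz bounds for the power nonlinearity\<close>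

lemma powr_diff_le:
  fixes x y q :: real
  assumes "0 \<le> y" "y \<le> x" "1 \<le> q"
  shows "x powr q - y powr q \<le> q * x powr (q - 1) * (x - y)"
proof -
  consider "x = y" | "y = 0" "0 < x" | "0 < y" "y < x" using assms by fastforce
  then show ?thesis
  proof cases
    case 2
    then have "x powr (q - 1) * x = x powr q" by (simp add: powr_diff)
    moreover have "1 * x powr q \<le> q * x powr q" using assms by (intro mult_right_mono) auto
    ultimately show ?thesis using 2 by (simp add: mult.assoc)
  next
    case 3
    have d: "((\<lambda>x. x powr q) has_real_derivative q * v powr (q - 1)) (at v)" if "y \<le> v" "v \<le> x" for v
      using that 3 by (intro has_real_derivative_powr) auto
    obtain z where z: "y < z" "z < x" "x powr q - y powr q = (x - y) * (q * z powr (q - 1))"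
      using MVT2[OF _ d] 3 by blast
    have "q * z powr (q - 1) \<le> q * x powr (q - 1)"
      using z 3 assms by (intro mult_left_mono powr_mono2) auto
    then show ?thesis using z 3 by (simp add: mult.commute mult_left_mono)
  qed auto
qed

text \<open>
  The weights \<open>D\<close> and \<open>A\<close> do not
  depend on the point, so no mixed-norm Hoelder inequality is needed.
\<close>

lemma power_nonlinearity_diff:
  fixes x y m D A :: real
  assumes m: "1 < m" and DA: "0 < D" "0 < A"
  shows "\<bar>\<bar>x\<bar> powr (2 * m) * x - \<bar>y\<bar> powr (2 * m) * y\<bar> \<le> (2 * m + 1) * (D * A powr (2 * m)) *
    (\<bar>x - y\<bar> powr (2 * m + 1) / D powr (2 * m + 1) + (\<bar>x\<bar> powr (2 * m + 1) + \<bar>y\<bar> powr (2 * m + 1)) / A powr (2 * m + 1))"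
proof -
  define q where "q = 2 * m + 1"
  define M where "M = max \<bar>x\<bar> \<bar>y\<bar>"
  have sgn: "\<bar>a\<bar> powr (2 * m) * a = sgn a * \<bar>a\<bar> powr q" for a
    by (cases "a = 0"; cases "0 < a") (auto simp: q_def powr_add)
  have main: "\<bar>\<bar>x\<bar> powr (2 * m) * x - \<bar>y\<bar> powr (2 * m) * y\<bar> \<le> q * (\<bar>x - y\<bar> * M powr (2 * m))"
  proof -
    have same: "\<bar>sgn a * \<bar>a\<bar> powr q - sgn b * \<bar>b\<bar> powr q\<bar> \<le> q * (\<bar>a - b\<bar> * max \<bar>a\<bar> \<bar>b\<bar> powr (2 * m))"
      if "0 \<le> b" "b \<le> a" for a b
    proof -
      have "b powr q \<le> a powr q" using that m by (intro powr_mono2) (auto simp: q_def)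
      moreover have "a powr q - b powr q \<le> q * ((a - b) * a powr (2 * m))"
        using powr_diff_le[OF that, of q] m by (simp add: q_def mult_ac)
      ultimately show ?thesis using that by (auto simp: sgn_if max_def)
    qed
    have opp: "\<bar>sgn a * \<bar>a\<bar> powr q - sgn b * \<bar>b\<bar> powr q\<bar> \<le> q * (\<bar>a - b\<bar> * max \<bar>a\<bar> \<bar>b\<bar> powr (2 * m))"
      if "b \<le> 0" "0 \<le> a" for a b
    proof -
      have "\<bar>sgn a * \<bar>a\<bar> powr q - sgn b * \<bar>b\<bar> powr q\<bar> \<le> \<bar>a\<bar> powr q + \<bar>b\<bar> powr q"
        by (rule order_trans[OF abs_triangle_ineq4]) (auto simp: abs_mult abs_sgn_eq)
      also have "\<dots> = \<bar>a\<bar> * \<bar>a\<bar> powr (2 * m) + \<bar>b\<bar> * \<bar>b\<bar> powr (2 * m)"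
        by (cases "a = 0"; cases "b = 0") (auto simp: q_def powr_add)
      also have "\<dots> \<le> \<bar>a\<bar> * max \<bar>a\<bar> \<bar>b\<bar> powr (2 * m) + \<bar>b\<bar> * max \<bar>a\<bar> \<bar>b\<bar> powr (2 * m)"
        using m by (intro add_mono mult_left_mono powr_mono2) auto
      also have "\<dots> = 1 * (\<bar>a - b\<bar> * max \<bar>a\<bar> \<bar>b\<bar> powr (2 * m))"
        using that by (simp add: algebra_simps)
      also have "\<dots> \<le> q * (\<bar>a - b\<bar> * max \<bar>a\<bar> \<bar>b\<bar> powr (2 * m))"
        using m by (intro mult_right_mono) (auto simp: q_def)
      finally show ?thesis .
    qed
    \<comment> \<open>The nonlinearity is odd, so the six sign patterns reduce to two numbers of
      equal sign or of opposite signs.\<close>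
    consider "0 \<le> y" "y \<le> x" | "0 \<le> x" "x \<le> y" | "y \<le> 0" "0 \<le> x" | "x \<le> 0" "0 \<le> y" | "x \<le> 0" "y \<le> x" | "y \<le> 0" "x \<le> y"
      by linarith
    then show ?thesis
      unfolding sgn M_def
      using same[of y x] same[of x y] opp[of y x] opp[of x y] same[of "- x" "- y"] same[of "- y" "- x"]
      by cases (auto simp: abs_minus_commute max.commute sgn_minus)
  qed
  have "\<bar>x - y\<bar> * M powr (2 * m) \<le> D * A powr (2 * m) * (\<bar>x - y\<bar> powr q / D powr q + M powr q / A powr q)"
  proof -
    \<comment> \<open>After rescaling by \<open>D\<close> and \<open>A\<close> a crude Young
      inequality \<open>X * Y powr (2 * m) \<le> X powr q + Y powr q\<close> remains, seen by
      replacing the smaller of the two by the larger.\<close>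
    define X Y where "X = \<bar>x - y\<bar> / D" and "Y = M / A"
    have XY: "0 \<le> X" "0 \<le> Y" using DA by (auto simp: X_def Y_def M_def)
    have "X * Y powr (2 * m) \<le> X powr q + Y powr q"
    proof (cases "X \<le> Y")
      case True
      have "X * Y powr (2 * m) \<le> Y * Y powr (2 * m)" using True by (intro mult_right_mono) auto
      also have "\<dots> = Y powr q" using XY by (cases "Y = 0") (auto simp: q_def powr_add)
      finally show ?thesis by (simp add: add_increasing)
    next
      case False
      have "X * Y powr (2 * m) \<le> X * X powr (2 * m)" using False XY m by (intro mult_left_mono powr_mono2) auto
      also have "\<dots> = X powr q" using XY by (cases "X = 0") (auto simp: q_def powr_add)
      finally show ?thesis by (simp add: add_increasing2)
    qed
    then have "D * A powr (2 * m) * (X * Y powr (2 * m)) \<le> D * A powr (2 * m) * (X powr q + Y powr q)"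
      using DA by (intro mult_left_mono) auto
    moreover have "D * A powr (2 * m) * (X * Y powr (2 * m)) = \<bar>x - y\<bar> * M powr (2 * m)"
      using DA by (simp add: X_def Y_def M_def powr_divide)
    ultimately show ?thesis using DA by (simp add: X_def Y_def M_def powr_divide)
  qed
  also have "\<dots> \<le> D * A powr (2 * m) * (\<bar>x - y\<bar> powr q / D powr q + (\<bar>x\<bar> powr q + \<bar>y\<bar> powr q) / A powr q)"
  proof -
    have "M powr q \<le> \<bar>x\<bar> powr q + \<bar>y\<bar> powr q" by (simp add: M_def max_def)
    then show ?thesis using DA by (intro mult_left_mono add_left_mono divide_right_mono) auto
  qed
  finally have "q * (\<bar>x - y\<bar> * M powr (2 * m)) \<le> q * (D * A powr (2 * m) * (\<bar>x - y\<bar> powr q / D powr q + (\<bar>x\<bar> powr q + \<bar>y\<bar> powr q) / A powr q))"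
    using m by (intro mult_left_mono) (auto simp: q_def)
  with main show ?thesis by (simp add: q_def mult.assoc)
qed

lemma ennreal_expand:
  "0 \<le> c \<Longrightarrow> 0 \<le> a \<Longrightarrow> 0 \<le> b \<Longrightarrow> 0 \<le> x \<Longrightarrow> 0 \<le> y \<Longrightarrow> 0 \<le> z \<Longrightarrow>
    ennreal (c * (a * x + b * (y + z))) = ennreal c * (ennreal a * ennreal x + ennreal b * (ennreal y + ennreal z))"
  by (simp add: ennreal_mult)

definition snorm :: "real \<Rightarrow> (real \<Rightarrow> real \<Rightarrow> real) \<Rightarrow> ennreal" where
  "snorm m u = S_int m (\<lambda>t r. ennreal \<bar>u t r\<bar>)"

definition src :: "real \<Rightarrow> (real \<Rightarrow> real \<Rightarrow> real) \<Rightarrow> real \<Rightarrow> real \<Rightarrow> real" where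
  "src m u s z = z * (\<bar>u s \<bar>z\<bar>\<bar> powr (2 * m) * u s \<bar>z\<bar>)"

lemma measurable_src [measurable]:
  assumes [measurable]: "joint_borel u" "f \<in> borel_measurable M" "g \<in> borel_measurable M"
  shows "(\<lambda>x. src m u (f x) (g x)) \<in> borel_measurable M"
  unfolding src_def by measurable

lemma src_minus: "src m u s (- z) = - src m u s z"
  by (simp add: src_def)

text \<open>The Lipschitz estimate of the source on balls. \<open>D\<close> and \<open>A\<close> are
  positive upper bounds instead of the norms themselves, so that vanishing norms are included;
  \<open>w = 0\<close> and \<open>D = A\<close> give the size of a single source.\<close>

theorem src_diff_bound:
  fixes m :: real
  assumes m: "1 < m"
  shows "\<exists>C>0. \<forall>u w D A. joint_borel u \<longrightarrow> joint_borel w \<longrightarrow>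
    0 < D \<longrightarrow> 0 < A \<longrightarrow> snorm m (\<lambda>t r. u t r - w t r) \<le> ennreal (D powr (2 * m + 1)) \<longrightarrow>
    snorm m u \<le> ennreal (A powr (2 * m + 1)) \<longrightarrow> snorm m w \<le> ennreal (A powr (2 * m + 1)) \<longrightarrow>
    (\<integral>\<^sup>+s. Lp_norm m (\<lambda>z. ennreal \<bar>src m u s z - src m w s z\<bar>) \<partial>lborel) \<le> ennreal (C * D * A powr (2 * m))"
proof -
  define q where "q = 2 * m + 1"
  have q: "0 < q" using m by (simp add: q_def)
  show ?thesis
  \<comment> \<open>128 = 4 * 4 * 2 * 4: two uses of \<open>Lp_norm_add\<close>, one of
    \<open>Lp_norm_abs\<close>, and 4 as a bound for three terms, each at most 1 after division by
    \<open>D powr q\<close> or \<open>A powr q\<close>.\<close>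
  proof (intro exI[of _ "q * 128"] conjI allI impI)
    show "0 < q * 128" using q by simp
    fix u w :: "real \<Rightarrow> real \<Rightarrow> real" and D A :: real
    assume [measurable]: "joint_borel u" "joint_borel w"
      and DA: "0 < D" "0 < A" and b: "snorm m (\<lambda>t r. u t r - w t r) \<le> ennreal (D powr (2 * m + 1))"
        "snorm m u \<le> ennreal (A powr (2 * m + 1))" "snorm m w \<le> ennreal (A powr (2 * m + 1))"
    define c where "c = q * (D * A powr (2 * m))"
    have c: "0 \<le> c" using q DA by (simp add: c_def)
    let ?k = "\<lambda>v s r. ennreal (r * \<bar>v s r\<bar> powr q)"
    let ?K = "\<lambda>v s z. ennreal (\<bar>z\<bar> * \<bar>v s \<bar>z\<bar>\<bar> powr q)"
    let ?L = "\<lambda>v s. Lp_norm m (\<lambda>r. ?k v s r * indicator {0..} r)"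
    let ?d = "\<lambda>t r. u t r - w t r"
    have L: "(\<integral>\<^sup>+s. ?L v s \<partial>lborel) = snorm m v" for v
      unfolding snorm_def S_int_eq[OF m] q_def
      by (intro nn_integral_cong arg_cong[where f = "Lp_norm m"] ext)
        (auto simp: indicator_def ennpowr_ennreal ennreal_mult mult.commute)
    have slice: "Lp_norm m (\<lambda>z. ennreal \<bar>src m u s z - src m w s z\<bar>)
      \<le> ennreal (c * 32) * (ennreal (1 / D powr q) * ?L ?d s + ennreal (1 / A powr q) * (?L u s + ?L w s))" for s
    proof -
      have "Lp_norm m (\<lambda>z. ennreal \<bar>src m u s z - src m w s z\<bar>)
        \<le> Lp_norm m (\<lambda>z. ennreal c * (ennreal (1 / D powr q) * ?K ?d s z + ennreal (1 / A powr q) * (?K u s z + ?K w s z)))"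
      proof (rule Lp_norm_mono)
        fix z
        let ?x = "u s \<bar>z\<bar>" and ?y = "w s \<bar>z\<bar>"
        have "src m u s z - src m w s z = z * (\<bar>?x\<bar> powr (2 * m) * ?x - \<bar>?y\<bar> powr (2 * m) * ?y)"
          by (simp add: src_def algebra_simps)
        then have "\<bar>src m u s z - src m w s z\<bar> = \<bar>z\<bar> * \<bar>\<bar>?x\<bar> powr (2 * m) * ?x - \<bar>?y\<bar> powr (2 * m) * ?y\<bar>"
          by (simp add: abs_mult)
        also have "\<dots> \<le> \<bar>z\<bar> * (c * (\<bar>?x - ?y\<bar> powr q / D powr q + (\<bar>?x\<bar> powr q + \<bar>?y\<bar> powr q) / A powr q))"
          unfolding c_def q_def by (intro mult_left_mono power_nonlinearity_diff m DA) auto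
        also have "\<dots> = c * (1 / D powr q * (\<bar>z\<bar> * \<bar>?x - ?y\<bar> powr q) + 1 / A powr q * (\<bar>z\<bar> * \<bar>?x\<bar> powr q + \<bar>z\<bar> * \<bar>?y\<bar> powr q))"
          by (simp add: algebra_simps add_divide_distrib)
        finally have "ennreal \<bar>src m u s z - src m w s z\<bar> \<le> ennreal (c * (1 / D powr q * (\<bar>z\<bar> * \<bar>?x - ?y\<bar> powr q) + 1 / A powr q * (\<bar>z\<bar> * \<bar>?x\<bar> powr q + \<bar>z\<bar> * \<bar>?y\<bar> powr q)))"
          by (rule ennreal_leI)
        also have "\<dots> = ennreal c * (ennreal (1 / D powr q) * ?K ?d s z + ennreal (1 / A powr q) * (?K u s z + ?K w s z))"
          using c by (intro ennreal_expand) auto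
        finally show "ennreal \<bar>src m u s z - src m w s z\<bar> \<le> ennreal c * (ennreal (1 / D powr q) * ?K ?d s z + ennreal (1 / A powr q) * (?K u s z + ?K w s z))" .
      qed (use m in auto)
      also have "\<dots> = ennreal c * Lp_norm m (\<lambda>z. ennreal (1 / D powr q) * ?K ?d s z + ennreal (1 / A powr q) * (?K u s z + ?K w s z))"
        using m by (intro Lp_norm_cmult) auto
      also have "\<dots> \<le> ennreal c * (4 * (Lp_norm m (\<lambda>z. ennreal (1 / D powr q) * ?K ?d s z) + Lp_norm m (\<lambda>z. ennreal (1 / A powr q) * (?K u s z + ?K w s z))))"
        using m by (intro mult_left_mono Lp_norm_add) auto
      also have "\<dots> = ennreal c * (4 * (ennreal (1 / D powr q) * Lp_norm m (?K ?d s) + ennreal (1 / A powr q) * Lp_norm m (\<lambda>z. ?K u s z + ?K w s z)))"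
        using m by (simp add: Lp_norm_cmult)
      also have "\<dots> \<le> ennreal c * (4 * (ennreal (1 / D powr q) * (4 * Lp_norm m (?K ?d s)) + ennreal (1 / A powr q) * (4 * (Lp_norm m (?K u s) + Lp_norm m (?K w s)))))"
      proof -
        have "1 * Lp_norm m (?K ?d s) \<le> 4 * Lp_norm m (?K ?d s)" by (intro mult_right_mono) auto
        then show ?thesis using m by (intro mult_left_mono add_mono Lp_norm_add) auto
      qed
      also have "\<dots> \<le> ennreal c * (4 * (ennreal (1 / D powr q) * (4 * (2 * ?L ?d s)) + ennreal (1 / A powr q) * (4 * (2 * ?L u s + 2 * ?L w s))))"
        using m Lp_norm_abs[OF m, of "?k ?d s"] Lp_norm_abs[OF m, of "?k u s"] Lp_norm_abs[OF m, of "?k w s"]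
        by (intro mult_left_mono add_mono) auto
      also have "\<dots> = ennreal (c * 32) * (ennreal (1 / D powr q) * ?L ?d s + ennreal (1 / A powr q) * (?L u s + ?L w s))"
      proof -
        have "ennreal (c * 32) = ennreal c * 4 * (4 * 2)" using c by (simp add: ennreal_mult mult.assoc)
        then show ?thesis by (simp only: distrib_left mult_ac)
      qed
      finally show ?thesis .
    qed
    have "(\<integral>\<^sup>+s. Lp_norm m (\<lambda>z. ennreal \<bar>src m u s z - src m w s z\<bar>) \<partial>lborel)
      \<le> (\<integral>\<^sup>+s. ennreal (c * 32) * (ennreal (1 / D powr q) * ?L ?d s + ennreal (1 / A powr q) * (?L u s + ?L w s)) \<partial>lborel)"
      by (intro nn_integral_mono slice)
    also have "\<dots> = ennreal (c * 32) * (ennreal (1 / D powr q) * (\<integral>\<^sup>+s. ?L ?d s \<partial>lborel) + ennreal (1 / A powr q) * ((\<integral>\<^sup>+s. ?L u s \<partial>lborel) + (\<integral>\<^sup>+s. ?L w s \<partial>lborel)))"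
      by (simp add: nn_integral_cmult nn_integral_add)
    also have "\<dots> = ennreal (c * 32) * (ennreal (1 / D powr q) * snorm m ?d + ennreal (1 / A powr q) * (snorm m u + snorm m w))"
      unfolding L ..
    also have "\<dots> \<le> ennreal (c * 32) * (ennreal (1 / D powr q) * ennreal (D powr q) + ennreal (1 / A powr q) * (ennreal (A powr q) + ennreal (A powr q)))"
      using b unfolding q_def by (intro mult_left_mono add_mono) auto
    also have "\<dots> = ennreal (c * 32) * 3"
      using DA by (simp add: distrib_left ennreal_mult[symmetric])
    also have "\<dots> \<le> ennreal (c * 32) * ennreal 4" by (intro mult_left_mono) auto
    also have "\<dots> = ennreal (q * 128 * D * A powr (2 * m))"
      using c by (subst ennreal_mult[symmetric]) (auto simp: c_def mult_ac)
    finally show "(\<integral>\<^sup>+s. Lp_norm m (\<lambda>z. ennreal \<bar>src m u s z - src m w s z\<bar>) \<partial>lborel) \<le> ennreal (q * 128 * D * A powr (2 * m))" .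
  qed
qed

section \<open>Wave profiles and short-time existence\<close>

text \<open>A function that is not integrable has integral 0 by convention, so the estimate is
  unconditional.\<close>

lemma abs_set_integral_le:
  fixes f :: "'a \<Rightarrow> real"
  shows "ennreal \<bar>LINT x:A|M. f x\<bar> \<le> (\<integral>\<^sup>+x\<in>A. ennreal \<bar>f x\<bar> \<partial>M)"
proof (cases "set_integrable M A f")
  case True
  then have "ennreal \<bar>LINT x:A|M. f x\<bar> \<le> (\<integral>\<^sup>+x. ennreal (norm (indicator A x *\<^sub>R f x)) \<partial>M)"
    unfolding set_lebesgue_integral_def set_integrable_def real_norm_def[symmetric]
    by (rule integral_norm_bound_ennreal)
  also have "\<dots> = (\<integral>\<^sup>+x\<in>A. ennreal \<bar>f x\<bar> \<partial>M)"
    by (intro nn_integral_cong) (auto simp: indicator_def)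
  finally show ?thesis .
next
  case False
  then show ?thesis
    by (simp add: set_lebesgue_integral_def set_integrable_def not_integrable_integral_eq)
qed

lemma set_integrableI_nn_integral:
  fixes f :: "'a \<Rightarrow> real"
  assumes [measurable]: "f \<in> borel_measurable M" "A \<in> sets M"
    and "(\<integral>\<^sup>+x\<in>A. ennreal \<bar>f x\<bar> \<partial>M) < top"
  shows "set_integrable M A f"
  unfolding set_integrable_def integrable_iff_bounded
proof
  have "(\<integral>\<^sup>+x. ennreal (norm (indicator A x *\<^sub>R f x)) \<partial>M) = (\<integral>\<^sup>+x\<in>A. ennreal \<bar>f x\<bar> \<partial>M)"
    by (intro nn_integral_cong) (auto simp: indicator_def)
  with assms show "(\<integral>\<^sup>+x. ennreal (norm (indicator A x *\<^sub>R f x)) \<partial>M) < \<infinity>" by simp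
qed measurable

text \<open>Continuity from above of the measure with density \<open>f\<close>, which has no atom at
  \<open>a\<close>. This is where the smallness for the contraction comes from, at any given
  time.\<close>

lemma nn_integral_shrinking_interval:
  fixes f :: "real \<Rightarrow> ennreal"
  assumes [measurable]: "f \<in> borel_measurable borel" and fin: "(\<integral>\<^sup>+t\<in>{a - 1..a + 1}. f t \<partial>lborel) < top" and e: "0 < e"
  shows "\<exists>d>0. d \<le> 1 \<and> (\<integral>\<^sup>+t\<in>{a - d..a + d}. f t \<partial>lborel) < e"
proof -
  define M where "M = density lborel f"
  define A where "A = (\<lambda>n::nat. {a - 1 / Suc n..a + 1 / Suc n})"
  have em: "emeasure M {c..d} = (\<integral>\<^sup>+t\<in>{c..d}. f t \<partial>lborel)" for c d
    by (simp add: M_def emeasure_density)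
  have mono: "A n \<subseteq> A k" if "k \<le> n" for n k
    using that by (auto simp: A_def intro: order_trans[OF _ diff_left_mono[of "1 / Suc n" "1 / Suc k"]]
      order_trans[OF _ add_left_mono[of "1 / Suc n" "1 / Suc k"]] frac_le)
  have "(\<lambda>n. emeasure M (A n)) \<longlonglongrightarrow> emeasure M (\<Inter>n. A n)"
  proof (rule Lim_emeasure_decseq)
    show "range A \<subseteq> sets M" by (auto simp: A_def M_def)
    show "decseq A" using mono by (auto simp: decseq_def)
    fix n
    have "emeasure M (A n) \<le> emeasure M (A 0)" by (intro emeasure_mono mono) (auto simp: A_def M_def)
    also have "\<dots> < top" using fin by (simp add: A_def em)
    finally show "emeasure M (A n) \<noteq> \<infinity>" by simp
  qed
  moreover have "(\<Inter>n. A n) \<subseteq> {a..a}"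
  proof
    fix x assume x: "x \<in> (\<Inter>n. A n)"
    have le: "\<bar>x - a\<bar> \<le> 1 / Suc n" for n
    proof -
      have "x \<in> A n" using x by blast
      then show ?thesis by (simp add: A_def abs_le_iff)
    qed
    have "x = a"
    proof (rule ccontr)
      assume "x \<noteq> a"
      then obtain n where "inverse (real (Suc n)) < \<bar>x - a\<bar>" using reals_Archimedean[of "\<bar>x - a\<bar>"] by auto
      with le[of n] show False by (simp add: inverse_eq_divide)
    qed
    then show "x \<in> {a..a}" by simp
  qed
  then have "emeasure M (\<Inter>n. A n) \<le> emeasure M {a..a}" by (intro emeasure_mono) (auto simp: M_def)
  moreover have "emeasure M {a..a} = 0"
  proof -
    have "AE x in lborel. f x * indicator {a..a} x = 0"
      using AE_lborel_singleton[of a] by eventually_elim auto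
    then show ?thesis unfolding em by (subst nn_integral_0_iff_AE) auto
  qed
  ultimately have "(\<lambda>n. emeasure M (A n)) \<longlonglongrightarrow> 0" by simp
  then have "eventually (\<lambda>n. emeasure M (A n) < e) sequentially"
    using e by (rule order_tendstoD)
  then obtain n where "emeasure M (A n) < e" by (auto simp: eventually_sequentially)
  then show ?thesis by (intro exI[of _ "1 / Suc n"]) (auto simp: A_def em)
qed

text \<open>The radial free wave \<open>(F (t + r) - F (t - r)) / r\<close> with \<open>F' = g\<close>.\<close>

definition avg :: "(real \<Rightarrow> real) \<Rightarrow> real \<Rightarrow> real \<Rightarrow> real" where
  "avg g t r = (LINT y:{t - r..t + r}|lborel. g y) / r"

text \<open>
  The contribution of the sources between the times \<open>a\<close> and \<open>t\<close> to the profile, without the factor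
  \<open>\<iota> / 2\<close>. The source \<open>src m u s\<close> is extended to an odd function on the line.
\<close>

definition acc :: "real \<Rightarrow> (real \<Rightarrow> real \<Rightarrow> real) \<Rightarrow> real \<Rightarrow> real \<Rightarrow> real \<Rightarrow> real" where
  "acc m u a t y = (LINT s:{a..t}|lborel. src m u s (y - s))"

text \<open>The difference of two sources summed absolutely along the characteristic through
  \<open>y\<close>. It runs over all times and so dominates the change of profile at every time at
  once; a time window is imposed by cutting off \<open>u\<close> and \<open>w\<close>.\<close>

definition mass :: "real \<Rightarrow> (real \<Rightarrow> real \<Rightarrow> real) \<Rightarrow> (real \<Rightarrow> real \<Rightarrow> real) \<Rightarrow> real \<Rightarrow> ennreal" where
  "mass m u w y = (\<integral>\<^sup>+s. ennreal \<bar>src m u s (y - s) - src m w s (y - s)\<bar> \<partial>lborel)"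

definition Lm_fun :: "real \<Rightarrow> (real \<Rightarrow> real) \<Rightarrow> bool" where
  "Lm_fun m h \<longleftrightarrow> h \<in> borel_measurable borel \<and> (\<integral>\<^sup>+y. ennreal (\<bar>h y\<bar> powr m) \<partial>lborel) < top"

lemma measurable_acc [measurable]:
  assumes [measurable]: "joint_borel u" "f \<in> borel_measurable M" "g \<in> borel_measurable M"
  shows "(\<lambda>x. acc m u a (f x) (g x)) \<in> borel_measurable M"
  unfolding acc_def set_lebesgue_integral_def indicator_def atLeastAtMost_iff by measurable

lemma measurable_avg [measurable]:
  assumes [measurable]: "case_prod g \<in> borel_measurable (M \<Otimes>\<^sub>M borel)" "f \<in> borel_measurable M" "k \<in> borel_measurable M"
  shows "(\<lambda>x. avg (g x) (f x) (k x)) \<in> borel_measurable M"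
  unfolding avg_def set_lebesgue_integral_def indicator_def atLeastAtMost_iff by measurable

lemma measurable_mass [measurable]:
  assumes [measurable]: "joint_borel u" "joint_borel w" "f \<in> borel_measurable M"
  shows "(\<lambda>x. mass m u w (f x)) \<in> borel_measurable M"
  unfolding mass_def by measurable

lemma src_zero [simp]: "src m (\<lambda>t r. 0) s z = 0"
  by (simp add: src_def)

lemma snorm_zero [simp]: "0 < m \<Longrightarrow> snorm m (\<lambda>t r. 0) = 0"
  by (simp add: snorm_def S_int_def)

lemma src_cong: "(\<And>r. 0 < r \<Longrightarrow> u s r = w s r) \<Longrightarrow> src m u s z = src m w s z"
  by (cases "z = 0") (auto simp: src_def)

lemma snorm_mono: "0 < m \<Longrightarrow> (\<And>t r. 0 < r \<Longrightarrow> \<bar>u t r\<bar> \<le> \<bar>w t r\<bar>) \<Longrightarrow> snorm m u \<le> snorm m w"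
  unfolding snorm_def by (intro S_int_mono) auto

lemma snorm_diff_le:
  assumes "1 < m" and [measurable]: "joint_borel u" "joint_borel w"
  shows "snorm m (\<lambda>t r. u t r - w t r) \<le> ennreal (4 * 2 powr (2 * m + 1)) * (snorm m u + snorm m w)"
proof -
  have "snorm m (\<lambda>t r. u t r - w t r) \<le> S_int m (\<lambda>t r. ennreal \<bar>u t r\<bar> + ennreal \<bar>w t r\<bar>)"
    unfolding snorm_def using assms(1)
    by (intro S_int_mono) (auto simp: ennreal_plus[symmetric] simp del: ennreal_plus intro!: ennreal_leI)
  also have "\<dots> \<le> ennreal (4 * 2 powr (2 * m + 1)) * (snorm m u + snorm m w)"
    unfolding snorm_def using assms(1) by (intro S_int_add) auto
  finally show ?thesis .
qed

text \<open>Fatou's lemma in \<open>r\<close> and then in \<open>t\<close>. Lower semicontinuity of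
  the norm does the work of completeness for the limit of the iteration.\<close>

lemma snorm_fatou:
  assumes m: "0 < m" and [measurable]: "\<And>n. joint_borel (f n)" "joint_borel g"
    and lim: "\<And>t r. 0 < r \<Longrightarrow> (\<lambda>n. f n t r) \<longlonglongrightarrow> g t r" and le: "\<And>n. snorm m (f n) \<le> c"
  shows "snorm m g \<le> c"
proof -
  let ?I = "\<lambda>f t r. ennpowr (ennreal \<bar>f t r\<bar>) ((2 * m + 1) * m) * ennreal (r powr m) * indicator {0<..} r"
  have pt: "?I g t r \<le> liminf (\<lambda>n. ?I (f n) t r)" for t r :: real
  proof (cases "0 < r")
    case True
    have "(\<lambda>n. ennreal ((\<bar>f n t r\<bar> powr ((2 * m + 1) * m)) * r powr m)) \<longlonglongrightarrow> ennreal ((\<bar>g t r\<bar> powr ((2 * m + 1) * m)) * r powr m)"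
      using m lim[OF True, of t] by (intro tendsto_ennrealI tendsto_mult tendsto_powr2 tendsto_rabs tendsto_const) auto
    then have "liminf (\<lambda>n. ennreal ((\<bar>f n t r\<bar> powr ((2 * m + 1) * m)) * r powr m)) = ennreal ((\<bar>g t r\<bar> powr ((2 * m + 1) * m)) * r powr m)"
      by (intro lim_imp_Liminf) auto
    then show ?thesis using True by (simp add: ennpowr_ennreal ennreal_mult)
  qed simp
  have "snorm m g \<le> (\<integral>\<^sup>+t. ennpowr (liminf (\<lambda>n. \<integral>\<^sup>+r. ?I (f n) t r \<partial>lborel)) (1 / m) \<partial>lborel)"
    unfolding snorm_def S_int_def
  proof (intro nn_integral_mono ennpowr_mono)
    fix t
    have "(\<integral>\<^sup>+r. ?I g t r \<partial>lborel) \<le> (\<integral>\<^sup>+r. liminf (\<lambda>n. ?I (f n) t r) \<partial>lborel)"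
      by (intro nn_integral_mono pt)
    also have "\<dots> \<le> liminf (\<lambda>n. \<integral>\<^sup>+r. ?I (f n) t r \<partial>lborel)"
      by (intro nn_integral_liminf) measurable
    finally show "(\<integral>\<^sup>+r. ?I g t r \<partial>lborel) \<le> liminf (\<lambda>n. \<integral>\<^sup>+r. ?I (f n) t r \<partial>lborel)" .
  qed (use m in auto)
  also have "\<dots> \<le> (\<integral>\<^sup>+t. liminf (\<lambda>n. ennpowr (\<integral>\<^sup>+r. ?I (f n) t r \<partial>lborel) (1 / m)) \<partial>lborel)"
    using m by (intro nn_integral_mono ennpowr_liminf_le) auto
  also have "\<dots> \<le> liminf (\<lambda>n. \<integral>\<^sup>+t. ennpowr (\<integral>\<^sup>+r. ?I (f n) t r \<partial>lborel) (1 / m) \<partial>lborel)"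
    by (intro nn_integral_liminf) measurable
  also have "\<dots> = liminf (\<lambda>n. snorm m (f n))"
    by (simp add: snorm_def S_int_def)
  also have "\<dots> \<le> c"
    using le by (intro order_trans[OF Liminf_le_Limsup] Limsup_bounded) auto
  finally show ?thesis .
qed

section \<open>The contraction estimate\<close>

locale wave =
  fixes m \<iota> :: real
  assumes m: "1 < m" and \<iota>: "\<bar>\<iota>\<bar> = 1"
begin

definition flow :: "(real \<Rightarrow> real) \<Rightarrow> (real \<Rightarrow> real \<Rightarrow> real) \<Rightarrow> real \<Rightarrow> real \<Rightarrow> real \<Rightarrow> real" where
  "flow h u a t y = h y + \<iota> / 2 * acc m u a t y"

lemma m0: "0 < m" using m by simp

lemma measurable_flow [measurable]:
  assumes [measurable]: "h \<in> borel_measurable borel" "joint_borel u" "f \<in> borel_measurable M" "g \<in> borel_measurable M"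
  shows "(\<lambda>x. flow h u a (f x) (g x)) \<in> borel_measurable M"
  unfolding flow_def by measurable

lemma slide_Lp_finite:
  assumes [measurable]: "G \<in> borel_measurable borel" and fin: "(\<integral>\<^sup>+y. ennpowr (G y) m \<partial>lborel) < top"
  shows "slide G t r < top"
proof -
  define I where "I = (\<integral>\<^sup>+y. ennpowr (G y) m \<partial>lborel)"
  obtain i where i: "0 \<le> i" "I = ennreal i" using fin unfolding I_def[symmetric] by (cases I) auto
  define \<Lambda> where "\<Lambda> = (i + 1) powr (1 / m)"
  have "\<Lambda> powr m = i + 1" using i m by (simp add: \<Lambda>_def powr_powr)
  then have "(\<integral>\<^sup>+y. ennpowr (G y) m \<partial>lborel) \<le> ennreal (\<Lambda> powr m)"
    using i by (simp add: I_def[symmetric] ennreal_leI)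
  then have "slide G t (max r 1) \<le> ennreal (4 * max r 1 powr (1 - 1 / m) * \<Lambda>)"
    using i m by (intro slide_bound) (auto simp: \<Lambda>_def)
  moreover have "slide G t r \<le> slide G t (max r 1)" by (intro slide_mono) auto
  ultimately show ?thesis by (metis ennreal_less_top leD le_less_trans)
qed

lemma Lm_fun_slide_finite:
  assumes "Lm_fun m h"
  shows "slide (\<lambda>y. ennreal \<bar>h y\<bar>) t r < top"
  using assms by (intro slide_Lp_finite) (auto simp: Lm_fun_def ennpowr_ennreal)

lemma Lm_fun_add:
  assumes "Lm_fun m f" "Lm_fun m g"
  shows "Lm_fun m (\<lambda>y. f y + c * g y)"
proof -
  have [measurable]: "f \<in> borel_measurable borel" "g \<in> borel_measurable borel" using assms by (auto simp: Lm_fun_def)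
  have "(\<integral>\<^sup>+y. ennreal (\<bar>f y + c * g y\<bar> powr m) \<partial>lborel) \<le> (\<integral>\<^sup>+y. ennreal (2 powr m) * (ennreal (\<bar>f y\<bar> powr m) + ennreal (\<bar>c\<bar> powr m) * ennreal (\<bar>g y\<bar> powr m)) \<partial>lborel)"
  proof (intro nn_integral_mono)
    fix y
    have "ennreal (\<bar>f y + c * g y\<bar> powr m) = ennpowr (ennreal \<bar>f y + c * g y\<bar>) m"
      by (simp add: ennpowr_ennreal)
    also have "\<dots> \<le> ennpowr (ennreal \<bar>f y\<bar> + ennreal \<bar>c * g y\<bar>) m"
      using m by (intro ennpowr_mono) (auto simp: ennreal_plus[symmetric] simp del: ennreal_plus intro!: ennreal_leI)
    also have "\<dots> \<le> ennreal (2 powr m) * (ennpowr (ennreal \<bar>f y\<bar>) m + ennpowr (ennreal \<bar>c * g y\<bar>) m)"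
      using m by (intro ennpowr_add_le) auto
    finally show "ennreal (\<bar>f y + c * g y\<bar> powr m) \<le> ennreal (2 powr m) * (ennreal (\<bar>f y\<bar> powr m) + ennreal (\<bar>c\<bar> powr m) * ennreal (\<bar>g y\<bar> powr m))"
      by (simp add: ennpowr_ennreal abs_mult powr_mult ennreal_mult ennpowr_mult)
  qed
  also have "\<dots> = ennreal (2 powr m) * ((\<integral>\<^sup>+y. ennreal (\<bar>f y\<bar> powr m) \<partial>lborel) + ennreal (\<bar>c\<bar> powr m) * (\<integral>\<^sup>+y. ennreal (\<bar>g y\<bar> powr m) \<partial>lborel))"
    by (simp add: nn_integral_cmult nn_integral_add)
  also have "\<dots> < top" using assms by (auto simp: Lm_fun_def ennreal_mult_less_top)
  finally show ?thesis by (simp add: Lm_fun_def)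
qed

text \<open>Three consequences of one smallness, with a common constant: for the profile in
  \<open>L\<^sup>m\<close>, for the wave in S, and for the wave at each radius. The last one lets
  the iteration converge at every point.\<close>

definition contracts :: "real \<Rightarrow> bool" where
  "contracts C \<longleftrightarrow> (\<forall>u w D A. joint_borel u \<longrightarrow> joint_borel w \<longrightarrow>
    0 < D \<longrightarrow> 0 < A \<longrightarrow> snorm m (\<lambda>t r. u t r - w t r) \<le> ennreal (D powr (2 * m + 1)) \<longrightarrow>
    snorm m u \<le> ennreal (A powr (2 * m + 1)) \<longrightarrow> snorm m w \<le> ennreal (A powr (2 * m + 1)) \<longrightarrow>
    (\<integral>\<^sup>+y. ennpowr (mass m u w y) m \<partial>lborel) \<le> ennreal ((C * D * A powr (2 * m)) powr m) \<and>
    S_int m (\<lambda>t r. slide (mass m u w) t r * ennreal (1 / r)) \<le> ennreal ((C * D * A powr (2 * m)) powr (2 * m + 1)) \<and>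
    (\<forall>t r. 0 < r \<longrightarrow> slide (mass m u w) t r * ennreal (1 / r) \<le> ennreal (C * r powr (- 1 / m) * D * A powr (2 * m))))"

text \<open>Minkowski's inequality turns the source bound, \<open>L\<^sup>1\<close> in time with
  values in \<open>L\<^sup>m\<close>, into an \<open>L\<^sup>m\<close> bound for
  \<open>mass\<close>, since translation along characteristics preserves the norm.
  \<open>strichartz\<close> and \<open>slide_bound\<close> are then applied to
  \<open>mass\<close>.\<close>

lemma contraction: "\<exists>C>0. contracts C"
proof -
  define q where "q = 2 * m + 1"
  have q: "1 < q" using m by (simp add: q_def)
  obtain C0 where C0: "0 < C0" and St: "\<And>G \<Lambda>. G \<in> borel_measurable borel \<Longrightarrow> 0 < \<Lambda> \<Longrightarrow> (\<integral>\<^sup>+y. ennpowr (G y) m \<partial>lborel) \<le> ennreal (\<Lambda> powr m) \<Longrightarrow>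
      S_int m (\<lambda>t r. slide G t r * ennreal (1 / r)) \<le> ennreal (C0 * \<Lambda> powr q)"
    using strichartz[OF m] unfolding q_def by blast
  obtain C1 where C1: "0 < C1" and Sr: "\<And>u w D A. joint_borel u \<Longrightarrow> joint_borel w \<Longrightarrow>
      0 < D \<Longrightarrow> 0 < A \<Longrightarrow> snorm m (\<lambda>t r. u t r - w t r) \<le> ennreal (D powr q) \<Longrightarrow>
      snorm m u \<le> ennreal (A powr q) \<Longrightarrow> snorm m w \<le> ennreal (A powr q) \<Longrightarrow>
      (\<integral>\<^sup>+s. Lp_norm m (\<lambda>z. ennreal \<bar>src m u s z - src m w s z\<bar>) \<partial>lborel) \<le> ennreal (C1 * D * A powr (2 * m))"
    using src_diff_bound[OF m] unfolding q_def by blast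
  \<comment> \<open>\<open>2 * C1\<close> is the source constant with Minkowski's factor;
    \<open>C0 powr (1 / q)\<close> absorbs the Strichartz constant and 4 the one of
    \<open>slide_bound\<close>.\<close>
  define C where "C = max (C0 powr (1 / q)) 4 * (2 * C1)"
  have C: "0 < C" unfolding C_def using C1 by (intro mult_pos_pos) (auto simp: less_max_iff_disj)
  show ?thesis
    unfolding contracts_def
  proof (intro exI[of _ C] conjI C allI impI)
    fix u w :: "real \<Rightarrow> real \<Rightarrow> real" and D A :: real
    assume [measurable]: "joint_borel u" "joint_borel w"
      and DA: "0 < D" "0 < A" and b: "snorm m (\<lambda>t r. u t r - w t r) \<le> ennreal (D powr (2 * m + 1))"
        "snorm m u \<le> ennreal (A powr (2 * m + 1))" "snorm m w \<le> ennreal (A powr (2 * m + 1))"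
    define \<Lambda> where "\<Lambda> = 2 * (C1 * D * A powr (2 * m))"
    have \<Lambda>: "0 < \<Lambda>" using C1 DA by (simp add: \<Lambda>_def)
    have M: "(\<integral>\<^sup>+y. ennpowr (mass m u w y) m \<partial>lborel) \<le> ennreal (\<Lambda> powr m)"
      unfolding mass_def \<Lambda>_def
    proof (rule minkowski_integral[OF m])
      have "ennpowr (\<integral>\<^sup>+x. ennpowr (ennreal \<bar>src m u s (x - s) - src m w s (x - s)\<bar>) m \<partial>lborel) (1 / m)
        = Lp_norm m (\<lambda>z. ennreal \<bar>src m u s z - src m w s z\<bar>)" for s
        using Lp_norm_shift[of "\<lambda>z. ennreal \<bar>src m u s z - src m w s z\<bar>" m s] by (simp add: Lp_norm_def)
      then show "(\<integral>\<^sup>+s. ennpowr (\<integral>\<^sup>+x. ennpowr (ennreal \<bar>src m u s (x - s) - src m w s (x - s)\<bar>) m \<partial>lborel) (1 / m) \<partial>lborel) \<le> ennreal (C1 * D * A powr (2 * m))"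
        using Sr[of u w D A] DA b by (simp add: q_def)
    qed (use C1 DA in auto)
    have \<Lambda>C: "\<Lambda> \<le> C * D * A powr (2 * m) / 4" "C0 powr (1 / q) * \<Lambda> \<le> C * D * A powr (2 * m)"
      using C1 DA by (auto simp: \<Lambda>_def C_def max_def field_simps)
    have \<Lambda>C': "\<Lambda> \<le> C * D * A powr (2 * m)" 
    proof -
      have "0 \<le> C * D * A powr (2 * m)" using C DA by simp
      then show ?thesis using \<Lambda>C(1) by linarith
    qed
    show "(\<integral>\<^sup>+y. ennpowr (mass m u w y) m \<partial>lborel) \<le> ennreal ((C * D * A powr (2 * m)) powr m)"
      using \<Lambda>C' \<Lambda> m by (intro order_trans[OF M] ennreal_leI powr_mono2) auto
    have "C0 * \<Lambda> powr q = (C0 powr (1 / q) * \<Lambda>) powr q"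
      using C0 q \<Lambda> by (simp add: powr_mult powr_powr)
    also have "\<dots> \<le> (C * D * A powr (2 * m)) powr q"
      using \<Lambda>C(2) C0 \<Lambda> q by (intro powr_mono2) auto
    finally show "S_int m (\<lambda>t r. slide (mass m u w) t r * ennreal (1 / r)) \<le> ennreal ((C * D * A powr (2 * m)) powr (2 * m + 1))"
      using St[OF _ \<Lambda> M] unfolding q_def by (auto intro: order_trans ennreal_leI)
    fix t r :: real
    assume r: "0 < r"
    have "slide (mass m u w) t r * ennreal (1 / r) \<le> ennreal (4 * r powr (1 - 1 / m) * \<Lambda>) * ennreal (1 / r)"
      by (intro mult_right_mono slide_bound[OF m _ r \<Lambda> M]) auto
    also have "\<dots> = ennreal (r powr (- 1 / m) * (4 * \<Lambda>))"
      using r \<Lambda> by (simp add: ennreal_mult[symmetric] powr_diff powr_minus field_simps)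
    also have "\<dots> \<le> ennreal (C * r powr (- 1 / m) * D * A powr (2 * m))"
    proof (intro ennreal_leI)
      have "r powr (- 1 / m) * (4 * \<Lambda>) \<le> r powr (- 1 / m) * (C * D * A powr (2 * m))"
        using \<Lambda>C(1) by (intro mult_left_mono) auto
      then show "r powr (- 1 / m) * (4 * \<Lambda>) \<le> C * r powr (- 1 / m) * D * A powr (2 * m)" by (simp add: mult_ac)
    qed
    finally show "slide (mass m u w) t r * ennreal (1 / r) \<le> ennreal (C * r powr (- 1 / m) * D * A powr (2 * m))" .
  qed
qed

text \<open>The Lipschitz bound against the zero function, with \<open>D = A\<close>, measures the
  source itself.\<close>

lemma mass_Lp_finite:
  assumes [measurable]: "joint_borel u" and fin: "snorm m u < top"
  shows "(\<integral>\<^sup>+y. ennpowr (mass m u (\<lambda>t r. 0) y) m \<partial>lborel) < top"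
proof -
  obtain i where i: "0 \<le> i" "snorm m u = ennreal i" using fin by (cases "snorm m u") auto
  define A where "A = (i + 1) powr (1 / (2 * m + 1))"
  have A: "0 < A" using i by (simp add: A_def)
  have "A powr (2 * m + 1) = i + 1" using i m by (simp add: A_def powr_powr)
  then have "snorm m u \<le> ennreal (A powr (2 * m + 1))" using i by (simp add: ennreal_leI)
  moreover obtain C where "contracts C" using contraction by blast
  from this[unfolded contracts_def, rule_format, of u "\<lambda>t r. 0" A A]
  have "snorm m u \<le> ennreal (A powr (2 * m + 1)) \<Longrightarrow> (\<integral>\<^sup>+y. ennpowr (mass m u (\<lambda>t r. 0) y) m \<partial>lborel) \<le> ennreal ((C * A * A powr (2 * m)) powr m)"
    using A m0 by simp
  ultimately have "\<exists>C. (\<integral>\<^sup>+y. ennpowr (mass m u (\<lambda>t r. 0) y) m \<partial>lborel) \<le> ennreal ((C * A * A powr (2 * m)) powr m)"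
    by blast
  then show ?thesis by (metis ennreal_less_top leD le_less_trans)
qed

lemma AE_src_integrable:
  assumes [measurable]: "joint_borel u" and fin: "snorm m u < top"
  shows "AE y in lborel. integrable lborel (\<lambda>s. src m u s (y - s))"
proof -
  have "AE y in lborel. ennpowr (mass m u (\<lambda>t r. 0) y) m \<noteq> \<infinity>"
    using mass_Lp_finite[OF assms] by (intro nn_integral_PInf_AE) auto
  then show ?thesis
    by eventually_elim (auto simp: integrable_iff_bounded mass_def less_top)
qed

lemma acc_le_mass: "ennreal \<bar>acc m u a t y\<bar> \<le> mass m u (\<lambda>t r. 0) y"
  unfolding acc_def mass_def
  by (rule order_trans[OF abs_set_integral_le]) (auto intro!: nn_integral_mono simp: indicator_def)

lemma Lm_fun_acc:
  assumes [measurable]: "joint_borel u" and fin: "snorm m u < top"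
  shows "Lm_fun m (acc m u a t)"
  unfolding Lm_fun_def
proof
  have "(\<integral>\<^sup>+y. ennreal (\<bar>acc m u a t y\<bar> powr m) \<partial>lborel) \<le> (\<integral>\<^sup>+y. ennpowr (mass m u (\<lambda>t r. 0) y) m \<partial>lborel)"
    using ennpowr_mono[OF acc_le_mass, of m u a t] m by (intro nn_integral_mono) (auto simp: ennpowr_ennreal)
  also have "\<dots> < top" by (intro mass_Lp_finite assms)
  finally show "(\<integral>\<^sup>+y. ennreal (\<bar>acc m u a t y\<bar> powr m) \<partial>lborel) < top" .
qed measurable

lemma Lm_fun_flow:
  assumes "Lm_fun m h" "joint_borel u" "snorm m u < top"
  shows "Lm_fun m (flow h u a t)"
  unfolding flow_def by (intro Lm_fun_add Lm_fun_acc assms)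

lemma Lm_fun_integrable: "Lm_fun m h \<Longrightarrow> set_integrable lborel {t - r..t + r} h"
  using Lm_fun_slide_finite[of h t r] unfolding slide_def
  by (intro set_integrableI_nn_integral) (auto simp: Lm_fun_def)

lemma abs_avg_le:
  assumes "0 < r"
  shows "ennreal \<bar>avg g t r\<bar> \<le> slide (\<lambda>y. ennreal \<bar>g y\<bar>) t r * ennreal (1 / r)"
proof -
  have "ennreal \<bar>avg g t r\<bar> = ennreal \<bar>LINT y:{t - r..t + r}|lborel. g y\<bar> * ennreal (1 / r)"
    using assms by (simp add: avg_def ennreal_mult[symmetric])
  also have "\<dots> \<le> slide (\<lambda>y. ennreal \<bar>g y\<bar>) t r * ennreal (1 / r)"
    unfolding slide_def by (intro mult_right_mono abs_set_integral_le) auto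
  finally show ?thesis .
qed

lemma avg_diff:
  assumes "Lm_fun m g" "Lm_fun m k"
  shows "avg g t r - avg k t r = avg (\<lambda>y. g y - k y) t r"
  unfolding avg_def using assms by (simp add: Lm_fun_integrable set_integral_diff diff_divide_distrib)

text \<open>Sources are integrable along almost every characteristic only, but averages in
  \<open>y\<close> do not see the exceptional set, so the estimate holds at every \<open>t\<close>.
  Times outside \<open>[a, t]\<close> are kept out because uniqueness cancels the earlier part of
  this interval; the bound by \<open>mass\<close> is a weakening.\<close>

lemma avg_flow_diff:
  assumes h: "Lm_fun m h" and [measurable]: "joint_borel u" "joint_borel w"
    and fin: "snorm m u < top" "snorm m w < top" and r: "0 < r"
  shows "ennreal \<bar>avg (flow h u a t) t r - avg (flow h w a t) t r\<bar>
    \<le> slide (\<lambda>y. \<integral>\<^sup>+s\<in>{a..t}. ennreal \<bar>src m u s (y - s) - src m w s (y - s)\<bar> \<partial>lborel) t r * ennreal (1 / r)"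
proof -
  have [measurable]: "h \<in> borel_measurable borel" using h by (simp add: Lm_fun_def)
  have "ennreal \<bar>avg (flow h u a t) t r - avg (flow h w a t) t r\<bar>
    \<le> slide (\<lambda>y. ennreal \<bar>flow h u a t y - flow h w a t y\<bar>) t r * ennreal (1 / r)"
    by (subst avg_diff) (auto intro!: Lm_fun_flow h fin abs_avg_le r)
  also have "\<dots> \<le> slide (\<lambda>y. \<integral>\<^sup>+s\<in>{a..t}. ennreal \<bar>src m u s (y - s) - src m w s (y - s)\<bar> \<partial>lborel) t r * ennreal (1 / r)"
    unfolding slide_def
  proof (intro mult_right_mono nn_integral_mono_AE)
    have ae: "AE y in lborel. integrable lborel (\<lambda>s. src m u s (y - s))" "AE y in lborel. integrable lborel (\<lambda>s. src m w s (y - s))"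
      by (rule AE_src_integrable; use fin in simp)+
    show "AE y in lborel. ennreal \<bar>flow h u a t y - flow h w a t y\<bar> * indicator {t - r..t + r} y
      \<le> (\<integral>\<^sup>+s\<in>{a..t}. ennreal \<bar>src m u s (y - s) - src m w s (y - s)\<bar> \<partial>lborel) * indicator {t - r..t + r} y"
      using ae
    proof eventually_elim
      fix y assume i: "integrable lborel (\<lambda>s. src m u s (y - s))" "integrable lborel (\<lambda>s. src m w s (y - s))"
      have "flow h u a t y - flow h w a t y = \<iota> / 2 * (acc m u a t y - acc m w a t y)"
        by (simp add: flow_def algebra_simps)
      also have "acc m u a t y - acc m w a t y = (LINT s:{a..t}|lborel. src m u s (y - s) - src m w s (y - s))"
        unfolding acc_def using i
        by (intro set_integral_diff(2)[symmetric]) (auto simp only: set_integrable_def intro!: integrable_mult_indicator, auto)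
      finally have "\<bar>flow h u a t y - flow h w a t y\<bar> = \<bar>\<iota> / 2 * (LINT s:{a..t}|lborel. src m u s (y - s) - src m w s (y - s))\<bar>"
        by (rule arg_cong)
      also have "\<dots> \<le> \<bar>LINT s:{a..t}|lborel. src m u s (y - s) - src m w s (y - s)\<bar>"
        using \<iota> by (simp add: abs_mult)
      finally have "\<bar>flow h u a t y - flow h w a t y\<bar> \<le> \<bar>LINT s:{a..t}|lborel. src m u s (y - s) - src m w s (y - s)\<bar>" .
      then have "ennreal \<bar>flow h u a t y - flow h w a t y\<bar> \<le> (\<integral>\<^sup>+s\<in>{a..t}. ennreal \<bar>src m u s (y - s) - src m w s (y - s)\<bar> \<partial>lborel)"
        using abs_set_integral_le order_trans ennreal_leI by blast
      then show "ennreal \<bar>flow h u a t y - flow h w a t y\<bar> * indicator {t - r..t + r} y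
        \<le> (\<integral>\<^sup>+s\<in>{a..t}. ennreal \<bar>src m u s (y - s) - src m w s (y - s)\<bar> \<partial>lborel) * indicator {t - r..t + r} y"
        by (intro mult_right_mono) auto
    qed measurable
  qed simp
  finally show ?thesis .
qed

end

lemma S_int_restrict:
  assumes "0 < m"
  shows "S_int m (\<lambda>t r. B t r * indicator I t)
    = (\<integral>\<^sup>+t\<in>I. ennpowr (\<integral>\<^sup>+r\<in>{0<..}. ennpowr (B t r) ((2 * m + 1) * m) * ennreal (r powr m) \<partial>lborel) (1 / m) \<partial>lborel)"
  unfolding S_int_def by (intro nn_integral_cong) (auto simp: indicator_def)

lemma S_int_shrinking_interval:
  assumes "0 < m" and [measurable]: "joint_borel B" and fin: "S_int m B < top" and "0 < e"
  shows "\<exists>d>0. d \<le> 1 \<and> S_int m (\<lambda>t r. B t r * indicator {a - d..a + d} t) < e"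
  unfolding S_int_restrict[OF assms(1)]
proof (rule nn_integral_shrinking_interval)
  show "(\<integral>\<^sup>+t\<in>{a - 1..a + 1}. ennpowr (\<integral>\<^sup>+r\<in>{0<..}. ennpowr (B t r) ((2 * m + 1) * m) * ennreal (r powr m) \<partial>lborel) (1 / m) \<partial>lborel) < top"
    using fin unfolding S_int_def
    by (rule le_less_trans[rotated]) (auto intro!: nn_integral_mono simp: indicator_def)
qed (use assms in auto)

text \<open>The end points of the time interval are null. Agreement before \<open>t\<close>
  therefore fixes the profile at \<open>t\<close>, which lets a solution be extended to a closing
  time.\<close>

lemma acc_cong:
  assumes [measurable]: "joint_borel u" "joint_borel w"
    and eq: "\<And>s r. a < s \<Longrightarrow> s < t \<Longrightarrow> 0 < r \<Longrightarrow> u s r = w s r"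
  shows "acc m u a t y = acc m w a t y"
  unfolding acc_def
proof (rule set_lebesgue_integral_cong_AE)
  show "AE s\<in>{a..t} in lborel. src m u s (y - s) = src m w s (y - s)"
    using AE_lborel_singleton[of a] AE_lborel_singleton[of t]
    by eventually_elim (auto intro!: src_cong eq)
qed measurable

lemma avg_cong_AE:
  assumes [measurable]: "g \<in> borel_measurable borel" "k \<in> borel_measurable borel" and "AE y in lborel. g y = k y"
  shows "avg g t r = avg k t r"
  unfolding avg_def using assms(3)
  by (intro arg_cong[where f = "\<lambda>x. x / r"] set_lebesgue_integral_cong_AE) (auto intro: AE_mp)

context wave
begin

text \<open>
  Solutions are cut off outside \<open>[a, b] \<times> (0, \<infinity>)\<close>, so that uniqueness is an equality of functions.
\<close>

definition sol :: "real \<Rightarrow> real \<Rightarrow> (real \<Rightarrow> real) \<Rightarrow> (real \<Rightarrow> real \<Rightarrow> real) \<Rightarrow> bool" where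
  "sol a b h u \<longleftrightarrow> joint_borel u \<and> snorm m u < top \<and>
    (\<forall>t r. \<not> (a \<le> t \<and> t \<le> b \<and> 0 < r) \<longrightarrow> u t r = 0) \<and>
    (\<forall>t r. a \<le> t \<longrightarrow> t \<le> b \<longrightarrow> 0 < r \<longrightarrow> u t r = avg (flow h u a t) t r)"

text \<open>\<open>snorm\<close> is a power of a norm, so its triangle inequality carries this
  constant.\<close>

definition quasi :: real where "quasi = 4 * 2 powr (2 * m + 1)"

lemma quasi_pos: "0 < quasi"
  by (simp add: quasi_def)

lemma snorm_diff: "joint_borel u \<Longrightarrow> joint_borel w \<Longrightarrow>
    snorm m (\<lambda>t r. u t r - w t r) \<le> ennreal quasi * (snorm m u + snorm m w)"
  unfolding quasi_def by (rule snorm_diff_le[OF m])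

lemma contractsD:
  assumes "contracts C" "joint_borel u" "joint_borel w"
    "0 < D" "0 < A" "snorm m (\<lambda>t r. u t r - w t r) \<le> ennreal (D powr (2 * m + 1))"
    "snorm m u \<le> ennreal (A powr (2 * m + 1))" "snorm m w \<le> ennreal (A powr (2 * m + 1))"
  shows "(\<integral>\<^sup>+y. ennpowr (mass m u w y) m \<partial>lborel) \<le> ennreal ((C * D * A powr (2 * m)) powr m)"
    "S_int m (\<lambda>t r. slide (mass m u w) t r * ennreal (1 / r)) \<le> ennreal ((C * D * A powr (2 * m)) powr (2 * m + 1))"
    "0 < r \<Longrightarrow> slide (mass m u w) t r * ennreal (1 / r) \<le> ennreal (C * r powr (- 1 / m) * D * A powr (2 * m))"
  using assms(1)[unfolded contracts_def, rule_format, of u w D A] assms by blast+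

lemma slide_part_le_mass:
  "slide (\<lambda>y. \<integral>\<^sup>+s\<in>{a..t}. ennreal \<bar>src m u s (y - s) - src m w s (y - s)\<bar> \<partial>lborel) t r \<le> slide (mass m u w) t r"
  unfolding mass_def by (intro slide_mono nn_integral_mono) (auto simp: indicator_def)

lemma flow_zero: "flow h (\<lambda>t r. 0) a t = h"
  by (auto simp: flow_def acc_def set_lebesgue_integral_def)

text \<open>Picard iteration with values kept at every point. The length of the interval is a time
  during which the free wave with profile \<open>h\<close> stays small in S.\<close>

theorem local_existence:
  assumes h: "Lm_fun m h"
  shows "\<exists>b>a. \<exists>u. sol a b h u"
proof -
  have [measurable]: "h \<in> borel_measurable borel" using h by (simp add: Lm_fun_def)
  define q where "q = 2 * m + 1"
  have q: "1 < q" using m by (simp add: q_def)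
  obtain C where C: "0 < C" "contracts C" using contraction by blast
  \<comment> \<open>The entry 1/2 makes the iteration contract. The other entry yields
    \<open>quasi * \<theta> powr q \<le> 1 / 2\<close>, which leaves the ball invariant in spite of
    the constant \<open>quasi\<close>.\<close>
  define \<theta> where "\<theta> = min (1 / 2) ((1 / (2 * quasi)) powr (1 / q))"
  have \<theta>: "0 < \<theta>" "\<theta> \<le> 1 / 2" "quasi * \<theta> powr q \<le> 1 / 2"
  proof -
    have "\<theta> powr q \<le> ((1 / (2 * quasi)) powr (1 / q)) powr q"
      using q quasi_pos by (intro powr_mono2) (auto simp: \<theta>_def)
    also have "\<dots> = 1 / (2 * quasi)" using q quasi_pos by (simp add: powr_powr)
    finally show "quasi * \<theta> powr q \<le> 1 / 2" using quasi_pos by (simp add: field_simps)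
  qed (use quasi_pos in \<open>auto simp: \<theta>_def\<close>)
  \<comment> \<open>The radius at which the Lipschitz constant \<open>C * A powr (2 * m)\<close>
    equals \<theta>.\<close>
  define A where "A = (\<theta> / C) powr (1 / (2 * m))"
  have A: "0 < A" "C * A powr (2 * m) = \<theta>"
    using C \<theta> m by (auto simp: A_def powr_powr)
  \<comment> \<open>Averaging the absolute value of \<open>h\<close> gives a majorant of the free
    wave to which the Strichartz estimate applies.\<close>
  define L where "L = (\<lambda>t r. slide (\<lambda>y. ennreal \<bar>h y\<bar>) t r * ennreal (1 / r))"
  have [measurable]: "joint_borel L" unfolding L_def by measurable
  have "S_int m L < top"
  proof -
    obtain i where i: "0 \<le> i" "(\<integral>\<^sup>+y. ennreal (\<bar>h y\<bar> powr m) \<partial>lborel) = ennreal i"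
      using h by (cases "\<integral>\<^sup>+y. ennreal (\<bar>h y\<bar> powr m) \<partial>lborel") (auto simp: Lm_fun_def)
    define \<Lambda> where "\<Lambda> = (i + 1) powr (1 / m)"
    have \<Lambda>: "0 < \<Lambda>" "\<Lambda> powr m = i + 1" using i m by (auto simp: \<Lambda>_def powr_powr)
    then have "(\<integral>\<^sup>+y. ennpowr (ennreal \<bar>h y\<bar>) m \<partial>lborel) \<le> ennreal (\<Lambda> powr m)"
      using i by (simp add: ennpowr_ennreal ennreal_leI)
    moreover obtain C' where "\<And>G \<Lambda>. G \<in> borel_measurable borel \<Longrightarrow> 0 < \<Lambda> \<Longrightarrow> (\<integral>\<^sup>+y. ennpowr (G y) m \<partial>lborel) \<le> ennreal (\<Lambda> powr m) \<Longrightarrow>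
      S_int m (\<lambda>t r. slide G t r * ennreal (1 / r)) \<le> ennreal (C' * \<Lambda> powr (2 * m + 1))"
      using strichartz[OF m] by blast
    ultimately have "S_int m L \<le> ennreal (C' * \<Lambda> powr (2 * m + 1))"
      unfolding L_def using \<Lambda> by auto
    then show ?thesis by (metis ennreal_less_top le_less_trans)
  qed
  then obtain d where d: "0 < d" "S_int m (\<lambda>t r. L t r * indicator {a - d..a + d} t) < ennreal (A powr q / (2 * quasi))"
    using S_int_shrinking_interval[OF m0, of L "ennreal (A powr q / (2 * quasi))" a] A quasi_pos by auto
  define T where "T = (\<lambda>u t r. if a \<le> t \<and> t \<le> a + d \<and> 0 < r then avg (flow h u a t) t r else 0)"
  have T_meas: "joint_borel (T u)" if [measurable]: "joint_borel u" for u
    unfolding T_def by measurable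
  have fin: "snorm m u < top" if "snorm m u \<le> ennreal (x powr q)" for u x
    using that by (metis ennreal_less_top le_less_trans)
  have T_diff: "\<bar>T u t r - T w t r\<bar> \<le> x" if "0 \<le> x" "joint_borel u" "joint_borel w"
      "snorm m u < top" "snorm m w < top" "0 < r" "slide (mass m u w) t r * ennreal (1 / r) \<le> ennreal x" for u w t r x
  proof (cases "a \<le> t \<and> t \<le> a + d")
    case True
    have "ennreal \<bar>avg (flow h u a t) t r - avg (flow h w a t) t r\<bar> \<le> slide (mass m u w) t r * ennreal (1 / r)"
      by (rule order_trans[OF avg_flow_diff[OF h that(2-6)]]) (intro mult_right_mono slide_part_le_mass, simp)
    also have "\<dots> \<le> ennreal x" by fact
    finally show ?thesis using True that by (simp add: T_def)
  qed (use that in \<open>auto simp: T_def\<close>)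
  have contr: "snorm m (\<lambda>t r. T u t r - T w t r) \<le> ennreal ((D / 2) powr q)" "\<And>t r. 0 < r \<Longrightarrow> \<bar>T u t r - T w t r\<bar> \<le> C * r powr (- 1 / m) * D * A powr (2 * m)"
    and contr_theta: "snorm m (\<lambda>t r. T u t r - T w t r) \<le> ennreal ((\<theta> * D) powr q)"
    if um: "joint_borel u" and wm: "joint_borel w"
      and D: "0 < D" and sd: "snorm m (\<lambda>t r. u t r - w t r) \<le> ennreal (D powr q)"
      and su: "snorm m u \<le> ennreal (A powr q)" and sw: "snorm m w \<le> ennreal (A powr q)" for u w D
  proof -
    note c = contractsD[OF C(2) um wm D A(1) sd[unfolded q_def] su[unfolded q_def] sw[unfolded q_def]]
    show "\<bar>T u t r - T w t r\<bar> \<le> C * r powr (- 1 / m) * D * A powr (2 * m)" if "0 < r" for t r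
      using C A D by (intro T_diff um wm fin[OF su] fin[OF sw] that c(3)) auto
    have pt: "ennreal \<bar>T u t r - T w t r\<bar> \<le> slide (mass m u w) t r * ennreal (1 / r)" if "0 < r" for t r
    proof -
      have "slide (mass m u w) t r * ennreal (1 / r) \<le> ennreal (C * r powr (- 1 / m) * D * A powr (2 * m))"
        by (rule c(3)[OF that])
      then obtain x where x: "0 \<le> x" "slide (mass m u w) t r * ennreal (1 / r) = ennreal x"
        by (cases "slide (mass m u w) t r * ennreal (1 / r)") (auto simp: top_unique)
      then have "\<bar>T u t r - T w t r\<bar> \<le> x" by (intro T_diff um wm fin[OF su] fin[OF sw] that) auto
      then show ?thesis using x by (simp add: ennreal_leI)
    qed
    have "snorm m (\<lambda>t r. T u t r - T w t r) \<le> S_int m (\<lambda>t r. slide (mass m u w) t r * ennreal (1 / r))"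
      unfolding snorm_def by (intro S_int_mono m0 pt)
    also have "\<dots> \<le> ennreal ((C * D * A powr (2 * m)) powr q)" using c(2) by (simp add: q_def)
    also have "C * D * A powr (2 * m) = \<theta> * D" using A(2) by (simp add: mult_ac)
    finally show t: "snorm m (\<lambda>t r. T u t r - T w t r) \<le> ennreal ((\<theta> * D) powr q)" .
    also have "\<dots> \<le> ennreal ((D / 2) powr q)"
      using \<theta> D q by (intro ennreal_leI powr_mono2) auto
    finally show "snorm m (\<lambda>t r. T u t r - T w t r) \<le> ennreal ((D / 2) powr q)" .
  qed
  define Z where "Z = (\<lambda>(t::real) (r::real). 0::real)"
  have Zm: "joint_borel Z" and Zs: "snorm m Z = 0" using m0 by (auto simp: Z_def)
  have T0: "snorm m (T Z) \<le> ennreal (A powr q / (2 * quasi))"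
  proof -
    have "snorm m (T Z) \<le> S_int m (\<lambda>t r. L t r * indicator {a - d..a + d} t)"
      unfolding snorm_def
    proof (intro S_int_mono m0)
      fix t r :: real assume "0 < r"
      then show "ennreal \<bar>T Z t r\<bar> \<le> L t r * indicator {a - d..a + d} t"
        using abs_avg_le[of r h t] d by (auto simp: T_def L_def Z_def flow_zero)
    qed
    with d show ?thesis by simp
  qed
  \<comment> \<open>Half of the ball is reserved for the free wave \<open>T Z\<close>, through the
    threshold \<open>A powr q / (2 * quasi)\<close>, and half for the Duhamel part, through the
    choice of \<theta>.\<close>
  have ball: "snorm m (T u) \<le> ennreal (A powr q)" if um: "joint_borel u" and su: "snorm m u \<le> ennreal (A powr q)" for u
  proof -
    have s: "snorm m (\<lambda>t r. Z t r - u t r) \<le> ennreal (A powr q)"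
      using su by (simp add: Z_def snorm_def)
    have "T u = (\<lambda>t r. T Z t r - (T Z t r - T u t r))" by auto
    then have "snorm m (T u) \<le> ennreal quasi * (snorm m (T Z) + snorm m (\<lambda>t r. T Z t r - T u t r))"
      using snorm_diff[of "T Z" "\<lambda>t r. T Z t r - T u t r"] T_meas[OF um] T_meas[OF Zm] by simp
    also have "\<dots> \<le> ennreal quasi * (ennreal (A powr q / (2 * quasi)) + ennreal ((\<theta> * A) powr q))"
      by (intro mult_left_mono add_mono T0 contr_theta[OF Zm um A(1) s _ su]) (auto simp: Zs)
    also have "\<dots> = ennreal (A powr q / 2 + quasi * \<theta> powr q * A powr q)"
      using quasi_pos \<theta> A by (simp add: ennreal_mult[symmetric] ennreal_plus[symmetric] powr_mult field_simps del: ennreal_plus)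
    also have "\<dots> \<le> ennreal (A powr q)"
    proof (intro ennreal_leI)
      have "quasi * \<theta> powr q * A powr q \<le> 1 / 2 * A powr q" using \<theta> by (intro mult_right_mono) auto
      then show "A powr q / 2 + quasi * \<theta> powr q * A powr q \<le> A powr q" by simp
    qed
    finally show ?thesis .
  qed
  define U where "U = (\<lambda>n. (T ^^ n) Z)"
  have U0: "U 0 = Z" and US: "U (Suc n) = T (U n)" for n by (simp_all add: U_def)
  have Um: "joint_borel (U n)" for n
    by (induction n) (auto simp: U0 US Zm intro: T_meas)
  have Us: "snorm m (U n) \<le> ennreal (A powr q)" for n
    by (induction n) (auto simp: U0 US Zs intro: ball Um)
  note Um[measurable]
  have Uc: "snorm m (\<lambda>t r. U (n + k) t r - U n t r) \<le> ennreal ((A / 2 ^ n) powr q)" for n k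
  proof (induction n)
    case 0
    then show ?case using Us[of k] by (simp add: U0 Z_def)
  next
    case (Suc n)
    show ?case using contr(1)[OF Um Um _ Suc Us Us] A by (simp add: US mult.commute)
  qed
  define B where "B = (\<lambda>r. C * r powr (- 1 / m) * A * A powr (2 * m))"
  \<comment> \<open>The shift of the index by one reflects that norms of the arguments give
    pointwise bounds for their images under \<open>T\<close>.\<close>
  have Up: "\<bar>U (Suc n + k) t r - U (Suc n) t r\<bar> \<le> B r * (1 / 2) ^ n" if "0 < r" for n k t r
    using contr(2)[OF Um Um _ Uc Us Us that] A by (simp add: US B_def power_divide mult_ac)
  have outside: "U n t r = 0" if "\<not> (a \<le> t \<and> t \<le> a + d \<and> 0 < r)" for n t r
    using that by (cases n) (auto simp: U0 US Z_def T_def)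
  have small: "\<exists>N. B r * (1 / 2) ^ N < e" if "0 < e" for r e
  proof -
    have "(\<lambda>N. B r * (1 / 2) ^ N) \<longlonglongrightarrow> B r * 0" by (intro tendsto_mult tendsto_const LIMSEQ_power_zero) auto
    then have "eventually (\<lambda>N. B r * (1 / 2) ^ N < e) sequentially" using that by (intro order_tendstoD(2)) auto
    then show ?thesis by (auto simp: eventually_sequentially)
  qed
  \<comment> \<open>Convergence holds at every point and not just almost everywhere: the geometric
    bound depends on the radius alone.\<close>
  have "Cauchy (\<lambda>n. U n t r)" for t r
  proof (cases "a \<le> t \<and> t \<le> a + d \<and> 0 < r")
    case True
    show ?thesis
    proof (rule CauchyI')
      fix e :: real assume "0 < e"
      then obtain N where N: "B r * (1 / 2) ^ N < e" using small by blast
      have "dist (U i t r) (U j t r) < e" if "Suc N \<le> i" "i < j" for i j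
      proof -
        note ij = that
        obtain n where n: "i = Suc n" "N \<le> n" using ij by (cases i) auto
        obtain k where k: "j = Suc n + k" using ij n by (auto dest: less_imp_add_positive)
        have "\<bar>U j t r - U i t r\<bar> \<le> B r * (1 / 2) ^ n" using Up[of r n k t] True n k by simp
        also have "\<dots> \<le> B r * (1 / 2) ^ N"
          using n C A by (intro mult_left_mono power_decreasing) (auto simp: B_def)
        finally show ?thesis using N by (simp add: dist_real_def abs_minus_commute)
      qed
      then show "\<exists>M. \<forall>i\<ge>M. \<forall>j>i. dist (U i t r) (U j t r) < e" by blast
    qed
  qed (use outside in \<open>auto intro!: convergent_Cauchy convergent_const\<close>)
  then have conv: "(\<lambda>n. U n t r) \<longlonglongrightarrow> lim (\<lambda>n. U n t r)" for t r
    by (simp add: Cauchy_convergent_iff convergent_LIMSEQ_iff)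
  define u where "u = (\<lambda>t r. lim (\<lambda>n. U n t r))"
  have um[measurable]: "joint_borel u"
    unfolding u_def by measurable
  have us: "snorm m u \<le> ennreal (A powr q)"
    using conv by (intro snorm_fatou[OF m0 Um um _ Us]) (auto simp: u_def)
  have uc: "snorm m (\<lambda>t r. u t r - U n t r) \<le> ennreal ((A / 2 ^ n) powr q)" for n
  proof (rule snorm_fatou[OF m0])
    show "(\<lambda>k. U (n + k) t r - U n t r) \<longlonglongrightarrow> u t r - U n t r" for t r
    proof -
      have "(\<lambda>k. U (k + n) t r) \<longlonglongrightarrow> u t r" using conv unfolding u_def by (rule LIMSEQ_ignore_initial_segment)
      then show ?thesis by (intro tendsto_diff tendsto_const) (simp add: add.commute)
    qed
    show "snorm m (\<lambda>t r. U (n + k) t r - U n t r) \<le> ennreal ((A / 2 ^ n) powr q)" for k by (rule Uc)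
  qed measurable
  have uT: "u t r = T u t r" for t r
  proof (cases "0 < r")
    case True
    \<comment> \<open>The pointwise half of the contraction estimate carries the limit through
      \<open>T\<close> at fixed \<open>t\<close> and \<open>r\<close>, so the equation is met at
      every point.\<close>
    have "(\<lambda>n. T (U n) t r) \<longlonglongrightarrow> T u t r"
    proof (rule LIMSEQ_I)
      fix e :: real assume "0 < e"
      then obtain N where N: "B r * (1 / 2) ^ N < e" using small by blast
      have "norm (T (U n) t r - T u t r) < e" if "N \<le> n" for n
      proof -
        have "\<bar>T u t r - T (U n) t r\<bar> \<le> B r * (1 / 2) ^ n"
          using contr(2)[OF um Um _ uc us Us True] A by (simp add: B_def power_divide mult_ac)
        also have "\<dots> \<le> B r * (1 / 2) ^ N"
          using that C A by (intro mult_left_mono power_decreasing) (auto simp: B_def)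
        finally show ?thesis using N by (simp add: abs_minus_commute)
      qed
      then show "\<exists>M. \<forall>n\<ge>M. norm (T (U n) t r - T u t r) < e" by blast
    qed
    moreover have "(\<lambda>n. T (U n) t r) \<longlonglongrightarrow> u t r"
      using LIMSEQ_Suc[OF conv[of t r]] by (simp add: US u_def)
    ultimately show ?thesis by (rule LIMSEQ_unique[rotated])
  next
    case False
    then show ?thesis by (simp add: u_def outside T_def)
  qed
  have "u t r = 0" if "\<not> (a \<le> t \<and> t \<le> a + d \<and> 0 < r)" for t r
    using uT[of t r] that by (simp only: T_def if_False)
  moreover have "u t r = avg (flow h u a t) t r" if "a \<le> t" "t \<le> a + d" "0 < r" for t r
    using uT[of t r] that by (simp only: T_def simp_thms if_True)
  ultimately have "sol a (a + d) h u"
    unfolding sol_def using um fin[OF us] by blast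
  then show ?thesis using d by (intro exI[of _ "a + d"]) auto
qed

end

section \<open>Uniqueness and maximal forward solutions\<close>

context wave
begin

lemma solD:
  assumes "sol a b h u"
  shows "joint_borel u" "snorm m u < top"
    "\<not> (a \<le> t \<and> t \<le> b \<and> 0 < r) \<Longrightarrow> u t r = 0"
    "a \<le> t \<Longrightarrow> t \<le> b \<Longrightarrow> 0 < r \<Longrightarrow> u t r = avg (flow h u a t) t r"
  using assms unfolding sol_def by blast+

text \<open>Continuation along time. Agreement up to \<open>c\<close> is a closed condition, as the
  value at \<open>c\<close> depends on earlier sources only; and it extends to the right, as finite
  S norms become small on short intervals.\<close>

lemma sol_unique:
  assumes h: "Lm_fun m h" and u: "sol a b h u" and w: "sol a b h w" and ab: "a \<le> b"
  shows "u = w"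
proof -
  define q where "q = 2 * m + 1"
  have q: "1 < q" using m by (simp add: q_def)
  note [measurable] = solD(1)[OF u] solD(1)[OF w]
  define P where "P = (\<lambda>c. \<forall>t\<le>c. \<forall>r. u t r = w t r)"
  have limit: "P c" if c: "c \<le> b" and eq: "\<And>t r. t < c \<Longrightarrow> u t r = w t r" for c
  proof -
    have "u c r = w c r" for r
    proof (cases "a \<le> c \<and> 0 < r")
      case True
      have "acc m u a c y = acc m w a c y" for y
        using eq by (intro acc_cong) auto
      then have "flow h u a c = flow h w a c" by (auto simp: flow_def)
      then show ?thesis using True c solD(4)[OF u, of c r] solD(4)[OF w, of c r] by simp
    qed (use solD(3)[OF u] solD(3)[OF w] in auto)
    then show ?thesis unfolding P_def using eq by (metis le_less)
  qed
  have step: "\<exists>e>c. e \<le> b \<and> P e" if c: "a \<le> c" "c < b" and Pc: "P c" for c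
  proof -
    obtain C where C: "0 < C" "contracts C" using contraction by blast
    \<comment> \<open>Makes the Lipschitz constant \<open>C * A powr (2 * m)\<close> equal to 1/2
      for the two solutions on a short interval after \<open>c\<close>.\<close>
    define A where "A = (1 / (2 * C)) powr (1 / (2 * m))"
    have A: "0 < A" "C * A powr (2 * m) = 1 / 2"
      using C m by (auto simp: A_def powr_powr)
    have Aq: "0 < ennreal (A powr q)" using A by simp
    obtain d1 where d1: "0 < d1" "S_int m (\<lambda>t r. ennreal \<bar>u t r\<bar> * indicator {c - d1..c + d1} t) < ennreal (A powr q)"
      using S_int_shrinking_interval[OF m0, of "\<lambda>t r. ennreal \<bar>u t r\<bar>" "ennreal (A powr q)" c] Aq solD(2)[OF u]
      by (auto simp: snorm_def)
    obtain d2 where d2: "0 < d2" "S_int m (\<lambda>t r. ennreal \<bar>w t r\<bar> * indicator {c - d2..c + d2} t) < ennreal (A powr q)"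
      using S_int_shrinking_interval[OF m0, of "\<lambda>t r. ennreal \<bar>w t r\<bar>" "ennreal (A powr q)" c] Aq solD(2)[OF w]
      by (auto simp: snorm_def)
    define e where "e = min b (c + min d1 d2)"
    have e: "c < e" "e \<le> b" "e \<le> c + d1" "e \<le> c + d2" using c d1 d2 by (auto simp: e_def)
    \<comment> \<open>Cutting to \<open>[c, e]\<close> loses nothing: up to \<open>c\<close> the two
      sources agree and cancel in the difference.\<close>
    define u' where "u' = (\<lambda>t r. if c \<le> t \<and> t \<le> e then u t r else 0)"
    define w' where "w' = (\<lambda>t r. if c \<le> t \<and> t \<le> e then w t r else 0)"
    have um: "joint_borel u'" and wm: "joint_borel w'"
      unfolding u'_def w'_def by measurable
    have "snorm m u' \<le> S_int m (\<lambda>t r. ennreal \<bar>u t r\<bar> * indicator {c - d1..c + d1} t)"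
      unfolding snorm_def using e d1 by (intro S_int_mono m0) (auto simp: u'_def indicator_def)
    with d1 have us: "snorm m u' \<le> ennreal (A powr q)" by simp
    have "snorm m w' \<le> S_int m (\<lambda>t r. ennreal \<bar>w t r\<bar> * indicator {c - d2..c + d2} t)"
      unfolding snorm_def using e d2 by (intro S_int_mono m0) (auto simp: w'_def indicator_def)
    with d2 have ws: "snorm m w' \<le> ennreal (A powr q)" by simp
    have pt: "ennreal \<bar>u' t r - w' t r\<bar> \<le> slide (mass m u' w') t r * ennreal (1 / r)" if r: "0 < r" for t r
    proof (cases "c \<le> t \<and> t \<le> e")
      case True
      then have t: "a \<le> t" "t \<le> b" using c e by auto
      have "ennreal \<bar>u t r - w t r\<bar> \<le> slide (\<lambda>y. \<integral>\<^sup>+s\<in>{a..t}. ennreal \<bar>src m u s (y - s) - src m w s (y - s)\<bar> \<partial>lborel) t r * ennreal (1 / r)"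
        using avg_flow_diff[OF h _ _ solD(2)[OF u] solD(2)[OF w] r, of a t] solD(4)[OF u t r] solD(4)[OF w t r] by simp
      also have "\<dots> \<le> slide (mass m u' w') t r * ennreal (1 / r)"
        unfolding mass_def
      proof (intro mult_right_mono slide_mono nn_integral_mono)
        fix y s
        have "src m u s (y - s) = src m w s (y - s)" if "s \<le> c"
          using that Pc by (intro src_cong) (auto simp: P_def)
        moreover have "src m u' s (y - s) = src m u s (y - s)" "src m w' s (y - s) = src m w s (y - s)" if "c < s" "s \<le> t"
          using that True by (auto intro!: src_cong simp: u'_def w'_def)
        ultimately show "ennreal \<bar>src m u s (y - s) - src m w s (y - s)\<bar> * indicator {a..t} s \<le> ennreal \<bar>src m u' s (y - s) - src m w' s (y - s)\<bar>"
          by (cases "s \<le> c") (auto simp: indicator_def)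
      qed auto
      finally show ?thesis using True by (simp add: u'_def w'_def)
    qed (auto simp: u'_def w'_def)
    have "snorm m (\<lambda>t r. u' t r - w' t r) \<le> ennreal quasi * (ennreal (A powr q) + ennreal (A powr q))"
      by (rule order_trans[OF snorm_diff[OF um wm]]) (intro mult_left_mono add_mono us ws, simp)
    also have "\<dots> = ennreal (quasi * (2 * A powr q))"
      using quasi_pos by (simp add: ennreal_mult ennreal_plus[symmetric] del: ennreal_plus)
    also have "quasi * (2 * A powr q) = ((quasi * (2 * A powr q)) powr (1 / q)) powr q"
      using q quasi_pos by (simp add: powr_powr)
    finally obtain D where D: "0 < D" "snorm m (\<lambda>t r. u' t r - w' t r) \<le> ennreal (D powr q)"
      using that A quasi_pos by (metis mult_pos_pos powr_gt_zero zero_less_numeral less_numeral_extra(3))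
    \<comment> \<open>The difference satisfies every bound that is half of one it already satisfies,
      so an arbitrary finite start \<open>D\<close> can be halved indefinitely.\<close>
    have halve: "snorm m (\<lambda>t r. u' t r - w' t r) \<le> ennreal ((D / 2 ^ n) powr q)" for n
    proof (induction n)
      case (Suc n)
      have Dn: "0 < D / 2 ^ n" using D by simp
      have "snorm m (\<lambda>t r. u' t r - w' t r) \<le> S_int m (\<lambda>t r. slide (mass m u' w') t r * ennreal (1 / r))"
        unfolding snorm_def by (intro S_int_mono m0 pt)
      also have "\<dots> \<le> ennreal ((C * (D / 2 ^ n) * A powr (2 * m)) powr q)"
        using contractsD(2)[OF C(2) um wm Dn A(1) Suc[unfolded q_def] us[unfolded q_def] ws[unfolded q_def]] by (simp add: q_def)
      also have "C * (D / 2 ^ n) * A powr (2 * m) = D / 2 ^ Suc n"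
        using A(2) by (simp add: field_simps)
      finally show ?case .
    qed (use D in simp)
    \<comment> \<open>Smallness in S alone would give equality almost everywhere; the pointwise
      bound tends to 0 as well and gives it at each point.\<close>
    have zero: "u' t r = w' t r" if r: "0 < r" for t r
    proof -
      have le: "\<bar>u' t r - w' t r\<bar> \<le> C * r powr (- 1 / m) * (D * (1 / 2) ^ n) * A powr (2 * m)" for n
      proof -
        have Dn: "0 < D / 2 ^ n" using D by simp
        have "ennreal \<bar>u' t r - w' t r\<bar> \<le> ennreal (C * r powr (- 1 / m) * (D / 2 ^ n) * A powr (2 * m))"
          by (rule order_trans[OF pt[OF r]])
            (rule contractsD(3)[OF C(2) um wm Dn A(1) halve[of n, unfolded q_def] us[unfolded q_def] ws[unfolded q_def] r])
        also have "C * r powr (- 1 / m) * (D / 2 ^ n) * A powr (2 * m) = C * r powr (- 1 / m) * (D * (1 / 2) ^ n) * A powr (2 * m)"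
          by (simp add: power_divide)
        finally show ?thesis
          using C D by (subst (asm) ennreal_le_iff) (auto intro!: mult_nonneg_nonneg)
      qed
      have "(\<lambda>n. C * r powr (- 1 / m) * (D * (1 / 2) ^ n) * A powr (2 * m)) \<longlonglongrightarrow> C * r powr (- 1 / m) * (D * 0) * A powr (2 * m)"
        by (intro tendsto_mult tendsto_const LIMSEQ_power_zero) auto
      from tendsto_lowerbound[OF this, of "\<bar>u' t r - w' t r\<bar>"] le have "\<bar>u' t r - w' t r\<bar> \<le> 0" by simp
      then show ?thesis by simp
    qed
    have "u t r = w t r" if "t \<le> e" for t r
    proof (cases "t \<le> c")
      case True
      then show ?thesis using Pc by (simp add: P_def)
    next
      case False
      show ?thesis
      proof (cases "0 < r")
        case True
        then show ?thesis using zero[OF True, of t] False that by (simp add: u'_def w'_def)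
      qed (use solD(3)[OF u] solD(3)[OF w] in auto)
    qed
    then have "P e" by (simp add: P_def)
    with e show ?thesis by blast
  qed
  define S where "S = {c. a \<le> c \<and> c \<le> b \<and> P c}"
  have "P a" using ab solD(3)[OF u] solD(3)[OF w] by (intro limit) auto
  then have aS: "a \<in> S" using ab by (simp add: S_def)
  have bdd: "bdd_above S" by (auto simp: S_def bdd_above_def)
  have sb: "Sup S \<le> b" using aS by (intro cSup_least) (auto simp: S_def)
  have sa: "a \<le> Sup S" using aS bdd by (rule cSup_upper)
  have "P (Sup S)"
  proof (rule limit[OF sb])
    fix t r assume "t < Sup S"
    then obtain c where "c \<in> S" "t < c" using less_cSup_iff[OF _ bdd] aS by blast
    then show "u t r = w t r" by (auto simp: S_def P_def)
  qed
  have "Sup S = b"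
  proof (rule ccontr)
    assume "Sup S \<noteq> b"
    then obtain e where "Sup S < e" "e \<le> b" "P e" using step[OF sa _ \<open>P (Sup S)\<close>] sb by auto
    then have "e \<in> S" using sa by (simp add: S_def)
    then have "e \<le> Sup S" using bdd by (rule cSup_upper)
    with \<open>Sup S < e\<close> show False by simp
  qed
  with \<open>P (Sup S)\<close> have "P b" by simp
  have "u t r = w t r" for t r
    using \<open>P b\<close> solD(3)[OF u, of t r] solD(3)[OF w, of t r] by (cases "t \<le> b") (auto simp: P_def)
  then show ?thesis by blast
qed

section \<open>Restriction, gluing and continuation\<close>

lemma sol_restrict:
  assumes u: "sol a b h u" and c: "c \<le> b"
  shows "sol a c h (\<lambda>t r. if t \<le> c then u t r else 0)"
proof -
  note [measurable] = solD(1)[OF u]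
  let ?v = "\<lambda>t r. if t \<le> c then u t r else 0"
  have vm: "joint_borel ?v" by measurable
  have "snorm m ?v \<le> snorm m u" by (intro snorm_mono m0) auto
  then have "snorm m ?v < top" using solD(2)[OF u] by simp
  moreover have "?v t r = avg (flow h ?v a t) t r" if "a \<le> t" "t \<le> c" "0 < r" for t r
  proof -
    have "acc m ?v a t y = acc m u a t y" for y
      using that by (intro acc_cong vm) auto
    then have "flow h ?v a t = flow h u a t" by (auto simp: flow_def)
    then show ?thesis using solD(4)[OF u, of t r] that c by simp
  qed
  ultimately show ?thesis unfolding sol_def using vm solD(3)[OF u] c by auto
qed

text \<open>The integral is additive only where the source is integrable along the characteristic,
  which is the case for almost every \<open>y\<close>.\<close>

lemma AE_acc_split:
  assumes [measurable]: "joint_borel u" and fin: "snorm m u < top" and bt: "a \<le> b" "b \<le> t"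
  shows "AE y in lborel. acc m u a t y = acc m u a b y + acc m u b t y"
  using AE_src_integrable[OF assms(1,2)]
proof eventually_elim
  fix y assume i: "integrable lborel (\<lambda>s. src m u s (y - s))"
  have i': "set_integrable lborel I (\<lambda>s. src m u s (y - s))" if "I \<in> sets lborel" for I
    unfolding set_integrable_def using i that by (rule integrable_mult_indicator[rotated])
  have "acc m u a t y = (LINT s:{a..b} \<union> {b<..t}|lborel. src m u s (y - s))"
    unfolding acc_def using bt by (intro arg_cong2[where f = "\<lambda>A f. set_lebesgue_integral lborel A f"]) auto
  also have "\<dots> = acc m u a b y + (LINT s:{b<..t}|lborel. src m u s (y - s))"
    unfolding acc_def by (intro set_integral_Un i') auto
  also have "(LINT s:{b<..t}|lborel. src m u s (y - s)) = acc m u b t y"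
    unfolding acc_def set_lebesgue_integral_def
    by (rule integral_cong_AE) (measurable, use AE_lborel_singleton[of b] in \<open>eventually_elim, auto simp: indicator_def\<close>)
  finally show "acc m u a t y = acc m u a b y + acc m u b t y" .
qed

text \<open>The profile accumulated up to \<open>b\<close> serves as initial profile for the
  restart. The source integral splits at \<open>b\<close> for almost every \<open>y\<close>, and an
  average over \<open>y\<close> ignores the exceptional set.\<close>

lemma sol_glue:
  assumes h: "Lm_fun m h" and u: "sol a b h u" and w: "sol b c (flow h u a b) w" and abc: "a \<le> b" "b \<le> c"
  shows "sol a c h (\<lambda>t r. if t \<le> b then u t r else w t r)"
proof -
  note [measurable] = solD(1)[OF u] solD(1)[OF w]
  have [measurable]: "h \<in> borel_measurable borel" using h by (simp add: Lm_fun_def)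
  let ?v = "\<lambda>t r. if t \<le> b then u t r else w t r"
  have vm[measurable]: "joint_borel ?v" by measurable
  have "snorm m ?v \<le> S_int m (\<lambda>t r. ennreal \<bar>u t r\<bar> + ennreal \<bar>w t r\<bar>)"
    unfolding snorm_def by (intro S_int_mono m0) auto
  also have "\<dots> \<le> ennreal (4 * 2 powr (2 * m + 1)) * (snorm m u + snorm m w)"
    unfolding snorm_def by (intro S_int_add m) auto
  also have "\<dots> < top" using solD(2)[OF u] solD(2)[OF w] by (simp add: ennreal_mult_less_top)
  finally have vs: "snorm m ?v < top" .
  have "?v t r = avg (flow h ?v a t) t r" if t: "a \<le> t" "t \<le> c" "0 < r" for t r
  proof (cases "t \<le> b")
    case True
    have "acc m ?v a t y = acc m u a t y" for y
      using True by (intro acc_cong) auto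
    then have "flow h ?v a t = flow h u a t" by (auto simp: flow_def)
    then show ?thesis using solD(4)[OF u, of t r] t True by simp
  next
    case False
    have "acc m ?v a b y = acc m u a b y" "acc m ?v b t y = acc m w b t y" for y
      by (auto intro!: acc_cong)
    note acc_eq = this
    have "AE y in lborel. acc m ?v a t y = acc m ?v a b y + acc m ?v b t y"
      using AE_acc_split[OF vm vs abc(1), of t] False by simp
    then have "AE y in lborel. flow h ?v a t y = flow (flow h u a b) w b t y"
      by eventually_elim (simp only: flow_def acc_eq distrib_left add.assoc)
    then have "avg (flow h ?v a t) t r = avg (flow (flow h u a b) w b t) t r"
      by (intro avg_cong_AE) measurable
    then show ?thesis using solD(4)[OF w, of t r] t False by simp
  qed
  moreover have "?v t r = 0" if "\<not> (a \<le> t \<and> t \<le> c \<and> 0 < r)" for t r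
    using solD(3)[OF u, of t r] solD(3)[OF w, of t r] that abc by (cases "t \<le> b") auto
  ultimately show ?thesis unfolding sol_def using vm vs by blast
qed

text \<open>The supremum of the existence times is not attained, because a solution on a closed
  interval can be restarted at its end. If the S norm up to a finite supremum were finite, the
  equation would also define the slice at that time, and the supremum would be attained.\<close>

theorem forward_maximal:
  assumes h: "Lm_fun m h"
  shows "\<exists>(T::ereal) U. 0 < T \<and>
    (\<forall>b. 0 \<le> b \<longrightarrow> ereal b < T \<longrightarrow> sol 0 b h (\<lambda>t r. if 0 \<le> t \<and> t \<le> b then U t r else 0)) \<and>
    (\<forall>b w. 0 \<le> b \<longrightarrow> sol 0 b h w \<longrightarrow> ereal b < T) \<and>
    (T < \<infinity> \<longrightarrow> S_int m (\<lambda>t r. ennreal \<bar>U t r\<bar> * indicator {t. 0 \<le> t \<and> ereal t < T} t) = top)"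
proof -
  have [measurable]: "h \<in> borel_measurable borel" using h by (simp add: Lm_fun_def)
  define E where "E = {b. 0 \<le> b \<and> (\<exists>u. sol 0 b h u)}"
  define T where "T = Sup (ereal ` E)"
  \<comment> \<open>Uniqueness makes the description legitimate. \<open>U\<close> then reads each
    slice off the solution that ends at that time, so that the pieces are compatible by
    construction.\<close>
  define V where "V = (\<lambda>b. THE u. sol 0 b h u)"
  define U where "U = (\<lambda>t. V t t)"
  have V: "sol 0 b h (V b)" if "b \<in> E" for b
  proof -
    from that obtain u where u: "sol 0 b h u" and b: "0 \<le> b" by (auto simp: E_def)
    show ?thesis
      unfolding V_def by (rule theI[of "sol 0 b h" u, OF u]) (rule sol_unique[OF h _ u b])
  qed
  have Vu: "u = V b" if "sol 0 b h u" "0 \<le> b" for b u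
    by (rule sol_unique[OF h that(1) V that(2)]) (use that in \<open>auto simp: E_def\<close>)
  have down: "c \<in> E" if "b \<in> E" "0 \<le> c" "c \<le> b" for b c
    using sol_restrict[OF V[OF that(1)] that(3)] that by (auto simp: E_def)
  \<comment> \<open>Local existence for the accumulated profile restarts the solution at
    \<open>b\<close>; the set of existence times has no maximum.\<close>
  have extend: "\<exists>c>b. c \<in> E" if "b \<in> E" for b
  proof -
    have "Lm_fun m (flow h (V b) 0 b)" using solD[OF V[OF that]] by (intro Lm_fun_flow h) auto
    from local_existence[OF this] obtain c w where c: "b < c" "sol b c (flow h (V b) 0 b) w" by blast
    then have "sol 0 c h (\<lambda>t r. if t \<le> b then V b t r else w t r)"
      using that by (intro sol_glue[OF h V[OF that]]) (auto simp: E_def)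
    then show ?thesis using c that by (auto simp: E_def intro!: exI[of _ c])
  qed
  obtain b0 where b0: "0 < b0" "b0 \<in> E"
    using local_existence[OF h, of 0] by (auto simp: E_def)
  have T0: "0 < T"
  proof -
    have "0 < ereal b0" using b0 by simp
    also have "\<dots> \<le> T" unfolding T_def using b0 by (intro Sup_upper) auto
    finally show ?thesis .
  qed
  have inE: "b \<in> E" if "0 \<le> b" "ereal b < T" for b
    using that down unfolding T_def less_Sup_iff by force
  have below: "ereal b < T" if "b \<in> E" for b
  proof -
    from extend[OF that] obtain c where c: "b < c" "c \<in> E" by blast
    then have "ereal c \<le> T" unfolding T_def by (intro Sup_upper) auto
    moreover have "ereal b < ereal c" using c by simp
    ultimately show ?thesis by (rule less_le_trans[rotated])
  qed
  have UV: "U t r = V b t r" if "b \<in> E" "0 \<le> t" "t \<le> b" for b t r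
  proof -
    have "(\<lambda>s r. if s \<le> t then V b s r else 0) = V t"
      using sol_restrict[OF V[OF that(1)] that(3)] that(2) by (rule Vu)
    from fun_cong[OF fun_cong[OF this, of t], of r] show ?thesis by (simp add: U_def)
  qed
  have cut: "(\<lambda>t r. if 0 \<le> t \<and> t \<le> b then U t r else 0) = V b" if "b \<in> E" for b
    using UV[OF that] solD(3)[OF V[OF that]] by (intro ext) auto
  have blowup: "S_int m (\<lambda>t r. ennreal \<bar>U t r\<bar> * indicator {t. 0 \<le> t \<and> ereal t < T} t) = top" if "T < \<infinity>"
  proof (rule ccontr)
    assume "S_int m (\<lambda>t r. ennreal \<bar>U t r\<bar> * indicator {t. 0 \<le> t \<and> ereal t < T} t) \<noteq> top"
    then have Sfin: "S_int m (\<lambda>t r. ennreal \<bar>U t r\<bar> * indicator {t. 0 \<le> t \<and> ereal t < T} t) < top"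
      by (simp add: less_top)
    from T0 \<open>T < \<infinity>\<close> obtain \<tau> where \<tau>: "T = ereal \<tau>" "0 < \<tau>" by (cases T) auto
    define w where "w = (\<lambda>t r. if 0 \<le> t \<and> t < \<tau> then U t r else 0)"
    have wV: "w t r = V b t r" if "b < \<tau>" "t \<le> b" "0 \<le> b" for t b r
      using that UV[of b t r] inE[of b] solD(3)[OF V[of b], of t r] \<tau> by (auto simp: w_def)
    \<comment> \<open>A definition slice by slice gives no measurability in both variables. It is
      recovered from the solutions on \<open>[0, b n]\<close>, which at each point equal
      \<open>w\<close> from some \<open>n\<close> on.\<close>
    have [measurable]: "joint_borel w"
    proof (rule borel_measurable_LIMSEQ_metric)
      define b where "b = (\<lambda>n::nat. \<tau> * (1 - 1 / Suc n))"
      have b: "b n < \<tau>" "0 \<le> b n" for n using \<tau> by (auto simp: b_def)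
      show "joint_borel (V (b n))" for n
        using b[of n] by (intro solD(1)[OF V] inE) (auto simp: \<tau>)
      fix p :: "real \<times> real"
      obtain t r where p: "p = (t, r)" by (cases p)
      have "b \<longlonglongrightarrow> \<tau> * (1 - 0)"
        unfolding b_def by (intro tendsto_intros LIMSEQ_Suc[OF lim_1_over_n])
      then have lim: "b \<longlonglongrightarrow> \<tau>" by simp
      have "eventually (\<lambda>n. V (b n) t r = w t r) sequentially"
      proof (cases "t < \<tau>")
        case True
        then have "eventually (\<lambda>n. t < b n) sequentially" by (rule order_tendstoD(1)[OF lim])
        then show ?thesis
        proof eventually_elim
          case (elim n)
          then show ?case using wV[of "b n" t r] b[of n] by simp
        qed
      next
        case False
        have "V (b n) t r = 0" for n
          using b[of n] False solD(3)[OF V[OF inE[of "b n"]], of t r] by (auto simp: \<tau>)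
        then show ?thesis using False by (simp add: w_def)
      qed
      then show "(\<lambda>n. (case p of (t, r) \<Rightarrow> V (b n) t r)) \<longlonglongrightarrow> (case p of (t, r) \<Rightarrow> w t r)"
        unfolding p by (simp add: tendsto_eventually)
    qed
    have ws: "snorm m w < top"
    proof -
      have "snorm m w \<le> S_int m (\<lambda>t r. ennreal \<bar>U t r\<bar> * indicator {t. 0 \<le> t \<and> ereal t < T} t)"
        unfolding snorm_def by (intro S_int_mono m0) (auto simp: w_def \<tau>)
      then show ?thesis using Sfin by simp
    qed
    \<comment> \<open>A single time is null for the S norm and for the source integrals, so the
      slice at \<tau> may be prescribed by the equation itself.\<close>
    define v where "v = (\<lambda>t r. if t = \<tau> \<and> 0 < r then avg (flow h w 0 \<tau>) \<tau> r else w t r)"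
    have vm[measurable]: "joint_borel v"
      unfolding v_def by measurable
    have "snorm m v = snorm m w"
      unfolding snorm_def S_int_def
      by (rule nn_integral_cong_AE, use AE_lborel_singleton[of \<tau>] in eventually_elim) (simp add: v_def)
    then have vs: "snorm m v < top" using ws by simp
    have fl: "flow h v 0 t = flow h w 0 t" if "t \<le> \<tau>" for t
    proof -
      have "acc m v 0 t y = acc m w 0 t y" for y
        using that by (intro acc_cong) (auto simp: v_def)
      then show ?thesis by (auto simp: flow_def)
    qed
    have "v t r = avg (flow h v 0 t) t r" if t: "0 \<le> t" "t \<le> \<tau>" "0 < r" for t r
    proof (cases "t = \<tau>")
      case True
      then show ?thesis using t fl[of \<tau>] by (simp add: v_def)
    next
      case False
      then have tE: "t \<in> E" "t < \<tau>" using t by (auto intro!: inE simp: \<tau>)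
      have "acc m w 0 t y = acc m (V t) 0 t y" for y
        using wV[OF tE(2)] t by (intro acc_cong solD(1)[OF V[OF tE(1)]]) auto
      then have "flow h w 0 t = flow h (V t) 0 t" by (auto simp: flow_def)
      then show ?thesis
        using False t fl[of t] wV[OF tE(2), of t r] solD(4)[OF V[OF tE(1)], of t r] by (simp add: v_def)
    qed
    moreover have "v t r = 0" if out: "\<not> (0 \<le> t \<and> t \<le> \<tau> \<and> 0 < r)" for t r
    proof (cases "0 \<le> t \<and> t < \<tau>")
      case True
      then have "t \<in> E" by (intro inE) (auto simp: \<tau>)
      then show ?thesis
        using True out solD(3)[OF V, of t t r] by (simp add: v_def w_def U_def)
    qed (use out \<tau> in \<open>auto simp: v_def w_def\<close>)
    ultimately have "sol 0 \<tau> h v"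
      unfolding sol_def using vm vs by blast
    then have "\<tau> \<in> E" using \<tau> by (auto simp: E_def)
    from below[OF this] \<tau> show False by simp
  qed
  show ?thesis
  proof (intro exI[of _ T] exI[of _ U] conjI allI impI)
    show "0 < T" by (rule T0)
    fix b assume "0 \<le> b" "ereal b < T"
    then have "b \<in> E" by (rule inE)
    then show "sol 0 b h (\<lambda>t r. if 0 \<le> t \<and> t \<le> b then U t r else 0)" by (simp only: cut V)
  next
    fix b w assume "0 \<le> b" "sol 0 b h w"
    then show "ereal b < T" by (intro below) (auto simp: E_def)
  qed (rule blowup)
qed

end

section \<open>Weak radial derivatives\<close>

lemma has_radial_derivD:
  assumes "has_radial_deriv w g" "0 < a" "a \<le> b"
  shows "set_integrable lebesgue {a..b} g" "w b - w a = (LINT r:{a..b}|lebesgue. g r)"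
  using assms by (auto simp: has_radial_deriv_def)

lemma has_radial_deriv_iff_lborel:
  assumes [measurable]: "g \<in> borel_measurable borel"
  shows "has_radial_deriv w g \<longleftrightarrow> (\<forall>a b. 0 < a \<longrightarrow> a \<le> b \<longrightarrow>
    set_integrable lborel {a..b} g \<and> w b - w a = (LINT r:{a..b}|lborel. g r))"
  by (simp add: has_radial_deriv_def set_integrable_def set_lebesgue_integral_def integrable_completion integral_completion)

text \<open>A weak derivative is only Lebesgue measurable, and only over compact parts of the
  half-line. An exhaustion and a Borel version allow later integrals over \<open>lborel\<close>,
  where Tonelli's theorem is at hand.\<close>

lemma has_radial_deriv_borel_version:
  assumes g: "has_radial_deriv w g"
  shows "\<exists>p. p \<in> borel_measurable borel \<and> (AE r in lebesgue. 0 < r \<longrightarrow> g r = p r) \<and> has_radial_deriv w p"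
proof -
  define f where "f = (\<lambda>r. if 0 < r then g r else 0)"
  define I where "I = (\<lambda>n::nat. {1 / real (Suc n)..real (Suc n)})"
  have I: "0 < 1 / real (Suc n)" "1 / real (Suc n) \<le> real (Suc n)" for n
    by (auto simp: field_simps)
  have fm: "f \<in> borel_measurable lebesgue"
  proof (rule borel_measurable_LIMSEQ_real)
    show "(\<lambda>r. indicator (I n) r *\<^sub>R g r) \<in> borel_measurable lebesgue" for n
      using has_radial_derivD(1)[OF g I(1,2), of n] unfolding set_integrable_def I_def by (rule borel_measurable_integrable)
    fix r :: real
    have "eventually (\<lambda>n. indicator (I n) r *\<^sub>R g r = f r) sequentially"
    proof (cases "0 < r")
      case True
      obtain n1 where n1: "inverse (real (Suc n1)) < r" using reals_Archimedean[OF True] by blast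
      obtain n2 where n2: "r < real n2" using reals_Archimedean2 by blast
      have "indicator (I n) r *\<^sub>R g r = f r" if "max n1 n2 \<le> n" for n
      proof -
        have "1 / real (Suc n) \<le> 1 / real (Suc n1)" using that by (intro divide_left_mono) auto
        then have "r \<in> I n" using n1 n2 that by (auto simp: I_def inverse_eq_divide)
        then show ?thesis using True by (simp add: f_def)
      qed
      then show ?thesis unfolding eventually_sequentially by blast
    next
      case False
      have "r \<notin> I n" for n
        using False I(1)[of n] unfolding I_def atLeastAtMost_iff by linarith
      then show ?thesis using False by (simp add: f_def)
    qed
    then show "(\<lambda>n. indicator (I n) r *\<^sub>R g r) \<longlonglongrightarrow> f r" by (rule tendsto_eventually)
  qed
  obtain p where "p \<in> borel_measurable lborel" and p2: "AE r in lborel. f r = p r"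
    using completion_ex_borel_measurable_real[OF fm] by blast
  then have p: "p \<in> borel_measurable borel" "AE r in lborel. f r = p r" by simp_all
  have ae: "AE r in lebesgue. 0 < r \<longrightarrow> g r = p r"
    using AE_completion[OF p(2)] by eventually_elim (auto simp: f_def)
  have pl: "p \<in> borel_measurable lebesgue" using p(1) by (simp add: measurable_completion)
  have "has_radial_deriv w p"
    unfolding has_radial_deriv_def
  proof (intro allI impI conjI)
    fix a b :: real assume ab: "0 < a" "a \<le> b"
    note gi = has_radial_derivD(1)[OF g ab, unfolded set_integrable_def]
    have ae': "AE r in lebesgue. indicator {a..b} r *\<^sub>R g r = indicator {a..b} r *\<^sub>R p r"
      using ae by eventually_elim (use ab in \<open>auto simp: indicator_def\<close>)
    have pm: "(\<lambda>r. indicator {a..b} r *\<^sub>R p r) \<in> borel_measurable lebesgue"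
      by (intro borel_measurable_scaleR borel_measurable_indicator pl) auto
    show "set_integrable lebesgue {a..b} p"
      unfolding set_integrable_def using gi integrable_cong_AE[OF borel_measurable_integrable[OF gi] pm ae'] by simp
    show "w b - w a = (LINT r:{a..b}|lebesgue. p r)"
      unfolding has_radial_derivD(2)[OF g ab] set_lebesgue_integral_def
      by (rule integral_cong_AE[OF borel_measurable_integrable[OF gi] pm ae'])
  qed
  with p ae show ?thesis by blast
qed

text \<open>Lebesgue differentiation: the difference has vanishing integral over every interval,
  while its averages over shrinking intervals recover its value almost everywhere.\<close>

lemma has_radial_deriv_unique:
  assumes g: "has_radial_deriv w g" and g': "has_radial_deriv w g'"
  shows "AE r in lebesgue. 0 < r \<longrightarrow> g r = g' r"
proof -
  have eps: "AE r in lebesgue. \<epsilon> < r \<longrightarrow> g r = g' r" if \<epsilon>: "0 < \<epsilon>" for \<epsilon>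
  proof -
    \<comment> \<open>The cut at \<epsilon> > 0 is there because neither derivative has to be
      integrable up to 0.\<close>
    define f where "f = (\<lambda>r. if \<epsilon> \<le> r then g r - g' r else 0)"
    have int: "set_integrable lebesgue {c..d} (\<lambda>r. g r - g' r)" "(LINT r:{c..d}|lebesgue. g r - g' r) = 0" if "\<epsilon> \<le> c" "c \<le> d" for c d
      using has_radial_derivD[OF g, of c d] has_radial_derivD[OF g', of c d] that \<epsilon>
      by (auto simp: set_integral_diff)
    have on: "((\<lambda>r. g r - g' r) has_integral 0) {c..d}" if "\<epsilon> \<le> c" "c \<le> d" for c d
      using set_lebesgue_integral_eq_integral[OF int(1)[OF that]] int(2)[OF that] by (simp add: has_integral_iff)
    have "f integrable_on cbox a b" for a b
    proof -
      have "((\<lambda>r. g r - g' r) has_integral 0) ({a..b} \<inter> {\<epsilon>..})"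
      proof (cases "max a \<epsilon> \<le> b")
        case True
        then have "{a..b} \<inter> {\<epsilon>..} = {max a \<epsilon>..b}" by auto
        then show ?thesis using on[of "max a \<epsilon>" b] True by simp
      next
        case False
        then have "{a..b} \<inter> {\<epsilon>..} = {}" by auto
        then show ?thesis by simp
      qed
      then have "((\<lambda>r. if r \<in> {\<epsilon>..} then g r - g' r else 0) has_integral 0) {a..b}"
        by (simp only: has_integral_restrict_Int Int_commute)
      then show ?thesis by (auto simp: f_def has_integral_integrable)
    qed
    then obtain N where N: "negligible N" "\<And>x e. x \<notin> N \<Longrightarrow> 0 < e \<Longrightarrow> \<exists>d>0. \<forall>h. 0 < h \<and> h < d \<longrightarrow>
        norm (integral (cbox x (x + h *\<^sub>R One)) f /\<^sub>R h ^ DIM(real) - f x) < e"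
      using integrable_ccontinuous_explicit[of f] by metis
    have off: "g x = g' x" if x: "x \<notin> N" "\<epsilon> < x" for x
    proof (rule ccontr)
      assume ne: "g x \<noteq> g' x"
      then have "0 < \<bar>f x\<bar>" using x by (simp add: f_def)
      then obtain d where d: "0 < d" "\<And>h. 0 < h \<Longrightarrow> h < d \<Longrightarrow> norm (integral (cbox x (x + h *\<^sub>R One)) f /\<^sub>R h ^ DIM(real) - f x) < \<bar>f x\<bar>"
        using N(2)[OF x(1)] by blast
      have "integral {x..x + d / 2} f = integral {x..x + d / 2} (\<lambda>r. g r - g' r)"
        using x by (intro integral_cong) (auto simp: f_def)
      also have "\<dots> = 0" using on[of x "x + d / 2"] x d by (simp add: has_integral_iff)
      finally show False using d(2)[of "d / 2"] d(1) by simp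
    qed
    have "AE x in lebesgue. x \<notin> N"
      using N(1) by (simp add: negligible_iff_null_sets AE_not_in)
    then show ?thesis by eventually_elim (use off in blast)
  qed
  have "AE r in lebesgue. \<forall>n::nat. inverse (real (Suc n)) < r \<longrightarrow> g r = g' r"
    unfolding AE_all_countable using eps by simp
  then show ?thesis
  proof eventually_elim
    case (elim r)
    then show ?case using reals_Archimedean[of r] by blast
  qed
qed

text \<open>Makes the choice in \<open>radial_deriv\<close> harmless: by uniqueness any weak
  derivative may stand for it inside an integral.\<close>

lemma radial_deriv_eq:
  assumes "has_radial_deriv w p"
  shows "AE r in lebesgue. 0 < r \<longrightarrow> radial_deriv w r = p r"
  unfolding radial_deriv_def by (rule has_radial_deriv_unique[OF someI[of "has_radial_deriv w"]]) (fact assms)+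

lemma has_radial_deriv_diff:
  assumes "has_radial_deriv w g" "has_radial_deriv v k"
  shows "has_radial_deriv (\<lambda>r. w r - v r) (\<lambda>r. g r - k r)"
  unfolding has_radial_deriv_def
proof (intro allI impI conjI)
  fix a b :: real assume "0 < a" "a \<le> b"
  note d = has_radial_derivD[OF assms(1) this] has_radial_derivD[OF assms(2) this]
  show "set_integrable lebesgue {a..b} (\<lambda>r. g r - k r)" using d by (intro set_integral_diff)
  show "w b - v b - (w a - v a) = (LINT r:{a..b}|lebesgue. g r - k r)" using d by (simp add: set_integral_diff)
qed

lemma has_radial_deriv_cong:
  "has_radial_deriv w g \<Longrightarrow> (\<And>r. 0 < r \<Longrightarrow> w r = v r) \<Longrightarrow> has_radial_deriv v g"
  unfolding has_radial_deriv_def by (metis less_le_trans)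

section \<open>The energy norm through Borel representatives\<close>

definition rad_Lm :: "real \<Rightarrow> (real \<Rightarrow> real) \<Rightarrow> ennreal" where
  "rad_Lm m k = (\<integral>\<^sup>+r\<in>{0<..}. ennreal (\<bar>r * k r\<bar> powr m) \<partial>lborel)"

lemma Lm_norm_eq:
  assumes [measurable]: "p \<in> borel_measurable borel" "k \<in> borel_measurable borel"
    and p: "has_radial_deriv w0 p" and k: "AE r in lebesgue. 0 < r \<longrightarrow> w1 r = k r"
  shows "Lm_norm m w0 w1 = ennpowr (rad_Lm m p + rad_Lm m k) (1 / m)"
proof -
  have "(\<integral>\<^sup>+r\<in>{0<..}. ennreal (\<bar>r * radial_deriv w0 r\<bar> powr m + \<bar>r * w1 r\<bar> powr m) \<partial>lebesgue)
    = (\<integral>\<^sup>+r. ennreal (\<bar>r * p r\<bar> powr m) * indicator {0<..} r + ennreal (\<bar>r * k r\<bar> powr m) * indicator {0<..} r \<partial>lebesgue)"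
  proof (rule nn_integral_cong_AE)
    show "AE r in lebesgue. ennreal (\<bar>r * radial_deriv w0 r\<bar> powr m + \<bar>r * w1 r\<bar> powr m) * indicator {0<..} r
      = ennreal (\<bar>r * p r\<bar> powr m) * indicator {0<..} r + ennreal (\<bar>r * k r\<bar> powr m) * indicator {0<..} r"
      using radial_deriv_eq[OF p] k by eventually_elim (auto simp: indicator_def)
  qed
  also have "\<dots> = rad_Lm m p + rad_Lm m k"
    unfolding nn_integral_completion rad_Lm_def by (intro nn_integral_add) measurable
  finally show ?thesis by (simp add: Lm_norm_def)
qed

lemma rad_Lm_add:
  assumes m: "1 < m" and [measurable]: "p \<in> borel_measurable borel" "k \<in> borel_measurable borel"
  shows "rad_Lm m (\<lambda>r. p r + c * k r) \<le> ennreal (2 powr m) * (rad_Lm m p + ennreal (\<bar>c\<bar> powr m) * rad_Lm m k)"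
proof -
  have "rad_Lm m (\<lambda>r. p r + c * k r) \<le> (\<integral>\<^sup>+r. ennreal (2 powr m) * (ennreal (\<bar>r * p r\<bar> powr m) * indicator {0<..} r + ennreal (\<bar>c\<bar> powr m) * (ennreal (\<bar>r * k r\<bar> powr m) * indicator {0<..} r)) \<partial>lborel)"
    unfolding rad_Lm_def
  proof (intro nn_integral_mono)
    fix r :: real
    have "ennreal (\<bar>r * (p r + c * k r)\<bar> powr m) = ennpowr (ennreal \<bar>r * p r + c * (r * k r)\<bar>) m"
      by (simp add: ennpowr_ennreal algebra_simps)
    also have "\<dots> \<le> ennpowr (ennreal \<bar>r * p r\<bar> + ennreal \<bar>c * (r * k r)\<bar>) m"
      using m by (intro ennpowr_mono) (auto simp: ennreal_plus[symmetric] simp del: ennreal_plus intro!: ennreal_leI)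
    also have "\<dots> \<le> ennreal (2 powr m) * (ennpowr (ennreal \<bar>r * p r\<bar>) m + ennpowr (ennreal \<bar>c * (r * k r)\<bar>) m)"
      using m by (intro ennpowr_add_le) auto
    also have "\<dots> = ennreal (2 powr m) * (ennreal (\<bar>r * p r\<bar> powr m) + ennreal (\<bar>c\<bar> powr m) * ennreal (\<bar>r * k r\<bar> powr m))"
      using abs_mult[of c "r * k r"] by (simp only: ennpowr_ennreal abs_ge_zero powr_mult ennreal_mult[OF powr_ge_zero powr_ge_zero])
    finally show "ennreal (\<bar>r * (p r + c * k r)\<bar> powr m) * indicator {0<..} r
      \<le> ennreal (2 powr m) * (ennreal (\<bar>r * p r\<bar> powr m) * indicator {0<..} r + ennreal (\<bar>c\<bar> powr m) * (ennreal (\<bar>r * k r\<bar> powr m) * indicator {0<..} r))"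
      by (auto simp: indicator_def)
  qed
  also have "\<dots> = ennreal (2 powr m) * (rad_Lm m p + ennreal (\<bar>c\<bar> powr m) * rad_Lm m k)"
    unfolding rad_Lm_def by (simp add: nn_integral_cmult nn_integral_add)
  finally show ?thesis .
qed

lemma rad_Lm_finite_add:
  assumes "1 < m" "p \<in> borel_measurable borel" "k \<in> borel_measurable borel" "rad_Lm m p < top" "rad_Lm m k < top"
  shows "rad_Lm m (\<lambda>r. p r + c * k r) < top"
  by (rule le_less_trans[OF rad_Lm_add[OF assms(1-3)]]) (use assms in \<open>auto simp: ennreal_mult_less_top\<close>)

lemma rad_Lm_finite_bounded:
  assumes B: "\<And>r. 0 < r \<Longrightarrow> \<bar>k r\<bar> \<le> B" and R: "\<And>r. R < r \<Longrightarrow> k r = 0" and m: "1 < m"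
  shows "rad_Lm m k < top"
proof -
  have "rad_Lm m k \<le> (\<integral>\<^sup>+r. ennreal ((\<bar>R\<bar> * \<bar>B\<bar>) powr m) * indicator {0..\<bar>R\<bar>} r \<partial>lborel)"
    unfolding rad_Lm_def
  proof (intro nn_integral_mono)
    fix r :: real
    show "ennreal (\<bar>r * k r\<bar> powr m) * indicator {0<..} r \<le> ennreal ((\<bar>R\<bar> * \<bar>B\<bar>) powr m) * indicator {0..\<bar>R\<bar>} r"
    proof (cases "0 < r \<and> r \<le> \<bar>R\<bar>")
      case True
      then have "\<bar>r * k r\<bar> \<le> \<bar>R\<bar> * \<bar>B\<bar>" unfolding abs_mult using B[of r] by (intro mult_mono) auto
      then show ?thesis using True m by (auto intro!: ennreal_leI powr_mono2)
    qed (use R[of r] in auto)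
  qed
  also have "\<dots> < top" by (subst nn_integral_cmult) (auto simp: ennreal_mult_less_top)
  finally show ?thesis .
qed

text \<open>Restriction to a line through the origin: \<open>\<phi> \<bar>r\<bar>\<close> is
  continuously differentiable on the whole line, also at 0, and the support bound in space becomes
  one in \<open>r\<close>.\<close>

lemma radial_test_properties:
  assumes "radial_test \<phi>"
  obtains g R B where "continuous_on UNIV g" "continuous_on UNIV (\<lambda>r. \<phi> \<bar>r\<bar>)" "has_radial_deriv \<phi> g"
    "\<And>r. R < r \<Longrightarrow> \<phi> r = 0 \<and> g r = 0" "\<And>r. 0 < r \<Longrightarrow> \<bar>\<phi> r\<bar> \<le> B \<and> \<bar>g r\<bar> \<le> B" "0 < R"
proof -
  define F where "F = (\<lambda>x::real^3. \<phi> (norm x))"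
  define e where "e = (axis 1 1 :: real^3)"
  have e: "norm e = 1" "e \<in> Basis" by (auto simp: e_def)
  have "Ck (Suc 0) F" using assms by (auto simp: radial_test_def smooth_def F_def)
  then have F: "\<And>x. F differentiable (at x)" and cont: "continuous_on UNIV (\<lambda>x. frechet_derivative F (at x) e)"
    using e(2) by auto
  define g where "g = (\<lambda>r. frechet_derivative F (at (r *\<^sub>R e)) e)"
  have gc: "continuous_on UNIV g"
    unfolding g_def by (rule continuous_on_compose2[OF cont]) (auto intro!: continuous_intros)
  have Fe: "F (r *\<^sub>R e) = \<phi> \<bar>r\<bar>" for r by (simp add: F_def e)
  have deriv: "((\<lambda>r. \<phi> \<bar>r\<bar>) has_real_derivative g r) (at r)" for r
  proof -
    have "(F has_derivative frechet_derivative F (at (r *\<^sub>R e))) (at (r *\<^sub>R e))"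
      using F frechet_derivative_works by blast
    moreover have "((\<lambda>r. r *\<^sub>R e) has_derivative (\<lambda>h. h *\<^sub>R e)) (at r)"
      by (intro derivative_intros)
    ultimately have "((\<lambda>r. F (r *\<^sub>R e)) has_derivative (\<lambda>h. frechet_derivative F (at (r *\<^sub>R e)) (h *\<^sub>R e))) (at r)"
      by (rule has_derivative_compose[rotated])
    moreover have "frechet_derivative F (at (r *\<^sub>R e)) (h *\<^sub>R e) = h * g r" for h
      unfolding g_def using linear_frechet_derivative[OF F] linear_scale by fastforce
    moreover have "(\<lambda>h. h * g r) = (*) (g r)" by (auto simp: mult.commute)
    ultimately show ?thesis by (simp add: Fe has_field_derivative_def)
  qed
  have pc: "continuous_on UNIV (\<lambda>r. \<phi> \<bar>r\<bar>)"
    using deriv by (intro DERIV_continuous_on) (auto intro: has_field_derivative_at_within)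
  have hd: "has_radial_deriv \<phi> g"
  proof (subst has_radial_deriv_iff_lborel)
    show "g \<in> borel_measurable borel" using gc by (rule borel_measurable_continuous_onI)
    show "\<forall>a b. 0 < a \<longrightarrow> a \<le> b \<longrightarrow> set_integrable lborel {a..b} g \<and> \<phi> b - \<phi> a = (LINT r:{a..b}|lborel. g r)"
    proof (intro allI impI)
      fix a b :: real assume ab: "0 < a" "a \<le> b"
      have "has_bochner_integral lborel (\<lambda>x. g x * indicator {a..b} x) (\<phi> \<bar>b\<bar> - \<phi> \<bar>a\<bar>)"
        using gc by (intro has_bochner_integral_FTC_Icc_real ab(2) deriv) (simp add: continuous_on_eq_continuous_at)
      then show "set_integrable lborel {a..b} g \<and> \<phi> b - \<phi> a = (LINT r:{a..b}|lborel. g r)"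
        using ab by (auto simp: has_bochner_integral_iff set_integrable_def set_lebesgue_integral_def mult.commute)
    qed
  qed
  have "bounded {x. F x \<noteq> 0}"
    using assms compact_imp_bounded bounded_subset[OF _ closure_subset] unfolding radial_test_def F_def by blast
  then obtain R where R: "0 < R" "\<And>x. F x \<noteq> 0 \<Longrightarrow> norm x \<le> R" unfolding bounded_pos by blast
  have zero: "\<phi> r = 0" if "R < r" for r
    using R(2)[of "r *\<^sub>R e"] that R(1) by (auto simp: Fe e)
  have gzero: "g r = 0" if "R < r" for r
  proof -
    have "eventually (\<lambda>s. s \<in> {R<..}) (nhds r)" using that by (intro eventually_nhds_in_open) auto
    then have "eventually (\<lambda>s. \<phi> \<bar>s\<bar> = 0) (nhds r)"
      by eventually_elim (use zero R(1) in auto)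
    then have "((\<lambda>_. 0) has_real_derivative g r) (at r)"
      using deriv[of r] by (subst (asm) DERIV_cong_ev[OF refl _ refl]) auto
    then show ?thesis using DERIV_unique[OF _ DERIV_const] by blast
  qed
  have "bounded ((\<lambda>r. \<phi> \<bar>r\<bar>) ` {0..R})" "bounded (g ` {0..R})"
    by (rule compact_imp_bounded, rule compact_continuous_image,
        rule continuous_on_subset[OF pc] continuous_on_subset[OF gc], simp, simp)+
  then obtain B1 B2 where B: "\<forall>r\<in>{0..R}. \<bar>\<phi> r\<bar> \<le> B1" "\<forall>r\<in>{0..R}. \<bar>g r\<bar> \<le> B2"
    unfolding bounded_iff by auto
  have "\<bar>\<phi> r\<bar> \<le> \<bar>B1\<bar> + \<bar>B2\<bar> \<and> \<bar>g r\<bar> \<le> \<bar>B1\<bar> + \<bar>B2\<bar>" if "0 < r" for r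
    using bspec[OF B(1), of r] bspec[OF B(2), of r] zero[of r] gzero[of r] that by (cases "r \<le> R") auto
  then show ?thesis using that[OF gc pc hd] zero gzero R(1) by blast
qed

text \<open>The definition of the closure speaks of distances only. Finite norms follow from one
  test function at distance below 1, whose own norm is finite because it is bounded with bounded
  support.\<close>

lemma Lm_space_D:
  assumes m: "1 < m" and w: "(w0, w1) \<in> Lm_space m"
  obtains p k where "p \<in> borel_measurable borel" "k \<in> borel_measurable borel" "has_radial_deriv w0 p"
    "(w0 \<longlongrightarrow> 0) at_top" "AE r in lebesgue. 0 < r \<longrightarrow> w1 r = k r" "rad_Lm m p < top" "rad_Lm m k < top"
proof -
  obtain g where g: "has_radial_deriv w0 g" and lim: "(w0 \<longlongrightarrow> 0) at_top" and w1: "w1 \<in> borel_measurable (lebesgue_on {0<..})"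
    and cl: "\<And>\<epsilon>. 0 < \<epsilon> \<Longrightarrow> \<exists>\<phi> \<psi>. radial_test \<phi> \<and> radial_test \<psi> \<and> Lm_norm m (\<lambda>r. w0 r - \<phi> r) (\<lambda>r. w1 r - \<psi> r) < \<epsilon>"
    using w by (auto simp: Lm_space_def)
  obtain p where p: "p \<in> borel_measurable borel" "has_radial_deriv w0 p"
    using has_radial_deriv_borel_version[OF g] by blast
  have w1m: "(\<lambda>r. if r \<in> {0<..} then w1 r else 0) \<in> borel_measurable lebesgue"
    using w1 by (subst borel_measurable_if) auto
  obtain k where "k \<in> borel_measurable lborel" and k2: "AE r in lborel. (if r \<in> {0<..} then w1 r else 0) = k r"
    using completion_ex_borel_measurable_real[OF w1m] by blast
  then have k: "k \<in> borel_measurable borel" "AE r in lborel. (if r \<in> {0<..} then w1 r else 0) = k r" by simp_all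
  have kae: "AE r in lebesgue. 0 < r \<longrightarrow> w1 r = k r"
    using AE_completion[OF k(2)] by eventually_elim auto
  note [measurable] = p(1) k(1)
  obtain \<phi> \<psi> where t: "radial_test \<phi>" "radial_test \<psi>" and n: "Lm_norm m (\<lambda>r. w0 r - \<phi> r) (\<lambda>r. w1 r - \<psi> r) < 1"
    using cl[of 1] by auto
  obtain g1 R1 B1 where 1: "continuous_on UNIV g1" "has_radial_deriv \<phi> g1" "\<And>r. R1 < r \<Longrightarrow> \<phi> r = 0 \<and> g1 r = 0" "\<And>r. 0 < r \<Longrightarrow> \<bar>\<phi> r\<bar> \<le> B1 \<and> \<bar>g1 r\<bar> \<le> B1"
    by (rule radial_test_properties[OF t(1)]) blast
  obtain g2 R2 B2 where 2: "continuous_on UNIV (\<lambda>r. \<psi> \<bar>r\<bar>)" "\<And>r. R2 < r \<Longrightarrow> \<psi> r = 0 \<and> g2 r = 0" "\<And>r. 0 < r \<Longrightarrow> \<bar>\<psi> r\<bar> \<le> B2 \<and> \<bar>g2 r\<bar> \<le> B2" "0 < R2"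
    by (rule radial_test_properties[OF t(2)]) blast
  have [measurable]: "g1 \<in> borel_measurable borel" "(\<lambda>r. \<psi> \<bar>r\<bar>) \<in> borel_measurable borel"
    using 1(1) 2(1) by (auto intro: borel_measurable_continuous_onI)
  have "Lm_norm m (\<lambda>r. w0 r - \<phi> r) (\<lambda>r. w1 r - \<psi> r) = ennpowr (rad_Lm m (\<lambda>r. p r - g1 r) + rad_Lm m (\<lambda>r. k r - \<psi> \<bar>r\<bar>)) (1 / m)"
  proof (rule Lm_norm_eq)
    show "AE r in lebesgue. 0 < r \<longrightarrow> w1 r - \<psi> r = k r - \<psi> \<bar>r\<bar>"
      using kae by eventually_elim auto
  qed (use has_radial_deriv_diff[OF p(2) 1(2)] in auto)
  from this[symmetric] have "ennpowr (rad_Lm m (\<lambda>r. p r - g1 r) + rad_Lm m (\<lambda>r. k r - \<psi> \<bar>r\<bar>)) (1 / m) < top"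
    using less_trans[OF n ennreal_one_less_top] by (simp only:)
  then have fin: "rad_Lm m (\<lambda>r. p r - g1 r) < top" "rad_Lm m (\<lambda>r. k r - \<psi> \<bar>r\<bar>) < top"
    by auto
  have "rad_Lm m g1 < top" using 1 m by (intro rad_Lm_finite_bounded[of _ B1 R1]) auto
  from rad_Lm_finite_add[OF m _ _ fin(1) this, of 1] have fp: "rad_Lm m p < top" by simp
  have "rad_Lm m (\<lambda>r. \<psi> \<bar>r\<bar>) < top" using 2 m by (intro rad_Lm_finite_bounded[of _ B2 R2]) auto
  from rad_Lm_finite_add[OF m _ _ fin(2) this, of 1] have fk: "rad_Lm m k < top" by simp
  show ?thesis by (rule that[OF p(1) k(1) p(2) lim kae fp fk])
qed

section \<open>Hardy's inequalities and the profile of the data\<close>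

text \<open>Hardy's inequalities in one statement, by Minkowski's inequality for the dilations of \<open>H\<close>.\<close>

lemma hardy_dilation:
  fixes \<kappa> :: "real \<Rightarrow> real" and H :: "real \<Rightarrow> ennreal"
  assumes m: "1 < m" and [measurable]: "\<kappa> \<in> borel_measurable borel" "H \<in> borel_measurable borel"
    and \<kappa>: "\<And>x. 0 \<le> \<kappa> x" and K: "0 < K" "(\<integral>\<^sup>+x\<in>{0<..}. ennreal (\<kappa> x * x powr (- 1 / m)) \<partial>lborel) \<le> ennreal K"
    and \<Lambda>: "0 < \<Lambda>" "(\<integral>\<^sup>+r\<in>{0<..}. ennpowr (H r) m \<partial>lborel) \<le> ennreal (\<Lambda> powr m)"
  shows "(\<integral>\<^sup>+r\<in>{0<..}. ennpowr (\<integral>\<^sup>+x\<in>{0<..}. ennreal (\<kappa> x) * H (x * r) \<partial>lborel) m \<partial>lborel) \<le> ennreal ((2 * (K * \<Lambda>)) powr m)"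
proof -
  define h where "h = (\<lambda>x r. ennreal (\<kappa> x) * H (x * r) * indicator {0<..} r * indicator {0<..} x)"
  have [measurable]: "joint_borel h"
    unfolding h_def by measurable
  have slice: "ennpowr (\<integral>\<^sup>+r. ennpowr (h x r) m \<partial>lborel) (1 / m) \<le> ennreal \<Lambda> * (ennreal (\<kappa> x * x powr (- 1 / m)) * indicator {0<..} x)" for x
  proof (cases "0 < x")
    case True
    let ?H = "\<lambda>r. ennpowr (H r) m * indicator {0<..} r"
    have "(\<integral>\<^sup>+r. ?H r \<partial>lborel) = ennreal x * (\<integral>\<^sup>+r. ?H (x * r) \<partial>lborel)"
      using nn_integral_real_affine[of ?H x 0] True by simp
    then have dil: "(\<integral>\<^sup>+r. ?H (x * r) \<partial>lborel) = ennreal (1 / x) * (\<integral>\<^sup>+r. ?H r \<partial>lborel)"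
      using True by (simp add: mult.assoc[symmetric] ennreal_mult[symmetric])
    have "(\<integral>\<^sup>+r. ennpowr (h x r) m \<partial>lborel) = (\<integral>\<^sup>+r. ennreal (\<kappa> x powr m) * ?H (x * r) \<partial>lborel)"
      using True \<kappa>[of x] by (intro nn_integral_cong) (auto simp: h_def indicator_def ennpowr_mult ennpowr_ennreal zero_less_mult_iff)
    also have "\<dots> = ennreal (\<kappa> x powr m) * (ennreal (1 / x) * (\<integral>\<^sup>+r. ?H r \<partial>lborel))"
      by (subst nn_integral_cmult) (auto simp: dil)
    also have "\<dots> \<le> ennreal (\<kappa> x powr m) * (ennreal (1 / x) * ennreal (\<Lambda> powr m))"
      by (intro mult_left_mono \<Lambda>) auto
    also have "\<dots> = ennreal ((\<kappa> x * x powr (- 1 / m) * \<Lambda>) powr m)"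
    proof -
      have "(\<kappa> x * x powr (- 1 / m) * \<Lambda>) powr m = \<kappa> x powr m * (1 / x * \<Lambda> powr m)"
        using True m \<Lambda> \<kappa>[of x] by (simp add: powr_mult powr_divide powr_powr powr_minus_divide)
      then show ?thesis
        using True by (simp only:) (subst ennreal_mult, simp, simp, subst ennreal_mult, simp, simp, simp)
    qed
    finally have "ennpowr (\<integral>\<^sup>+r. ennpowr (h x r) m \<partial>lborel) (1 / m) \<le> ennpowr (ennreal ((\<kappa> x * x powr (- 1 / m) * \<Lambda>) powr m)) (1 / m)"
      using m by (intro ennpowr_mono) auto
    also have "\<dots> = ennreal (\<kappa> x * x powr (- 1 / m) * \<Lambda>)"
      using m \<Lambda> \<kappa>[of x] by (simp add: ennpowr_ennreal powr_powr)
    finally show ?thesis using True \<Lambda> \<kappa>[of x] by (simp add: ennreal_mult mult.commute)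
  next
    case False
    then show ?thesis by (simp add: h_def)
  qed
  have "(\<integral>\<^sup>+r. ennpowr (\<integral>\<^sup>+x. h x r \<partial>lborel) m \<partial>lborel) \<le> ennreal ((2 * (K * \<Lambda>)) powr m)"
  proof (rule minkowski_integral[OF m])
    have "(\<integral>\<^sup>+x. ennpowr (\<integral>\<^sup>+r. ennpowr (h x r) m \<partial>lborel) (1 / m) \<partial>lborel) \<le> (\<integral>\<^sup>+x. ennreal \<Lambda> * (ennreal (\<kappa> x * x powr (- 1 / m)) * indicator {0<..} x) \<partial>lborel)"
      by (intro nn_integral_mono slice)
    also have "\<dots> \<le> ennreal \<Lambda> * ennreal K"
      using mult_left_mono[OF K(2), of "ennreal \<Lambda>"] by (subst nn_integral_cmult) auto
    finally show "(\<integral>\<^sup>+x. ennpowr (\<integral>\<^sup>+r. ennpowr (h x r) m \<partial>lborel) (1 / m) \<partial>lborel) \<le> ennreal (K * \<Lambda>)"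
      using K \<Lambda> by (simp add: ennreal_mult mult.commute)
  qed (use K \<Lambda> in auto)
  moreover have "(\<integral>\<^sup>+r. ennpowr (\<integral>\<^sup>+x. h x r \<partial>lborel) m \<partial>lborel) = (\<integral>\<^sup>+r\<in>{0<..}. ennpowr (\<integral>\<^sup>+x\<in>{0<..}. ennreal (\<kappa> x) * H (x * r) \<partial>lborel) m \<partial>lborel)"
    by (intro nn_integral_cong) (auto simp: h_def indicator_def)
  ultimately show ?thesis by simp
qed

lemma finite_bound_powr:
  assumes "x < top" "0 < m"
  obtains \<Lambda> where "0 < \<Lambda>" "x \<le> ennreal (\<Lambda> powr m)"
proof -
  obtain i where i: "0 \<le> i" "x = ennreal i" using assms(1) by (cases x) auto
  show thesis
    using that[of "(i + 1) powr (1 / m)"] i assms(2) by (simp add: powr_powr ennreal_leI)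
qed

lemma radial_tail_bound:
  assumes [measurable]: "p \<in> borel_measurable borel" and p: "has_radial_deriv w p" and lim: "(w \<longlongrightarrow> 0) at_top" and r: "0 < r"
  shows "ennreal \<bar>w r\<bar> \<le> (\<integral>\<^sup>+s\<in>{r<..}. ennreal \<bar>p s\<bar> \<partial>lborel)"
proof (rule ennreal_le_epsilon)
  fix e :: real assume e: "0 < e"
  have "eventually (\<lambda>b. \<bar>w b\<bar> < e) at_top" using tendstoD[OF lim e] by (simp add: dist_real_def)
  then obtain b0 where b0: "\<And>b. b0 \<le> b \<Longrightarrow> \<bar>w b\<bar> < e" by (auto simp: eventually_at_top_linorder)
  define b where "b = max r b0"
  have b: "r \<le> b" "\<bar>w b\<bar> < e" using b0 by (auto simp: b_def)
  have "w b - w r = (LINT s:{r..b}|lborel. p s)"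
    using p r b by (simp add: has_radial_deriv_iff_lborel)
  then have "ennreal \<bar>w b - w r\<bar> \<le> (\<integral>\<^sup>+s\<in>{r..b}. ennreal \<bar>p s\<bar> \<partial>lborel)"
    using abs_set_integral_le by simp
  also have "\<dots> \<le> (\<integral>\<^sup>+s\<in>{r<..}. ennreal \<bar>p s\<bar> \<partial>lborel)"
  proof (rule nn_integral_mono_AE)
    show "AE s in lborel. ennreal \<bar>p s\<bar> * indicator {r..b} s \<le> ennreal \<bar>p s\<bar> * indicator {r<..} s"
      using AE_lborel_singleton[of r] by eventually_elim (auto simp: indicator_def)
  qed
  finally have *: "ennreal \<bar>w b - w r\<bar> \<le> (\<integral>\<^sup>+s\<in>{r<..}. ennreal \<bar>p s\<bar> \<partial>lborel)" .
  have "ennreal \<bar>w r\<bar> \<le> ennreal (\<bar>w b - w r\<bar> + e)" using b by (intro ennreal_leI) linarith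
  also have "\<dots> = ennreal \<bar>w b - w r\<bar> + ennreal e" using e by simp
  also have "\<dots> \<le> (\<integral>\<^sup>+s\<in>{r<..}. ennreal \<bar>p s\<bar> \<partial>lborel) + ennreal e" using * by (rule add_right_mono)
  finally show "ennreal \<bar>w r\<bar> \<le> (\<integral>\<^sup>+s\<in>{r<..}. ennreal \<bar>p s\<bar> \<partial>lborel) + ennreal e" .
qed

text \<open>Weighted Jensen for the tail of \<open>p\<close> on \<open>(r, \<infinity>)\<close>. The
  bound forces \<open>r * w r\<close> to vanish at the origin and, for differences, turns continuity
  in the energy norm into continuity at each radius.\<close>

lemma radial_pointwise:
  assumes m: "1 < m" and [measurable]: "p \<in> borel_measurable borel" and p: "has_radial_deriv w p" and lim: "(w \<longlongrightarrow> 0) at_top"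
    and r: "0 < r" and \<Lambda>: "0 < \<Lambda>" "rad_Lm m p \<le> ennreal (\<Lambda> powr m)"
  shows "\<bar>w r\<bar> \<le> 2 * (m - 1) powr ((m - 1) / m) * r powr (- 1 / m) * \<Lambda>"
proof -
  \<comment> \<open>The conjugate exponent of \<open>m\<close>: the weight
    \<open>s powr (- \<alpha>)\<close> to the power \<open>1 - m\<close> is \<open>s powr m\<close>,
    exactly the weight in \<open>rad_Lm\<close>.\<close>
  define \<alpha> where "\<alpha> = m / (m - 1)"
  have \<alpha>: "1 < \<alpha>" "\<alpha> * (m - 1) = m" using m by (auto simp: \<alpha>_def field_simps)
  define a where "a = (\<lambda>s. ennreal (s powr (- \<alpha>)) * indicator {r<..} s)"
  define A where "A = r powr (1 - \<alpha>) * (m - 1)"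
  have A: "0 < A" using m r by (simp add: A_def)
  have "(\<integral>\<^sup>+s. a s \<partial>lborel) = ennreal (r powr (- \<alpha> + 1) / (\<alpha> - 1))"
    unfolding a_def using nn_integral_powr_to_inf[of "- \<alpha>" r] \<alpha> r by simp
  also have "r powr (- \<alpha> + 1) / (\<alpha> - 1) = A"
    using m by (simp add: A_def \<alpha>_def field_simps)
  finally have a: "(\<integral>\<^sup>+s. a s \<partial>lborel) \<le> ennreal A" by simp
  have "ennpowr (\<integral>\<^sup>+s. ennreal \<bar>p s\<bar> * indicator {r<..} s \<partial>lborel) m \<le> ennreal (2 powr m * A powr (m - 1)) *
    (\<integral>\<^sup>+s. inverse (ennpowr (a s) (m - 1)) * ennpowr (ennreal \<bar>p s\<bar> * indicator {r<..} s) m \<partial>lborel)"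
    by (intro weighted_jensen m A a) (auto simp: a_def)
  also have "\<dots> \<le> ennreal (2 powr m * A powr (m - 1)) * rad_Lm m p"
    unfolding rad_Lm_def
  proof (intro mult_left_mono nn_integral_mono)
    fix s
    show "inverse (ennpowr (a s) (m - 1)) * ennpowr (ennreal \<bar>p s\<bar> * indicator {r<..} s) m \<le> ennreal (\<bar>s * p s\<bar> powr m) * indicator {0<..} s"
    proof (cases "r < s")
      case True
      then have s: "0 < s" using r by simp
      have "- \<alpha> * (m - 1) = - m" using \<alpha>(2) by simp
      then have "(s powr (- \<alpha>)) powr (m - 1) = s powr (- m)" by (simp only: powr_powr)
      then have "inverse (ennpowr (a s) (m - 1)) = inverse (ennreal (s powr (- m)))"
        using True by (simp add: a_def ennpowr_ennreal)
      also have "\<dots> = ennreal (s powr m)"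
        using s by (subst inverse_ennreal) (auto simp: powr_minus)
      finally have "inverse (ennpowr (a s) (m - 1)) = ennreal (s powr m)" .
      then show ?thesis using True s
        by (simp add: ennpowr_ennreal abs_mult powr_mult ennreal_mult)
    qed (simp add: a_def)
  qed simp
  also have "\<dots> \<le> ennreal (2 powr m * A powr (m - 1)) * ennreal (\<Lambda> powr m)"
    by (intro mult_left_mono \<Lambda>) auto
  also have "\<dots> = ennreal ((2 * A powr ((m - 1) / m) * \<Lambda>) powr m)"
    using m \<Lambda> by (simp add: ennreal_mult[symmetric] powr_mult powr_powr)
  also have "\<dots> = ennpowr (ennreal (2 * A powr ((m - 1) / m) * \<Lambda>)) m"
    using \<Lambda> by (simp add: ennpowr_ennreal)
  finally have "(\<integral>\<^sup>+s\<in>{r<..}. ennreal \<bar>p s\<bar> \<partial>lborel) \<le> ennreal (2 * A powr ((m - 1) / m) * \<Lambda>)"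
    using m by (subst (asm) ennpowr_le_iff) auto
  then have "ennreal \<bar>w r\<bar> \<le> ennreal (2 * A powr ((m - 1) / m) * \<Lambda>)"
    using radial_tail_bound[OF assms(2) p lim r] order_trans by blast
  then have "\<bar>w r\<bar> \<le> 2 * A powr ((m - 1) / m) * \<Lambda>"
    using \<Lambda> by (subst (asm) ennreal_le_iff) auto
  also have "A powr ((m - 1) / m) = (m - 1) powr ((m - 1) / m) * r powr (- 1 / m)"
  proof -
    have "(1 - \<alpha>) * ((m - 1) / m) = - 1 / m" using m by (simp add: \<alpha>_def field_simps)
    then show ?thesis using m r by (simp add: A_def powr_mult powr_powr)
  qed
  finally show ?thesis by (simp add: mult_ac)
qed

lemma radial_hardy:
  assumes m: "1 < m" and [measurable]: "p \<in> borel_measurable borel" "w \<in> borel_measurable borel" and p: "has_radial_deriv w p" and lim: "(w \<longlongrightarrow> 0) at_top"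
    and fin: "rad_Lm m p < top"
  shows "(\<integral>\<^sup>+r\<in>{0<..}. ennreal (\<bar>w r\<bar> powr m) \<partial>lborel) < top"
proof -
  obtain \<Lambda> where \<Lambda>: "0 < \<Lambda>" "rad_Lm m p \<le> ennreal (\<Lambda> powr m)" using finite_bound_powr[OF fin, of m] m by auto
  \<comment> \<open>The substitution \<open>s = x * r\<close> writes the tail of \<open>p\<close> as
    a superposition of dilations of \<open>r * p r\<close> with this kernel; the integral of
    \<open>\<kappa> x * x powr (- 1 / m)\<close> is \<open>m\<close>.\<close>
  define \<kappa> where "\<kappa> = (\<lambda>x::real. indicator {1<..} x / x)"
  define H where "H = (\<lambda>r. ennreal \<bar>r * p r\<bar>)"
  have [measurable]: "\<kappa> \<in> borel_measurable borel" "H \<in> borel_measurable borel" unfolding \<kappa>_def H_def by measurable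
  have \<kappa>: "0 \<le> \<kappa> x" for x by (auto simp: \<kappa>_def indicator_def)
  have "(\<integral>\<^sup>+x\<in>{0<..}. ennreal (\<kappa> x * x powr (- 1 / m)) \<partial>lborel) = (\<integral>\<^sup>+x\<in>{1<..}. ennreal (x powr (- 1 / m - 1)) \<partial>lborel)"
    by (intro nn_integral_cong) (auto simp: \<kappa>_def indicator_def powr_diff)
  also have "\<dots> = ennreal m"
    using m nn_integral_powr_to_inf[of "- 1 / m - 1" 1] by (simp add: field_simps)
  finally have K: "(\<integral>\<^sup>+x\<in>{0<..}. ennreal (\<kappa> x * x powr (- 1 / m)) \<partial>lborel) \<le> ennreal m" by simp
  have "(\<integral>\<^sup>+r\<in>{0<..}. ennreal (\<bar>w r\<bar> powr m) \<partial>lborel)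
    \<le> (\<integral>\<^sup>+r\<in>{0<..}. ennpowr (\<integral>\<^sup>+x\<in>{0<..}. ennreal (\<kappa> x) * H (x * r) \<partial>lborel) m \<partial>lborel)"
  proof (intro nn_integral_mono)
    fix r :: real
    show "ennreal (\<bar>w r\<bar> powr m) * indicator {0<..} r \<le> ennpowr (\<integral>\<^sup>+x\<in>{0<..}. ennreal (\<kappa> x) * H (x * r) \<partial>lborel) m * indicator {0<..} r"
    proof (cases "0 < r")
      case True
      have "ennreal \<bar>w r\<bar> \<le> (\<integral>\<^sup>+s. ennreal \<bar>p s\<bar> * indicator {r<..} s \<partial>lborel)"
        by (rule radial_tail_bound[OF assms(2) p lim True])
      also have "\<dots> = ennreal r * (\<integral>\<^sup>+x. ennreal \<bar>p (r * x)\<bar> * indicator {r<..} (r * x) \<partial>lborel)"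
        using nn_integral_real_affine[of "\<lambda>s. ennreal \<bar>p s\<bar> * indicator {r<..} s" r 0] True by simp
      also have "\<dots> = (\<integral>\<^sup>+x. ennreal r * (ennreal \<bar>p (r * x)\<bar> * indicator {r<..} (r * x)) \<partial>lborel)"
        by (intro nn_integral_cmult[symmetric]) measurable
      also have "\<dots> = (\<integral>\<^sup>+x\<in>{0<..}. ennreal (\<kappa> x) * H (x * r) \<partial>lborel)"
      proof (intro nn_integral_cong)
        fix x
        show "ennreal r * (ennreal \<bar>p (r * x)\<bar> * indicator {r<..} (r * x)) = ennreal (\<kappa> x) * H (x * r) * indicator {0<..} x"
        proof (cases "1 < x")
          case True
          then show ?thesis using \<open>0 < r\<close>
            by (simp add: \<kappa>_def H_def ennreal_mult[symmetric] abs_mult mult_ac)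
        next
          case False
          then have "\<not> r < r * x" using \<open>0 < r\<close> by (simp add: mult_le_cancel_left1 not_less)
          then show ?thesis using False by (simp add: \<kappa>_def)
        qed
      qed
      finally have "ennpowr (ennreal \<bar>w r\<bar>) m \<le> ennpowr (\<integral>\<^sup>+x\<in>{0<..}. ennreal (\<kappa> x) * H (x * r) \<partial>lborel) m"
        using m by (intro ennpowr_mono) auto
      then show ?thesis using True by (simp add: ennpowr_ennreal)
    qed simp
  qed
  also have "\<dots> \<le> ennreal ((2 * (m * \<Lambda>)) powr m)"
    using m \<Lambda> \<kappa> K by (intro hardy_dilation) (auto simp: H_def rad_Lm_def ennpowr_ennreal)
  finally show ?thesis by (rule le_less_trans) simp
qed

text \<open>Fubini on the triangle \<open>s \<le> r\<close> takes the place of a Lebesgue-point argument.\<close>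

lemma has_radial_deriv_mult:
  assumes [measurable]: "p \<in> borel_measurable borel" "w \<in> borel_measurable borel" and p: "has_radial_deriv w p"
    and c: "\<And>x. 0 < x \<Longrightarrow> (c has_real_derivative c' x) (at x)" and c': "continuous_on {0<..} c'"
    and [measurable]: "c \<in> borel_measurable borel" "c' \<in> borel_measurable borel"
  shows "has_radial_deriv (\<lambda>r. c r * w r) (\<lambda>r. c' r * w r + c r * p r)"
proof (subst has_radial_deriv_iff_lborel)
  show "\<forall>a b. 0 < a \<longrightarrow> a \<le> b \<longrightarrow> set_integrable lborel {a..b} (\<lambda>r. c' r * w r + c r * p r) \<and>
    c b * w b - c a * w a = (LINT r:{a..b}|lborel. c' r * w r + c r * p r)"
  proof (intro allI impI)
    fix a b :: real assume ab: "0 < a" "a \<le> b"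
    have pi: "set_integrable lborel {x..y} p" "w y - w x = (LINT r:{x..y}|lborel. p r)" if "a \<le> x" "x \<le> y" for x y
      using p that ab by (auto simp: has_radial_deriv_iff_lborel)
    have c'i: "set_integrable lborel {x..y} c'" "c y - c x = (LINT r:{x..y}|lborel. c' r)" if "a \<le> x" "x \<le> y" for x y
    proof -
      have "has_bochner_integral lborel (\<lambda>r. c' r * indicator {x..y} r) (c y - c x)"
        using that ab by (intro has_bochner_integral_FTC_Icc_real c)
          (auto intro!: continuous_on_interior[OF c'] simp: interior_open)
      then show "set_integrable lborel {x..y} c'" "c y - c x = (LINT r:{x..y}|lborel. c' r)"
        by (auto simp: has_bochner_integral_iff set_integrable_def set_lebesgue_integral_def mult.commute)
    qed
    \<comment> \<open>The product \<open>c' r * p s\<close> on the triangle: integrated over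
      \<open>s\<close> it gives \<open>c' * (w - w a)\<close>, integrated over \<open>r\<close> it
      gives \<open>p * (c b - c)\<close>.\<close>
    define T where "T = (\<lambda>r s. indicator {a..b} r * c' r * (indicator {a..b} s * p s * (if s \<le> r then 1 else 0)))"
    have Tm: "case_prod T \<in> borel_measurable (lborel \<Otimes>\<^sub>M lborel)" unfolding T_def by measurable
    have T: "integrable (lborel \<Otimes>\<^sub>M lborel) (case_prod T)"
    proof (rule Bochner_Integration.integrable_bound[OF _ Tm])
      define F G where "F = (\<lambda>r. indicator {a..b} r *\<^sub>R c' r)" and "G = (\<lambda>s. indicator {a..b} s *\<^sub>R p s)"
      have FG: "integrable lborel F" "integrable lborel G"
        using c'i(1)[of a b] pi(1)[of a b] ab by (auto simp: set_integrable_def F_def G_def)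
      note [measurable] = borel_measurable_integrable[OF FG(1)] borel_measurable_integrable[OF FG(2)]
      show "integrable (lborel \<Otimes>\<^sub>M lborel) (\<lambda>(r, s). F r * G s)"
      proof (rule lborel_pair.Fubini_integrable)
        have "integrable lborel (\<lambda>r. \<bar>F r\<bar> * (LINT s|lborel. \<bar>G s\<bar>))"
          using FG by (intro integrable_mult_left integrable_abs)
        then show "integrable lborel (\<lambda>x. LINT y|lborel. norm (case (x, y) of (r, s) \<Rightarrow> F r * G s))"
          by (simp add: abs_mult)
        show "AE x in lborel. integrable lborel (\<lambda>y. case (x, y) of (r, s) \<Rightarrow> F r * G s)"
          using FG by simp
      qed measurable
      show "AE x in lborel \<Otimes>\<^sub>M lborel. norm (case_prod T x) \<le> norm (case x of (r, s) \<Rightarrow> F r * G s)"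
        by (intro AE_I2) (auto simp: T_def F_def G_def abs_mult indicator_def)
    qed
    have w: "w r = w a + (LINT s|lborel. indicator {a..b} s * p s * (if s \<le> r then 1 else 0))" if "r \<in> {a..b}" for r
    proof -
      have "(LINT s|lborel. indicator {a..b} s * p s * (if s \<le> r then 1 else 0)) = (LINT s:{a..r}|lborel. p s)"
        unfolding set_lebesgue_integral_def using that by (intro Bochner_Integration.integral_cong) (auto simp: indicator_def)
      then show ?thesis using pi(2)[of a r] that by simp
    qed
    have i1: "integrable lborel (\<lambda>r. LINT s|lborel. T r s)" by (rule lborel_pair.integrable_fst[OF T])
    have Tr: "(LINT s|lborel. T r s) = indicator {a..b} r * c' r * (w r - w a)" for r
    proof (cases "r \<in> {a..b}")
      case True
      then have "w r - w a = (LINT s|lborel. indicator {a..b} s * p s * (if s \<le> r then 1 else 0))"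
        using w[OF True] by simp
      with True show ?thesis by (simp add: T_def)
    qed (simp add: T_def)
    have i2: "integrable lborel (\<lambda>r. indicator {a..b} r * c' r * w a)"
      using c'i(1)[of a b] ab by (simp add: set_integrable_def)
    have ic'w: "set_integrable lborel {a..b} (\<lambda>r. c' r * w r)"
    proof -
      have "integrable lborel (\<lambda>r. (LINT s|lborel. T r s) + indicator {a..b} r * c' r * w a)"
        using i1 i2 by (rule Bochner_Integration.integrable_add)
      then show ?thesis unfolding Tr set_integrable_def by (simp add: algebra_simps)
    qed
    have Ts: "(LINT r|lborel. T r s) = indicator {a..b} s * p s * (c b - c s)" for s
    proof (cases "s \<in> {a..b}")
      case True
      have "(LINT r|lborel. T r s) = p s * (LINT r:{s..b}|lborel. c' r)"
        unfolding T_def set_lebesgue_integral_def integral_mult_right_zero[symmetric]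
        using True by (intro Bochner_Integration.integral_cong) (auto simp: indicator_def)
      then show ?thesis using True c'i(2)[of s b] by simp
    qed (simp add: T_def)
    have i3: "integrable lborel (\<lambda>s. LINT r|lborel. T r s)" by (rule lborel_pair.integrable_snd[OF T])
    have i4: "integrable lborel (\<lambda>s. indicator {a..b} s * p s * c b)"
      using pi(1)[of a b] ab by (simp add: set_integrable_def)
    have icp: "set_integrable lborel {a..b} (\<lambda>r. c r * p r)"
    proof -
      have "integrable lborel (\<lambda>s. indicator {a..b} s * p s * c b - (LINT r|lborel. T r s))"
        using i4 i3 by (rule Bochner_Integration.integrable_diff)
      then show ?thesis unfolding Ts set_integrable_def by (simp add: algebra_simps)
    qed
    have e1: "(LINT r:{a..b}|lborel. c' r * w r) = (LINT r|lborel. LINT s|lborel. T r s) + w a * (c b - c a)"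
    proof -
      have "(LINT r:{a..b}|lborel. c' r * w r) = (LINT r|lborel. (LINT s|lborel. T r s) + indicator {a..b} r * c' r * w a)"
        unfolding Tr set_lebesgue_integral_def by (intro Bochner_Integration.integral_cong) (auto simp: algebra_simps)
      also have "\<dots> = (LINT r|lborel. LINT s|lborel. T r s) + (LINT r|lborel. indicator {a..b} r * c' r * w a)"
        by (rule Bochner_Integration.integral_add[OF i1 i2])
      also have "(LINT r|lborel. indicator {a..b} r * c' r * w a) = w a * (c b - c a)"
        using c'i(2)[of a b] ab by (simp add: set_lebesgue_integral_def mult.commute)
      finally show ?thesis .
    qed
    have e2: "(LINT r:{a..b}|lborel. c r * p r) = c b * (w b - w a) - (LINT s|lborel. LINT r|lborel. T r s)"
    proof -
      have "(LINT r:{a..b}|lborel. c r * p r) = (LINT s|lborel. indicator {a..b} s * p s * c b - (LINT r|lborel. T r s))"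
        unfolding Ts set_lebesgue_integral_def by (intro Bochner_Integration.integral_cong) (auto simp: algebra_simps)
      also have "\<dots> = (LINT s|lborel. indicator {a..b} s * p s * c b) - (LINT s|lborel. LINT r|lborel. T r s)"
        by (rule Bochner_Integration.integral_diff[OF i4 i3])
      also have "(LINT s|lborel. indicator {a..b} s * p s * c b) = c b * (w b - w a)"
        using pi(2)[of a b] ab by (simp add: set_lebesgue_integral_def mult.commute)
      finally show ?thesis .
    qed
    have "(LINT r|lborel. LINT s|lborel. T r s) = (LINT s|lborel. LINT r|lborel. T r s)"
      by (rule lborel_pair.Fubini_integral[OF T, symmetric])
    then have "(LINT r:{a..b}|lborel. c' r * w r + c r * p r) = c b * w b - c a * w a"
      using e1 e2 ic'w icp by (simp add: set_integral_add algebra_simps)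
    then show "set_integrable lborel {a..b} (\<lambda>r. c' r * w r + c r * p r) \<and>
      c b * w b - c a * w a = (LINT r:{a..b}|lborel. c' r * w r + c r * p r)"
      using ic'w icp by (auto intro!: set_integral_add)
  qed
qed measurable

section \<open>Profiles of initial data\<close>

definition prim :: "(real \<Rightarrow> real) \<Rightarrow> real \<Rightarrow> real" where
  "prim f \<sigma> = (if 0 \<le> \<sigma> then LINT y:{0..\<sigma>}|lborel. f y else - (LINT y:{\<sigma>..0}|lborel. f y))"

text \<open>For the wave \<open>avg g t r\<close>, differentiating the end points of the window
  gives this quotient as the time derivative at time 0, and \<open>prf_du\<close> as the radial
  one.\<close>

definition prf_v :: "(real \<Rightarrow> real) \<Rightarrow> real \<Rightarrow> real" where
  "prf_v g r = (g r - g (- r)) / r"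

definition prf_du :: "(real \<Rightarrow> real) \<Rightarrow> real \<Rightarrow> real" where
  "prf_du g r = (g r + g (- r)) / r - avg g 0 r / r"

lemma set_integral_reflect_real:
  fixes f :: "real \<Rightarrow> real"
  shows "(LINT y:{a..b}|lborel. f (- y)) = (LINT y:{- b..- a}|lborel. f y)"
  unfolding set_lebesgue_integral_def
  by (subst (2) lborel_integral_real_affine[where c = "-1" and t = 0])
    (auto intro!: Bochner_Integration.integral_cong simp: indicator_def)

lemma avg_reflect: "avg f (- t) r = avg (\<lambda>y. f (- y)) t r"
  using set_integral_reflect_real[of "t - r" "t + r" f] by (simp add: avg_def)

lemma set_integral_singleton [simp]: "(LINT y:{a}|lborel. f y) = (0::real)" for a :: real
  unfolding set_lebesgue_integral_def
  by (rule integral_eq_zero_AE) (use AE_lborel_singleton[of a] in \<open>eventually_elim, auto\<close>)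

lemma integral_eq_prim_diff:
  assumes f: "\<And>a b. set_integrable lborel {a..b} f" and ab: "a \<le> b"
  shows "(LINT y:{a..b}|lborel. f y) = prim f b - prim f a"
proof -
  have split: "(LINT y:{x..z}|lborel. f y) = (LINT y:{x..y}|lborel. f y) + (LINT y:{y..z}|lborel. f y)" if "x \<le> y" "y \<le> z" for x y z
  proof -
    have "(LINT y:{x..y} \<union> {y..z}|lborel. f y) = (LINT y:{x..y}|lborel. f y) + (LINT y:{y..z}|lborel. f y)"
    proof (rule set_integral_Un_AE)
      show "AE v in lborel. \<not> (v \<in> {x..y} \<and> v \<in> {y..z})"
        using AE_lborel_singleton[of y] by eventually_elim auto
    qed (auto intro: f)
    moreover have "{x..y} \<union> {y..z} = {x..z}" using that by auto
    ultimately show ?thesis by simp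
  qed
  consider "0 \<le> a" | "a < 0" "0 \<le> b" | "b < 0" by linarith
  then show ?thesis
  proof cases
    case 1
    then show ?thesis using split[of 0 a b] ab by (simp add: prim_def)
  next
    case 2
    then show ?thesis using split[of a 0 b] by (simp add: prim_def)
  next
    case 3
    then show ?thesis using split[of a b 0] ab by (simp add: prim_def)
  qed
qed

context wave
begin

lemma Lm_fun_set_integrable:
  assumes "Lm_fun m f"
  shows "set_integrable lborel {a..b} f"
  using Lm_fun_integrable[OF assms, of "(a + b) / 2" "(b - a) / 2"] by (simp add: field_simps)

lemma avg_eq_prim:
  assumes "Lm_fun m f" "0 < r"
  shows "avg f t r = (prim f (t + r) - prim f (t - r)) / r"
  unfolding avg_def using assms by (subst integral_eq_prim_diff) (auto intro: Lm_fun_set_integrable)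

lemma Lm_fun_cmult: "Lm_fun m g \<Longrightarrow> Lm_fun m (\<lambda>y. c * g y)"
  using Lm_fun_add[of "\<lambda>y. 0" g c] m by (simp add: Lm_fun_def)

lemma Lm_fun_radial:
  assumes [measurable]: "e \<in> borel_measurable borel" "g \<in> borel_measurable borel"
    and eq: "\<And>\<sigma>. \<bar>g \<sigma>\<bar> = \<bar>e \<bar>\<sigma>\<bar>\<bar>" and fin: "(\<integral>\<^sup>+r\<in>{0<..}. ennreal (\<bar>e r\<bar> powr m) \<partial>lborel) < top"
  shows "Lm_fun m g"
proof -
  have "(\<integral>\<^sup>+z. ennpowr (ennreal \<bar>e z\<bar> * indicator {0..} z) m \<partial>lborel) = (\<integral>\<^sup>+r\<in>{0<..}. ennreal (\<bar>e r\<bar> powr m) \<partial>lborel)"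
  proof (rule nn_integral_cong_AE)
    show "AE z in lborel. ennpowr (ennreal \<bar>e z\<bar> * indicator {0..} z) m = ennreal (\<bar>e z\<bar> powr m) * indicator {0<..} z"
      using AE_lborel_singleton[of 0] by eventually_elim (auto simp: indicator_def ennpowr_ennreal)
  qed
  then have "Lp_norm m (\<lambda>z. ennreal \<bar>e z\<bar> * indicator {0..} z) < top"
    using fin by (simp add: Lp_norm_def)
  then have "Lp_norm m (\<lambda>z. ennreal \<bar>e \<bar>z\<bar>\<bar>) < top"
    using Lp_norm_abs[OF m, of "\<lambda>z. ennreal \<bar>e z\<bar>"] by (auto intro: le_less_trans simp: ennreal_mult_less_top)
  then show ?thesis
    by (simp add: Lm_fun_def Lp_norm_def eq ennpowr_ennreal)
qed

text \<open>The profile is the derivative of \<open>wave_profile\<close>. Hardy's inequality puts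
  its part coming from \<open>u0\<close> itself into \<open>L\<^sup>m\<close>; the terms with the
  derivative of \<open>u0\<close> and with \<open>u1\<close> are there by the definition of the
  norm.\<close>

lemma data_profile:
  assumes u: "(u0, u1) \<in> Lm_space m"
  shows "\<exists>f. Lm_fun m f \<and> (\<forall>t r. 0 < r \<longrightarrow> S_L t u0 u1 r = avg f t r) \<and> (AE r in lebesgue. 0 < r \<longrightarrow> prf_v f r = u1 r)"
proof -
  obtain p k where [measurable]: "p \<in> borel_measurable borel" "k \<in> borel_measurable borel" and p: "has_radial_deriv u0 p"
    and lim: "(u0 \<longlongrightarrow> 0) at_top" and k: "AE r in lebesgue. 0 < r \<longrightarrow> u1 r = k r" and fp: "rad_Lm m p < top" and fk: "rad_Lm m k < top"
    by (rule Lm_space_D[OF m u]) blast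
  \<comment> \<open>A Borel version of \<open>u0\<close>, rebuilt from its derivative; it agrees
    with \<open>u0\<close> at every \<open>r > 0\<close>.\<close>
  define w where "w = (\<lambda>r. if 0 < r then u0 1 + ((LINT s:{1..r}|lborel. p s) - (LINT s:{r..1}|lborel. p s)) else 0)"
  have wm[measurable]: "w \<in> borel_measurable borel"
    unfolding w_def set_lebesgue_integral_def indicator_def atLeastAtMost_iff by measurable
  have w: "w r = u0 r" if "0 < r" for r
  proof -
    have d: "\<And>a b. 0 < a \<Longrightarrow> a \<le> b \<Longrightarrow> u0 b - u0 a = (LINT r:{a..b}|lborel. p r)"
      using p by (simp add: has_radial_deriv_iff_lborel)
    consider "r = 1" | "r < 1" | "1 < r" by linarith
    then show ?thesis
      using d[of r 1] d[of 1 r] that by cases (auto simp: w_def set_lebesgue_integral_def[of _ "{}"])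
  qed
  have pw: "has_radial_deriv w p" using p by (rule has_radial_deriv_cong) (simp add: w)
  have limw: "(w \<longlongrightarrow> 0) at_top"
    using lim by (rule Lim_transform_eventually) (use eventually_gt_at_top[of 0] in \<open>eventually_elim, simp add: w\<close>)
  obtain \<Lambda> where \<Lambda>: "0 < \<Lambda>" "rad_Lm m p \<le> ennreal (\<Lambda> powr m)" using finite_bound_powr[OF fp m0] by blast
  \<comment> \<open>Half the derivative of \<open>\<sigma> * w \<bar>\<sigma>\<bar>\<close>, which
    is even, plus half of \<open>\<sigma> * k \<bar>\<sigma>\<bar>\<close>, which is odd. The
    factors 1 fit the shape of \<open>Lm_fun_add\<close>.\<close>
  define f where "f = (\<lambda>\<sigma>. 1 / 2 * ((w \<bar>\<sigma>\<bar> + 1 * (\<bar>\<sigma>\<bar> * p \<bar>\<sigma>\<bar>)) + 1 * (\<sigma> * k \<bar>\<sigma>\<bar>)))"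
  have [measurable]: "f \<in> borel_measurable borel" unfolding f_def by measurable
  have L1: "Lm_fun m (\<lambda>\<sigma>. w \<bar>\<sigma>\<bar> + 1 * (\<bar>\<sigma>\<bar> * p \<bar>\<sigma>\<bar>))"
  proof (intro Lm_fun_add)
    show "Lm_fun m (\<lambda>\<sigma>. w \<bar>\<sigma>\<bar>)"
      using radial_hardy[OF m _ _ pw limw fp] by (intro Lm_fun_radial[of w]) auto
    show "Lm_fun m (\<lambda>\<sigma>. \<bar>\<sigma>\<bar> * p \<bar>\<sigma>\<bar>)"
      using fp by (intro Lm_fun_radial[of "\<lambda>r. r * p r"]) (auto simp: rad_Lm_def)
  qed
  have L2: "Lm_fun m (\<lambda>\<sigma>. \<sigma> * k \<bar>\<sigma>\<bar>)"
    using fk by (intro Lm_fun_radial[of "\<lambda>r. r * k r"]) (auto simp: rad_Lm_def abs_mult)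
  have f: "Lm_fun m f" unfolding f_def by (intro Lm_fun_cmult Lm_fun_add L1 L2)
  \<comment> \<open>The product rule is available away from 0 only. In the limit at the origin the
    boundary term \<open>a * w a\<close> disappears, being bounded by a multiple of
    \<open>a powr (1 - 1 / m)\<close>, a positive power.\<close>
  have even: "(LINT \<rho>:{0..\<sigma>}|lborel. w \<bar>\<rho>\<bar> + \<bar>\<rho>\<bar> * p \<bar>\<rho>\<bar>) = \<sigma> * w \<sigma>" if \<sigma>: "0 < \<sigma>" for \<sigma>
  proof -
    have rd: "has_radial_deriv (\<lambda>r. r * w r) (\<lambda>r. 1 * w r + r * p r)"
      by (rule has_radial_deriv_mult[OF _ _ pw]) (auto intro!: continuous_intros derivative_eq_intros)
    have si: "set_integrable lborel {0<..\<sigma>} (\<lambda>r. 1 * w r + r * p r)"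
    proof (rule set_integrable_cong[THEN iffD1, OF refl refl])
      show "set_integrable lborel {0<..\<sigma>} (\<lambda>\<sigma>. w \<bar>\<sigma>\<bar> + 1 * (\<bar>\<sigma>\<bar> * p \<bar>\<sigma>\<bar>))"
        by (rule set_integrable_subset[OF Lm_fun_set_integrable[OF L1, of 0 \<sigma>]]) auto
    qed simp
    have "((\<lambda>a. LINT r:{a..\<sigma>}|lborel. 1 * w r + r * p r) \<longlongrightarrow> (LINT r:{0<..\<sigma>}|lborel. 1 * w r + r * p r)) (at_right 0)"
      by (intro tendsto_set_lebesgue_integral_at_right \<sigma> si) auto
    moreover have "((\<lambda>a. LINT r:{a..\<sigma>}|lborel. 1 * w r + r * p r) \<longlongrightarrow> \<sigma> * w \<sigma> - 0) (at_right 0)"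
    proof (rule Lim_transform_eventually)
      define c where "c = 2 * (m - 1) powr ((m - 1) / m) * \<Lambda>"
      have pos: "eventually (\<lambda>a::real. 0 \<le> a) (at_right 0)"
        using eventually_at_right_less[of "0::real"] by eventually_elim simp
      have "((\<lambda>a. c * a powr (1 - 1 / m)) \<longlongrightarrow> c * 0) (at_right 0)"
        using m by (intro tendsto_mult tendsto_const tendsto_zero_powrI[OF tendsto_ident_at tendsto_const pos]) auto
      then have z: "((\<lambda>a. c * a powr (1 - 1 / m)) \<longlongrightarrow> 0) (at_right 0)" by simp
      have "((\<lambda>a. a * w a) \<longlongrightarrow> 0) (at_right 0)"
      proof (rule Lim_null_comparison[OF _ z])
        show "eventually (\<lambda>a. norm (a * w a) \<le> c * a powr (1 - 1 / m)) (at_right 0)"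
          using eventually_at_right_less[of 0]
        proof eventually_elim
          fix a :: real assume a: "0 < a"
          have "\<bar>w a\<bar> \<le> 2 * (m - 1) powr ((m - 1) / m) * a powr (- 1 / m) * \<Lambda>"
            by (rule radial_pointwise[OF m _ pw limw a \<Lambda>]) simp
          then have "a * \<bar>w a\<bar> \<le> a * (2 * (m - 1) powr ((m - 1) / m) * a powr (- 1 / m) * \<Lambda>)"
            using a by (intro mult_left_mono) auto
          also have "\<dots> = c * a powr (1 - 1 / m)" using a by (simp add: c_def powr_diff powr_minus field_simps)
          finally show "norm (a * w a) \<le> c * a powr (1 - 1 / m)" using a by (simp add: abs_mult)
        qed
      qed
      then show "((\<lambda>a. \<sigma> * w \<sigma> - a * w a) \<longlongrightarrow> \<sigma> * w \<sigma> - 0) (at_right 0)"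
        by (intro tendsto_diff tendsto_const)
      show "eventually (\<lambda>a. \<sigma> * w \<sigma> - a * w a = (LINT r:{a..\<sigma>}|lborel. 1 * w r + r * p r)) (at_right 0)"
        using eventually_at_right_less[of 0] eventually_at_right_real[OF \<sigma>]
      proof eventually_elim
        fix a :: real assume "0 < a" "a \<in> {0<..<\<sigma>}"
        then show "\<sigma> * w \<sigma> - a * w a = (LINT r:{a..\<sigma>}|lborel. 1 * w r + r * p r)"
          using rd by (simp add: has_radial_deriv_iff_lborel)
      qed
    qed
    ultimately have "(LINT r:{0<..\<sigma>}|lborel. 1 * w r + r * p r) = \<sigma> * w \<sigma> - 0"
      by (rule tendsto_unique[rotated]) simp
    moreover have "(LINT \<rho>:{0..\<sigma>}|lborel. w \<bar>\<rho>\<bar> + \<bar>\<rho>\<bar> * p \<bar>\<rho>\<bar>) = (LINT r:{0<..\<sigma>}|lborel. 1 * w r + r * p r)"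
      unfolding set_lebesgue_integral_def
    proof (rule integral_cong_AE)
      show "AE \<rho> in lborel. indicator {0..\<sigma>} \<rho> *\<^sub>R (w \<bar>\<rho>\<bar> + \<bar>\<rho>\<bar> * p \<bar>\<rho>\<bar>) = indicator {0<..\<sigma>} \<rho> *\<^sub>R (1 * w \<rho> + \<rho> * p \<rho>)"
        using AE_lborel_singleton[of 0] by eventually_elim (auto simp: indicator_def)
    qed measurable
    ultimately show ?thesis by simp
  qed
  \<comment> \<open>\<open>u1\<close> is only Lebesgue measurable and given up to null sets, so
    \<open>k\<close> replaces it; at 0 the factor \<rho> makes both sides vanish.\<close>
  have odd: "(LINT \<rho>:{0..\<sigma>}|lebesgue. \<rho> * u1 \<rho>) = (LINT \<rho>:{0..\<sigma>}|lborel. \<rho> * k \<bar>\<rho>\<bar>)" for \<sigma>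
  proof -
    have ae: "AE \<rho> in lebesgue. indicator {0..\<sigma>} \<rho> *\<^sub>R (\<rho> * k \<bar>\<rho>\<bar>) = indicator {0..\<sigma>} \<rho> *\<^sub>R (\<rho> * u1 \<rho>)"
      using k
    proof eventually_elim
      case (elim \<rho>)
      then show ?case by (cases "\<rho> = 0") (auto simp: indicator_def)
    qed
    have km: "(\<lambda>\<rho>. indicator {0..\<sigma>} \<rho> *\<^sub>R (\<rho> * k \<bar>\<rho>\<bar>)) \<in> borel_measurable lborel" by measurable
    have "(LINT \<rho>:{0..\<sigma>}|lebesgue. \<rho> * u1 \<rho>) = (LINT \<rho>:{0..\<sigma>}|lebesgue. \<rho> * k \<bar>\<rho>\<bar>)"
      unfolding set_lebesgue_integral_def
      by (rule integral_cong_AE[symmetric, OF measurable_completion[OF km] borel_measurable_AE[OF measurable_completion[OF km] ae] ae])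
    also have "\<dots> = (LINT \<rho>:{0..\<sigma>}|lborel. \<rho> * k \<bar>\<rho>\<bar>)"
      unfolding set_lebesgue_integral_def by (rule integral_completion[OF km])
    finally show ?thesis .
  qed
  have prof: "wave_profile u0 u1 \<sigma> = prim f \<sigma>" for \<sigma>
  proof -
    have i1: "set_integrable lborel {0..\<bar>\<sigma>\<bar>} (\<lambda>\<rho>. w \<bar>\<rho>\<bar> + \<bar>\<rho>\<bar> * p \<bar>\<rho>\<bar>)" using Lm_fun_set_integrable[OF L1] by simp
    have i2: "set_integrable lborel {0..\<bar>\<sigma>\<bar>} (\<lambda>\<rho>. \<rho> * k \<bar>\<rho>\<bar>)" by (rule Lm_fun_set_integrable[OF L2])
    consider "\<sigma> = 0" | "0 < \<sigma>" | "\<sigma> < 0" by linarith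
    then show ?thesis
    proof cases
      case 1
      then show ?thesis using odd[of 0] by (simp add: wave_profile_def prim_def)
    next
      case 2
      have "prim f \<sigma> = (LINT \<rho>:{0..\<sigma>}|lborel. 1 / 2 * ((w \<bar>\<rho>\<bar> + \<bar>\<rho>\<bar> * p \<bar>\<rho>\<bar>) + \<rho> * k \<bar>\<rho>\<bar>))"
        using 2 by (simp add: prim_def f_def)
      also have "\<dots> = 1 / 2 * ((LINT \<rho>:{0..\<sigma>}|lborel. w \<bar>\<rho>\<bar> + \<bar>\<rho>\<bar> * p \<bar>\<rho>\<bar>) + (LINT \<rho>:{0..\<sigma>}|lborel. \<rho> * k \<bar>\<rho>\<bar>))"
        using i1 i2 2 by (subst set_integral_mult_right) (simp add: set_integral_add)
      finally show ?thesis using 2 even[OF 2] by (simp add: wave_profile_def odd w field_simps)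
    next
      case 3
      have "prim f \<sigma> = - (LINT y:{0..- \<sigma>}|lborel. f (- y))"
        using 3 by (subst set_integral_reflect_real) (simp add: prim_def)
      also have "(LINT y:{0..- \<sigma>}|lborel. f (- y)) = (LINT \<rho>:{0..- \<sigma>}|lborel. 1 / 2 * ((w \<bar>\<rho>\<bar> + \<bar>\<rho>\<bar> * p \<bar>\<rho>\<bar>) - \<rho> * k \<bar>\<rho>\<bar>))"
        by (simp add: f_def)
      also have "\<dots> = 1 / 2 * ((LINT \<rho>:{0..- \<sigma>}|lborel. w \<bar>\<rho>\<bar> + \<bar>\<rho>\<bar> * p \<bar>\<rho>\<bar>) - (LINT \<rho>:{0..- \<sigma>}|lborel. \<rho> * k \<bar>\<rho>\<bar>))"
        using i1 i2 3 by (subst set_integral_mult_right) (simp add: set_integral_diff)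
      finally show ?thesis using 3 even[of "- \<sigma>"] by (simp add: wave_profile_def odd w field_simps)
    qed
  qed
  show ?thesis
  proof (intro exI[of _ f] conjI f allI impI)
    show "S_L t u0 u1 r = avg f t r" if "0 < r" for t r
      using that by (simp add: S_L_def prof avg_eq_prim[OF f])
    show "AE r in lebesgue. 0 < r \<longrightarrow> prf_v f r = u1 r"
      using k by eventually_elim (auto simp: prf_v_def f_def field_simps)
  qed
qed

section \<open>From a profile back to position and velocity\<close>

lemma prf_u_deriv:
  assumes g: "Lm_fun m g"
  shows "has_radial_deriv (avg g 0) (prf_du g)"
proof -
  have [measurable]: "g \<in> borel_measurable borel" using g by (simp add: Lm_fun_def)
  note si = Lm_fun_set_integrable[OF g]
  define Q where "Q = (\<lambda>r. LINT y:{- r..r}|lborel. g y)"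
  have Qm: "Q \<in> borel_measurable borel"
    unfolding Q_def set_lebesgue_integral_def indicator_def atLeastAtMost_iff by measurable
  have Q: "has_radial_deriv Q (\<lambda>r. g r + g (- r))"
  proof (subst has_radial_deriv_iff_lborel)
    show "\<forall>a b. 0 < a \<longrightarrow> a \<le> b \<longrightarrow> set_integrable lborel {a..b} (\<lambda>r. g r + g (- r)) \<and>
      Q b - Q a = (LINT r:{a..b}|lborel. g r + g (- r))"
    proof (intro allI impI)
      fix a b :: real assume ab: "0 < a" "a \<le> b"
      have "Lm_fun m (\<lambda>r. g (- r))"
        using g unfolding Lm_fun_def
        by (subst (asm) nn_integral_real_affine[where c = "-1" and t = 0]) auto
      note si' = Lm_fun_set_integrable[OF this, of a b]
      have "Q b - Q a = (prim g b - prim g a) + (prim g (- a) - prim g (- b))"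
        using ab by (simp add: Q_def integral_eq_prim_diff[OF si])
      also have "\<dots> = (LINT r:{a..b}|lborel. g r) + (LINT r:{- b..- a}|lborel. g r)"
        using ab by (simp add: integral_eq_prim_diff[OF si])
      also have "\<dots> = (LINT r:{a..b}|lborel. g r + g (- r))"
        using si si' by (simp add: set_integral_add set_integral_reflect_real)
      finally show "set_integrable lborel {a..b} (\<lambda>r. g r + g (- r)) \<and> Q b - Q a = (LINT r:{a..b}|lborel. g r + g (- r))"
        using si si' by (auto intro: set_integral_add)
    qed
  qed measurable
  have "has_radial_deriv (\<lambda>r. inverse r * Q r) (\<lambda>r. - (inverse r ^ 2) * Q r + inverse r * (g r + g (- r)))"
    by (rule has_radial_deriv_mult[OF _ Qm Q])
      (auto intro!: continuous_intros derivative_eq_intros simp: power2_eq_square)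
  moreover have "(\<lambda>r. inverse r * Q r) = avg g 0" by (auto simp: avg_def Q_def divide_inverse)
  moreover have "(\<lambda>r. - (inverse r ^ 2) * Q r + inverse r * (g r + g (- r))) = prf_du g"
    by (auto simp: prf_du_def avg_def Q_def divide_inverse power2_eq_square algebra_simps)
  ultimately show ?thesis by simp
qed

lemma measurable_prf [measurable]:
  assumes [measurable]: "g \<in> borel_measurable borel"
  shows "prf_v g \<in> borel_measurable borel" "prf_du g \<in> borel_measurable borel"
  unfolding prf_v_def prf_du_def by measurable

lemma Lm_fun_bound:
  assumes "Lm_fun m g"
  obtains \<Lambda> where "0 < \<Lambda>" "(\<integral>\<^sup>+y. ennreal (\<bar>g y\<bar> powr m) \<partial>lborel) \<le> ennreal (\<Lambda> powr m)"
  using assms finite_bound_powr[of "\<integral>\<^sup>+y. ennreal (\<bar>g y\<bar> powr m) \<partial>lborel" m] m0 by (auto simp: Lm_fun_def)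

lemma prf_u_pointwise:
  assumes g: "Lm_fun m g" and \<Lambda>: "0 < \<Lambda>" "(\<integral>\<^sup>+y. ennreal (\<bar>g y\<bar> powr m) \<partial>lborel) \<le> ennreal (\<Lambda> powr m)" and r: "0 < r"
  shows "\<bar>avg g t r\<bar> \<le> 4 * r powr (- 1 / m) * \<Lambda>"
proof -
  have [measurable]: "g \<in> borel_measurable borel" using g by (simp add: Lm_fun_def)
  have "ennreal \<bar>avg g t r\<bar> \<le> slide (\<lambda>y. ennreal \<bar>g y\<bar>) t r * ennreal (1 / r)" by (rule abs_avg_le[OF r])
  also have "\<dots> \<le> ennreal (4 * r powr (1 - 1 / m) * \<Lambda>) * ennreal (1 / r)"
    using \<Lambda> by (intro mult_right_mono slide_bound[OF m _ r]) (auto simp: ennpowr_ennreal)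
  also have "\<dots> = ennreal (4 * r powr (- 1 / m) * \<Lambda>)"
    using r \<Lambda> by (simp add: ennreal_mult[symmetric] powr_diff powr_minus field_simps)
  finally show ?thesis using \<Lambda> by (subst (asm) ennreal_le_iff) auto
qed

lemma prf_u_tendsto:
  assumes g: "Lm_fun m g"
  shows "(avg g t \<longlongrightarrow> 0) at_top"
proof -
  obtain \<Lambda> where \<Lambda>: "0 < \<Lambda>" "(\<integral>\<^sup>+y. ennreal (\<bar>g y\<bar> powr m) \<partial>lborel) \<le> ennreal (\<Lambda> powr m)" by (rule Lm_fun_bound[OF g])
  have "((\<lambda>r. r powr (- 1 / m)) \<longlongrightarrow> 0) at_top"
    using m by (intro tendsto_neg_powr filterlim_ident) auto
  then have "((\<lambda>r. 4 * r powr (- 1 / m) * \<Lambda>) \<longlongrightarrow> 4 * 0 * \<Lambda>) at_top"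
    by (intro tendsto_mult tendsto_const)
  then have lim: "((\<lambda>r. 4 * r powr (- 1 / m) * \<Lambda>) \<longlongrightarrow> 0) at_top" by simp
  show ?thesis
    by (rule Lim_null_comparison[OF _ lim])
      (use eventually_gt_at_top[of 0] in \<open>eventually_elim, use prf_u_pointwise[OF g \<Lambda>] in auto\<close>)
qed

text \<open>\<open>r\<close> times the radial derivative is \<open>g r + g (- r)\<close> minus
  \<open>avg g 0 r\<close>, and the average is a Hardy operator. This quantitative direction is the
  one that gives continuity in time.\<close>

lemma prf_norm:
  "\<exists>C>0. \<forall>g \<Lambda>. Lm_fun m g \<longrightarrow> 0 < \<Lambda> \<longrightarrow> (\<integral>\<^sup>+y. ennreal (\<bar>g y\<bar> powr m) \<partial>lborel) \<le> ennreal (\<Lambda> powr m) \<longrightarrow>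
    rad_Lm m (prf_du g) + rad_Lm m (prf_v g) \<le> ennreal ((C * \<Lambda>) powr m) \<and>
    Lm_norm m (avg g 0) (prf_v g) \<le> ennreal (C * \<Lambda>)"
proof -
  \<comment> \<open>The integral of \<open>x powr (- 1 / m)\<close> over \<open>(0, 1)\<close>,
    finite because \<open>m > 1\<close>.\<close>
  define K where "K = m / (m - 1)"
  have K: "0 < K" using m by (simp add: K_def)
  \<comment> \<open>The bracket is the bound of \<open>prf_du\<close> through \<open>G + Hd\<close>,
    with norms at most \<open>2 * \<Lambda>\<close> and \<open>2 * (K * (2 * \<Lambda>))\<close>;
    the last summand is the share of \<open>prf_v\<close>. The power of \<Lambda> is factored
    out.\<close>
  define c where "c = 2 powr m * (2 powr m + (2 * (K * 2)) powr m) + 2 powr m"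
  define C where "C = c powr (1 / m)"
  have c: "0 < c" unfolding c_def by (intro add_nonneg_pos mult_nonneg_nonneg) auto
  have C: "0 < C" "C powr m = c" using c m by (auto simp: C_def powr_powr)
  show ?thesis
  proof (intro exI[of _ C] conjI C(1) allI impI)
    fix g \<Lambda> assume g: "Lm_fun m g" and \<Lambda>: "0 < \<Lambda>" and g\<Lambda>: "(\<integral>\<^sup>+y. ennreal (\<bar>g y\<bar> powr m) \<partial>lborel) \<le> ennreal (\<Lambda> powr m)"
    have [measurable]: "g \<in> borel_measurable borel" using g by (simp add: Lm_fun_def)
    define G where "G = (\<lambda>r. ennreal \<bar>g r\<bar> + ennreal \<bar>g (- r)\<bar>)"
    have [measurable]: "G \<in> borel_measurable borel" unfolding G_def by measurable
    have GI: "(\<integral>\<^sup>+r\<in>{0<..}. ennpowr (G r) m \<partial>lborel) \<le> ennreal ((2 * \<Lambda>) powr m)"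
    proof -
      have "(\<integral>\<^sup>+r\<in>{0<..}. ennpowr (G r) m \<partial>lborel) \<le> (\<integral>\<^sup>+r. ennreal (2 powr m) * (ennreal (\<bar>g r\<bar> powr m) * indicator {0<..} r + ennreal (\<bar>g (- r)\<bar> powr m) * indicator {..<0} (- r)) \<partial>lborel)"
      proof (intro nn_integral_mono)
        fix r
        have "ennpowr (G r) m \<le> ennreal (2 powr m) * (ennreal (\<bar>g r\<bar> powr m) + ennreal (\<bar>g (- r)\<bar> powr m))"
          unfolding G_def using ennpowr_add_le[of m "ennreal \<bar>g r\<bar>" "ennreal \<bar>g (- r)\<bar>"] m by (simp add: ennpowr_ennreal)
        then show "ennpowr (G r) m * indicator {0<..} r \<le> ennreal (2 powr m) * (ennreal (\<bar>g r\<bar> powr m) * indicator {0<..} r + ennreal (\<bar>g (- r)\<bar> powr m) * indicator {..<0} (- r))"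
          by (auto simp: indicator_def)
      qed
      also have "\<dots> = ennreal (2 powr m) * ((\<integral>\<^sup>+r\<in>{0<..}. ennreal (\<bar>g r\<bar> powr m) \<partial>lborel) + (\<integral>\<^sup>+r. ennreal (\<bar>g (- r)\<bar> powr m) * indicator {..<0} (- r) \<partial>lborel))"
        by (subst nn_integral_cmult) (auto simp: nn_integral_add)
      also have "(\<integral>\<^sup>+r. ennreal (\<bar>g (- r)\<bar> powr m) * indicator {..<0} (- r) \<partial>lborel) = (\<integral>\<^sup>+r\<in>{..<0}. ennreal (\<bar>g r\<bar> powr m) \<partial>lborel)"
        by (subst (2) nn_integral_real_affine[where c = "-1" and t = 0]) auto
      also have "(\<integral>\<^sup>+r\<in>{0<..}. ennreal (\<bar>g r\<bar> powr m) \<partial>lborel) + (\<integral>\<^sup>+r\<in>{..<0}. ennreal (\<bar>g r\<bar> powr m) \<partial>lborel)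
        = (\<integral>\<^sup>+r. ennreal (\<bar>g r\<bar> powr m) * indicator {0<..} r + ennreal (\<bar>g r\<bar> powr m) * indicator {..<0} r \<partial>lborel)"
        by (intro nn_integral_add[symmetric]) measurable
      also have "\<dots> \<le> (\<integral>\<^sup>+r. ennreal (\<bar>g r\<bar> powr m) \<partial>lborel)"
        by (intro nn_integral_mono) (auto simp: indicator_def)
      finally have "(\<integral>\<^sup>+r\<in>{0<..}. ennpowr (G r) m \<partial>lborel) \<le> ennreal (2 powr m) * (\<integral>\<^sup>+r. ennreal (\<bar>g r\<bar> powr m) \<partial>lborel)"
        by (simp add: mult_left_mono)
      also have "\<dots> \<le> ennreal (2 powr m) * ennreal (\<Lambda> powr m)" by (intro mult_left_mono g\<Lambda>) auto
      finally show ?thesis using \<Lambda> by (simp add: powr_mult ennreal_mult)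
    qed
    define Hd where "Hd = (\<lambda>r. \<integral>\<^sup>+x\<in>{0<..}. ennreal (indicator {..<1} x) * G (x * r) \<partial>lborel)"
    have [measurable]: "Hd \<in> borel_measurable borel" unfolding Hd_def by measurable
    have HdI: "(\<integral>\<^sup>+r\<in>{0<..}. ennpowr (Hd r) m \<partial>lborel) \<le> ennreal ((2 * (K * (2 * \<Lambda>))) powr m)"
      unfolding Hd_def
    proof (rule hardy_dilation[OF m])
      have "(\<integral>\<^sup>+x\<in>{0<..}. ennreal (indicator {..<1} x * x powr (- 1 / m)) \<partial>lborel) \<le> (\<integral>\<^sup>+x\<in>{0<..1}. ennreal (x powr (- 1 / m)) \<partial>lborel)"
        by (intro nn_integral_mono) (auto simp: indicator_def)
      also have "\<dots> = ennreal K"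
        using m nn_integral_powr_from_0[of "- 1 / m" 1] by (simp add: K_def field_simps)
      finally show "(\<integral>\<^sup>+x\<in>{0<..}. ennreal (indicator {..<1} x * x powr (- 1 / m)) \<partial>lborel) \<le> ennreal K" .
    qed (use K \<Lambda> GI in auto)
    \<comment> \<open>Rescaling takes the window \<open>[- r, r]\<close> to \<open>[- 1, 1]\<close>,
      which is then folded onto \<open>(0, 1)\<close> off a null set.\<close>
    have avg_Hd: "ennreal \<bar>avg g 0 r\<bar> \<le> Hd r" if r: "0 < r" for r
    proof -
      have "ennreal \<bar>avg g 0 r\<bar> \<le> slide (\<lambda>y. ennreal \<bar>g y\<bar>) 0 r * ennreal (1 / r)" by (rule abs_avg_le[OF r])
      also have "slide (\<lambda>y. ennreal \<bar>g y\<bar>) 0 r = ennreal r * (\<integral>\<^sup>+x. ennreal \<bar>g (r * x)\<bar> * indicator {- r..r} (r * x) \<partial>lborel)"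
        unfolding slide_def using nn_integral_real_affine[of "\<lambda>y. ennreal \<bar>g y\<bar> * indicator {- r..r} y" r 0] r by simp
      also have "(\<integral>\<^sup>+x. ennreal \<bar>g (r * x)\<bar> * indicator {- r..r} (r * x) \<partial>lborel)
        = (\<integral>\<^sup>+x. ennreal \<bar>g (r * x)\<bar> * indicator {0<..<1} x + ennreal \<bar>g (r * x)\<bar> * indicator {0<..<1} (- x) \<partial>lborel)"
      proof (rule nn_integral_cong_AE)
        have i: "r * x \<in> {- r..r} \<longleftrightarrow> x \<in> {-1..1}" for x
          using r mult_le_cancel_left_pos[OF r, of x 1] mult_le_cancel_left_pos[OF r, of "-1" x] by auto
        show "AE x in lborel. ennreal \<bar>g (r * x)\<bar> * indicator {- r..r} (r * x)
          = ennreal \<bar>g (r * x)\<bar> * indicator {0<..<1} x + ennreal \<bar>g (r * x)\<bar> * indicator {0<..<1} (- x)"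
          using AE_lborel_singleton[of 0] AE_lborel_singleton[of 1] AE_lborel_singleton[of "-1"]
        proof eventually_elim
          case (elim x)
          then show ?case using i[of x] by (auto simp: indicator_def)
        qed
      qed
      also have "\<dots> = (\<integral>\<^sup>+x. ennreal \<bar>g (r * x)\<bar> * indicator {0<..<1} x \<partial>lborel) + (\<integral>\<^sup>+x. ennreal \<bar>g (r * x)\<bar> * indicator {0<..<1} (- x) \<partial>lborel)"
        by (intro nn_integral_add) measurable
      also have "(\<integral>\<^sup>+x. ennreal \<bar>g (r * x)\<bar> * indicator {0<..<1} (- x) \<partial>lborel) = (\<integral>\<^sup>+x. ennreal \<bar>g (- (r * x))\<bar> * indicator {0<..<1} x \<partial>lborel)"
        by (subst nn_integral_real_affine[where c = "-1" and t = 0]) auto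
      also have "(\<integral>\<^sup>+x. ennreal \<bar>g (r * x)\<bar> * indicator {0<..<1} x \<partial>lborel) + (\<integral>\<^sup>+x. ennreal \<bar>g (- (r * x))\<bar> * indicator {0<..<1} x \<partial>lborel)
        = (\<integral>\<^sup>+x. ennreal \<bar>g (r * x)\<bar> * indicator {0<..<1} x + ennreal \<bar>g (- (r * x))\<bar> * indicator {0<..<1} x \<partial>lborel)"
        by (intro nn_integral_add[symmetric]) measurable
      also have "\<dots> = Hd r"
        unfolding Hd_def G_def by (intro nn_integral_cong) (auto simp: indicator_def mult.commute)
      finally have "ennreal \<bar>avg g 0 r\<bar> \<le> ennreal r * Hd r * ennreal (1 / r)" .
      also have "\<dots> = ennreal (r * (1 / r)) * Hd r"
        using r by (subst ennreal_mult) (auto simp: mult_ac)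
      finally show ?thesis using r by simp
    qed
    have v: "rad_Lm m (prf_v g) \<le> ennreal ((2 * \<Lambda>) powr m)"
      unfolding rad_Lm_def
    proof (rule order_trans[OF nn_integral_mono GI])
      fix r :: real
      have "ennreal (\<bar>r * prf_v g r\<bar> powr m) \<le> ennpowr (G r) m" if "0 < r"
      proof -
        have "ennreal \<bar>r * prf_v g r\<bar> \<le> G r"
          using that by (simp add: prf_v_def G_def ennreal_plus[symmetric] ennreal_leI del: ennreal_plus)
        from ennpowr_mono[OF this, of m] show ?thesis using m by (simp add: ennpowr_ennreal)
      qed
      then show "ennreal (\<bar>r * prf_v g r\<bar> powr m) * indicator {0<..} r \<le> ennpowr (G r) m * indicator {0<..} r"
        by (auto simp: indicator_def)
    qed
    have du: "rad_Lm m (prf_du g) \<le> ennreal (2 powr m) * (ennreal ((2 * \<Lambda>) powr m) + ennreal ((2 * (K * (2 * \<Lambda>))) powr m))"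
    proof -
      have "rad_Lm m (prf_du g) \<le> (\<integral>\<^sup>+r. ennreal (2 powr m) * (ennpowr (G r) m * indicator {0<..} r + ennpowr (Hd r) m * indicator {0<..} r) \<partial>lborel)"
        unfolding rad_Lm_def
      proof (intro nn_integral_mono)
        fix r :: real
        have "ennreal (\<bar>r * prf_du g r\<bar> powr m) \<le> ennreal (2 powr m) * (ennpowr (G r) m + ennpowr (Hd r) m)" if r: "0 < r"
        proof -
          have "r * prf_du g r = (g r + g (- r)) - avg g 0 r"
            using r by (simp add: prf_du_def field_simps)
          then have "\<bar>r * prf_du g r\<bar> \<le> \<bar>g r\<bar> + \<bar>g (- r)\<bar> + \<bar>avg g 0 r\<bar>" by linarith
          then have "ennreal \<bar>r * prf_du g r\<bar> \<le> G r + ennreal \<bar>avg g 0 r\<bar>"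
            by (simp add: G_def ennreal_plus[symmetric] ennreal_leI del: ennreal_plus)
          also have "\<dots> \<le> G r + Hd r" by (intro add_left_mono avg_Hd r)
          finally have "ennpowr (ennreal \<bar>r * prf_du g r\<bar>) m \<le> ennpowr (G r + Hd r) m" using m by (intro ennpowr_mono) auto
          also have "\<dots> \<le> ennreal (2 powr m) * (ennpowr (G r) m + ennpowr (Hd r) m)" using m by (intro ennpowr_add_le) auto
          finally show ?thesis by (simp add: ennpowr_ennreal)
        qed
        then show "ennreal (\<bar>r * prf_du g r\<bar> powr m) * indicator {0<..} r \<le> ennreal (2 powr m) * (ennpowr (G r) m * indicator {0<..} r + ennpowr (Hd r) m * indicator {0<..} r)"
          by (auto simp: indicator_def)
      qed
      also have "\<dots> = ennreal (2 powr m) * ((\<integral>\<^sup>+r\<in>{0<..}. ennpowr (G r) m \<partial>lborel) + (\<integral>\<^sup>+r\<in>{0<..}. ennpowr (Hd r) m \<partial>lborel))"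
        by (simp add: nn_integral_cmult nn_integral_add)
      also have "\<dots> \<le> ennreal (2 powr m) * (ennreal ((2 * \<Lambda>) powr m) + ennreal ((2 * (K * (2 * \<Lambda>))) powr m))"
        by (intro mult_left_mono add_mono GI HdI) auto
      finally show ?thesis .
    qed
    have "rad_Lm m (prf_du g) + rad_Lm m (prf_v g) \<le> ennreal (2 powr m) * (ennreal ((2 * \<Lambda>) powr m) + ennreal ((2 * (K * (2 * \<Lambda>))) powr m)) + ennreal ((2 * \<Lambda>) powr m)"
      by (intro add_mono du v)
    also have "\<dots> = ennreal (2 powr m * ((2 * \<Lambda>) powr m + (2 * (K * (2 * \<Lambda>))) powr m) + (2 * \<Lambda>) powr m)"
      by (simp add: ennreal_mult')
    also have "2 powr m * ((2 * \<Lambda>) powr m + (2 * (K * (2 * \<Lambda>))) powr m) + (2 * \<Lambda>) powr m = (C * \<Lambda>) powr m"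
    proof -
      have "(4::real) powr m = 2 powr m * 2 powr m" using powr_mult[of 2 2 m] by simp
      then show ?thesis unfolding powr_mult C(2) by (simp add: c_def powr_mult algebra_simps)
    qed
    finally show b: "rad_Lm m (prf_du g) + rad_Lm m (prf_v g) \<le> ennreal ((C * \<Lambda>) powr m)" .
    have "Lm_norm m (avg g 0) (prf_v g) = ennpowr (rad_Lm m (prf_du g) + rad_Lm m (prf_v g)) (1 / m)"
      by (intro Lm_norm_eq prf_u_deriv g) auto
    also have "\<dots> \<le> ennpowr (ennreal ((C * \<Lambda>) powr m)) (1 / m)"
      using m by (intro ennpowr_mono b) auto
    also have "\<dots> = ennreal (C * \<Lambda>)" using C \<Lambda> m by (simp add: ennpowr_ennreal powr_powr)
    finally show "Lm_norm m (avg g 0) (prf_v g) \<le> ennreal (C * \<Lambda>)" .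
  qed
qed

end

section \<open>Density of the test functions\<close>

text \<open>The case \<open>p = 1\<close> is the standard function that is flat at 0. The polynomial
  factor in \<open>1 / x\<close> makes the family closed under differentiation.\<close>

definition flat :: "real poly \<Rightarrow> real \<Rightarrow> real" where
  "flat p x = (if 0 < x then poly p (1 / x) * exp (- (1 / x)) else 0)"

lemma poly_times_exp_tendsto_0:
  fixes p :: "real poly"
  shows "((\<lambda>y. poly p y * exp (- y)) \<longlongrightarrow> 0) at_top"
proof -
  \<comment> \<open>The additional power of \<open>y\<close> makes the induction over the
    coefficients work: splitting off one coefficient multiplies the rest by
    \<open>y\<close>.\<close>
  have "((\<lambda>y. y ^ k * poly p y * exp (- y)) \<longlongrightarrow> 0) at_top" for k
  proof (induction p arbitrary: k)
    case (pCons a p)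
    have "((\<lambda>y. a * (y ^ k / exp y) + y ^ Suc k * poly p y * exp (- y)) \<longlongrightarrow> a * 0 + 0) at_top"
      by (intro tendsto_intros tendsto_power_div_exp_0 pCons.IH)
    then show ?case by (simp add: exp_minus field_simps)
  qed simp
  from this[of 0] show ?thesis by simp
qed

text \<open>By the chain rule the new polynomial in \<open>1 / x\<close> is the square of the
  variable times \<open>p - pderiv p\<close>. At 0 the difference quotient tends to 0, as the
  exponential beats every polynomial.\<close>

lemma flat_deriv: "(flat p has_real_derivative flat ([:0, 0, 1:] * (p - pderiv p)) x) (at x)"
proof -
  consider "x < 0" | "x = 0" | "0 < x" by linarith
  then show ?thesis
  proof cases
    case 1
    have "eventually (\<lambda>y. y \<in> {..<0}) (nhds x)" using 1 by (intro eventually_nhds_in_open) auto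
    then have "eventually (\<lambda>y. flat p y = 0) (nhds x)" by eventually_elim (simp add: flat_def)
    then show ?thesis using 1 by (subst DERIV_cong_ev[OF refl _ refl]) (auto simp: flat_def)
  next
    case 3
    have "eventually (\<lambda>y. y \<in> {0<..}) (nhds x)" using 3 by (intro eventually_nhds_in_open) auto
    then have ev: "eventually (\<lambda>y. flat p y = poly p (1 / y) * exp (- (1 / y))) (nhds x)" by eventually_elim (simp add: flat_def)
    have "((\<lambda>y. poly p (1 / y) * exp (- (1 / y))) has_real_derivative flat ([:0, 0, 1:] * (p - pderiv p)) x) (at x)"
      using 3 by (auto intro!: derivative_eq_intros DERIV_chain'[OF _ poly_DERIV] simp: flat_def power2_eq_square field_simps)
    then show ?thesis by (subst DERIV_cong_ev[OF refl ev refl])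
  next
    case 2
    have "((\<lambda>h. flat p h / h) \<longlongrightarrow> 0) (at 0)"
    proof (rule filterlim_split_at)
      have "((\<lambda>y. poly ([:0, 1:] * p) y * exp (- y)) \<longlongrightarrow> 0) at_top" by (rule poly_times_exp_tendsto_0)
      then have "((\<lambda>h. poly ([:0, 1:] * p) (inverse h) * exp (- inverse h)) \<longlongrightarrow> 0) (at_right 0)"
        by (rule filterlim_compose[OF _ filterlim_inverse_at_top_right])
      moreover have "eventually (\<lambda>h. poly ([:0, 1:] * p) (inverse h) * exp (- inverse h) = flat p h / h) (at_right 0)"
        using eventually_at_right_less[of "0::real"] by eventually_elim (simp add: flat_def field_simps)
      ultimately show "((\<lambda>h. flat p h / h) \<longlongrightarrow> 0) (at_right 0)" by (rule Lim_transform_eventually)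
      have "eventually (\<lambda>h. 0 = flat p h / h) (at_left 0)"
        by (rule eventually_at_leftI[of "-1"]) (auto simp: flat_def)
      then show "((\<lambda>h. flat p h / h) \<longlongrightarrow> 0) (at_left 0)" by (rule Lim_transform_eventually[OF tendsto_const])
    qed
    then show ?thesis using 2 by (simp add: DERIV_def flat_def)
  qed
qed

text \<open>Closed under differentiation, hence a class of smooth functions.\<close>

inductive elem :: "(real \<Rightarrow> real) \<Rightarrow> bool" where
  elem_const: "elem (\<lambda>x. c)"
| elem_id: "elem (\<lambda>x. x)"
| elem_add: "elem f \<Longrightarrow> elem g \<Longrightarrow> elem (\<lambda>x. f x + g x)"
| elem_mult: "elem f \<Longrightarrow> elem g \<Longrightarrow> elem (\<lambda>x. f x * g x)"
| elem_flat: "elem f \<Longrightarrow> elem (\<lambda>x. flat p (f x))"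

lemma elem_deriv: "elem f \<Longrightarrow> \<exists>f'. elem f' \<and> (\<forall>x. (f has_real_derivative f' x) (at x))"
proof (induction rule: elem.induct)
  case (elem_const c)
  show ?case by (intro exI[of _ "\<lambda>x. 0"] conjI elem.elem_const) auto
next
  case elem_id
  show ?case by (intro exI[of _ "\<lambda>x. 1"] conjI elem.elem_const) auto
next
  case (elem_add f g)
  then obtain f' g' where "elem f'" "elem g'" "\<And>x. (f has_real_derivative f' x) (at x)" "\<And>x. (g has_real_derivative g' x) (at x)" by blast
  then show ?case by (intro exI[of _ "\<lambda>x. f' x + g' x"] conjI elem.elem_add allI DERIV_add)
next
  case (elem_mult f g)
  then obtain f' g' where "elem f'" "elem g'" "\<And>x. (f has_real_derivative f' x) (at x)" "\<And>x. (g has_real_derivative g' x) (at x)" by blast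
  then show ?case using elem_mult by (intro exI[of _ "\<lambda>x. f' x * g x + g' x * f x"] conjI elem.elem_add elem.elem_mult allI DERIV_mult)
next
  case (elem_flat f p)
  then obtain f' where "elem f'" "\<And>x. (f has_real_derivative f' x) (at x)" by blast
  then show ?case using elem_flat
    by (intro exI[of _ "\<lambda>x. flat ([:0, 0, 1:] * (p - pderiv p)) (f x) * f' x"] conjI elem.elem_mult elem.elem_flat allI DERIV_chain2[OF flat_deriv])
qed

lemma elem_polynomial: "real_polynomial_function f \<Longrightarrow> elem f" for f :: "real \<Rightarrow> real"
proof (induction rule: real_polynomial_function.induct)
  case (linear f)
  then have "f = (\<lambda>x. f 1 * x)"
    by (metis linear_simps(5) mult.commute mult.right_neutral real_scaleR_def)
  then show ?case by (metis elem_mult[OF elem_const elem_id])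
qed (auto intro: elem.intros)

text \<open>A coinductive reading of smoothness: some set contains \<open>h\<close> and is closed
  under differentiation. Adding one function to such a set shows at once that antiderivatives are
  smooth too.\<close>

definition smooth1 :: "(real \<Rightarrow> real) \<Rightarrow> bool" where
  "smooth1 h \<longleftrightarrow> (\<exists>S. h \<in> S \<and> (\<forall>f\<in>S. \<exists>f'\<in>S. \<forall>x. (f has_real_derivative f' x) (at x)))"

lemma smooth1_deriv: "smooth1 h \<Longrightarrow> \<exists>h'. smooth1 h' \<and> (\<forall>x. (h has_real_derivative h' x) (at x))"
  unfolding smooth1_def by metis

lemma elem_smooth1: "elem h \<Longrightarrow> smooth1 h"
  unfolding smooth1_def using elem_deriv by (intro exI[of _ "Collect elem"]) auto

lemma smooth1_continuous: "smooth1 h \<Longrightarrow> continuous_on UNIV h"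
  using smooth1_deriv[of h] DERIV_continuous_on has_field_derivative_at_within by blast

lemma smooth1_antideriv: "smooth1 h \<Longrightarrow> (\<And>x. (H has_real_derivative h x) (at x)) \<Longrightarrow> smooth1 H"
  unfolding smooth1_def by (elim exE conjE, rule_tac x = "insert H S" in exI) auto

text \<open>Partial derivatives of \<open>h (x \<bullet> x)\<close> are no longer radial. With the
  factors \<open>x \<bullet> b\<close> the class is closed under differentiation, and
  \<open>Ck\<close> of every order follows by induction.\<close>

inductive radial_class :: "('a::euclidean_space \<Rightarrow> real) \<Rightarrow> bool" where
  rc_base: "smooth1 h \<Longrightarrow> radial_class (\<lambda>x. h (x \<bullet> x))"
| rc_coord: "radial_class f \<Longrightarrow> radial_class (\<lambda>x. (x \<bullet> b) * f x)"
| rc_scale: "radial_class f \<Longrightarrow> radial_class (\<lambda>x. c * f x)"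
| rc_add: "radial_class f \<Longrightarrow> radial_class g \<Longrightarrow> radial_class (\<lambda>x. f x + g x)"

lemma radial_class_deriv:
  fixes f :: "'a::euclidean_space \<Rightarrow> real"
  assumes "radial_class f"
  shows "\<exists>f'. (\<forall>x. (f has_derivative f' x) (at x)) \<and> (\<forall>b. radial_class (\<lambda>x. f' x b))"
  using assms
proof induction
  case (rc_base h)
  obtain h' where h': "smooth1 h'" "\<And>x. (h has_real_derivative h' x) (at x)" using smooth1_deriv[OF rc_base] by blast
  have "((\<lambda>x. h (x \<bullet> x)) has_derivative (\<lambda>b. h' (x \<bullet> x) * (x \<bullet> b + b \<bullet> x))) (at x)" for x :: 'a
    by (rule has_derivative_compose[OF _ h'(2)[unfolded has_field_derivative_def], of "\<lambda>x. x \<bullet> x"])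
      (auto intro!: derivative_eq_intros)
  moreover have "radial_class (\<lambda>x::'a. h' (x \<bullet> x) * (x \<bullet> b + b \<bullet> x))" for b
  proof -
    have "radial_class (\<lambda>x::'a. 2 * ((x \<bullet> b) * h' (x \<bullet> x)))" by (intro radial_class.intros h')
    then show ?thesis by (simp add: inner_commute[of b] mult_ac)
  qed
  ultimately show ?case by (intro exI[of _ "\<lambda>x b. h' (x \<bullet> x) * (x \<bullet> b + b \<bullet> x)"]) auto
next
  case (rc_coord f c)
  then obtain f' where f': "\<And>x. (f has_derivative f' x) (at x)" "\<And>b. radial_class (\<lambda>x. f' x b)" by blast
  have "((\<lambda>x. (x \<bullet> c) * f x) has_derivative (\<lambda>b. (x \<bullet> c) * f' x b + (b \<bullet> c) * f x)) (at x)" for x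
    by (auto intro!: derivative_eq_intros f')
  moreover have "radial_class (\<lambda>x. (x \<bullet> c) * f' x b + (b \<bullet> c) * f x)" for b
    by (intro radial_class.intros f' rc_coord)
  ultimately show ?case by (intro exI[of _ "\<lambda>x b. (x \<bullet> c) * f' x b + (b \<bullet> c) * f x"]) auto
next
  case (rc_scale f c)
  then obtain f' where f': "\<And>x. (f has_derivative f' x) (at x)" "\<And>b. radial_class (\<lambda>x. f' x b)" by blast
  then show ?case by (intro exI[of _ "\<lambda>x b. c * f' x b"]) (auto intro!: derivative_eq_intros radial_class.intros)
next
  case (rc_add f g)
  then obtain f' g' where "\<And>x. (f has_derivative f' x) (at x)" "\<And>b. radial_class (\<lambda>x. f' x b)"
    "\<And>x. (g has_derivative g' x) (at x)" "\<And>b. radial_class (\<lambda>x. g' x b)" by blast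
  then show ?case by (intro exI[of _ "\<lambda>x b. f' x b + g' x b"]) (auto intro!: derivative_eq_intros radial_class.intros)
qed

lemma radial_class_Ck: "radial_class f \<Longrightarrow> Ck k f"
proof (induction k arbitrary: f)
  case 0
  then show ?case using radial_class_deriv[of f] has_derivative_continuous_on has_derivative_at_withinI by (metis Ck.simps(1))
next
  case (Suc k)
  obtain f' where f': "\<And>x. (f has_derivative f' x) (at x)" "\<And>b. radial_class (\<lambda>x. f' x b)"
    using radial_class_deriv[OF Suc.prems] by blast
  have "frechet_derivative f (at x) = f' x" for x using frechet_derivative_at[OF f'(1)] by simp
  then show ?case using f' Suc.IH by (auto simp: differentiable_def)
qed

text \<open>Written in \<open>r ^ 2\<close> because the square of the norm is smooth at the origin,
  whereas the norm is not.\<close>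

lemma radial_test_smooth1:
  assumes h: "smooth1 h" and b: "\<And>x. b < x \<Longrightarrow> h x = 0"
  shows "radial_test (\<lambda>r. h (r ^ 2))"
  unfolding radial_test_def smooth_def
proof (intro conjI allI)
  have e: "h ((norm x) ^ 2) = h (x \<bullet> x)" for x :: "real^3" by (simp add: power2_norm_eq_inner)
  show "Ck k (\<lambda>x::real^3. h ((norm x) ^ 2))" for k
    unfolding e by (intro radial_class_Ck rc_base h)
  have "{x::real^3. h ((norm x) ^ 2) \<noteq> 0} \<subseteq> cball 0 (sqrt \<bar>b\<bar>)"
  proof
    fix x :: "real^3" assume "x \<in> {x. h ((norm x) ^ 2) \<noteq> 0}"
    then have "(norm x) ^ 2 \<le> \<bar>b\<bar>" using b[of "(norm x) ^ 2"] by (cases "b < (norm x) ^ 2") auto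
    then show "x \<in> cball 0 (sqrt \<bar>b\<bar>)" by (simp add: real_le_rsqrt)
  qed
  then have "bounded {x::real^3. h ((norm x) ^ 2) \<noteq> 0}" using bounded_cball bounded_subset by blast
  then show "compact (closure {x::real^3. h ((norm x) ^ 2) \<noteq> 0})" by simp
qed

section \<open>Approximation in the Lebesgue space of profiles\<close>

context wave
begin

text \<open>Truncating values and support leaves a bounded function, which is an almost everywhere
  limit of continuous ones. Clamping these and cutting them off provides the majorant for dominated
  convergence.\<close>

lemma Lm_fun_dense:
  assumes f: "Lm_fun m f" and e: "0 < e"
  shows "\<exists>g R. continuous_on UNIV g \<and> (\<forall>y. R < \<bar>y\<bar> \<longrightarrow> g y = 0) \<and> (\<integral>\<^sup>+y. ennreal (\<bar>f y - g y\<bar> powr m) \<partial>lborel) < e"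
proof -
  have [measurable]: "f \<in> borel_measurable borel" and fin: "(\<integral>\<^sup>+y. ennreal (\<bar>f y\<bar> powr m) \<partial>lborel) < top"
    using f by (auto simp: Lm_fun_def)
  obtain \<epsilon> where \<epsilon>: "0 < \<epsilon>" "ennreal (2 powr m) * (ennreal \<epsilon> + ennreal \<epsilon>) < e"
  proof -
    obtain e' where e': "0 < e'" "ennreal e' < e" using e by (metis dense ennreal_less_zero_iff ennreal_cases less_ennreal.rep_eq ennreal_0 not_less_zero top.not_eq_extremum ennreal_less_iff less_le zero_le)
    have "ennreal (2 powr m) * (ennreal (e' / (2 * 2 powr m)) + ennreal (e' / (2 * 2 powr m))) = ennreal e'"
      using e'(1) by (simp add: ennreal_plus[symmetric] ennreal_mult[symmetric] del: ennreal_plus)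
    then show thesis using that[of "e' / (2 * 2 powr m)"] e' by simp
  qed
  define T where "T = (\<lambda>n y. if \<bar>y\<bar> \<le> real n \<and> \<bar>f y\<bar> \<le> real n then f y else 0)"
  have [measurable]: "T n \<in> borel_measurable borel" for n unfolding T_def by measurable
  have "(\<lambda>n. \<integral>\<^sup>+y. ennreal (\<bar>f y - T n y\<bar> powr m) \<partial>lborel) \<longlonglongrightarrow> (\<integral>\<^sup>+y. 0 \<partial>(lborel :: real measure))"
  proof (rule nn_integral_dominated_convergence[where w = "\<lambda>y. ennreal (\<bar>f y\<bar> powr m)"])
    show "AE y in lborel. ennreal (\<bar>f y - T n y\<bar> powr m) \<le> ennreal (\<bar>f y\<bar> powr m)" for n
      by (intro AE_I2) (auto simp: T_def)
    show "AE y in lborel. (\<lambda>n. ennreal (\<bar>f y - T n y\<bar> powr m)) \<longlonglongrightarrow> 0"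
    proof (intro AE_I2 tendsto_eventually)
      fix y
      obtain N :: nat where N: "max \<bar>y\<bar> \<bar>f y\<bar> \<le> real N" using real_arch_simple by blast
      show "eventually (\<lambda>n. ennreal (\<bar>f y - T n y\<bar> powr m) = 0) sequentially"
        unfolding eventually_sequentially by (rule exI[of _ N]) (use N in \<open>auto simp: T_def\<close>)
    qed
  qed (use fin in auto)
  then have "eventually (\<lambda>n. (\<integral>\<^sup>+y. ennreal (\<bar>f y - T n y\<bar> powr m) \<partial>lborel) < ennreal \<epsilon>) sequentially"
    using \<epsilon> by (intro order_tendstoD) auto
  then obtain n where n: "(\<integral>\<^sup>+y. ennreal (\<bar>f y - T n y\<bar> powr m) \<partial>lborel) < ennreal \<epsilon>" by (auto simp: eventually_sequentially)
  have "T n \<in> borel_measurable lebesgue" by (simp add: measurable_completion)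
  then have "T n measurable_on UNIV" by (intro lebesgue_measurable_imp_measurable_on) auto
  then obtain N G where N: "negligible N" and G: "\<And>j. continuous_on UNIV (G j)" "\<And>x. x \<notin> N \<Longrightarrow> (\<lambda>j. G j x) \<longlonglongrightarrow> T n x"
    unfolding measurable_on_def by auto
  \<comment> \<open>A continuous cut-off that equals 1 wherever \<open>T n\<close> may be nonzero,
    so cutting off and clamping leave the limit \<open>T n\<close> unchanged.\<close>
  define co where "co = (\<lambda>y. max 0 (min 1 (real n + 1 - \<bar>y\<bar>)))"
  define g where "g = (\<lambda>j y. co y * max (- real n) (min (real n) (G j y)))"
  have gc: "continuous_on UNIV (g j)" for j
    unfolding g_def co_def by (intro continuous_intros G)
  have [measurable]: "g j \<in> borel_measurable borel" for j using gc by (rule borel_measurable_continuous_onI)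
  have gz: "g j y = 0" if "real n + 1 < \<bar>y\<bar>" for j y using that by (simp add: g_def co_def)
  have gb: "\<bar>g j y\<bar> \<le> real n" for j y
  proof -
    have "\<bar>g j y\<bar> = co y * \<bar>max (- real n) (min (real n) (G j y))\<bar>" by (simp add: g_def co_def abs_mult)
    also have "\<dots> \<le> 1 * real n" by (intro mult_mono) (auto simp: co_def)
    finally show ?thesis by simp
  qed
  have "(\<lambda>j. \<integral>\<^sup>+y. ennreal (\<bar>T n y - g j y\<bar> powr m) \<partial>lborel) \<longlonglongrightarrow> (\<integral>\<^sup>+y. 0 \<partial>(lborel :: real measure))"
  proof (rule nn_integral_dominated_convergence[where w = "\<lambda>y. ennreal ((2 * real n) powr m) * indicator {- real n - 1..real n + 1} y"])
    show "AE y in lborel. ennreal (\<bar>T n y - g j y\<bar> powr m) \<le> ennreal ((2 * real n) powr m) * indicator {- real n - 1..real n + 1} y" for j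
    proof (intro AE_I2)
      fix y
      have "\<bar>T n y - g j y\<bar> \<le> 2 * real n" using gb[of j y] abs_triangle_ineq4[of "T n y" "g j y"] by (auto simp: T_def)
      then have "\<bar>T n y - g j y\<bar> powr m \<le> (2 * real n) powr m" using m by (intro powr_mono2) auto
      moreover have "T n y - g j y = 0" if "y \<notin> {- real n - 1..real n + 1}" using that gz[of y j] by (auto simp: T_def)
      ultimately show "ennreal (\<bar>T n y - g j y\<bar> powr m) \<le> ennreal ((2 * real n) powr m) * indicator {- real n - 1..real n + 1} y"
        by (auto simp: indicator_def ennreal_leI)
    qed
    show "(\<integral>\<^sup>+y. ennreal ((2 * real n) powr m) * indicator {- real n - 1..real n + 1} y \<partial>lborel) < \<infinity>"
      by (subst nn_integral_cmult) (auto simp: ennreal_mult_less_top)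
    have "AE y in lebesgue. y \<notin> N" using N by (simp add: negligible_iff_null_sets AE_not_in)
    then have "AE y in lborel. y \<notin> N" by (simp add: AE_completion_iff)
    then show "AE y in lborel. (\<lambda>j. ennreal (\<bar>T n y - g j y\<bar> powr m)) \<longlonglongrightarrow> 0"
    proof eventually_elim
      case (elim y)
      have "(\<lambda>j. g j y) \<longlonglongrightarrow> co y * max (- real n) (min (real n) (T n y))"
        unfolding g_def using G(2)[OF elim] by (intro tendsto_intros)
      also have "co y * max (- real n) (min (real n) (T n y)) = T n y"
        by (auto simp: T_def co_def)
      finally have "(\<lambda>j. \<bar>T n y - g j y\<bar>) \<longlonglongrightarrow> \<bar>T n y - T n y\<bar>" by (intro tendsto_intros)
      then have "(\<lambda>j. \<bar>T n y - g j y\<bar> powr m) \<longlonglongrightarrow> 0"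
        using m by (intro tendsto_zero_powrI[OF _ tendsto_const]) auto
      then show ?case using tendsto_ennrealI by fastforce
    qed
  qed measurable
  then have "eventually (\<lambda>j. (\<integral>\<^sup>+y. ennreal (\<bar>T n y - g j y\<bar> powr m) \<partial>lborel) < ennreal \<epsilon>) sequentially"
    using \<epsilon> by (intro order_tendstoD) auto
  then obtain j where j: "(\<integral>\<^sup>+y. ennreal (\<bar>T n y - g j y\<bar> powr m) \<partial>lborel) < ennreal \<epsilon>" by (auto simp: eventually_sequentially)
  have "(\<integral>\<^sup>+y. ennreal (\<bar>f y - g j y\<bar> powr m) \<partial>lborel) \<le> (\<integral>\<^sup>+y. ennreal (2 powr m) * (ennreal (\<bar>f y - T n y\<bar> powr m) + ennreal (\<bar>T n y - g j y\<bar> powr m)) \<partial>lborel)"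
  proof (intro nn_integral_mono)
    fix y
    have "ennreal (\<bar>f y - g j y\<bar> powr m) \<le> ennpowr (ennreal \<bar>f y - T n y\<bar> + ennreal \<bar>T n y - g j y\<bar>) m"
      unfolding ennpowr_ennreal[OF abs_ge_zero, symmetric] using m
      by (intro ennpowr_mono) (auto simp: ennreal_plus[symmetric] simp del: ennreal_plus intro!: ennreal_leI)
    also have "\<dots> \<le> ennreal (2 powr m) * (ennreal (\<bar>f y - T n y\<bar> powr m) + ennreal (\<bar>T n y - g j y\<bar> powr m))"
      using ennpowr_add_le[of m "ennreal \<bar>f y - T n y\<bar>" "ennreal \<bar>T n y - g j y\<bar>"] m by (simp add: ennpowr_ennreal)
    finally show "ennreal (\<bar>f y - g j y\<bar> powr m) \<le> ennreal (2 powr m) * (ennreal (\<bar>f y - T n y\<bar> powr m) + ennreal (\<bar>T n y - g j y\<bar> powr m))" .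
  qed
  also have "\<dots> = ennreal (2 powr m) * ((\<integral>\<^sup>+y. ennreal (\<bar>f y - T n y\<bar> powr m) \<partial>lborel) + (\<integral>\<^sup>+y. ennreal (\<bar>T n y - g j y\<bar> powr m) \<partial>lborel))"
    by (simp add: nn_integral_cmult nn_integral_add)
  also have "\<dots> \<le> ennreal (2 powr m) * (ennreal \<epsilon> + ennreal \<epsilon>)"
    using n j by (intro mult_left_mono add_mono) auto
  also have "\<dots> < e" by (rule \<epsilon>)
  finally show ?thesis using gc gz by (intro exI[of _ "g j"] exI[of _ "real n + 1"]) auto
qed

end

lemma ennpowr_add3_le:
  assumes "0 \<le> p"
  shows "ennpowr (x + y + z) p \<le> ennreal (4 powr p) * (ennpowr x p + ennpowr y p + ennpowr z p)"
proof -
  have one: "(1::ennreal) \<le> ennreal (2 powr p)" using ge_one_powr_ge_zero[of 2 p] assms by simp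
  have "ennpowr (x + y + z) p \<le> ennreal (2 powr p) * (ennpowr (x + y) p + ennpowr z p)"
    by (rule ennpowr_add_le[OF assms])
  also have "\<dots> \<le> ennreal (2 powr p) * (ennreal (2 powr p) * (ennpowr x p + ennpowr y p) + ennreal (2 powr p) * ennpowr z p)"
    using mult_right_mono[OF one, of "ennpowr z p"]
    by (intro mult_left_mono add_mono ennpowr_add_le assms) auto
  also have "\<dots> = ennreal (2 powr p * 2 powr p) * (ennpowr x p + ennpowr y p + ennpowr z p)"
    by (simp add: ennreal_mult distrib_left mult.assoc)
  also have "2 powr p * 2 powr p = (4::real) powr p" using powr_mult[of 2 2 p] by simp
  finally show ?thesis .
qed

lemma flat_pos: "0 < x \<Longrightarrow> 0 < flat 1 x" "x \<le> 0 \<Longrightarrow> flat 1 x = 0"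
  by (auto simp: flat_def)

lemma continuous_pos_bounds:
  fixes w :: "real \<Rightarrow> real"
  assumes "continuous_on {a..b} w" "\<And>x. x \<in> {a..b} \<Longrightarrow> 0 < w x" "a \<le> b"
  obtains c where "0 < c" "\<And>x. x \<in> {a..b} \<Longrightarrow> c \<le> w x"
proof -
  obtain x where "x \<in> {a..b}" "\<forall>y\<in>{a..b}. w x \<le> w y"
    using continuous_attains_inf[of "{a..b}" w] assms by auto
  then show thesis using that[of "w x"] assms(2) by blast
qed

lemma smooth1_const_on:
  assumes "\<And>x::real. (H has_real_derivative h x) (at x)" "\<And>x. b \<le> x \<Longrightarrow> h x = 0" "b \<le> x"
  shows "H x = H b"
proof (cases "b < x")
  case True
  obtain z where "b < z" "z < x" "H x - H b = (x - b) * h z"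
    using MVT2[OF True, of H h] assms(1) by blast
  then show ?thesis using assms(2)[of z] by simp
qed (use assms in auto)

context wave
begin

text \<open>The weight is what remains in the energy norm for a function of \<open>r ^ 2\<close>:
  \<open>r\<close> for a velocity \<open>h (r ^ 2)\<close>, and \<open>2 * r ^ 2\<close> for
  \<open>r\<close> times the derivative of a primitive of \<open>h\<close> at \<open>r ^ 2\<close>.
  The function is divided by weight and bump, and the quotient is approximated by a continuous
  function and then by a polynomial.\<close>

lemma smooth_approx:
  assumes [measurable]: "f \<in> borel_measurable borel" and fin: "(\<integral>\<^sup>+r\<in>{0<..}. ennreal (\<bar>f r\<bar> powr m) \<partial>lborel) < top"
    and wc: "continuous_on {0<..} w" and wp: "\<And>r. 0 < r \<Longrightarrow> 0 < w r" and [measurable]: "w \<in> borel_measurable borel"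
    and e: "0 < (e::real)"
  shows "\<exists>h b. smooth1 h \<and> (\<forall>x. b \<le> x \<longrightarrow> h x = 0) \<and> (\<integral>\<^sup>+r\<in>{0<..}. ennreal (\<bar>f r - w r * h (r ^ 2)\<bar> powr m) \<partial>lborel) < ennreal e"
proof -
  define J where "J = (\<lambda>n::nat. {1 / (real n + 1)..real n + 1})"
  have "(\<lambda>n. \<integral>\<^sup>+r. ennreal (\<bar>f r\<bar> powr m) * indicator ({0<..} - J n) r \<partial>lborel) \<longlonglongrightarrow> (\<integral>\<^sup>+r. 0 \<partial>(lborel :: real measure))"
  proof (rule nn_integral_dominated_convergence[where w = "\<lambda>r. ennreal (\<bar>f r\<bar> powr m) * indicator {0<..} r"])
    show "AE r in lborel. (\<lambda>n. ennreal (\<bar>f r\<bar> powr m) * indicator ({0<..} - J n) r) \<longlonglongrightarrow> 0"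
    proof (intro AE_I2 tendsto_eventually)
      fix r :: real
      show "eventually (\<lambda>n. ennreal (\<bar>f r\<bar> powr m) * indicator ({0<..} - J n) r = 0) sequentially"
      proof (cases "0 < r")
        case True
        obtain N :: nat where N: "max r (1 / r) \<le> real N" using real_arch_simple by blast
        have "r \<in> J n" if "N \<le> n" for n
        proof -
          have "1 / r \<le> real n + 1" "r \<le> real n + 1" using N that by auto
          moreover from this(1) have "1 / (real n + 1) \<le> r" using True by (simp add: field_simps)
          ultimately show ?thesis by (simp add: J_def)
        qed
        then show ?thesis unfolding eventually_sequentially by (intro exI[of _ N]) auto
      qed auto
    qed
  qed (use fin in \<open>auto simp: J_def indicator_def\<close>)
  then have "eventually (\<lambda>n. (\<integral>\<^sup>+r. ennreal (\<bar>f r\<bar> powr m) * indicator ({0<..} - J n) r \<partial>lborel) < ennreal (e / (4 * 4 powr m))) sequentially"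
    using e by (intro order_tendstoD) auto
  then obtain n where n: "(\<integral>\<^sup>+r. ennreal (\<bar>f r\<bar> powr m) * indicator ({0<..} - J n) r \<partial>lborel) < ennreal (e / (4 * 4 powr m))"
    by (auto simp: eventually_sequentially)
  \<comment> \<open>\<open>[L, U]\<close> is larger than \<open>J n\<close> on both sides, so a bump
    that vanishes outside it is bounded below on \<open>J n\<close>.\<close>
  define \<alpha> \<gamma> L U where "\<alpha> = 1 / (real n + 1)" and "\<gamma> = real n + 1" and "L = \<alpha> / 2" and "U = \<gamma> + 1"
  have \<alpha>: "0 < L" "L < \<alpha>" "\<alpha> \<le> \<gamma>" "\<gamma> < U" by (auto simp: \<alpha>_def \<gamma>_def L_def U_def field_simps)
  have Jn: "J n = {\<alpha>..\<gamma>}" by (simp add: J_def \<alpha>_def \<gamma>_def)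
  define \<beta> where "\<beta> = (\<lambda>x. flat 1 (x - L ^ 2) * flat 1 (U ^ 2 - x))"
  have \<beta>e: "elem \<beta>"
  proof -
    have "elem (\<lambda>x. flat 1 (x + (- (L ^ 2))) * flat 1 (U ^ 2 + (-1) * x))" by (intro elem.intros)
    then show ?thesis by (simp add: \<beta>_def)
  qed
  have \<beta>c: "continuous_on UNIV \<beta>" by (intro smooth1_continuous elem_smooth1 \<beta>e)
  have [measurable]: "\<beta> \<in> borel_measurable borel" using \<beta>c by (rule borel_measurable_continuous_onI)
  have \<beta>0: "\<beta> x = 0" if "x \<le> L ^ 2 \<or> U ^ 2 \<le> x" for x using that by (auto simp: \<beta>_def flat_pos(2))
  have \<beta>pos: "0 < \<beta> (r ^ 2)" if "L < r" "r < U" for r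
  proof -
    have "L ^ 2 < r ^ 2" "r ^ 2 < U ^ 2" using that \<alpha> by (auto intro!: power_strict_mono)
    then show ?thesis by (simp add: \<beta>_def flat_pos(1))
  qed
  define W0 where "W0 = (\<lambda>r. w r * \<beta> (r ^ 2))"
  have W0c: "continuous_on {L..U} W0"
    unfolding W0_def
    by (intro continuous_intros continuous_on_subset[OF wc] continuous_on_compose2[OF \<beta>c]) (use \<alpha> in auto)
  have W0p: "0 < W0 r" if "r \<in> {\<alpha>..\<gamma>}" for r using that \<alpha> wp[of r] \<beta>pos[of r] by (simp add: W0_def)
  have [measurable]: "W0 \<in> borel_measurable borel" unfolding W0_def by measurable
  obtain c where c: "0 < c" "\<And>r. r \<in> {\<alpha>..\<gamma>} \<Longrightarrow> c \<le> W0 r"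
    using continuous_pos_bounds[of \<alpha> \<gamma> W0] continuous_on_subset[OF W0c, of "{\<alpha>..\<gamma>}"] W0p \<alpha> by auto
  have "bounded (W0 ` {L..U})" by (intro compact_imp_bounded compact_continuous_image W0c) auto
  then obtain W where W: "0 < W" "\<And>r. r \<in> {L..U} \<Longrightarrow> \<bar>W0 r\<bar> \<le> W" unfolding bounded_pos by auto
  \<comment> \<open>The quotient is taken on \<open>{\<alpha>..\<gamma>}\<close> only, where
    \<open>W0 \<ge> c\<close>; what \<open>f\<close> has elsewhere is small by the choice of
    \<open>n\<close>.\<close>
  define q where "q = (\<lambda>r. indicator {\<alpha>..\<gamma>} r * (f r / W0 r))"
  have [measurable]: "q \<in> borel_measurable borel" unfolding q_def by measurable
  have "Lm_fun m q"
    unfolding Lm_fun_def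
  proof
    have "(\<integral>\<^sup>+r. ennreal (\<bar>q r\<bar> powr m) \<partial>lborel) \<le> (\<integral>\<^sup>+r. ennreal ((1 / c) powr m) * (ennreal (\<bar>f r\<bar> powr m) * indicator {0<..} r) \<partial>lborel)"
    proof (intro nn_integral_mono)
      fix r
      show "ennreal (\<bar>q r\<bar> powr m) \<le> ennreal ((1 / c) powr m) * (ennreal (\<bar>f r\<bar> powr m) * indicator {0<..} r)"
      proof (cases "r \<in> {\<alpha>..\<gamma>}")
        case True
        then have "\<bar>q r\<bar> = \<bar>f r\<bar> / W0 r" using W0p[of r] by (simp add: q_def abs_divide)
        also have "\<dots> \<le> \<bar>f r\<bar> / c" using c True W0p[of r] by (intro divide_left_mono) auto
        finally have "\<bar>q r\<bar> powr m \<le> (1 / c * \<bar>f r\<bar>) powr m" using m by (intro powr_mono2) auto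
        then have "ennreal (\<bar>q r\<bar> powr m) \<le> ennreal ((1 / c) powr m * \<bar>f r\<bar> powr m)"
          using c by (intro ennreal_leI) (simp add: powr_mult powr_divide)
        then show ?thesis using True \<alpha> by (simp add: ennreal_mult)
      qed (simp add: q_def)
    qed
    also have "\<dots> < top" using fin by (subst nn_integral_cmult) (auto simp: ennreal_mult_less_top)
    finally show "(\<integral>\<^sup>+r. ennreal (\<bar>q r\<bar> powr m) \<partial>lborel) < top" .
  qed measurable
  moreover have "0 < ennreal (e / (4 * 4 powr m * W powr m))" using e W by simp
  ultimately obtain g where g: "continuous_on UNIV g" "(\<integral>\<^sup>+y. ennreal (\<bar>q y - g y\<bar> powr m) \<partial>lborel) < ennreal (e / (4 * 4 powr m * W powr m))"
    using Lm_fun_dense by blast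
  \<comment> \<open>The uniform error on \<open>[L, U]\<close>, multiplied by the bound
    \<open>W\<close> of weight and bump, then contributes \<open>e / 4\<close>. The tail of
    \<open>f\<close> and the error of \<open>g\<close> have the same share; the factor
    \<open>4 powr m\<close> belongs to \<open>ennpowr_add3_le\<close>.\<close>
  define \<delta> where "\<delta> = (e / (4 * 4 powr m * W powr m * (U - L))) powr (1 / m)"
  have UL: "0 < U - L" using \<alpha> by simp
  have \<delta>: "0 < \<delta>" "\<delta> powr m = e / (4 * 4 powr m * W powr m * (U - L))"
    using e W UL m by (auto simp: \<delta>_def powr_powr)
  \<comment> \<open>In the variable \<open>x = r ^ 2\<close>, so that the polynomial can become a
    factor of \<open>h\<close>.\<close>
  have "continuous_on {L ^ 2..U ^ 2} (\<lambda>x. g (sqrt x))"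
    by (intro continuous_on_compose2[OF g(1)] continuous_intros) auto
  then obtain P where P: "real_polynomial_function P" "\<And>x. x \<in> {L ^ 2..U ^ 2} \<Longrightarrow> \<bar>g (sqrt x) - P x\<bar> < \<delta>"
    by (rule Stone_Weierstrass_real_polynomial_function[OF compact_Icc _ \<delta>(1)]) blast
  define h where "h = (\<lambda>x. \<beta> x * P x)"
  have he: "elem h" unfolding h_def by (intro elem_mult \<beta>e elem_polynomial P)
  have [measurable]: "h \<in> borel_measurable borel"
    using smooth1_continuous[OF elem_smooth1[OF he]] by (rule borel_measurable_continuous_onI)
  have [measurable]: "g \<in> borel_measurable borel" using g(1) by (rule borel_measurable_continuous_onI)
  have pt: "\<bar>f r - w r * h (r ^ 2)\<bar> \<le> \<bar>f r\<bar> * indicator ({0<..} - J n) r + W * \<bar>q r - g r\<bar> + W * \<delta> * indicator {L..U} r" if r: "0 < r" for r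
  proof (cases "r \<in> {L..U}")
    case True
    have r2: "r ^ 2 \<in> {L ^ 2..U ^ 2}" using True \<alpha> by (auto intro!: power_mono)
    have "\<bar>g r - P (r ^ 2)\<bar> < \<delta>" using P(2)[OF r2] r by simp
    then have "\<bar>q r - P (r ^ 2)\<bar> \<le> \<bar>q r - g r\<bar> + \<delta>" by linarith
    then have "\<bar>W0 r * (q r - P (r ^ 2))\<bar> \<le> W * (\<bar>q r - g r\<bar> + \<delta>)"
      unfolding abs_mult using W(2)[OF True] by (intro mult_mono) auto
    moreover have "f r - w r * h (r ^ 2) = f r * indicator ({0<..} - J n) r + W0 r * (q r - P (r ^ 2))"
    proof (cases "r \<in> {\<alpha>..\<gamma>}")
      case True
      then have "W0 r * q r = f r" "r \<notin> {0<..} - J n" using W0p[of r] by (auto simp: q_def Jn)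
      then show ?thesis by (simp add: right_diff_distrib) (simp add: W0_def h_def)
    next
      case False
      then have "q r = 0" "r \<in> {0<..} - J n" using r by (auto simp: q_def Jn)
      then show ?thesis by (simp add: W0_def h_def)
    qed
    ultimately have "\<bar>f r - w r * h (r ^ 2)\<bar> \<le> \<bar>f r * indicator ({0<..} - J n) r\<bar> + W * (\<bar>q r - g r\<bar> + \<delta>)" by linarith
    then show ?thesis using True by (simp add: abs_mult distrib_left)
  next
    case False
    then have "r < L \<or> U < r" by auto
    then have "r ^ 2 \<le> L ^ 2 \<or> U ^ 2 \<le> r ^ 2" using r \<alpha> by (auto intro!: power_mono)
    then have "h (r ^ 2) = 0" using \<beta>0 by (simp add: h_def)
    moreover have "r \<in> {0<..} - J n" using False r \<alpha> by (auto simp: Jn)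
    ultimately show ?thesis using W(1) \<delta>(1) by (simp add: add_increasing2)
  qed
  have "(\<integral>\<^sup>+r\<in>{0<..}. ennreal (\<bar>f r - w r * h (r ^ 2)\<bar> powr m) \<partial>lborel)
    \<le> (\<integral>\<^sup>+r. ennreal (4 powr m) * (ennreal (\<bar>f r\<bar> powr m) * indicator ({0<..} - J n) r + ennreal (W powr m) * ennreal (\<bar>q r - g r\<bar> powr m) + ennreal ((W * \<delta>) powr m) * indicator {L..U} r) \<partial>lborel)"
  proof (intro nn_integral_mono)
    fix r :: real
    show "ennreal (\<bar>f r - w r * h (r ^ 2)\<bar> powr m) * indicator {0<..} r
      \<le> ennreal (4 powr m) * (ennreal (\<bar>f r\<bar> powr m) * indicator ({0<..} - J n) r + ennreal (W powr m) * ennreal (\<bar>q r - g r\<bar> powr m) + ennreal ((W * \<delta>) powr m) * indicator {L..U} r)"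
    proof (cases "0 < r")
      case True
      have "ennpowr (ennreal \<bar>f r - w r * h (r ^ 2)\<bar>) m \<le> ennpowr (ennreal (\<bar>f r\<bar> * indicator ({0<..} - J n) r) + ennreal (W * \<bar>q r - g r\<bar>) + ennreal (W * \<delta> * indicator {L..U} r)) m"
        using pt[OF True] W(1) \<delta>(1) m by (intro ennpowr_mono) (auto simp: ennreal_plus[symmetric] simp del: ennreal_plus intro!: ennreal_leI)
      also have "\<dots> \<le> ennreal (4 powr m) * (ennpowr (ennreal (\<bar>f r\<bar> * indicator ({0<..} - J n) r)) m + ennpowr (ennreal (W * \<bar>q r - g r\<bar>)) m + ennpowr (ennreal (W * \<delta> * indicator {L..U} r)) m)"
        using m by (intro ennpowr_add3_le) auto
      also have "ennpowr (ennreal (\<bar>f r\<bar> * indicator ({0<..} - J n) r)) m = ennreal (\<bar>f r\<bar> powr m) * indicator ({0<..} - J n) r"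
        by (auto simp: indicator_def ennpowr_ennreal)
      also have "ennpowr (ennreal (W * \<bar>q r - g r\<bar>)) m = ennreal (W powr m) * ennreal (\<bar>q r - g r\<bar> powr m)"
        using W(1) by (simp add: ennpowr_ennreal powr_mult ennreal_mult ennpowr_mult)
      also have "ennpowr (ennreal (W * \<delta> * indicator {L..U} r)) m = ennreal ((W * \<delta>) powr m) * indicator {L..U} r"
        using W(1) \<delta>(1) by (auto simp: indicator_def ennpowr_ennreal)
      finally show ?thesis using True by (simp add: ennpowr_ennreal)
    qed simp
  qed
  also have "\<dots> = ennreal (4 powr m) * ((\<integral>\<^sup>+r. ennreal (\<bar>f r\<bar> powr m) * indicator ({0<..} - J n) r \<partial>lborel) + ennreal (W powr m) * (\<integral>\<^sup>+r. ennreal (\<bar>q r - g r\<bar> powr m) \<partial>lborel) + ennreal ((W * \<delta>) powr m) * ennreal (U - L))"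
    using \<alpha> by (simp add: nn_integral_cmult nn_integral_add J_def)
  also have "\<dots> \<le> ennreal (4 powr m) * (ennreal (e / (4 * 4 powr m)) + ennreal (W powr m) * ennreal (e / (4 * 4 powr m * W powr m)) + ennreal ((W * \<delta>) powr m) * ennreal (U - L))"
    using n g(2) by (intro mult_left_mono add_mono) auto
  also have "\<dots> = ennreal (3 * e / 4)"
  proof -
    define E where "E = e / (4 * 4 powr m)"
    have "ennreal (W powr m) * ennreal (e / (4 * 4 powr m * W powr m)) = ennreal E"
      using W e by (subst ennreal_mult[symmetric]) (auto simp: E_def)
    moreover have "(W * \<delta>) powr m = W powr m * (e / (4 * 4 powr m * W powr m * (U - L)))"
      using W \<delta> by (simp add: powr_mult)
    then have "(W * \<delta>) powr m * (U - L) = E" using W UL by (simp add: E_def)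
    then have "ennreal ((W * \<delta>) powr m) * ennreal (U - L) = ennreal E"
      using UL by (subst ennreal_mult[symmetric]) auto
    moreover have "ennreal (4 powr m) * (ennreal E + ennreal E + ennreal E) = ennreal (4 powr m * (E + E + E))"
    proof -
      have "0 \<le> E" using e by (simp add: E_def)
      then show ?thesis by (simp only: ennreal_mult ennreal_plus powr_ge_zero add_nonneg_nonneg)
    qed
    moreover have "4 powr m * (E + E + E) = 3 * e / 4" by (simp add: E_def)
    ultimately show ?thesis by (simp add: E_def)
  qed
  also have "\<dots> < ennreal e" using e by (intro ennreal_lessI) auto
  finally have "(\<integral>\<^sup>+r\<in>{0<..}. ennreal (\<bar>f r - w r * h (r ^ 2)\<bar> powr m) \<partial>lborel) < ennreal e" .
  moreover have "h x = 0" if "U ^ 2 \<le> x" for x using \<beta>0[of x] that by (simp add: h_def)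
  ultimately show ?thesis using elem_smooth1[OF he] by blast
qed

text \<open>The velocity is approximated directly, the position through its derivative: a primitive
  \<open>H\<close> of the approximant makes \<open>H (r ^ 2)\<close> a test function.\<close>

lemma Lm_spaceI:
  assumes [measurable]: "p \<in> borel_measurable borel" "k \<in> borel_measurable borel" and p: "has_radial_deriv w0 p"
    and lim: "(w0 \<longlongrightarrow> 0) at_top" and fin: "rad_Lm m p < top" "rad_Lm m k < top"
  shows "(w0, k) \<in> Lm_space m"
proof -
  have "\<exists>\<phi> \<psi>. radial_test \<phi> \<and> radial_test \<psi> \<and> Lm_norm m (\<lambda>r. w0 r - \<phi> r) (\<lambda>r. k r - \<psi> r) < \<epsilon>" if \<epsilon>: "0 < \<epsilon>" for \<epsilon>
  proof -
    obtain x where x: "0 < x" "ennreal x < \<epsilon>"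
    proof -
      obtain y where y: "0 < y" "y < \<epsilon>" using dense[OF \<epsilon>] by blast
      then have "y \<noteq> top" using top.not_eq_extremum by (metis less_trans not_less_iff_gr_or_eq top_greatest leD)
      then obtain x where "y = ennreal x" "0 \<le> x" by (cases y) auto
      then show thesis using y that[of x] by auto
    qed
    define e where "e = x powr m / 2"
    have e: "0 < e" using x by (simp add: e_def)
    have "(\<integral>\<^sup>+r\<in>{0<..}. ennreal (\<bar>r * k r\<bar> powr m) \<partial>lborel) < top" using fin by (simp add: rad_Lm_def)
    then have "\<exists>h b. smooth1 h \<and> (\<forall>x. b \<le> x \<longrightarrow> h x = 0) \<and> (\<integral>\<^sup>+r\<in>{0<..}. ennreal (\<bar>r * k r - r * h (r ^ 2)\<bar> powr m) \<partial>lborel) < ennreal e"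
      by (intro smooth_approx[where w = "\<lambda>r. r"]) (simp_all add: e continuous_on_id)
    then obtain h b where h: "smooth1 h" "\<And>x. b \<le> x \<Longrightarrow> h x = 0" "(\<integral>\<^sup>+r\<in>{0<..}. ennreal (\<bar>r * k r - r * h (r ^ 2)\<bar> powr m) \<partial>lborel) < ennreal e"
      by blast
    have "(\<integral>\<^sup>+r\<in>{0<..}. ennreal (\<bar>r * p r\<bar> powr m) \<partial>lborel) < top" using fin by (simp add: rad_Lm_def)
    then have "\<exists>h b. smooth1 h \<and> (\<forall>x. b \<le> x \<longrightarrow> h x = 0) \<and> (\<integral>\<^sup>+r\<in>{0<..}. ennreal (\<bar>r * p r - 2 * r ^ 2 * h (r ^ 2)\<bar> powr m) \<partial>lborel) < ennreal e"
      by (intro smooth_approx[where w = "\<lambda>r. 2 * r ^ 2"]) (simp_all add: e continuous_on_mult continuous_on_power continuous_on_id)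
    then obtain h' b' where h': "smooth1 h'" "\<And>x. b' \<le> x \<Longrightarrow> h' x = 0" "(\<integral>\<^sup>+r\<in>{0<..}. ennreal (\<bar>r * p r - 2 * r ^ 2 * h' (r ^ 2)\<bar> powr m) \<partial>lborel) < ennreal e"
      by blast
    note hc = smooth1_continuous[OF h(1)] smooth1_continuous[OF h'(1)]
    have [measurable]: "h \<in> borel_measurable borel" "h' \<in> borel_measurable borel"
      using hc by (auto intro: borel_measurable_continuous_onI)
    obtain H0 where H0: "\<And>x. (H0 has_real_derivative h' x) (at x)"
      using einterval_antiderivative[of "-\<infinity>" "\<infinity>" h'] hc(2)
      by (auto simp: continuous_on_eq_continuous_at has_real_derivative_iff_has_vector_derivative)
    \<comment> \<open>Beyond \<open>b'\<close> a primitive is constant; subtracting this constant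
      gives bounded support.\<close>
    define H where "H = (\<lambda>x. H0 x - H0 b')"
    have H: "(H has_real_derivative h' x) (at x)" for x
      unfolding H_def using H0 by (auto intro!: derivative_eq_intros)
    have Hs: "smooth1 H" by (rule smooth1_antideriv[OF h'(1) H])
    have Hz: "H x = 0" if "b' < x" for x
      using smooth1_const_on[of H0 h' b' x] H0 h'(2) that by (simp add: H_def)
    have t: "radial_test (\<lambda>r. H (r ^ 2))" "radial_test (\<lambda>r. h (r ^ 2))"
      using radial_test_smooth1[OF Hs Hz] radial_test_smooth1[OF h(1), of b] h(2) by auto
    have Hd: "((\<lambda>r. H (r ^ 2)) has_real_derivative 2 * r * h' (r ^ 2)) (at r)" for r
    proof -
      have "((\<lambda>r. r ^ 2) has_real_derivative 2 * r) (at r)" by (auto intro!: derivative_eq_intros)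
      from DERIV_chain2[OF H this] show ?thesis by (simp add: mult.commute)
    qed
    have dc: "continuous_on UNIV (\<lambda>r. 2 * r * h' (r ^ 2))"
      by (intro continuous_intros continuous_on_compose2[OF hc(2)]) auto
    have "has_radial_deriv (\<lambda>r. H (r ^ 2)) (\<lambda>r. 2 * r * h' (r ^ 2))"
    proof (subst has_radial_deriv_iff_lborel)
      show "\<forall>a b. 0 < a \<longrightarrow> a \<le> b \<longrightarrow> set_integrable lborel {a..b} (\<lambda>r. 2 * r * h' (r ^ 2)) \<and>
        H (b ^ 2) - H (a ^ 2) = (LINT r:{a..b}|lborel. 2 * r * h' (r ^ 2))"
      proof (intro allI impI)
        fix a b :: real assume ab: "0 < a" "a \<le> b"
        have "has_bochner_integral lborel (\<lambda>r. 2 * r * h' (r ^ 2) * indicator {a..b} r) (H (b ^ 2) - H (a ^ 2))"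
          by (rule has_bochner_integral_FTC_Icc_real[OF ab(2) Hd]) (use dc in \<open>simp add: continuous_on_eq_continuous_at\<close>)
        then show "set_integrable lborel {a..b} (\<lambda>r. 2 * r * h' (r ^ 2)) \<and> H (b ^ 2) - H (a ^ 2) = (LINT r:{a..b}|lborel. 2 * r * h' (r ^ 2))"
          by (auto simp: has_bochner_integral_iff set_integrable_def set_lebesgue_integral_def mult.commute)
      qed
    qed measurable
    from has_radial_deriv_diff[OF p this]
    have "Lm_norm m (\<lambda>r. w0 r - H (r ^ 2)) (\<lambda>r. k r - h (r ^ 2))
      = ennpowr (rad_Lm m (\<lambda>r. p r - 2 * r * h' (r ^ 2)) + rad_Lm m (\<lambda>r. k r - h (r ^ 2))) (1 / m)"
      by (intro Lm_norm_eq) auto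
    also have "\<dots> \<le> ennpowr (ennreal e + ennreal e) (1 / m)"
    proof (intro ennpowr_mono add_mono)
      show "rad_Lm m (\<lambda>r. p r - 2 * r * h' (r ^ 2)) \<le> ennreal e"
        using h'(3) unfolding rad_Lm_def by (simp add: right_diff_distrib power2_eq_square mult_ac)
      show "rad_Lm m (\<lambda>r. k r - h (r ^ 2)) \<le> ennreal e"
        using h(3) unfolding rad_Lm_def by (simp add: right_diff_distrib)
    qed (use m in auto)
    also have "\<dots> = ennreal x" using x m by (simp add: e_def ennreal_plus[symmetric] ennpowr_ennreal powr_powr del: ennreal_plus)
    also have "\<dots> < \<epsilon>" by (rule x)
    finally show ?thesis using t by blast
  qed
  moreover have "k \<in> borel_measurable (lebesgue_on {0<..})"
    by (intro measurable_restrict_space1 measurable_completion) simp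
  ultimately show ?thesis using p lim by (auto simp: Lm_space_def)
qed

lemma prf_in_Lm_space:
  assumes g: "Lm_fun m g"
  shows "(avg g 0, prf_v g) \<in> Lm_space m"
proof -
  have [measurable]: "g \<in> borel_measurable borel" using g by (simp add: Lm_fun_def)
  obtain \<Lambda> where \<Lambda>: "0 < \<Lambda>" "(\<integral>\<^sup>+y. ennreal (\<bar>g y\<bar> powr m) \<partial>lborel) \<le> ennreal (\<Lambda> powr m)" by (rule Lm_fun_bound[OF g])
  obtain C where "rad_Lm m (prf_du g) + rad_Lm m (prf_v g) \<le> ennreal ((C * \<Lambda>) powr m)"
    using prf_norm g \<Lambda> by blast
  then have "rad_Lm m (prf_du g) + rad_Lm m (prf_v g) < top" by (rule le_less_trans) simp
  then show ?thesis
    by (intro Lm_spaceI[where p = "prf_du g"] prf_u_deriv[OF g] prf_u_tendsto[OF g]) auto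
qed

text \<open>True for continuous functions of bounded support by uniform continuity, and carried over
  by density, as translation preserves the \<open>L\<^sup>m\<close> norm of the error.\<close>

lemma translation_continuous:
  assumes f: "Lm_fun m f" and e: "0 < (e::real)"
  shows "\<exists>d>0. \<forall>t. \<bar>t\<bar> < d \<longrightarrow> (\<integral>\<^sup>+y. ennreal (\<bar>f (y + t) - f y\<bar> powr m) \<partial>lborel) < ennreal e"
proof -
  have [measurable]: "f \<in> borel_measurable borel" using f by (simp add: Lm_fun_def)
  have "0 < ennreal (e / (4 * 4 powr m))" using e by simp
  then obtain g R where g: "continuous_on UNIV g" "\<And>y. R < \<bar>y\<bar> \<Longrightarrow> g y = 0" "(\<integral>\<^sup>+y. ennreal (\<bar>f y - g y\<bar> powr m) \<partial>lborel) < ennreal (e / (4 * 4 powr m))"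
    using Lm_fun_dense[OF f] by blast
  have [measurable]: "g \<in> borel_measurable borel" using g(1) by (rule borel_measurable_continuous_onI)
  define S where "S = \<bar>R\<bar> + 1"
  define \<delta> where "\<delta> = (e / (4 * 4 powr m * (2 * S))) powr (1 / m)"
  have S: "0 < S" by (simp add: S_def)
  have \<delta>: "0 < \<delta>" "\<delta> powr m = e / (4 * 4 powr m * (2 * S))" using e S m by (auto simp: \<delta>_def powr_powr)
  have "uniformly_continuous_on {- S - 1..S + 1} g"
    by (intro compact_uniformly_continuous continuous_on_subset[OF g(1)]) auto
  then obtain d where d: "0 < d" "\<And>x y. x \<in> {- S - 1..S + 1} \<Longrightarrow> y \<in> {- S - 1..S + 1} \<Longrightarrow> dist y x < d \<Longrightarrow> dist (g y) (g x) < \<delta>"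
    unfolding uniformly_continuous_on_def using \<delta>(1) by metis
  show ?thesis
  proof (intro exI[of _ "min d 1"] conjI allI impI)
    show "0 < min d 1" using d by simp
    fix t :: real assume t: "\<bar>t\<bar> < min d 1"
    have pt: "\<bar>g (y + t) - g y\<bar> \<le> \<delta> * indicator {- S..S} y" for y
    proof (cases "y \<in> {- S..S}")
      case True
      then have "dist (g (y + t)) (g y) < \<delta>" using t by (intro d(2)) (auto simp: dist_real_def)
      then show ?thesis using True by (simp add: dist_real_def)
    next
      case False
      then have "R < \<bar>y\<bar>" "R < \<bar>y + t\<bar>" using t by (auto simp: S_def)
      then show ?thesis using g(2) False by simp
    qed
    have "(\<integral>\<^sup>+y. ennreal (\<bar>f (y + t) - f y\<bar> powr m) \<partial>lborel)
      \<le> (\<integral>\<^sup>+y. ennreal (4 powr m) * (ennreal (\<bar>f (y + t) - g (y + t)\<bar> powr m) + ennreal (\<delta> powr m) * indicator {- S..S} y + ennreal (\<bar>f y - g y\<bar> powr m)) \<partial>lborel)"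
    proof (intro nn_integral_mono)
      fix y
      have "\<bar>f (y + t) - f y\<bar> \<le> \<bar>f (y + t) - g (y + t)\<bar> + \<delta> * indicator {- S..S} y + \<bar>f y - g y\<bar>" using pt[of y] by linarith
      then have "ennpowr (ennreal \<bar>f (y + t) - f y\<bar>) m \<le> ennpowr (ennreal \<bar>f (y + t) - g (y + t)\<bar> + ennreal (\<delta> * indicator {- S..S} y) + ennreal \<bar>f y - g y\<bar>) m"
        using \<delta> m by (intro ennpowr_mono) (auto simp: ennreal_plus[symmetric] simp del: ennreal_plus intro!: ennreal_leI)
      also have "\<dots> \<le> ennreal (4 powr m) * (ennpowr (ennreal \<bar>f (y + t) - g (y + t)\<bar>) m + ennpowr (ennreal (\<delta> * indicator {- S..S} y)) m + ennpowr (ennreal \<bar>f y - g y\<bar>) m)"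
        using m by (intro ennpowr_add3_le) auto
      also have "ennpowr (ennreal (\<delta> * indicator {- S..S} y)) m = ennreal (\<delta> powr m) * indicator {- S..S} y"
        using \<delta> by (auto simp: indicator_def ennpowr_ennreal)
      finally show "ennreal (\<bar>f (y + t) - f y\<bar> powr m) \<le> ennreal (4 powr m) * (ennreal (\<bar>f (y + t) - g (y + t)\<bar> powr m) + ennreal (\<delta> powr m) * indicator {- S..S} y + ennreal (\<bar>f y - g y\<bar> powr m))"
        by (simp add: ennpowr_ennreal)
    qed
    also have "\<dots> = ennreal (4 powr m) * ((\<integral>\<^sup>+y. ennreal (\<bar>f (y + t) - g (y + t)\<bar> powr m) \<partial>lborel) + ennreal (\<delta> powr m) * ennreal (2 * S) + (\<integral>\<^sup>+y. ennreal (\<bar>f y - g y\<bar> powr m) \<partial>lborel))"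
      using S by (simp add: nn_integral_cmult nn_integral_add)
    also have "(\<integral>\<^sup>+y. ennreal (\<bar>f (y + t) - g (y + t)\<bar> powr m) \<partial>lborel) = (\<integral>\<^sup>+y. ennreal (\<bar>f y - g y\<bar> powr m) \<partial>lborel)"
      by (subst (2) nn_integral_real_affine[where c = 1 and t = t]) (auto simp: add.commute)
    also have "ennreal (4 powr m) * ((\<integral>\<^sup>+y. ennreal (\<bar>f y - g y\<bar> powr m) \<partial>lborel) + ennreal (\<delta> powr m) * ennreal (2 * S) + (\<integral>\<^sup>+y. ennreal (\<bar>f y - g y\<bar> powr m) \<partial>lborel))
      \<le> ennreal (4 powr m) * (ennreal (e / (4 * 4 powr m)) + ennreal (\<delta> powr m) * ennreal (2 * S) + ennreal (e / (4 * 4 powr m)))"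
      using g(3) by (intro mult_left_mono add_mono) auto
    also have "\<dots> = ennreal (4 powr m) * (ennreal (e / (4 * 4 powr m)) + ennreal (e / (4 * 4 powr m)) + ennreal (e / (4 * 4 powr m)))"
    proof -
      have "ennreal (\<delta> powr m) * ennreal (2 * S) = ennreal (e / (4 * 4 powr m))"
        unfolding \<delta>(2) using e S by (subst ennreal_mult[symmetric]) auto
      then show ?thesis by simp
    qed
    also have "\<dots> = ennreal (3 * e / 4)"
      using e by (simp add: ennreal_plus[symmetric] ennreal_mult[symmetric] field_simps del: ennreal_plus)
    also have "\<dots> < ennreal e" using e by (intro ennreal_lessI) auto
    finally show "(\<integral>\<^sup>+y. ennreal (\<bar>f (y + t) - f y\<bar> powr m) \<partial>lborel) < ennreal e" .
  qed
qed

end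

section \<open>Continuity in time\<close>

lemma avg_shift: "avg (\<lambda>\<sigma>. g (\<sigma> + t)) 0 r = avg g t r"
proof -
  have "(LINT y:{t - r..t + r}|lborel. g y) = (LINT y:{- r..r}|lborel. g (y + t))"
    unfolding set_lebesgue_integral_def
    by (subst lborel_integral_real_affine[where c = 1 and t = t])
      (auto intro!: Bochner_Integration.integral_cong simp: indicator_def add.commute)
  then show ?thesis by (simp add: avg_def)
qed

lemma has_radial_deriv_cong_iff:
  "(\<And>r. 0 < r \<Longrightarrow> w r = w' r) \<Longrightarrow> has_radial_deriv w g \<longleftrightarrow> has_radial_deriv w' g"
  using has_radial_deriv_cong[of w g w'] has_radial_deriv_cong[of w' g w] by auto

text \<open>The choice in \<open>radial_deriv\<close> depends on \<open>w\<close> only through the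
  predicate \<open>has_radial_deriv w\<close>, so functions that agree for \<open>r > 0\<close>
  receive the very same derivative.\<close>

lemma Lm_norm_cong:
  assumes "\<And>r. 0 < r \<Longrightarrow> w r = w' r" "\<And>r. 0 < r \<Longrightarrow> v r = v' r"
  shows "Lm_norm m w v = Lm_norm m w' v'"
proof -
  have "has_radial_deriv w = has_radial_deriv w'"
    by (intro ext has_radial_deriv_cong_iff assms(1))
  then have "radial_deriv w = radial_deriv w'" by (simp add: radial_deriv_def)
  then show ?thesis
    unfolding Lm_norm_def using assms(2)
    by (intro arg_cong[where f = "\<lambda>x. ennpowr x (1 / m)"] nn_integral_cong) (auto simp: indicator_def)
qed

lemma Lm_space_cong:
  assumes w: "\<And>r. 0 < r \<Longrightarrow> w r = w' r" and mem: "(w, v) \<in> Lm_space m"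
  shows "(w', v) \<in> Lm_space m"
proof -
  have "Lm_norm m (\<lambda>r. w r - \<phi> r) k = Lm_norm m (\<lambda>r. w' r - \<phi> r) k" for \<phi> k
    using w by (intro Lm_norm_cong) auto
  moreover have "(w \<longlongrightarrow> 0) at_top \<longleftrightarrow> (w' \<longlongrightarrow> 0) at_top"
  proof (rule tendsto_cong)
    show "eventually (\<lambda>r. w r = w' r) at_top"
      using eventually_gt_at_top[of 0] by eventually_elim (rule w)
  qed
  moreover have "has_radial_deriv w = has_radial_deriv w'"
    by (intro ext has_radial_deriv_cong_iff w)
  ultimately show ?thesis
    using mem by (simp add: Lm_space_def)
qed

context wave
begin

text \<open>The profile recentred at time \<open>t\<close>: \<open>u (t, \<cdot>)\<close> and its time derivative are read off at time \<open>0\<close>.\<close>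

definition state :: "(real \<Rightarrow> real) \<Rightarrow> (real \<Rightarrow> real \<Rightarrow> real) \<Rightarrow> real \<Rightarrow> real \<Rightarrow> real" where
  "state f u t \<sigma> = flow f u 0 t (\<sigma> + t)"

lemma Lm_fun_shift:
  assumes "Lm_fun m g"
  shows "Lm_fun m (\<lambda>\<sigma>. g (\<sigma> + t))"
proof -
  have [measurable]: "g \<in> borel_measurable borel" using assms by (simp add: Lm_fun_def)
  have "(\<integral>\<^sup>+y. ennreal (\<bar>g y\<bar> powr m) \<partial>lborel) = (\<integral>\<^sup>+y. ennreal (\<bar>g (y + t)\<bar> powr m) \<partial>lborel)"
    by (subst nn_integral_real_affine[where c = 1 and t = t]) (auto simp: add.commute)
  then show ?thesis using assms by (simp add: Lm_fun_def)
qed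

lemma Lm_fun_state:
  assumes "Lm_fun m f" "sol 0 b f u"
  shows "Lm_fun m (state f u t)"
  unfolding state_def using assms solD[OF assms(2)] by (intro Lm_fun_shift Lm_fun_flow) auto

lemma sol_eq_state:
  assumes "sol 0 b f u" "0 \<le> t" "t \<le> b" "0 < r"
  shows "u t r = avg (state f u t) 0 r"
  using solD(4)[OF assms] unfolding state_def avg_shift .

lemma abs_acc_le: "ennreal \<bar>acc m u a t y\<bar> \<le> (\<integral>\<^sup>+s\<in>{a..t}. ennreal \<bar>src m u s (y - s)\<bar> \<partial>lborel)"
  unfolding acc_def by (rule abs_set_integral_le)

lemma Lm_pow_add_le:
  assumes [measurable]: "f \<in> borel_measurable borel" "g \<in> borel_measurable borel"
  shows "(\<integral>\<^sup>+y. ennreal (\<bar>f y + g y\<bar> powr m) \<partial>lborel) \<le> ennreal (2 powr m) * ((\<integral>\<^sup>+y. ennreal (\<bar>f y\<bar> powr m) \<partial>lborel) + (\<integral>\<^sup>+y. ennreal (\<bar>g y\<bar> powr m) \<partial>lborel))"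
proof -
  have "(\<integral>\<^sup>+y. ennreal (\<bar>f y + g y\<bar> powr m) \<partial>lborel) \<le> (\<integral>\<^sup>+y. ennreal (2 powr m) * (ennreal (\<bar>f y\<bar> powr m) + ennreal (\<bar>g y\<bar> powr m)) \<partial>lborel)"
  proof (intro nn_integral_mono)
    fix y
    have "ennpowr (ennreal \<bar>f y + g y\<bar>) m \<le> ennpowr (ennreal \<bar>f y\<bar> + ennreal \<bar>g y\<bar>) m"
      using m by (intro ennpowr_mono) (auto simp: ennreal_plus[symmetric] simp del: ennreal_plus intro!: ennreal_leI)
    also have "\<dots> \<le> ennreal (2 powr m) * (ennpowr (ennreal \<bar>f y\<bar>) m + ennpowr (ennreal \<bar>g y\<bar>) m)"
      using m by (intro ennpowr_add_le) auto
    finally show "ennreal (\<bar>f y + g y\<bar> powr m) \<le> ennreal (2 powr m) * (ennreal (\<bar>f y\<bar> powr m) + ennreal (\<bar>g y\<bar> powr m))"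
      by (simp add: ennpowr_ennreal)
  qed
  then show ?thesis by (simp add: nn_integral_cmult nn_integral_add)
qed

text \<open>Two effects are separated: the profile at time \<open>t0\<close> is translated, and the
  profile itself changes by the sources between \<open>t0\<close> and \<open>t\<close>.\<close>

lemma state_continuous:
  assumes f: "Lm_fun m f" and u: "sol 0 b f u" and t0: "0 \<le> t0" and e: "0 < (e::real)"
  shows "\<exists>d>0. \<forall>t. 0 \<le> t \<longrightarrow> \<bar>t - t0\<bar> < d \<longrightarrow> (\<integral>\<^sup>+y. ennreal (\<bar>state f u t y - state f u t0 y\<bar> powr m) \<partial>lborel) < ennreal e"
proof -
  note um[measurable] = solD(1)[OF u]
  have [measurable]: "f \<in> borel_measurable borel" using f by (simp add: Lm_fun_def)
  let ?F = "flow f u 0"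
  have F: "Lm_fun m (?F t)" for t using solD[OF u] by (intro Lm_fun_flow f) auto
  define \<epsilon> where "\<epsilon> = e / (4 * 2 powr m)"
  have \<epsilon>: "0 < \<epsilon>" using e by (simp add: \<epsilon>_def)
  obtain d1 where d1: "0 < d1" "\<And>t. \<bar>t\<bar> < d1 \<Longrightarrow> (\<integral>\<^sup>+y. ennreal (\<bar>?F t0 (y + t) - ?F t0 y\<bar> powr m) \<partial>lborel) < ennreal \<epsilon>"
    using translation_continuous[OF F \<epsilon>] by blast
  obtain C where C: "0 < C" "contracts C" using contraction by blast
  \<comment> \<open>Makes \<open>C * A powr (2 * m + 1)\<close> equal to
    \<open>\<epsilon> powr (1 / m)\<close>, the bound wanted for the \<open>L\<^sup>m\<close> norm
    of \<open>mass\<close>.\<close>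
  define A where "A = (\<epsilon> powr (1 / m) / C) powr (1 / (2 * m + 1))"
  have A: "0 < A" "C * A * A powr (2 * m) = \<epsilon> powr (1 / m)"
  proof -
    show "0 < A" using \<epsilon> C by (simp add: A_def)
    have "A * A powr (2 * m) = A powr (2 * m + 1)" using \<open>0 < A\<close> by (simp add: powr_add)
    also have "\<dots> = \<epsilon> powr (1 / m) / C" using \<epsilon> C m by (simp add: A_def powr_powr)
    finally show "C * A * A powr (2 * m) = \<epsilon> powr (1 / m)" using C by (simp add: mult.assoc)
  qed
  obtain d2 where d2: "0 < d2" "S_int m (\<lambda>t r. ennreal \<bar>u t r\<bar> * indicator {t0 - d2..t0 + d2} t) < ennreal (A powr (2 * m + 1))"
    using S_int_shrinking_interval[OF m0, of "\<lambda>t r. ennreal \<bar>u t r\<bar>" "ennreal (A powr (2 * m + 1))" t0] A(1) solD(2)[OF u]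
    by (auto simp: snorm_def)
  \<comment> \<open>One cut-off for all \<open>t\<close> near \<open>t0\<close>: its
    \<open>mass\<close> dominates the sources between \<open>t0\<close> and \<open>t\<close> on
    either side.\<close>
  define w where "w = (\<lambda>t r. if t0 - d2 \<le> t \<and> t \<le> t0 + d2 then u t r else 0)"
  have wm: "joint_borel w" unfolding w_def by measurable
  have "snorm m w \<le> S_int m (\<lambda>t r. ennreal \<bar>u t r\<bar> * indicator {t0 - d2..t0 + d2} t)"
    unfolding snorm_def by (intro S_int_mono m0) (auto simp: w_def indicator_def)
  with d2 have ws: "snorm m w \<le> ennreal (A powr (2 * m + 1))" by simp
  have mass: "(\<integral>\<^sup>+y. ennpowr (mass m w (\<lambda>t r. 0) y) m \<partial>lborel) \<le> ennreal \<epsilon>"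
  proof -
    have "(\<integral>\<^sup>+y. ennpowr (mass m w (\<lambda>t r. 0) y) m \<partial>lborel) \<le> ennreal ((C * A * A powr (2 * m)) powr m)"
      by (rule contractsD(1)[OF C(2) wm _ A(1) A(1)]) (use ws m0 in auto)
    also have "(C * A * A powr (2 * m)) powr m = \<epsilon>" unfolding A(2) using \<epsilon> m by (simp add: powr_powr)
    finally show ?thesis .
  qed
  show ?thesis
  proof (intro exI[of _ "min d1 d2"] conjI allI impI)
    show "0 < min d1 d2" using d1 d2 by simp
    fix t assume t: "0 \<le> t" "\<bar>t - t0\<bar> < min d1 d2"
    have part: "ennreal \<bar>acc m u c d y\<bar> \<le> mass m w (\<lambda>t r. 0) y" if "t0 - d2 \<le> c" "d \<le> t0 + d2" for c d y
    proof -
      have "ennreal \<bar>acc m u c d y\<bar> \<le> (\<integral>\<^sup>+s\<in>{c..d}. ennreal \<bar>src m u s (y - s)\<bar> \<partial>lborel)" by (rule abs_acc_le)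
      also have "\<dots> \<le> mass m w (\<lambda>t r. 0) y"
        unfolding mass_def
      proof (intro nn_integral_mono)
        fix s
        have "src m w s (y - s) = src m u s (y - s)" if "s \<in> {c..d}"
          using that \<open>t0 - d2 \<le> c\<close> \<open>d \<le> t0 + d2\<close> by (intro src_cong) (auto simp: w_def)
        then show "ennreal \<bar>src m u s (y - s)\<bar> * indicator {c..d} s \<le> ennreal \<bar>src m w s (y - s) - src m (\<lambda>t r. 0) s (y - s)\<bar>"
          by (auto simp: indicator_def)
      qed
      finally show ?thesis .
    qed
    have "AE y in lborel. ennreal \<bar>acc m u 0 t y - acc m u 0 t0 y\<bar> \<le> mass m w (\<lambda>t r. 0) y"
    proof (cases "t0 \<le> t")
      case True
      show ?thesis
        using AE_acc_split[OF um solD(2)[OF u] t0 True]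
        by eventually_elim (use part[of t0 t] t d2 True in auto)
    next
      case False
      then have "t \<le> t0" by simp
      show ?thesis
        using AE_acc_split[OF um solD(2)[OF u] t(1) \<open>t \<le> t0\<close>]
        by eventually_elim (use part[of t t0] t d2 False in auto)
    qed
    then have "(\<integral>\<^sup>+y. ennreal (\<bar>?F t y - ?F t0 y\<bar> powr m) \<partial>lborel) \<le> (\<integral>\<^sup>+y. ennpowr (mass m w (\<lambda>t r. 0) y) m \<partial>lborel)"
    proof (intro nn_integral_mono_AE, eventually_elim)
      fix y assume le: "ennreal \<bar>acc m u 0 t y - acc m u 0 t0 y\<bar> \<le> mass m w (\<lambda>t r. 0) y"
      have "?F t y - ?F t0 y = \<iota> / 2 * (acc m u 0 t y - acc m u 0 t0 y)" by (simp add: flow_def algebra_simps)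
      then have "\<bar>?F t y - ?F t0 y\<bar> = \<bar>\<iota> / 2 * (acc m u 0 t y - acc m u 0 t0 y)\<bar>" by (rule arg_cong)
      also have "\<dots> = \<bar>acc m u 0 t y - acc m u 0 t0 y\<bar> / 2" using \<iota> by (simp add: abs_mult)
      finally have "\<bar>?F t y - ?F t0 y\<bar> = \<bar>acc m u 0 t y - acc m u 0 t0 y\<bar> / 2" .
      then have "\<bar>?F t y - ?F t0 y\<bar> \<le> \<bar>acc m u 0 t y - acc m u 0 t0 y\<bar>" by (rule ord_eq_le_trans) simp
      then have "ennreal \<bar>?F t y - ?F t0 y\<bar> \<le> ennreal \<bar>acc m u 0 t y - acc m u 0 t0 y\<bar>" by (rule ennreal_leI)
      also note le
      finally have "ennpowr (ennreal \<bar>?F t y - ?F t0 y\<bar>) m \<le> ennpowr (mass m w (\<lambda>t r. 0) y) m" using m by (intro ennpowr_mono) auto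
      then show "ennreal (\<bar>?F t y - ?F t0 y\<bar> powr m) \<le> ennpowr (mass m w (\<lambda>t r. 0) y) m" by (simp add: ennpowr_ennreal)
    qed
    with mass have I1: "(\<integral>\<^sup>+y. ennreal (\<bar>?F t y - ?F t0 y\<bar> powr m) \<partial>lborel) \<le> ennreal \<epsilon>" by simp
    have "(\<integral>\<^sup>+y. ennreal (\<bar>state f u t y - state f u t0 y\<bar> powr m) \<partial>lborel)
      = (\<integral>\<^sup>+y. ennreal (\<bar>(?F t (y + t) - ?F t0 (y + t)) + (?F t0 (y + t) - ?F t0 (y + t0))\<bar> powr m) \<partial>lborel)"
      by (simp add: state_def)
    also have "\<dots> \<le> ennreal (2 powr m) * ((\<integral>\<^sup>+y. ennreal (\<bar>?F t (y + t) - ?F t0 (y + t)\<bar> powr m) \<partial>lborel) + (\<integral>\<^sup>+y. ennreal (\<bar>?F t0 (y + t) - ?F t0 (y + t0)\<bar> powr m) \<partial>lborel))"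
      by (intro Lm_pow_add_le) measurable
    also have "(\<integral>\<^sup>+y. ennreal (\<bar>?F t (y + t) - ?F t0 (y + t)\<bar> powr m) \<partial>lborel) = (\<integral>\<^sup>+y. ennreal (\<bar>?F t y - ?F t0 y\<bar> powr m) \<partial>lborel)"
      by (subst (2) nn_integral_real_affine[where c = 1 and t = t]) (auto simp: add.commute)
    also have "(\<integral>\<^sup>+y. ennreal (\<bar>?F t0 (y + t) - ?F t0 (y + t0)\<bar> powr m) \<partial>lborel) = (\<integral>\<^sup>+y. ennreal (\<bar>?F t0 (y + (t - t0)) - ?F t0 y\<bar> powr m) \<partial>lborel)"
      by (subst (2) nn_integral_real_affine[where c = 1 and t = t0]) (auto simp: algebra_simps)
    also have "ennreal (2 powr m) * ((\<integral>\<^sup>+y. ennreal (\<bar>?F t y - ?F t0 y\<bar> powr m) \<partial>lborel) + (\<integral>\<^sup>+y. ennreal (\<bar>?F t0 (y + (t - t0)) - ?F t0 y\<bar> powr m) \<partial>lborel))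
      \<le> ennreal (2 powr m) * (ennreal \<epsilon> + ennreal \<epsilon>)"
      using d1(2)[of "t - t0"] t by (intro mult_left_mono add_mono I1) auto
    also have "\<dots> = ennreal (e / 2)"
      using e by (simp add: \<epsilon>_def ennreal_plus[symmetric] ennreal_mult[symmetric] del: ennreal_plus)
    also have "\<dots> < ennreal e" using e by (intro ennreal_lessI) auto
    finally show "(\<integral>\<^sup>+y. ennreal (\<bar>state f u t y - state f u t0 y\<bar> powr m) \<partial>lborel) < ennreal e" .
  qed
qed

lemma ennreal_tendsto_0I:
  fixes F :: "'a filter" and g :: "'a \<Rightarrow> ennreal"
  assumes "\<And>x::real. 0 < x \<Longrightarrow> eventually (\<lambda>t. g t \<le> ennreal x) F"
  shows "(g \<longlongrightarrow> 0) F"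
proof (rule order_tendstoI)
  fix a :: ennreal assume "0 < a"
  then obtain y where y: "0 < y" "y < a" using dense by blast
  then obtain x where x: "y = ennreal x" "0 \<le> x" by (cases y) auto
  then have "0 < x" using y by simp
  from assms[OF this] show "eventually (\<lambda>t. g t < a) F"
    by eventually_elim (use x y in \<open>auto intro: le_less_trans\<close>)
qed simp

lemma sol_Lm_continuous:
  assumes f: "Lm_fun m f" and u: "sol 0 b f u"
  shows "Lm_continuous_on m {0..b} u (\<lambda>t. prf_v (state f u t))"
  unfolding Lm_continuous_on_def
proof (intro conjI ballI)
  fix t assume t: "t \<in> {0..b}"
  have "(avg (state f u t) 0, prf_v (state f u t)) \<in> Lm_space m" by (rule prf_in_Lm_space[OF Lm_fun_state[OF f u]])
  then show "(u t, prf_v (state f u t)) \<in> Lm_space m"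
    by (rule Lm_space_cong[rotated]) (use sol_eq_state[OF u] t in auto)
next
  fix t0 assume t0: "t0 \<in> {0..b}"
  obtain C where C: "0 < C" and N: "\<And>g \<Lambda>. Lm_fun m g \<Longrightarrow> 0 < \<Lambda> \<Longrightarrow> (\<integral>\<^sup>+y. ennreal (\<bar>g y\<bar> powr m) \<partial>lborel) \<le> ennreal (\<Lambda> powr m) \<Longrightarrow>
    Lm_norm m (avg g 0) (prf_v g) \<le> ennreal (C * \<Lambda>)"
    using prf_norm by blast
  show "((\<lambda>t. Lm_norm m (\<lambda>r. u t r - u t0 r) (\<lambda>r. prf_v (state f u t) r - prf_v (state f u t0) r)) \<longlongrightarrow> 0) (at t0 within {0..b})"
  proof (rule ennreal_tendsto_0I)
    fix x :: real assume x: "0 < x"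
    define \<Lambda> where "\<Lambda> = x / C"
    have \<Lambda>: "0 < \<Lambda>" "C * \<Lambda> = x" using x C by (auto simp: \<Lambda>_def)
    obtain d where d: "0 < d" "\<And>t. 0 \<le> t \<Longrightarrow> \<bar>t - t0\<bar> < d \<Longrightarrow> (\<integral>\<^sup>+y. ennreal (\<bar>state f u t y - state f u t0 y\<bar> powr m) \<partial>lborel) < ennreal (\<Lambda> powr m)"
      using state_continuous[OF f u, of t0 "\<Lambda> powr m"] t0 \<Lambda> by auto
    have le: "Lm_norm m (\<lambda>r. u t r - u t0 r) (\<lambda>r. prf_v (state f u t) r - prf_v (state f u t0) r) \<le> ennreal x"
      if t: "t \<in> {0..b}" "\<bar>t - t0\<bar> < d" for t
    proof -
      define g where "g = (\<lambda>y. state f u t y - state f u t0 y)"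
      have "Lm_fun m (\<lambda>y. state f u t y + (-1) * state f u t0 y)" by (intro Lm_fun_add Lm_fun_state[OF f u])
      then have g: "Lm_fun m g" by (simp add: g_def)
      have "Lm_norm m (\<lambda>r. u t r - u t0 r) (\<lambda>r. prf_v (state f u t) r - prf_v (state f u t0) r) = Lm_norm m (avg g 0) (prf_v g)"
      proof (rule Lm_norm_cong)
        fix r :: real assume r: "0 < r"
        show "u t r - u t0 r = avg g 0 r"
          using sol_eq_state[OF u _ _ r] t t0 avg_diff[OF Lm_fun_state[OF f u] Lm_fun_state[OF f u], of t 0 r t0] by (simp add: g_def)
        show "prf_v (state f u t) r - prf_v (state f u t0) r = prf_v g r"
          by (simp add: prf_v_def g_def diff_divide_distrib[symmetric] algebra_simps)
      qed
      also have "\<dots> \<le> ennreal (C * \<Lambda>)"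
        using d(2)[of t] t by (intro N g \<Lambda>) (auto simp: g_def)
      finally show ?thesis by (simp add: \<Lambda>)
    qed
    show "eventually (\<lambda>t. Lm_norm m (\<lambda>r. u t r - u t0 r) (\<lambda>r. prf_v (state f u t) r - prf_v (state f u t0) r) \<le> ennreal x) (at t0 within {0..b})"
      unfolding eventually_at by (intro exI[of _ d] conjI d(1) ballI impI le) (auto simp: dist_real_def)
  qed
qed

lemma AE_src_Lm:
  assumes um[measurable]: "joint_borel u" and fin: "snorm m u < top"
  shows "AE s in lborel. Lm_fun m (src m u s)"
proof -
  obtain A where A: "0 < A" "snorm m u \<le> ennreal (A powr (2 * m + 1))"
    using finite_bound_powr[OF fin, of "2 * m + 1"] m by auto
  obtain C where "\<And>u w D A. joint_borel u \<Longrightarrow> joint_borel w \<Longrightarrow>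
    0 < D \<Longrightarrow> 0 < A \<Longrightarrow> snorm m (\<lambda>t r. u t r - w t r) \<le> ennreal (D powr (2 * m + 1)) \<Longrightarrow>
    snorm m u \<le> ennreal (A powr (2 * m + 1)) \<Longrightarrow> snorm m w \<le> ennreal (A powr (2 * m + 1)) \<Longrightarrow>
    (\<integral>\<^sup>+s. Lp_norm m (\<lambda>z. ennreal \<bar>src m u s z - src m w s z\<bar>) \<partial>lborel) \<le> ennreal (C * D * A powr (2 * m))"
    using src_diff_bound[OF m] by blast
  from this[OF um _ A(1) A(1), of "\<lambda>t r. 0"] A(2) m0
  have "(\<integral>\<^sup>+s. Lp_norm m (\<lambda>z. ennreal \<bar>src m u s z\<bar>) \<partial>lborel) \<le> ennreal (C * A * A powr (2 * m))" by simp
  then have "(\<integral>\<^sup>+s. Lp_norm m (\<lambda>z. ennreal \<bar>src m u s z\<bar>) \<partial>lborel) < top" by (rule le_less_trans) simp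
  then have "AE s in lborel. Lp_norm m (\<lambda>z. ennreal \<bar>src m u s z\<bar>) \<noteq> \<infinity>"
    by (intro nn_integral_PInf_AE) auto
  then show ?thesis
    by eventually_elim (auto simp: Lm_fun_def Lp_norm_def ennpowr_ennreal less_top)
qed

lemma mass_slide_finite:
  assumes "joint_borel u" "snorm m u < top"
  shows "slide (mass m u (\<lambda>t r. 0)) t r < top"
  using assms by (intro slide_Lp_finite mass_Lp_finite) auto

text \<open>The joint integrability behind \<open>fubini_diagonal\<close> and
  \<open>fubini_slab\<close>, from local integrability of \<open>mass\<close>. The shift
  \<open>e\<close> is \<open>r\<close> or \<open>- r\<close> on the edges of a moving window and 0
  on a fixed one.\<close>

lemma src_integrable:
  assumes um[measurable]: "joint_borel u" and fin: "snorm m u < top"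
  shows "integrable (lborel \<Otimes>\<^sub>M lborel) (\<lambda>(s, y). indicator {c..d} y * src m u s (y + e - s))"
  unfolding integrable_iff_bounded
proof
  have "(\<integral>\<^sup>+p. ennreal (norm (case p of (s, y) \<Rightarrow> indicator {c..d} y * src m u s (y + e - s))) \<partial>(lborel \<Otimes>\<^sub>M lborel))
    = (\<integral>\<^sup>+y. \<integral>\<^sup>+s. ennreal (norm (indicator {c..d} y * src m u s (y + e - s))) \<partial>lborel \<partial>lborel)"
    by (subst lborel_pair.nn_integral_snd[symmetric]) auto
  also have "\<dots> = (\<integral>\<^sup>+y. mass m u (\<lambda>t r. 0) (e + 1 * y) * indicator {c + e..d + e} (e + 1 * y) \<partial>lborel)"
    unfolding mass_def
    by (intro nn_integral_cong) (auto simp: indicator_def add.commute abs_mult)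
  also have "\<dots> = (\<integral>\<^sup>+y. mass m u (\<lambda>t r. 0) y * indicator {c + e..d + e} y \<partial>lborel)"
    by (subst (2) nn_integral_real_affine[where c = 1 and t = e]) auto
  also have "\<dots> \<le> slide (mass m u (\<lambda>t r. 0)) 0 (max \<bar>c + e\<bar> \<bar>d + e\<bar>)"
    unfolding slide_def by (intro nn_integral_mono) (auto simp: indicator_def)
  also have "\<dots> < top" by (rule mass_slide_finite[OF assms])
  finally show "(\<integral>\<^sup>+p. ennreal (norm (case p of (s, y) \<Rightarrow> indicator {c..d} y * src m u s (y + e - s))) \<partial>(lborel \<Otimes>\<^sub>M lborel)) < \<infinity>"
    by simp
qed measurable

end

section \<open>Duhamel's formula and the time derivative\<close>

lemma set_integral_shift:
  fixes f :: "real \<Rightarrow> real"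
  shows "(LINT y:{a..b}|lborel. f (y + e)) = (LINT y:{a + e..b + e}|lborel. f y)"
  unfolding set_lebesgue_integral_def
  by (subst (2) lborel_integral_real_affine[where c = 1 and t = e])
    (auto intro!: Bochner_Integration.integral_cong simp: indicator_def add.commute)

lemma prim_even:
  assumes "\<And>y. f (- y) = - f y"
  shows "prim f (- \<sigma>) = prim f \<sigma>"
proof -
  have pos: "prim f (- \<sigma>) = prim f \<sigma>" if "0 < \<sigma>" for \<sigma>
  proof -
    have "(LINT y:{- \<sigma>..0}|lborel. f y) = (LINT y:{0..\<sigma>}|lborel. f (- y))"
      by (subst set_integral_reflect_real) simp
    also have "\<dots> = - (LINT y:{0..\<sigma>}|lborel. f y)"
      unfolding assms set_lebesgue_integral_def by simp
    finally show ?thesis using that by (simp add: prim_def)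
  qed
  then show ?thesis proof (cases \<sigma> "0 :: real" rule: linorder_cases)
    case less
    then show ?thesis using pos[of "- \<sigma>"] by simp
  qed (use pos[of \<sigma>] in auto)
qed

lemma measurable_prim [measurable]:
  assumes [measurable]: "case_prod g \<in> borel_measurable (M \<Otimes>\<^sub>M borel)" "f \<in> borel_measurable M"
  shows "(\<lambda>x. prim (g x) (f x)) \<in> borel_measurable M"
  unfolding prim_def set_lebesgue_integral_def indicator_def atLeastAtMost_iff by measurable

context wave
begin

text \<open>For a source at time \<open>s\<close>, the moving edge \<open>\<tau> + e\<close> of a
  window sweeps the points \<open>z = \<tau> + e - s\<close>, which fill
  \<open>[e, t - s + e]\<close> while \<tau> runs from \<open>s\<close> to \<open>t\<close>.\<close>

lemma fubini_diagonal:
  assumes um[measurable]: "joint_borel u" and fin: "snorm m u < top"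
  shows "set_integrable lborel {0..t} (\<lambda>\<tau>. acc m u 0 \<tau> (\<tau> + e))"
    "set_integrable lborel {0..t} (\<lambda>s. LINT z:{e..t - s + e}|lborel. src m u s z)"
    "(LINT \<tau>:{0..t}|lborel. acc m u 0 \<tau> (\<tau> + e)) = (LINT s:{0..t}|lborel. LINT z:{e..t - s + e}|lborel. src m u s z)"
proof -
  define F where "F = (\<lambda>s \<tau>. (indicator {0..t} \<tau> * src m u s (\<tau> + e - s)) * (if 0 \<le> s \<and> s \<le> \<tau> then 1 else 0 :: real))"
  have F: "integrable (lborel \<Otimes>\<^sub>M lborel) (case_prod F)"
    by (rule Bochner_Integration.integrable_bound[OF src_integrable[OF assms, of 0 t e]])
      (auto simp: F_def split: if_splits)
  have snd: "(LINT s|lborel. F s \<tau>) = indicator {0..t} \<tau> *\<^sub>R acc m u 0 \<tau> (\<tau> + e)" for \<tau>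
  proof -
    have "(LINT s|lborel. F s \<tau>) = (LINT s|lborel. indicator {0..t} \<tau> * (indicator {0..\<tau>} s *\<^sub>R src m u s (\<tau> + e - s)))"
      by (intro Bochner_Integration.integral_cong) (auto simp: F_def indicator_def)
    then show ?thesis by (simp add: acc_def set_lebesgue_integral_def)
  qed
  have fst: "(LINT \<tau>|lborel. F s \<tau>) = indicator {0..t} s *\<^sub>R (LINT z:{e..t - s + e}|lborel. src m u s z)" for s
  proof (cases "s \<in> {0..t}")
    case True
    have "(LINT \<tau>|lborel. F s \<tau>) = (LINT \<tau>:{s..t}|lborel. src m u s (\<tau> + (e - s)))"
      unfolding set_lebesgue_integral_def using True
      by (intro Bochner_Integration.integral_cong) (auto simp: F_def indicator_def algebra_simps)
    also have "\<dots> = (LINT z:{e..t - s + e}|lborel. src m u s z)"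
      by (subst set_integral_shift) (simp add: algebra_simps)
    finally show ?thesis using True by simp
  next
    case False
    then have "F s \<tau> = 0" for \<tau> by (auto simp: F_def indicator_def)
    then show ?thesis using False by simp
  qed
  show "set_integrable lborel {0..t} (\<lambda>\<tau>. acc m u 0 \<tau> (\<tau> + e))"
    unfolding set_integrable_def snd[symmetric] by (rule lborel_pair.integrable_snd[OF F])
  show "set_integrable lborel {0..t} (\<lambda>s. LINT z:{e..t - s + e}|lborel. src m u s z)"
    unfolding set_integrable_def fst[symmetric] by (rule lborel_pair.integrable_fst[OF F])
  show "(LINT \<tau>:{0..t}|lborel. acc m u 0 \<tau> (\<tau> + e)) = (LINT s:{0..t}|lborel. LINT z:{e..t - s + e}|lborel. src m u s z)"
    unfolding set_lebesgue_integral_def[of lborel "{0..t}"] snd[symmetric] fst[symmetric]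
    by (rule lborel_pair.Fubini_integral[OF F])
qed

lemma fubini_slab:
  assumes um[measurable]: "joint_borel u" and fin: "snorm m u < top"
  shows "(LINT y:{c..d}|lborel. acc m u 0 t y) = (LINT s:{0..t}|lborel. LINT z:{c - s..d - s}|lborel. src m u s z)"
proof -
  define F where "F = (\<lambda>s y. (indicator {c..d} y * src m u s (y + 0 - s)) * (indicator {0..t} s :: real))"
  have F: "integrable (lborel \<Otimes>\<^sub>M lborel) (case_prod F)"
    by (rule Bochner_Integration.integrable_bound[OF src_integrable[OF assms, of c d 0]])
      (auto simp: F_def indicator_def)
  have snd: "(LINT s|lborel. F s y) = indicator {c..d} y *\<^sub>R acc m u 0 t y" for y
  proof -
    have "(LINT s|lborel. F s y) = (LINT s|lborel. indicator {c..d} y * (indicator {0..t} s *\<^sub>R src m u s (y - s)))"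
      by (intro Bochner_Integration.integral_cong) (auto simp: F_def)
    then show ?thesis by (simp add: acc_def set_lebesgue_integral_def)
  qed
  have fst: "(LINT y|lborel. F s y) = indicator {0..t} s *\<^sub>R (LINT z:{c - s..d - s}|lborel. src m u s z)" for s
  proof -
    have "(LINT y|lborel. F s y) = indicator {0..t} s * (LINT y:{c..d}|lborel. src m u s (y + (- s)))"
      unfolding set_lebesgue_integral_def integral_mult_right_zero[symmetric]
      by (intro Bochner_Integration.integral_cong) (auto simp: F_def)
    then show ?thesis by (subst (asm) set_integral_shift) simp
  qed
  show ?thesis
    unfolding set_lebesgue_integral_def[of lborel "{c..d}"] set_lebesgue_integral_def[of lborel "{0..t}"] snd[symmetric] fst[symmetric]
    by (rule lborel_pair.Fubini_integral[OF F])
qed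

lemma AE_src_prim:
  assumes "joint_borel u" "snorm m u < top"
  shows "AE s in lborel. \<forall>c d. c \<le> d \<longrightarrow> (LINT z:{c..d}|lborel. src m u s z) = prim (src m u s) d - prim (src m u s) c"
  using AE_src_Lm[OF assms]
  by eventually_elim (auto intro!: integral_eq_prim_diff Lm_fun_set_integrable)

lemma prim_src_even: "prim (src m u s) (- \<sigma>) = prim (src m u s) \<sigma>"
  by (rule prim_even) (rule src_minus)

lemma flow_initial: "flow f u 0 0 = f"
  by (rule ext) (simp add: flow_def acc_def)

text \<open>The velocity involves values of the profile at the two edges of the window, which are
  meaningful only up to null sets; integrated in time they become integrals over intervals and can
  be compared with \<open>u\<close> at every radius.\<close>

lemma time_primitive:
  assumes f: "Lm_fun m f" and u: "sol 0 b f u" and t: "0 \<le> t" "t \<le> b" and r: "0 < r"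
  shows "set_integrable lborel {0..t} (\<lambda>\<tau>. prf_v (state f u \<tau>) r)"
    "u t r - u 0 r = (LINT \<tau>:{0..t}|lborel. prf_v (state f u \<tau>) r)"
proof -
  note um[measurable] = solD(1)[OF u]
  note fin = solD(2)[OF u]
  note fi = Lm_fun_set_integrable[OF f]
  note ai = Lm_fun_set_integrable[OF Lm_fun_acc[OF um fin]]
  let ?a = "\<lambda>e \<tau>. acc m u 0 \<tau> (\<tau> + e)"
  have v: "prf_v (state f u \<tau>) r = ((f (\<tau> + r) - f (\<tau> + (- r))) + \<iota> / 2 * (?a r \<tau> - ?a (- r) \<tau>)) / r" for \<tau>
    by (simp add: prf_v_def state_def flow_def algebra_simps)
  have fs: "set_integrable lborel {0..t} (\<lambda>\<tau>. f (\<tau> + e))" for e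
    by (rule Lm_fun_set_integrable[OF Lm_fun_shift[OF f]])
  note d = fubini_diagonal[OF um fin]
  have i1: "set_integrable lborel {0..t} (\<lambda>\<tau>. f (\<tau> + r) - f (\<tau> + (- r)))" by (intro set_integral_diff fs)
  have i2: "set_integrable lborel {0..t} (\<lambda>\<tau>. \<iota> / 2 * (?a r \<tau> - ?a (- r) \<tau>))"
    by (intro set_integrable_mult_right set_integral_diff d(1))
  show "set_integrable lborel {0..t} (\<lambda>\<tau>. prf_v (state f u \<tau>) r)"
    unfolding v by (intro set_integrable_divide set_integral_add i1 i2)
  have "(LINT \<tau>:{0..t}|lborel. f (\<tau> + r) - f (\<tau> + (- r))) = (LINT y:{r..t + r}|lborel. f y) - (LINT y:{- r..t - r}|lborel. f y)"
    using fs[of r] fs[of "- r"] set_integral_shift[of 0 t f r] set_integral_shift[of 0 t f "- r"]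
    by (subst set_integral_diff(2)) auto
  also have "\<dots> = (LINT y:{t - r..t + r}|lborel. f y) - (LINT y:{- r..r}|lborel. f y)"
    using t r by (simp add: integral_eq_prim_diff[OF fi])
  finally have e1: "(LINT \<tau>:{0..t}|lborel. f (\<tau> + r) - f (\<tau> + (- r))) = (LINT y:{t - r..t + r}|lborel. f y) - (LINT y:{- r..r}|lborel. f y)" .
  have "(LINT \<tau>:{0..t}|lborel. ?a r \<tau> - ?a (- r) \<tau>)
    = (LINT s:{0..t}|lborel. (LINT z:{r..t - s + r}|lborel. src m u s z) - (LINT z:{- r..t - s + - r}|lborel. src m u s z))"
    using d(1,2)[of t r] d(1,2)[of t "- r"] d(3)[of t r] d(3)[of t "- r"] by (simp add: set_integral_diff)
  \<comment> \<open>The source is odd, so its primitive is even: the contributions of the lower ends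
    \<open>r\<close> and \<open>- r\<close> cancel, and the window
    \<open>[t - s - r, t - s + r]\<close> is left.\<close>
  also have "\<dots> = (LINT s:{0..t}|lborel. LINT z:{t - r - s..t + r - s}|lborel. src m u s z)"
  proof (rule set_lebesgue_integral_cong_AE)
    show "AE s\<in>{0..t} in lborel. (LINT z:{r..t - s + r}|lborel. src m u s z) - (LINT z:{- r..t - s + - r}|lborel. src m u s z)
      = (LINT z:{t - r - s..t + r - s}|lborel. src m u s z)"
      using AE_src_prim[OF um fin]
    proof eventually_elim
      case (elim s)
      then have P: "c \<le> d \<Longrightarrow> (LINT z:{c..d}|lborel. src m u s z) = prim (src m u s) d - prim (src m u s) c" for c d by blast
      have e: "t - r - s = t - s + - r" "t + r - s = t - s + r" by auto
      show ?case
        unfolding e using r P[of r "t - s + r"] P[of "- r" "t - s + - r"] P[of "t - s + - r" "t - s + r"] prim_src_even[of u s r]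
        by (intro impI) simp
    qed
  qed (simp, (unfold set_lebesgue_integral_def indicator_def atLeastAtMost_iff, measurable)+)
  also have "\<dots> = (LINT y:{t - r..t + r}|lborel. acc m u 0 t y)" by (rule fubini_slab[OF um fin, symmetric])
  finally have e2: "(LINT \<tau>:{0..t}|lborel. ?a r \<tau> - ?a (- r) \<tau>) = (LINT y:{t - r..t + r}|lborel. acc m u 0 t y)" .
  have "(LINT \<tau>:{0..t}|lborel. prf_v (state f u \<tau>) r) = ((LINT \<tau>:{0..t}|lborel. f (\<tau> + r) - f (\<tau> + (- r))) + \<iota> / 2 * (LINT \<tau>:{0..t}|lborel. ?a r \<tau> - ?a (- r) \<tau>)) / r"
    unfolding v using i1 i2 by (simp add: set_integral_add del: set_integral_mult_right) simp
  also have "\<dots> = ((LINT y:{t - r..t + r}|lborel. f y + \<iota> / 2 * acc m u 0 t y) - (LINT y:{- r..r}|lborel. f y)) / r"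
    unfolding e1 e2 using fi ai by (simp add: set_integral_add)
  also have "\<dots> = u t r - u 0 r"
    using solD(4)[OF u, of t r] solD(4)[OF u, of 0 r] t r
    by (simp add: flow_initial) (simp add: avg_def flow_def diff_divide_distrib)
  finally show "u t r - u 0 r = (LINT \<tau>:{0..t}|lborel. prf_v (state f u \<tau>) r)" by simp
qed

text \<open>The source is odd, its primitive is even, and the absolute value in
  \<open>wave_profile\<close> disappears. The 2 in the denominator is that of
  \<open>wave_profile\<close>; it becomes the factor \<open>\<iota> / 2\<close> in
  \<open>flow\<close>.\<close>

lemma S_L_source:
  assumes [measurable]: "joint_borel u"
  shows "S_L \<tau> (\<lambda>\<rho>. 0) (\<lambda>\<rho>. \<bar>u s \<rho>\<bar> powr (2 * m) * u s \<rho>) r = (prim (src m u s) (\<tau> + r) - prim (src m u s) (\<tau> - r)) / (2 * r)"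
proof -
  have "wave_profile (\<lambda>\<rho>. 0) (\<lambda>\<rho>. \<bar>u s \<rho>\<bar> powr (2 * m) * u s \<rho>) \<sigma> = prim (src m u s) \<sigma> / 2" for \<sigma>
  proof -
    have "(LINT \<rho>:{0..\<bar>\<sigma>\<bar>}|lebesgue. \<rho> * (\<bar>u s \<rho>\<bar> powr (2 * m) * u s \<rho>)) = (LINT \<rho>:{0..\<bar>\<sigma>\<bar>}|lebesgue. src m u s \<rho>)"
      unfolding set_lebesgue_integral_def by (intro Bochner_Integration.integral_cong) (auto simp: src_def indicator_def)
    also have "\<dots> = (LINT \<rho>:{0..\<bar>\<sigma>\<bar>}|lborel. src m u s \<rho>)"
      unfolding set_lebesgue_integral_def by (rule integral_completion) measurable
    also have "\<dots> = prim (src m u s) \<bar>\<sigma>\<bar>" by (simp add: prim_def)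
    also have "\<dots> = prim (src m u s) \<sigma>" using prim_src_even[of u s \<sigma>] by (cases "0 \<le> \<sigma>") auto
    finally show ?thesis by (simp add: wave_profile_def)
  qed
  then show ?thesis unfolding S_L_def by (simp only: diff_divide_distrib divide_divide_eq_left)
qed

lemma duhamel_lborel:
  assumes [measurable]: "joint_borel u" and t: "0 \<le> t"
  shows "interval_lebesgue_integral lebesgue (ereal 0) (ereal t) (\<lambda>s. S_L (t - s) (\<lambda>\<rho>. 0) (\<lambda>\<rho>. \<bar>u s \<rho>\<bar> powr (2 * m) * u s \<rho>) r)
    = (LINT s:{0..t}|lborel. (prim (src m u s) (t - s + r) - prim (src m u s) (t - s - r)) / (2 * r))"
proof -
  have "interval_lebesgue_integral lebesgue (ereal 0) (ereal t) (\<lambda>s. S_L (t - s) (\<lambda>\<rho>. 0) (\<lambda>\<rho>. \<bar>u s \<rho>\<bar> powr (2 * m) * u s \<rho>) r)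
    = (LINT s:{0<..<t}|lborel. (prim (src m u s) (t - s + r) - prim (src m u s) (t - s - r)) / (2 * r))"
    unfolding S_L_source[OF assms(1)] interval_lebesgue_integral_def set_lebesgue_integral_def using t
    by (simp add: integral_completion)
  also have "\<dots> = (LINT s:{0..t}|lborel. (prim (src m u s) (t - s + r) - prim (src m u s) (t - s - r)) / (2 * r))"
    unfolding set_lebesgue_integral_def
    by (rule integral_cong_AE) (measurable, use AE_lborel_singleton[of 0] AE_lborel_singleton[of t] in \<open>eventually_elim, auto simp: indicator_def\<close>)
  finally show ?thesis .
qed

text \<open>Exchanging the time integral with the average identifies the stated integral equation
  with the fixed point form in \<open>sol\<close>. It is used in both directions.\<close>

lemma duhamel_flow:
  assumes f: "Lm_fun m f" and um[measurable]: "joint_borel u" and fin: "snorm m u < top"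
    and t: "0 \<le> t" and r: "0 < r"
  shows "avg (flow f u 0 t) t r = avg f t r +
    \<iota> * interval_lebesgue_integral lebesgue (ereal 0) (ereal t) (\<lambda>s. S_L (t - s) (\<lambda>\<rho>. 0) (\<lambda>\<rho>. \<bar>u s \<rho>\<bar> powr (2 * m) * u s \<rho>) r)"
proof -
  have "(LINT s:{0..t}|lborel. (prim (src m u s) (t - s + r) - prim (src m u s) (t - s - r)) / (2 * r))
    = (LINT s:{0..t}|lborel. (LINT z:{t - r - s..t + r - s}|lborel. src m u s z) / (2 * r))"
  proof (rule set_lebesgue_integral_cong_AE)
    show "AE s\<in>{0..t} in lborel. (prim (src m u s) (t - s + r) - prim (src m u s) (t - s - r)) / (2 * r) = (LINT z:{t - r - s..t + r - s}|lborel. src m u s z) / (2 * r)"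
      using AE_src_prim[OF um fin]
    proof eventually_elim
      case (elim s)
      then have "(LINT z:{t - r - s..t + r - s}|lborel. src m u s z) = prim (src m u s) (t + r - s) - prim (src m u s) (t - r - s)"
        using r by simp
      moreover have e: "t - s - r = t - r - s" "t - s + r = t + r - s" by auto
      ultimately show ?case unfolding e by simp
    qed
  qed (simp, (unfold set_lebesgue_integral_def indicator_def atLeastAtMost_iff, measurable)+)
  also have "\<dots> = (LINT y:{t - r..t + r}|lborel. acc m u 0 t y) / (2 * r)"
    using fubini_slab[OF um fin, of "t - r" "t + r" t] by simp
  finally have "interval_lebesgue_integral lebesgue (ereal 0) (ereal t) (\<lambda>s. S_L (t - s) (\<lambda>\<rho>. 0) (\<lambda>\<rho>. \<bar>u s \<rho>\<bar> powr (2 * m) * u s \<rho>) r)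
    = (LINT y:{t - r..t + r}|lborel. acc m u 0 t y) / (2 * r)"
    using duhamel_lborel[OF um t] by simp
  moreover have "avg (flow f u 0 t) t r = avg f t r + \<iota> / 2 * (LINT y:{t - r..t + r}|lborel. acc m u 0 t y) / r"
    unfolding avg_def flow_def using Lm_fun_set_integrable[OF f] Lm_fun_set_integrable[OF Lm_fun_acc[OF um fin]]
    by (simp add: set_integral_add add_divide_distrib)
  ultimately show ?thesis by simp
qed


text \<open>\<open>k\<close> stands for a test function times the volume density
  \<open>r ^ 2\<close>. One factor \<open>r\<close> compensates the \<open>1 / r\<close> in
  \<open>prf_v\<close>, so integrability of \<open>g\<close> near the origin is enough.\<close>

lemma weighted_prf_bound:
  assumes [measurable]: "g \<in> borel_measurable borel" "k \<in> borel_measurable borel"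
    and k: "\<And>r. \<bar>k r\<bar> \<le> c * r * indicator {0<..R} r" and c: "0 \<le> c"
  shows "(\<integral>\<^sup>+r. ennreal \<bar>prf_v g r * k r\<bar> \<partial>lborel) \<le> ennreal c * slide (\<lambda>y. ennreal \<bar>g y\<bar>) 0 R"
proof -
  have k0: "k r = 0" if "r \<notin> {0<..R}" for r using k[of r] that by simp
  have "(\<integral>\<^sup>+r. ennreal \<bar>prf_v g r * k r\<bar> \<partial>lborel)
    \<le> (\<integral>\<^sup>+r. ennreal c * (ennreal \<bar>g r\<bar> * indicator {0<..R} r + ennreal \<bar>g (- r)\<bar> * indicator {0<..R} r) \<partial>lborel)"
  proof (rule nn_integral_mono)
    fix r
    show "ennreal \<bar>prf_v g r * k r\<bar> \<le> ennreal c * (ennreal \<bar>g r\<bar> * indicator {0<..R} r + ennreal \<bar>g (- r)\<bar> * indicator {0<..R} r)"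
    proof (cases "r \<in> {0<..R}")
      case True
      have "\<bar>prf_v g r * k r\<bar> \<le> (\<bar>g r\<bar> + \<bar>g (- r)\<bar>) / r * (c * r)"
        unfolding abs_mult using True k[of r] by (intro mult_mono) (auto simp: prf_v_def abs_divide intro!: divide_right_mono)
      also have "\<dots> = c * (\<bar>g r\<bar> + \<bar>g (- r)\<bar>)" using True by simp
      finally show ?thesis
        using True c by (simp add: ennreal_mult[symmetric] ennreal_plus[symmetric] del: ennreal_plus)
    qed (use k0 in simp)
  qed
  also have "\<dots> = ennreal c * ((\<integral>\<^sup>+r. ennreal \<bar>g r\<bar> * indicator {0<..R} r \<partial>lborel) + (\<integral>\<^sup>+r. ennreal \<bar>g (- r)\<bar> * indicator {0<..R} r \<partial>lborel))"
    by (simp add: nn_integral_cmult nn_integral_add)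
  also have "(\<integral>\<^sup>+r. ennreal \<bar>g (- r)\<bar> * indicator {0<..R} r \<partial>lborel) = (\<integral>\<^sup>+r. ennreal \<bar>g r\<bar> * indicator {0<..R} (- r) \<partial>lborel)"
    by (subst nn_integral_real_affine[where c = "- 1" and t = 0]) auto
  also have "(\<integral>\<^sup>+r. ennreal \<bar>g r\<bar> * indicator {0<..R} r \<partial>lborel) + (\<integral>\<^sup>+r. ennreal \<bar>g r\<bar> * indicator {0<..R} (- r) \<partial>lborel)
    = (\<integral>\<^sup>+r. ennreal \<bar>g r\<bar> * indicator {0<..R} r + ennreal \<bar>g r\<bar> * indicator {0<..R} (- r) \<partial>lborel)"
    by (simp add: nn_integral_add)
  also have "\<dots> \<le> slide (\<lambda>y. ennreal \<bar>g y\<bar>) 0 R"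
    unfolding slide_def by (rule nn_integral_mono) (auto simp: indicator_def)
  finally show ?thesis by (simp add: mult_left_mono)
qed

lemma weighted_prf_integrable:
  assumes g: "Lm_fun m g" and [measurable]: "k \<in> borel_measurable borel"
    and k: "\<And>r. \<bar>k r\<bar> \<le> c * r * indicator {0<..R} r" and c: "0 \<le> c"
  shows "integrable lborel (\<lambda>r. prf_v g r * k r)"
proof -
  have [measurable]: "g \<in> borel_measurable borel" using g by (simp add: Lm_fun_def)
  have "(\<integral>\<^sup>+r. ennreal \<bar>prf_v g r * k r\<bar> \<partial>lborel) \<le> ennreal c * slide (\<lambda>y. ennreal \<bar>g y\<bar>) 0 R"
    by (rule weighted_prf_bound[OF _ _ k c]) auto
  also have "\<dots> < top" using Lm_fun_slide_finite[OF g] by (simp add: ennreal_mult_less_top)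
  finally show ?thesis by (simp add: integrable_iff_bounded)
qed

lemma weighted_avg_integrable:
  assumes g: "Lm_fun m g" and [measurable]: "k \<in> borel_measurable borel"
    and k: "\<And>r. \<bar>k r\<bar> \<le> c * r * indicator {0<..R} r" and c: "0 \<le> c" and R: "0 < R"
  shows "integrable lborel (\<lambda>r. avg g 0 r * k r)"
proof -
  have [measurable]: "g \<in> borel_measurable borel" using g by (simp add: Lm_fun_def)
  have k0: "k r = 0" if "r \<notin> {0<..R}" for r using k[of r] that by simp
  have "(\<integral>\<^sup>+r. ennreal \<bar>avg g 0 r * k r\<bar> \<partial>lborel) \<le> (\<integral>\<^sup>+r. (slide (\<lambda>y. ennreal \<bar>g y\<bar>) 0 R * ennreal c) * indicator {0<..R} r \<partial>lborel)"
  proof (rule nn_integral_mono)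
    fix r
    show "ennreal \<bar>avg g 0 r * k r\<bar> \<le> slide (\<lambda>y. ennreal \<bar>g y\<bar>) 0 R * ennreal c * indicator {0<..R} r"
    proof (cases "r \<in> {0<..R}")
      case True
      have "ennreal \<bar>avg g 0 r * k r\<bar> = ennreal \<bar>avg g 0 r\<bar> * ennreal \<bar>k r\<bar>" by (simp add: abs_mult ennreal_mult)
      also have "\<dots> \<le> (slide (\<lambda>y. ennreal \<bar>g y\<bar>) 0 R * ennreal (1 / r)) * ennreal (c * r)"
        using True k[of r]
        by (intro mult_mono order_trans[OF abs_avg_le] slide_mono ennreal_leI) (auto simp: ennreal_mult)
      also have "\<dots> = slide (\<lambda>y. ennreal \<bar>g y\<bar>) 0 R * ennreal c"
        using True c by (simp add: mult.assoc ennreal_mult[symmetric])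
      finally show ?thesis using True by simp
    qed (use k0 in simp)
  qed
  also have "\<dots> = slide (\<lambda>y. ennreal \<bar>g y\<bar>) 0 R * ennreal c * ennreal R"
    using R by (subst nn_integral_cmult_indicator) auto
  also have "\<dots> < top" using Lm_fun_slide_finite[OF g] by (simp add: ennreal_mult_less_top)
  finally show ?thesis by (simp add: integrable_iff_bounded)
qed

lemma measurable_state [measurable]:
  assumes [measurable]: "f \<in> borel_measurable borel" "joint_borel u" "a \<in> borel_measurable M" "b \<in> borel_measurable M"
  shows "(\<lambda>x. state f u (a x) (b x)) \<in> borel_measurable M"
  unfolding state_def by measurable

text \<open>At each radius \<open>time_primitive\<close> applies; exchanging the integrals in \<tau>
  and \<open>r\<close> rests on a majorant of the profiles that is uniform in \<tau>.\<close>

lemma time_primitive_weighted: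
  assumes f: "Lm_fun m f" and u: "sol 0 b f u" and t: "0 \<le> t" "t \<le> b" and km[measurable]: "k \<in> borel_measurable borel"
    and k: "\<And>r. \<bar>k r\<bar> \<le> c * r * indicator {0<..R} r" and c: "0 \<le> c" and R: "0 < R"
  shows "(LINT r|lborel. u t r * k r) - (LINT r|lborel. u 0 r * k r) = (LINT \<tau>:{0..t}|lborel. LINT r|lborel. prf_v (state f u \<tau>) r * k r)"
proof -
  note um[measurable] = solD(1)[OF u]
  note fin = solD(2)[OF u]
  have [measurable]: "f \<in> borel_measurable borel" using f by (simp add: Lm_fun_def)
  have k0: "k r = 0" if "r \<notin> {0<..R}" for r using k[of r] that by simp
  define F where "F = (\<lambda>\<tau> r. indicator {0..t} \<tau> * (prf_v (state f u \<tau>) r * k r))"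
  have Fm: "case_prod F \<in> borel_measurable (lborel \<Otimes>\<^sub>M lborel)" unfolding F_def prf_v_def by measurable
  \<comment> \<open>Bounds all \<open>flow f u 0 \<tau>\<close> at once, because \<open>mass\<close>
    counts the sources of all times.\<close>
  define M where "M = (\<lambda>y. ennreal \<bar>f y\<bar> + mass m u (\<lambda>t r. 0) y)"
  have [measurable]: "M \<in> borel_measurable borel" unfolding M_def by measurable
  have M: "ennreal \<bar>flow f u 0 \<tau> y\<bar> \<le> M y" for \<tau> y
  proof -
    have "\<bar>flow f u 0 \<tau> y\<bar> \<le> \<bar>f y\<bar> + \<bar>\<iota> / 2 * acc m u 0 \<tau> y\<bar>" unfolding flow_def by (rule abs_triangle_ineq)
    also have "\<bar>\<iota> / 2 * acc m u 0 \<tau> y\<bar> = \<bar>acc m u 0 \<tau> y\<bar> / 2" using \<iota> by (simp add: abs_mult)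
    also have "\<bar>f y\<bar> + \<bar>acc m u 0 \<tau> y\<bar> / 2 \<le> \<bar>f y\<bar> + \<bar>acc m u 0 \<tau> y\<bar>" by simp
    finally have "ennreal \<bar>flow f u 0 \<tau> y\<bar> \<le> ennreal \<bar>f y\<bar> + ennreal \<bar>acc m u 0 \<tau> y\<bar>"
      by (simp add: ennreal_plus[symmetric] ennreal_leI del: ennreal_plus)
    also have "\<dots> \<le> M y" unfolding M_def by (intro add_left_mono acc_le_mass)
    finally show ?thesis .
  qed
  have Mfin: "slide M s \<rho> < top" for s \<rho>
    unfolding M_def using Lm_fun_slide_finite[OF f] mass_slide_finite[OF um fin] by (simp add: slide_add)
  have bound: "(\<integral>\<^sup>+r. ennreal \<bar>prf_v (state f u \<tau>) r * k r\<bar> \<partial>lborel) \<le> ennreal c * slide M 0 (t + R)" if "\<tau> \<in> {0..t}" for \<tau>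
  proof -
    have "(\<integral>\<^sup>+r. ennreal \<bar>prf_v (state f u \<tau>) r * k r\<bar> \<partial>lborel) \<le> ennreal c * slide (\<lambda>y. ennreal \<bar>state f u \<tau> y\<bar>) 0 R"
      by (rule weighted_prf_bound[OF _ _ k c]) measurable
    also have "slide (\<lambda>y. ennreal \<bar>state f u \<tau> y\<bar>) 0 R \<le> (\<integral>\<^sup>+y\<in>{- R..R}. M (\<tau> + 1 * y) \<partial>lborel)"
      unfolding slide_def state_def by (intro nn_integral_mono mult_mono) (auto simp: M add.commute)
    also have "\<dots> \<le> (\<integral>\<^sup>+y. M (\<tau> + 1 * y) * indicator {0 - (t + R)..0 + (t + R)} (\<tau> + 1 * y) \<partial>lborel)"
      using that by (intro nn_integral_mono mult_left_mono) (auto simp: indicator_def)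
    also have "\<dots> = slide M 0 (t + R)"
      unfolding slide_def by (subst (2) nn_integral_real_affine[where c = 1 and t = \<tau>]) auto
    finally show ?thesis by (simp add: mult_left_mono)
  qed
  have F: "integrable (lborel \<Otimes>\<^sub>M lborel) (case_prod F)"
    unfolding integrable_iff_bounded
  proof
    have "(\<integral>\<^sup>+p. ennreal (norm (case_prod F p)) \<partial>(lborel \<Otimes>\<^sub>M lborel)) = (\<integral>\<^sup>+\<tau>. \<integral>\<^sup>+r. ennreal (norm (F \<tau> r)) \<partial>lborel \<partial>lborel)"
      using Fm by (subst lborel.nn_integral_fst[symmetric]) auto
    also have "\<dots> \<le> (\<integral>\<^sup>+\<tau>. (ennreal c * slide M 0 (t + R)) * indicator {0..t} \<tau> \<partial>lborel)"
    proof (rule nn_integral_mono)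
      fix \<tau>
      show "(\<integral>\<^sup>+r. ennreal (norm (F \<tau> r)) \<partial>lborel) \<le> ennreal c * slide M 0 (t + R) * indicator {0..t} \<tau>"
        using bound[of \<tau>] by (cases "\<tau> \<in> {0..t}") (auto simp: F_def)
    qed
    also have "\<dots> = ennreal c * slide M 0 (t + R) * ennreal t"
      using t by (subst nn_integral_cmult_indicator) auto
    also have "\<dots> < top" using Mfin by (simp add: ennreal_mult_less_top)
    finally show "(\<integral>\<^sup>+p. ennreal (norm (case_prod F p)) \<partial>(lborel \<Otimes>\<^sub>M lborel)) < \<infinity>" by simp
  qed (rule Fm)
  have ui: "integrable lborel (\<lambda>r. u s r * k r)" if "0 \<le> s" "s \<le> b" for s
  proof -
    have "integrable lborel (\<lambda>r. avg (state f u s) 0 r * k r)"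
      by (rule weighted_avg_integrable[OF Lm_fun_state[OF f u] km k c R])
    moreover have "avg (state f u s) 0 r * k r = u s r * k r" for r
      using sol_eq_state[OF u that, of r] k0[of r] by (cases "0 < r") auto
    ultimately show ?thesis by simp
  qed
  have "(LINT r|lborel. u t r * k r) - (LINT r|lborel. u 0 r * k r) = (LINT r|lborel. u t r * k r - u 0 r * k r)"
    using t by (intro Bochner_Integration.integral_diff[symmetric] ui) auto
  also have "\<dots> = (LINT r|lborel. LINT \<tau>|lborel. F \<tau> r)"
  proof (rule Bochner_Integration.integral_cong)
    fix r
    show "u t r * k r - u 0 r * k r = (LINT \<tau>|lborel. F \<tau> r)"
    proof (cases "0 < r")
      case True
      have "u t r * k r - u 0 r * k r = (LINT \<tau>:{0..t}|lborel. prf_v (state f u \<tau>) r) * k r"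
        using time_primitive(2)[OF f u t True] by (simp add: algebra_simps)
      also have "\<dots> = (LINT \<tau>|lborel. F \<tau> r)"
        unfolding set_lebesgue_integral_def integral_mult_left_zero[symmetric] F_def
        by (intro Bochner_Integration.integral_cong) auto
      finally show ?thesis .
    next
      case False
      then show ?thesis using k0[of r] by (simp add: F_def)
    qed
  qed simp
  also have "\<dots> = (LINT \<tau>|lborel. LINT r|lborel. F \<tau> r)" by (rule lborel_pair.Fubini_integral[OF F])
  also have "\<dots> = (LINT \<tau>:{0..t}|lborel. LINT r|lborel. prf_v (state f u \<tau>) r * k r)"
    unfolding set_lebesgue_integral_def F_def by simp
  finally show ?thesis .
qed

text \<open>Continuity upgrades the integral formula to a derivative at every time, including the
  end points of the interval.\<close>

lemma weighted_velocity_continuous: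
  assumes f: "Lm_fun m f" and u: "sol 0 b f u" and km[measurable]: "k \<in> borel_measurable borel"
    and k: "\<And>r. \<bar>k r\<bar> \<le> c * r * indicator {0<..R} r" and c: "0 \<le> c" and R: "0 < R"
  shows "continuous_on {0..b} (\<lambda>\<tau>. LINT r|lborel. prf_v (state f u \<tau>) r * k r)"
  unfolding continuous_on_iff
proof (intro ballI allI impI)
  note um[measurable] = solD(1)[OF u]
  have [measurable]: "f \<in> borel_measurable borel" using f by (simp add: Lm_fun_def)
  let ?V = "\<lambda>\<tau>. LINT r|lborel. prf_v (state f u \<tau>) r * k r"
  fix t0 e :: real assume t0: "t0 \<in> {0..b}" and e: "0 < e"
  \<comment> \<open>\<open>c + 1\<close> instead of \<open>c\<close> keeps \<open>K\<close> positive
    when \<open>c\<close> is 0.\<close>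
  define K where "K = (c + 1) * (4 * R powr (1 - 1 / m))"
  have K: "0 < K" unfolding K_def using c R by (intro mult_pos_pos) auto
  define \<Lambda> where "\<Lambda> = e / (2 * K)"
  have \<Lambda>: "0 < \<Lambda>" "K * \<Lambda> = e / 2" using e K by (auto simp: \<Lambda>_def)
  obtain d where d: "0 < d" "\<And>t. 0 \<le> t \<Longrightarrow> \<bar>t - t0\<bar> < d \<Longrightarrow> (\<integral>\<^sup>+y. ennreal (\<bar>state f u t y - state f u t0 y\<bar> powr m) \<partial>lborel) < ennreal (\<Lambda> powr m)"
    using state_continuous[OF f u, of t0 "\<Lambda> powr m"] t0 \<Lambda> by auto
  show "\<exists>d>0. \<forall>x'\<in>{0..b}. dist x' t0 < d \<longrightarrow> dist (?V x') (?V t0) < e"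
  proof (intro exI[of _ d] conjI d(1) ballI impI)
    fix t assume t: "t \<in> {0..b}" "dist t t0 < d"
    define g where "g = (\<lambda>y. state f u t y - state f u t0 y)"
    have gm[measurable]: "g \<in> borel_measurable borel" unfolding g_def by measurable
    have "?V t - ?V t0 = (LINT r|lborel. prf_v (state f u t) r * k r - prf_v (state f u t0) r * k r)"
      by (intro Bochner_Integration.integral_diff[symmetric] weighted_prf_integrable[OF _ km k c] Lm_fun_state[OF f u])
    also have "\<dots> = (LINT r:UNIV|lborel. prf_v g r * k r)"
      unfolding set_lebesgue_integral_def
      by (intro Bochner_Integration.integral_cong) (auto simp: prf_v_def g_def diff_divide_distrib[symmetric] left_diff_distrib[symmetric] algebra_simps)
    finally have "ennreal \<bar>?V t - ?V t0\<bar> \<le> (\<integral>\<^sup>+r\<in>UNIV. ennreal \<bar>prf_v g r * k r\<bar> \<partial>lborel)"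
      by (simp only: abs_set_integral_le)
    also have "\<dots> \<le> ennreal c * slide (\<lambda>y. ennreal \<bar>g y\<bar>) 0 R"
      using weighted_prf_bound[OF gm km k c] by simp
    also have "\<dots> \<le> ennreal c * ennreal (4 * R powr (1 - 1 / m) * \<Lambda>)"
    proof (intro mult_left_mono slide_bound m R \<Lambda>)
      show "(\<integral>\<^sup>+y. ennpowr (ennreal \<bar>g y\<bar>) m \<partial>lborel) \<le> ennreal (\<Lambda> powr m)"
        using d(2)[of t] t by (simp add: ennpowr_ennreal g_def dist_real_def)
    qed auto
    also have "\<dots> = ennreal (c * (4 * R powr (1 - 1 / m) * \<Lambda>))" using c \<Lambda> by (simp add: ennreal_mult)
    finally have "\<bar>?V t - ?V t0\<bar> \<le> c * (4 * R powr (1 - 1 / m) * \<Lambda>)" using c \<Lambda> by (subst (asm) ennreal_le_iff) auto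
    also have "c * (4 * R powr (1 - 1 / m) * \<Lambda>) \<le> K * \<Lambda>" using \<Lambda> by (auto simp: K_def intro!: mult_right_mono)
    also have "K * \<Lambda> < e" using \<Lambda> e by simp
    finally show "dist (?V t) (?V t0) < e" unfolding dist_real_def .
  qed
qed

lemma sol_has_time_deriv:
  assumes f: "Lm_fun m f" and u: "sol 0 b f u"
  shows "has_time_deriv {0..b} u (\<lambda>t. prf_v (state f u t))"
  unfolding has_time_deriv_def
proof (intro allI impI ballI)
  note um[measurable] = solD(1)[OF u]
  have [measurable]: "f \<in> borel_measurable borel" using f by (simp add: Lm_fun_def)
  fix \<phi> t assume \<phi>: "radial_test \<phi>" and t: "t \<in> {0..b}"
  obtain g R B where cont: "continuous_on UNIV (\<lambda>r. \<phi> \<bar>r\<bar>)" and z: "\<And>r. R < r \<Longrightarrow> \<phi> r = 0 \<and> g r = 0"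
    and B: "\<And>r. 0 < r \<Longrightarrow> \<bar>\<phi> r\<bar> \<le> B \<and> \<bar>g r\<bar> \<le> B" and R: "0 < R"
    by (rule radial_test_properties[OF \<phi>]) blast
  \<comment> \<open>Only \<open>\<phi> \<bar>r\<bar>\<close> is known to be continuous; \<phi>
    itself is arbitrary at negative arguments.\<close>
  define k where "k = (\<lambda>r. \<phi> \<bar>r\<bar> * r\<^sup>2 * indicator {0<..R} r)"
  have [measurable]: "(\<lambda>r. \<phi> \<bar>r\<bar>) \<in> borel_measurable borel" using cont by (rule borel_measurable_continuous_onI)
  have km[measurable]: "k \<in> borel_measurable borel" unfolding k_def by measurable
  have c: "0 \<le> B * R" using B[of 1] R by auto
  have k: "\<bar>k r\<bar> \<le> (B * R) * r * indicator {0<..R} r" for r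
  proof (cases "r \<in> {0<..R}")
    case True
    have "\<bar>\<phi> r\<bar> * r\<^sup>2 \<le> B * (R * r)"
      unfolding power2_eq_square using True B[of r] by (intro mult_mono) auto
    then show ?thesis using True by (simp add: k_def abs_mult mult_ac)
  qed (simp add: k_def)
  have pair: "(LINT r:{0<..}|lebesgue. w r * \<phi> r * r\<^sup>2) = (LINT r|lborel. w r * k r)" if [measurable]: "w \<in> borel_measurable borel" for w
  proof -
    have "(LINT r:{0<..}|lebesgue. w r * \<phi> r * r\<^sup>2) = (LINT r|lebesgue. w r * k r)"
      unfolding set_lebesgue_integral_def
    proof (rule Bochner_Integration.integral_cong)
      fix r :: real
      show "indicator {0<..} r *\<^sub>R (w r * \<phi> r * r\<^sup>2) = w r * k r"
        using z[of r] by (cases "0 < r"; cases "r \<le> R") (auto simp: k_def)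
    qed simp
    then show ?thesis by (simp add: integral_completion)
  qed
  let ?V = "\<lambda>\<tau>. LINT r|lborel. prf_v (state f u \<tau>) r * k r"
  have V: "continuous_on {0..b} ?V" by (rule weighted_velocity_continuous[OF f u km k c R])
  have U: "(LINT r:{0<..}|lebesgue. u s r * \<phi> r * r\<^sup>2) = (LINT r|lborel. u 0 r * k r) + integral {0..s} ?V" if "s \<in> {0..b}" for s
  proof -
    have "set_integrable lborel {0..s} ?V"
      using that by (intro borel_integrable_atLeastAtMost' continuous_on_subset[OF V]) auto
    then have "(LINT \<tau>:{0..s}|lborel. ?V \<tau>) = integral {0..s} ?V" by (rule set_borel_integral_eq_integral)
    then show ?thesis
      using time_primitive_weighted[OF f u _ _ km k c R, of s] that by (subst pair) auto
  qed
  have "((\<lambda>s. integral {0..s} ?V) has_real_derivative ?V t) (at t within {0..b})"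
    unfolding has_real_derivative_iff_has_vector_derivative by (rule integral_has_vector_derivative[OF V t])
  then have "((\<lambda>s. (LINT r|lborel. u 0 r * k r) + integral {0..s} ?V) has_real_derivative ?V t) (at t within {0..b})"
    by (auto intro!: derivative_eq_intros)
  then have "((\<lambda>s. LINT r:{0<..}|lebesgue. u s r * \<phi> r * r\<^sup>2) has_real_derivative ?V t) (at t within {0..b})"
    by (rule has_field_derivative_transform_within[where d = 1]) (use t U in auto)
  moreover have "?V t = (LINT r:{0<..}|lebesgue. prf_v (state f u t) r * \<phi> r * r\<^sup>2)"
    by (rule pair[symmetric]) measurable
  ultimately show "((\<lambda>s. LINT r:{0<..}|lebesgue. u s r * \<phi> r * r\<^sup>2) has_real_derivative (LINT r:{0<..}|lebesgue. prf_v (state f u t) r * \<phi> r * r\<^sup>2)) (at t within {0..b})"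
    by simp
qed

end

section \<open>Time reversal and well-posedness\<close>

lemma S_norm_eq: "S_norm m I w = ennpowr (S_int m (\<lambda>t r. ennreal \<bar>w t r\<bar> * indicator I t)) (1 / (2 * m + 1))"
proof -
  have e: "ennreal (\<bar>w t r\<bar> powr ((2 * m + 1) * m) * r powr m) = ennpowr (ennreal \<bar>w t r\<bar>) ((2 * m + 1) * m) * ennreal (r powr m)" for t r
    by (simp add: ennpowr_ennreal ennreal_mult)
  have i: "ennpowr (\<integral>\<^sup>+r\<in>{0<..}. ennpowr (ennreal \<bar>w t r\<bar>) ((2 * m + 1) * m) * ennreal (r powr m) \<partial>lborel) (1 / m) * indicator I t
    = ennpowr (\<integral>\<^sup>+r\<in>{0<..}. ennpowr (ennreal \<bar>w t r\<bar> * indicator I t) ((2 * m + 1) * m) * ennreal (r powr m) \<partial>lborel) (1 / m)" for t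
    by (cases "t \<in> I") auto
  show ?thesis
    unfolding S_norm_def S_int_def nn_integral_completion e i ..
qed

lemma S_int_reflect:
  assumes [measurable]: "joint_borel B"
  shows "S_int m (\<lambda>t r. B (- t) r) = S_int m B"
  unfolding S_int_def by (subst (2) nn_integral_real_affine[where c = "- 1" and t = 0]) auto

text \<open>\<open>radial_pointwise\<close> asks for a Borel derivative and decay at infinity, which
  both members of the space supply. Convergence in the energy norm becomes convergence at each
  radius, uniformly away from 0.\<close>

lemma Lm_norm_pointwise:
  assumes m: "1 < m" and w: "(w0, v0) \<in> Lm_space m" "(w1, v1) \<in> Lm_space m"
    and x: "0 < x" "Lm_norm m (\<lambda>r. w0 r - w1 r) (\<lambda>r. v0 r - v1 r) \<le> ennreal x" and r: "0 < r"
  shows "\<bar>w0 r - w1 r\<bar> \<le> 2 * (m - 1) powr ((m - 1) / m) * r powr (- 1 / m) * x"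
proof -
  obtain p0 k0 where [measurable]: "p0 \<in> borel_measurable borel" "k0 \<in> borel_measurable borel" and p0: "has_radial_deriv w0 p0"
    "(w0 \<longlongrightarrow> 0) at_top" "AE r in lebesgue. 0 < r \<longrightarrow> v0 r = k0 r"
    by (rule Lm_space_D[OF m w(1)]) blast
  obtain p1 k1 where [measurable]: "p1 \<in> borel_measurable borel" "k1 \<in> borel_measurable borel" and p1: "has_radial_deriv w1 p1"
    "(w1 \<longlongrightarrow> 0) at_top" "AE r in lebesgue. 0 < r \<longrightarrow> v1 r = k1 r"
    by (rule Lm_space_D[OF m w(2)]) blast
  let ?p = "\<lambda>r. p0 r - p1 r" and ?k = "\<lambda>r. k0 r - k1 r"
  have p: "has_radial_deriv (\<lambda>r. w0 r - w1 r) ?p" by (rule has_radial_deriv_diff[OF p0(1) p1(1)])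
  have k: "AE r in lebesgue. 0 < r \<longrightarrow> v0 r - v1 r = ?k r" using p0(3) p1(3) by eventually_elim auto
  have "rad_Lm m ?p \<le> ennpowr (ennpowr (rad_Lm m ?p + rad_Lm m ?k) (1 / m)) m"
    using m by (simp add: ennpowr_ennpowr)
  also have "\<dots> \<le> ennpowr (ennreal x) m"
    using x(2) Lm_norm_eq[OF _ _ p k, of m] m by (intro ennpowr_mono) auto
  also have "\<dots> = ennreal (x powr m)" using x by (simp add: ennpowr_ennreal)
  finally have "rad_Lm m ?p \<le> ennreal (x powr m)" .
  moreover have "((\<lambda>r. w0 r - w1 r) \<longlongrightarrow> 0) at_top" using tendsto_diff[OF p0(2) p1(2)] by simp
  ultimately show ?thesis by (intro radial_pointwise[OF m _ p _ r x(1)]) auto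
qed

lemma has_radial_deriv_continuous_on:
  assumes "has_radial_deriv w p"
  shows "continuous_on {0<..} w"
  unfolding continuous_on_eq_continuous_within
proof
  fix x :: real assume x: "x \<in> {0<..}"
  define a b where "a = x / 2" "b = x + 1"
  have ab: "0 < a" "a < x" "x < b" using x by (auto simp: a_b_def)
  have "set_integrable lebesgue {a..b} p" using has_radial_derivD[OF assms ab(1)] ab by auto
  then have "continuous_on {a..b} (\<lambda>y. integral {a..y} p)"
    by (intro indefinite_integral_continuous_1 set_lebesgue_integral_eq_integral(1))
  then have "continuous_on {a..b} (\<lambda>y. w a + integral {a..y} p)" by (intro continuous_intros)
  moreover have "w a + integral {a..y} p = w y" if "y \<in> {a..b}" for y
    using has_radial_derivD[OF assms ab(1), of y] that set_lebesgue_integral_eq_integral(2)[of "{a..y}" p] by auto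
  ultimately have "continuous_on {a..b} w" by (rule continuous_on_eq)
  then have "isCont w x" using ab by (intro continuous_on_interior[of "{a..b}"]) auto
  then show "continuous (at x within {0<..}) w" by (rule continuous_at_imp_continuous_at_within)
qed

section \<open>Symmetry under time reversal\<close>

lemma ili_reflect:
  fixes g :: "real \<Rightarrow> real"
  shows "interval_lebesgue_integral lebesgue (ereal 0) (ereal (- t)) g = - interval_lebesgue_integral lebesgue (ereal 0) (ereal t) (\<lambda>s. g (- s))"
proof -
  have r: "(LINT s:einterval (ereal a) (ereal b)|lebesgue. g s) = (LINT s:einterval (ereal (- b)) (ereal (- a))|lebesgue. g (- s))" for a b
    unfolding set_lebesgue_integral_def
    by (subst lebesgue_integral_real_affine[where c = "- 1" and t = 0])
      (auto intro!: Bochner_Integration.integral_cong simp: indicator_def einterval_eq)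
  show ?thesis
    using r[of 0 "- t"] r[of "- t" 0]
    by (cases t "0 :: real" rule: linorder_cases) (auto simp: interval_lebesgue_integral_def zero_ereal_def einterval_eq set_lebesgue_integral_def)
qed

lemma ili_minus: "interval_lebesgue_integral M a b (\<lambda>s. - g s) = - interval_lebesgue_integral M a b (g :: real \<Rightarrow> real)"
  by (simp add: interval_lebesgue_integral_def set_lebesgue_integral_def)

lemma S_L_reflect: "S_L (- t) w0 w1 r = S_L t w0 (\<lambda>\<rho>. - w1 \<rho>) r"
proof -
  have P: "wave_profile w0 w1 (- \<sigma>) = - wave_profile w0 (\<lambda>\<rho>. - w1 \<rho>) \<sigma>" for \<sigma>
    by (simp add: wave_profile_def set_lebesgue_integral_def)
  have "- t + r = - (t - r)" "- t - r = - (t + r)" by auto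
  then show ?thesis unfolding S_L_def P by (simp only: P) simp
qed

lemma S_L_source_minus: "S_L t (\<lambda>\<rho>. 0) (\<lambda>\<rho>. - k \<rho>) r = - S_L t (\<lambda>\<rho>. 0) k r"
proof -
  have "wave_profile (\<lambda>\<rho>. 0) (\<lambda>\<rho>. - k \<rho>) \<sigma> = - wave_profile (\<lambda>\<rho>. 0) k \<sigma>" for \<sigma>
    by (simp add: wave_profile_def set_lebesgue_integral_def)
  then show ?thesis by (simp add: S_L_def diff_divide_distrib)
qed

lemma integral_equation_reflect:
  assumes e: "integral_equation m \<iota> J u0 u1 w"
  shows "integral_equation m \<iota> (uminus ` J) u0 (\<lambda>r. - u1 r) (\<lambda>t. w (- t))"
  unfolding integral_equation_def
proof (intro ballI allI impI)
  fix t r :: real assume t: "t \<in> uminus ` J" and r: "0 < r"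
  let ?N = "\<lambda>s \<rho>. \<bar>w s \<rho>\<bar> powr (2 * m) * w s \<rho>"
  have eq: "w (- t) r = S_L (- t) u0 u1 r + \<iota> * interval_lebesgue_integral lebesgue (ereal 0) (ereal (- t)) (\<lambda>s. S_L (- t - s) (\<lambda>\<rho>. 0) (?N s) r)"
  proof -
    have "- t \<in> J" using t by auto
    from e[unfolded integral_equation_def, rule_format, OF this r] show ?thesis .
  qed
  have "(\<lambda>s. S_L (- t - - s) (\<lambda>\<rho>. 0) (?N (- s)) r) = (\<lambda>s. - S_L (t - s) (\<lambda>\<rho>. 0) (?N (- s)) r)"
  proof
    fix s
    have "- t - - s = - (t - s)" by simp
    then show "S_L (- t - - s) (\<lambda>\<rho>. 0) (?N (- s)) r = - S_L (t - s) (\<lambda>\<rho>. 0) (?N (- s)) r"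
      by (simp only: S_L_reflect S_L_source_minus)
  qed
  then have ili: "interval_lebesgue_integral lebesgue (ereal 0) (ereal (- t)) (\<lambda>s. S_L (- t - s) (\<lambda>\<rho>. 0) (?N s) r)
    = interval_lebesgue_integral lebesgue (ereal 0) (ereal t) (\<lambda>s. S_L (t - s) (\<lambda>\<rho>. 0) (?N (- s)) r)"
    unfolding ili_reflect by (simp only: ili_minus minus_minus)
  show "w (- t) r = S_L t u0 (\<lambda>r. - u1 r) r + \<iota> * interval_lebesgue_integral lebesgue (ereal 0) (ereal t) (\<lambda>s. S_L (t - s) (\<lambda>\<rho>. 0) (?N (- s)) r)"
    unfolding eq ili S_L_reflect ..
qed

lemma integral_equation_cong:
  assumes w: "\<And>t r. 0 \<le> t \<Longrightarrow> t \<le> b \<Longrightarrow> 0 < r \<Longrightarrow> w t r = w' t r" and e: "integral_equation m \<iota> {0..b} u0 u1 w"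
  shows "integral_equation m \<iota> {0..b} u0 u1 w'"
  unfolding integral_equation_def
proof (intro ballI allI impI)
  fix t r :: real assume t: "t \<in> {0..b}" and r: "0 < r"
  have P: "wave_profile (\<lambda>\<rho>. 0) (\<lambda>\<rho>. \<bar>w s \<rho>\<bar> powr (2 * m) * w s \<rho>) = wave_profile (\<lambda>\<rho>. 0) (\<lambda>\<rho>. \<bar>w' s \<rho>\<bar> powr (2 * m) * w' s \<rho>)" if "0 \<le> s" "s \<le> b" for s
  proof -
    \<comment> \<open>The two functions may differ at \<open>\<rho> = 0\<close>, where the factor
      \<rho> makes both sides vanish.\<close>
    have h: "indicator {0..c} \<rho> *\<^sub>R (\<rho> * (\<bar>w s \<rho>\<bar> powr (2 * m) * w s \<rho>)) = indicator {0..c} \<rho> *\<^sub>R (\<rho> * (\<bar>w' s \<rho>\<bar> powr (2 * m) * w' s \<rho>))" for c \<rho>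
      using w[OF that, of \<rho>] by (cases \<rho> "0 :: real" rule: linorder_cases) auto
    show ?thesis unfolding wave_profile_def set_lebesgue_integral_def h ..
  qed
  have "interval_lebesgue_integral lebesgue (ereal 0) (ereal t) (\<lambda>s. S_L (t - s) (\<lambda>\<rho>. 0) (\<lambda>\<rho>. \<bar>w s \<rho>\<bar> powr (2 * m) * w s \<rho>) r)
    = interval_lebesgue_integral lebesgue (ereal 0) (ereal t) (\<lambda>s. S_L (t - s) (\<lambda>\<rho>. 0) (\<lambda>\<rho>. \<bar>w' s \<rho>\<bar> powr (2 * m) * w' s \<rho>) r)"
  proof (rule interval_lebesgue_integral_cong)
    fix s assume "s \<in> einterval (ereal 0) (ereal t)"
    then have "0 \<le> s" "s \<le> b" using t by (auto simp: einterval_eq)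
    from P[OF this] show "S_L (t - s) (\<lambda>\<rho>. 0) (\<lambda>\<rho>. \<bar>w s \<rho>\<bar> powr (2 * m) * w s \<rho>) r = S_L (t - s) (\<lambda>\<rho>. 0) (\<lambda>\<rho>. \<bar>w' s \<rho>\<bar> powr (2 * m) * w' s \<rho>) r"
      unfolding S_L_def by simp
  qed (use t in auto)
  moreover have "w t r = S_L t u0 u1 r + \<iota> * interval_lebesgue_integral lebesgue (ereal 0) (ereal t) (\<lambda>s. S_L (t - s) (\<lambda>\<rho>. 0) (\<lambda>\<rho>. \<bar>w s \<rho>\<bar> powr (2 * m) * w s \<rho>) r)"
    using e[unfolded integral_equation_def, rule_format, OF t r] .
  moreover have "w t r = w' t r" using w[of t r] t r by simp
  ultimately show "w' t r = S_L t u0 u1 r + \<iota> * interval_lebesgue_integral lebesgue (ereal 0) (ereal t) (\<lambda>s. S_L (t - s) (\<lambda>\<rho>. 0) (\<lambda>\<rho>. \<bar>w' s \<rho>\<bar> powr (2 * m) * w' s \<rho>) r)"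
    by simp
qed

lemma Ck_minus: "Ck k f \<Longrightarrow> Ck k (\<lambda>x. - f x)"
proof (induction k arbitrary: f)
  case (Suc k)
  have "(\<lambda>x. frechet_derivative (\<lambda>x. - f x) (at x) b) = (\<lambda>x. - frechet_derivative f (at x) b)" for b
  proof
    fix x
    have "(f has_derivative frechet_derivative f (at x)) (at x)" using Suc.prems by (simp add: frechet_derivative_works)
    from frechet_derivative_at[OF has_derivative_minus[OF this]]
    show "frechet_derivative (\<lambda>x. - f x) (at x) b = - frechet_derivative f (at x) b" by metis
  qed
  then show ?case using Suc by (simp add: differentiable_minus)
qed (simp add: continuous_on_minus)

lemma radial_test_minus: "radial_test \<phi> \<Longrightarrow> radial_test (\<lambda>r. - \<phi> r)"
  by (simp add: radial_test_def smooth_def Ck_minus)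

lemma Lm_space_minus: "(w, v) \<in> Lm_space m \<Longrightarrow> (w, \<lambda>r. - v r) \<in> Lm_space m"
  unfolding Lm_space_def mem_Collect_eq prod.case
proof (elim conjE, intro conjI allI impI)
  assume *: "\<forall>\<epsilon>>0. \<exists>\<phi> \<psi>. radial_test \<phi> \<and> radial_test \<psi> \<and> Lm_norm m (\<lambda>r. w r - \<phi> r) (\<lambda>r. v r - \<psi> r) < \<epsilon>"
  fix \<epsilon> :: ennreal assume "0 < \<epsilon>"
  with * obtain \<phi> \<psi> where "radial_test \<phi>" "radial_test \<psi>" "Lm_norm m (\<lambda>r. w r - \<phi> r) (\<lambda>r. v r - \<psi> r) < \<epsilon>" by blast
  moreover have "Lm_norm m (\<lambda>r. w r - \<phi> r) (\<lambda>r. - v r - - \<psi> r) = Lm_norm m (\<lambda>r. w r - \<phi> r) (\<lambda>r. v r - \<psi> r)"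
    unfolding Lm_norm_def by (simp add: abs_mult abs_minus_commute)
  moreover have "radial_test (\<lambda>r. - \<psi> r)" if "radial_test \<psi>"
    using radial_test_minus[OF that] .
  ultimately show "\<exists>\<phi> \<psi>. radial_test \<phi> \<and> radial_test \<psi> \<and> Lm_norm m (\<lambda>r. w r - \<phi> r) (\<lambda>r. - v r - \<psi> r) < \<epsilon>" by fastforce
qed auto
lemma filterlim_uminus_at_within: "filterlim uminus (at (- t :: real) within J) (at t within (uminus ` J))"
  unfolding filterlim_at
proof
  show "(uminus \<longlongrightarrow> - t) (at t within (uminus ` J))" by (intro tendsto_intros)
  have "- x \<in> J \<and> - x \<noteq> - t" if "x \<in> uminus ` J" "x \<noteq> t" for x
    using that by auto
  then show "eventually (\<lambda>x. - x \<in> J \<and> - x \<noteq> - t) (at t within (uminus ` J))"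
    unfolding eventually_at by (intro exI[of _ 1] conjI ballI impI) auto
qed

lemma Lm_continuous_on_reflect:
  assumes "Lm_continuous_on m J w v"
  shows "Lm_continuous_on m (uminus ` J) (\<lambda>t. w (- t)) (\<lambda>t r. - v (- t) r)"
  unfolding Lm_continuous_on_def
proof (intro conjI ballI)
  fix t assume "t \<in> uminus ` J"
  then show "(w (- t), \<lambda>r. - v (- t) r) \<in> Lm_space m" using assms by (intro Lm_space_minus) (auto simp: Lm_continuous_on_def)
next
  fix t0 assume t0: "t0 \<in> uminus ` J"
  have "Lm_norm m (\<lambda>r. w (- t) r - w (- t0) r) (\<lambda>r. - v (- t) r - - v (- t0) r) = Lm_norm m (\<lambda>r. w (- t) r - w (- t0) r) (\<lambda>r. v (- t) r - v (- t0) r)" for t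
    unfolding Lm_norm_def by (simp add: abs_mult abs_minus_commute)
  moreover have "((\<lambda>t. Lm_norm m (\<lambda>r. w t r - w (- t0) r) (\<lambda>r. v t r - v (- t0) r)) \<longlongrightarrow> 0) (at (- t0) within J)"
    using assms t0 by (auto simp: Lm_continuous_on_def)
  note filterlim_compose[OF this filterlim_uminus_at_within]
  ultimately show "((\<lambda>t. Lm_norm m (\<lambda>r. w (- t) r - w (- t0) r) (\<lambda>r. - v (- t) r - - v (- t0) r)) \<longlongrightarrow> 0) (at t0 within uminus ` J)"
    by simp
qed

lemma has_time_deriv_reflect:
  assumes d: "has_time_deriv J w v"
  shows "has_time_deriv (uminus ` J) (\<lambda>t. w (- t)) (\<lambda>t r. - v (- t) r)"
  unfolding has_time_deriv_def
proof (intro allI impI ballI)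
  fix \<phi> t assume "radial_test \<phi>" and t: "t \<in> uminus ` J"
  then have "((\<lambda>t. LINT r:{0<..}|lebesgue. w t r * \<phi> r * r\<^sup>2) has_real_derivative (LINT r:{0<..}|lebesgue. v (- t) r * \<phi> r * r\<^sup>2)) (at (- t) within (uminus ` (uminus ` J)))"
    using d by (auto simp: has_time_deriv_def image_image)
  moreover have "(uminus has_real_derivative - 1) (at t within uminus ` J)" by (auto intro!: derivative_eq_intros)
  ultimately have "((\<lambda>t. LINT r:{0<..}|lebesgue. w t r * \<phi> r * r\<^sup>2) \<circ> uminus has_real_derivative (LINT r:{0<..}|lebesgue. v (- t) r * \<phi> r * r\<^sup>2) * - 1) (at t within uminus ` J)"
    by (rule DERIV_image_chain)
  then show "((\<lambda>t. LINT r:{0<..}|lebesgue. w (- t) r * \<phi> r * r\<^sup>2) has_real_derivative (LINT r:{0<..}|lebesgue. - v (- t) r * \<phi> r * r\<^sup>2)) (at t within uminus ` J)"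
    by (simp add: o_def set_lebesgue_integral_def)
qed

text \<open>When \<open>t\<close> lies outside one of the two closed intervals, the filter of that
  interval is trivial; each one-sided limit is assumed exactly where it has content.\<close>

lemma tendsto_split_at_0:
  fixes a b t :: real
  assumes ab: "0 \<le> a" "0 \<le> b" and F: "0 \<le> t \<Longrightarrow> filterlim F G (at t within {0..b})" "t \<le> 0 \<Longrightarrow> filterlim F G (at t within {- a..0})"
  shows "filterlim F G (at t within {- a..b})"
proof -
  have "filterlim F G (at t within {0..b})"
  proof (cases "0 \<le> t")
    case False
    then have "t \<notin> closure ({0..b} - {t})" using closure_minimal[of "{0..b} - {t}" "{0..b}"] by auto
    then show ?thesis by (simp add: at_within_eq_bot_iff[THEN iffD2] filterlim_def)
  qed (rule F)
  moreover have "filterlim F G (at t within {- a..0})"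
  proof (cases "t \<le> 0")
    case False
    then have "t \<notin> closure ({- a..0} - {t})" using closure_minimal[of "{- a..0} - {t}" "{- a..0}"] by auto
    then show ?thesis by (simp add: at_within_eq_bot_iff[THEN iffD2] filterlim_def)
  qed (rule F)
  ultimately have "filterlim F G (sup (at t within {- a..0}) (at t within {0..b}))" by (intro filterlim_sup)
  moreover have "{- a..0} \<union> {0..b} = {- a..b}" using ab by auto
  ultimately show ?thesis by (metis at_within_union)
qed

definition box_fun :: "real \<Rightarrow> real \<Rightarrow> (real \<Rightarrow> real \<Rightarrow> real) \<Rightarrow> real \<Rightarrow> real \<Rightarrow> real" where
  "box_fun a b w = (\<lambda>t r. if a \<le> t \<and> t \<le> b \<and> 0 < r then w t r else 0)"

text \<open>In \<open>t\<close> by the pointwise bound, uniform for radii above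
  \<open>r0 / 2\<close>; in \<open>r\<close> by local absolute continuity at the fixed time
  \<open>t0\<close>. In this way arbitrary solutions become jointly Borel.\<close>

lemma Lm_continuous_on_joint:
  assumes m: "1 < m" and c: "Lm_continuous_on m I w v"
  shows "continuous_on (I \<times> {0<..}) (\<lambda>(t, r). w t r)"
  unfolding continuous_on_iff
proof (intro ballI allI impI)
  fix p :: "real \<times> real" and e :: real assume p: "p \<in> I \<times> {0<..}" and e: "0 < e"
  obtain t0 r0 where p_eq: "p = (t0, r0)" and t0: "t0 \<in> I" and r0: "0 < r0" using p by auto
  have mem: "(w t, v t) \<in> Lm_space m" if "t \<in> I" for t using c that by (simp add: Lm_continuous_on_def)
  define K where "K = 2 * (m - 1) powr ((m - 1) / m) * (r0 / 2) powr (- 1 / m)"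
  have K: "0 < K" using m r0 by (simp add: K_def)
  define x where "x = e / (2 * K)"
  have x: "0 < x" "K * x = e / 2" using e K by (auto simp: x_def)
  have "((\<lambda>t. Lm_norm m (\<lambda>r. w t r - w t0 r) (\<lambda>r. v t r - v t0 r)) \<longlongrightarrow> 0) (at t0 within I)"
    using c t0 by (simp add: Lm_continuous_on_def)
  then have "eventually (\<lambda>t. Lm_norm m (\<lambda>r. w t r - w t0 r) (\<lambda>r. v t r - v t0 r) < ennreal x) (at t0 within I)"
    using x by (intro order_tendstoD(2)) auto
  then obtain d1 where d1: "0 < d1" "\<And>t. t \<in> I \<Longrightarrow> t \<noteq> t0 \<Longrightarrow> dist t t0 < d1 \<Longrightarrow> Lm_norm m (\<lambda>r. w t r - w t0 r) (\<lambda>r. v t r - v t0 r) < ennreal x"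
    unfolding eventually_at by blast
  obtain q where "has_radial_deriv (w t0) q" using mem[OF t0] by (auto simp: Lm_space_def)
  then have "continuous_on {0<..} (w t0)" by (rule has_radial_deriv_continuous_on)
  then obtain d2 where d2: "0 < d2" "\<And>r. 0 < r \<Longrightarrow> dist r r0 < d2 \<Longrightarrow> dist (w t0 r) (w t0 r0) < e / 2"
    unfolding continuous_on_iff using r0 e by (metis greaterThan_iff half_gt_zero)
  show "\<exists>d>0. \<forall>p'\<in>I \<times> {0<..}. dist p' p < d \<longrightarrow> dist (case p' of (t, r) \<Rightarrow> w t r) (case p of (t, r) \<Rightarrow> w t r) < e"
  proof (intro exI[of _ "min (min d1 d2) (r0 / 2)"] conjI ballI impI)
    show "0 < min (min d1 d2) (r0 / 2)" using d1 d2 r0 by simp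
    fix p' assume p': "p' \<in> I \<times> {0<..}" "dist p' p < min (min d1 d2) (r0 / 2)"
    obtain t r where p'_eq: "p' = (t, r)" and t: "t \<in> I" and r: "0 < r" using p' by auto
    have dt: "dist t t0 < d1" and dr: "dist r r0 < d2" "dist r r0 < r0 / 2"
      using p'(2) dist_fst_le[of p' p] dist_snd_le[of p' p] by (auto simp: p'_eq p_eq)
    have "\<bar>w t r - w t0 r\<bar> \<le> e / 2"
    proof (cases "t = t0")
      case False
      have "\<bar>w t r - w t0 r\<bar> \<le> 2 * (m - 1) powr ((m - 1) / m) * r powr (- 1 / m) * x"
        using d1(2)[OF t False dt] by (intro Lm_norm_pointwise[OF m mem[OF t] mem[OF t0] x(1) _ r]) simp
      also have "\<dots> \<le> K * x"
      proof -
        have "r0 / 2 \<le> r" using dr by (auto simp: dist_real_def abs_if split: if_splits)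
        then have "r powr (- 1 / m) \<le> (r0 / 2) powr (- 1 / m)"
          using m r0 by (intro powr_mono2') auto
        then show ?thesis unfolding K_def using m x by (intro mult_right_mono mult_left_mono) auto
      qed
      finally show ?thesis using x by simp
    qed (use e in simp)
    moreover have "\<bar>w t0 r - w t0 r0\<bar> < e / 2" using d2(2)[OF r dr(1)] by (simp add: dist_real_def)
    ultimately have "\<bar>w t r - w t0 r0\<bar> < e" by linarith
    then show "dist (case p' of (t, r) \<Rightarrow> w t r) (case p of (t, r) \<Rightarrow> w t r) < e"
      by (simp add: p'_eq p_eq dist_real_def)
  qed
qed

lemma measurable_box_fun:
  assumes m: "1 < m" and c: "Lm_continuous_on m {a..b} w v"
  shows "joint_borel (box_fun a b w)"
proof -
  have "{a..b} \<times> {0<..} \<in> sets (borel :: (real \<times> real) measure)"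
    unfolding borel_prod[symmetric] by (intro pair_measureI) auto
  from borel_measurable_continuous_on_indicator[OF this Lm_continuous_on_joint[OF m c]]
  have "(\<lambda>p. indicator ({a..b} \<times> {0<..}) p *\<^sub>R (case p of (t, r) \<Rightarrow> w t r)) \<in> borel_measurable (borel \<Otimes>\<^sub>M borel)"
    unfolding borel_prod .
  moreover have "(\<lambda>p. indicator ({a..b} \<times> {0<..}) p *\<^sub>R (case p of (t, r) \<Rightarrow> w t r)) = case_prod (box_fun a b w)"
    by (rule ext) (auto simp: box_fun_def split: if_splits)
  ultimately show ?thesis by simp
qed

lemma S_norm_box_fun:
  assumes "0 < m"
  shows "S_norm m {a..b} w = ennpowr (snorm m (box_fun a b w)) (1 / (2 * m + 1))"
proof -
  have "S_int m (\<lambda>t r. ennreal \<bar>w t r\<bar> * indicator {a..b} t) = snorm m (box_fun a b w)"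
    unfolding snorm_def by (intro antisym S_int_mono assms) (auto simp: box_fun_def indicator_def)
  then show ?thesis by (simp add: S_norm_eq)
qed

text \<open>Continuity in time enters through the Borel measurability that the change of variables
  asks for.\<close>

lemma S_norm_reflect:
  assumes m: "1 < m" and c: "Lm_continuous_on m {a..b} w v"
  shows "S_norm m {- b..- a} (\<lambda>t. w (- t)) = S_norm m {a..b} w"
proof -
  have [measurable]: "joint_borel (box_fun a b w)" by (rule measurable_box_fun[OF m c])
  have eq: "box_fun (- b) (- a) (\<lambda>t. w (- t)) = (\<lambda>t. box_fun a b w (- t))" by (auto simp: box_fun_def fun_eq_iff)
  have "snorm m (box_fun (- b) (- a) (\<lambda>t. w (- t))) = snorm m (box_fun a b w)"
    unfolding eq snorm_def by (rule S_int_reflect) measurable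
  then show ?thesis using m by (simp add: S_norm_box_fun)
qed

lemma Lm_continuous_on_cong:
  assumes "\<And>t r. t \<in> I \<Longrightarrow> 0 < r \<Longrightarrow> w t r = w' t r" "\<And>t r. t \<in> I \<Longrightarrow> 0 < r \<Longrightarrow> v t r = v' t r"
    and "\<And>t. t \<in> I \<Longrightarrow> v' t = v t" and c: "Lm_continuous_on m I w v"
  shows "Lm_continuous_on m I w' v'"
  unfolding Lm_continuous_on_def
proof (intro conjI ballI)
  fix t assume t: "t \<in> I"
  then show "(w' t, v' t) \<in> Lm_space m"
    unfolding assms(3)[OF t] using c assms(1) by (intro Lm_space_cong[of "w t" "w' t"]) (auto simp: Lm_continuous_on_def)
next
  fix t0 assume t0: "t0 \<in> I"
  have "((\<lambda>t. Lm_norm m (\<lambda>r. w t r - w t0 r) (\<lambda>r. v t r - v t0 r)) \<longlongrightarrow> 0) (at t0 within I)"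
    using c t0 by (auto simp: Lm_continuous_on_def)
  moreover have "Lm_norm m (\<lambda>r. w t r - w t0 r) (\<lambda>r. v t r - v t0 r) = Lm_norm m (\<lambda>r. w' t r - w' t0 r) (\<lambda>r. v' t r - v' t0 r)" if "t \<in> I" for t
    using assms(1,2) that t0 by (intro Lm_norm_cong) auto
  ultimately show "((\<lambda>t. Lm_norm m (\<lambda>r. w' t r - w' t0 r) (\<lambda>r. v' t r - v' t0 r)) \<longlongrightarrow> 0) (at t0 within I)"
    by (rule Lim_transform_within[OF _ zero_less_one]) auto
qed

lemma has_time_deriv_cong:
  assumes w: "\<And>t r. t \<in> I \<Longrightarrow> 0 < r \<Longrightarrow> w t r = w' t r" and v: "\<And>t r. t \<in> I \<Longrightarrow> 0 < r \<Longrightarrow> v t r = v' t r"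
    and d: "has_time_deriv I w v"
  shows "has_time_deriv I w' v'"
  unfolding has_time_deriv_def
proof (intro allI impI ballI)
  fix \<phi> t assume \<phi>: "radial_test \<phi>" and t: "t \<in> I"
  have eq: "(LINT r:{0<..}|lebesgue. w t r * \<phi> r * r\<^sup>2) = (LINT r:{0<..}|lebesgue. w' t r * \<phi> r * r\<^sup>2)" if "t \<in> I" for t
    unfolding set_lebesgue_integral_def using w[OF that] by (intro Bochner_Integration.integral_cong) (auto simp: indicator_def)
  have "(LINT r:{0<..}|lebesgue. v t r * \<phi> r * r\<^sup>2) = (LINT r:{0<..}|lebesgue. v' t r * \<phi> r * r\<^sup>2)"
    unfolding set_lebesgue_integral_def using v[OF t] by (intro Bochner_Integration.integral_cong) (auto simp: indicator_def)
  moreover have "((\<lambda>t. LINT r:{0<..}|lebesgue. w t r * \<phi> r * r\<^sup>2) has_real_derivative (LINT r:{0<..}|lebesgue. v t r * \<phi> r * r\<^sup>2)) (at t within I)"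
    using d \<phi> t by (simp add: has_time_deriv_def)
  ultimately have "((\<lambda>t. LINT r:{0<..}|lebesgue. w t r * \<phi> r * r\<^sup>2) has_real_derivative (LINT r:{0<..}|lebesgue. v' t r * \<phi> r * r\<^sup>2)) (at t within I)"
    by simp
  then show "((\<lambda>t. LINT r:{0<..}|lebesgue. w' t r * \<phi> r * r\<^sup>2) has_real_derivative (LINT r:{0<..}|lebesgue. v' t r * \<phi> r * r\<^sup>2)) (at t within I)"
    by (rule has_field_derivative_transform_within[OF _ zero_less_one t]) (rule eq)
qed

context wave
begin

definition profile_of :: "(real \<Rightarrow> real) \<Rightarrow> (real \<Rightarrow> real) \<Rightarrow> (real \<Rightarrow> real) \<Rightarrow> bool" where
  "profile_of u0 u1 f \<longleftrightarrow> Lm_fun m f \<and> (\<forall>t r. 0 < r \<longrightarrow> S_L t u0 u1 r = avg f t r)"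

lemma profile_of_reflect:
  assumes "profile_of u0 u1 f"
  shows "profile_of u0 (\<lambda>r. - u1 r) (\<lambda>y. f (- y))"
proof -
  have f: "Lm_fun m f" using assms by (simp add: profile_of_def)
  then have [measurable]: "f \<in> borel_measurable borel" by (simp add: Lm_fun_def)
  have "(\<integral>\<^sup>+y. ennreal (\<bar>f y\<bar> powr m) \<partial>lborel) = (\<integral>\<^sup>+y. ennreal (\<bar>f (- y)\<bar> powr m) \<partial>lborel)"
    by (subst nn_integral_real_affine[where c = "- 1" and t = 0]) auto
  then have "Lm_fun m (\<lambda>y. f (- y))" using f by (simp add: Lm_fun_def)
  moreover have "S_L t u0 (\<lambda>r. - u1 r) r = avg (\<lambda>y. f (- y)) t r" if "0 < r" for t r
    using assms that by (simp add: profile_of_def S_L_reflect[symmetric] avg_reflect[symmetric])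
  ultimately show ?thesis by (simp add: profile_of_def)
qed

text \<open>Joint measurability comes from continuity in time, the fixed point form from
  \<open>duhamel_flow\<close>. This is how uniqueness and maximality for \<open>sol\<close> reach
  arbitrary solutions.\<close>

lemma solution_imp_sol:
  assumes f: "profile_of u0 u1 f" and e: "integral_equation m \<iota> {0..b} u0 u1 w"
    and c: "Lm_continuous_on m {0..b} w v" and s: "S_norm m {0..b} w < \<infinity>"
  shows "sol 0 b f (box_fun 0 b w)"
  unfolding sol_def
proof (intro conjI allI impI)
  let ?w = "box_fun 0 b w"
  show wm: "joint_borel ?w" by (rule measurable_box_fun[OF m c])
  show fin: "snorm m ?w < top" using s by (simp add: S_norm_box_fun[OF m0])
  have e': "integral_equation m \<iota> {0..b} u0 u1 ?w" by (rule integral_equation_cong[OF _ e]) (simp add: box_fun_def)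
  fix t r :: real
  show "?w t r = 0" if "\<not> (0 \<le> t \<and> t \<le> b \<and> 0 < r)" using that by (auto simp: box_fun_def)
  assume t: "0 \<le> t" "t \<le> b" and r: "0 < r"
  from t have "t \<in> {0..b}" by simp
  from e'[unfolded integral_equation_def, rule_format, OF this r]
  show "?w t r = avg (flow f ?w 0 t) t r"
    using duhamel_flow[OF _ wm fin t(1) r, of f] f r by (simp add: profile_of_def)
qed

text \<open>Cutting off at \<open>t\<close> itself makes the velocity independent of the interval of
  existence, so one function serves all of them.\<close>

definition vel :: "(real \<Rightarrow> real) \<Rightarrow> (real \<Rightarrow> real \<Rightarrow> real) \<Rightarrow> real \<Rightarrow> real \<Rightarrow> real" where
  "vel f U t = prf_v (state f (box_fun 0 t U) t)"

lemma vel_eq: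
  assumes "sol 0 b f (box_fun 0 b U)" "0 \<le> t" "t \<le> b"
  shows "vel f U t = prf_v (state f (box_fun 0 b U) t)"
proof -
  have um[measurable]: "joint_borel (box_fun 0 b U)" by (rule solD(1)[OF assms(1)])
  have eq: "box_fun 0 t U = (\<lambda>s r. if s \<le> t then box_fun 0 b U s r else 0)"
    using assms(3) by (auto simp: box_fun_def fun_eq_iff)
  have "joint_borel (box_fun 0 t U)" unfolding eq by measurable
  then have "acc m (box_fun 0 t U) 0 t y = acc m (box_fun 0 b U) 0 t y" for y
    using assms(3) by (intro acc_cong um) (auto simp: box_fun_def)
  then show ?thesis unfolding vel_def by (intro ext) (simp add: prf_v_def state_def flow_def)
qed

lemma vel_0: "vel f U 0 = prf_v f"
  by (rule ext) (simp add: vel_def prf_v_def state_def flow_initial)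

lemma sol_imp_solution:
  assumes f: "profile_of u0 u1 f" and U: "sol 0 b f (box_fun 0 b U)"
  shows "integral_equation m \<iota> {0..b} u0 u1 U" "has_time_deriv {0..b} U (vel f U)"
    "Lm_continuous_on m {0..b} U (vel f U)" "S_norm m {0..b} U < \<infinity>"
proof -
  have fL: "Lm_fun m f" using f by (simp add: profile_of_def)
  let ?w = "box_fun 0 b U"
  have box: "?w t r = U t r" if "t \<in> {0..b}" "0 < r" for t r using that by (simp add: box_fun_def)
  have v: "prf_v (state f ?w t) = vel f U t" if "t \<in> {0..b}" for t using vel_eq[OF U] that by simp
  have "integral_equation m \<iota> {0..b} u0 u1 ?w"
    unfolding integral_equation_def
  proof (intro ballI allI impI)
    fix t r :: real assume t: "t \<in> {0..b}" and r: "0 < r"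
    then have t': "0 \<le> t" "t \<le> b" by auto
    have "S_L t u0 u1 r = avg f t r" using f r by (simp add: profile_of_def)
    then show "?w t r = S_L t u0 u1 r + \<iota> * interval_lebesgue_integral lebesgue (ereal 0) (ereal t) (\<lambda>s. S_L (t - s) (\<lambda>\<rho>. 0) (\<lambda>\<rho>. \<bar>?w s \<rho>\<bar> powr (2 * m) * ?w s \<rho>) r)"
      using solD(4)[OF U t' r] duhamel_flow[OF fL solD(1)[OF U] solD(2)[OF U] t'(1) r] by simp
  qed
  then show "integral_equation m \<iota> {0..b} u0 u1 U" by (rule integral_equation_cong[rotated]) (use box in auto)
  show "has_time_deriv {0..b} U (vel f U)"
    by (rule has_time_deriv_cong[OF _ _ sol_has_time_deriv[OF fL U]]) (use box v in auto)
  show "Lm_continuous_on m {0..b} U (vel f U)"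
    by (rule Lm_continuous_on_cong[OF _ _ _ sol_Lm_continuous[OF fL U]]) (use box v in auto)
  show "S_norm m {0..b} U < \<infinity>" using solD(2)[OF U] by (simp add: S_norm_box_fun[OF m0])
qed

end

section \<open>From one-sided intervals to an open interval of existence\<close>

lemma Lm_continuous_onD:
  assumes "Lm_continuous_on m I w v" "t \<in> I"
  shows "(w t, v t) \<in> Lm_space m" "((\<lambda>s. Lm_norm m (\<lambda>r. w s r - w t r) (\<lambda>r. v s r - v t r)) \<longlongrightarrow> 0) (at t within I)"
  using assms unfolding Lm_continuous_on_def by blast+

lemma Lm_continuous_on_subset:
  assumes "Lm_continuous_on m I w v" "J \<subseteq> I"
  shows "Lm_continuous_on m J w v"
  using assms unfolding Lm_continuous_on_def by (meson subsetD tendsto_within_subset)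

lemma integral_equation_subset: "integral_equation m \<iota> I u0 u1 w \<Longrightarrow> J \<subseteq> I \<Longrightarrow> integral_equation m \<iota> J u0 u1 w"
  by (auto simp: integral_equation_def)

lemma Lm_continuous_on_split:
  assumes "0 \<le> a" "0 \<le> b" "Lm_continuous_on m {- a..0} w v" "Lm_continuous_on m {0..b} w v"
  shows "Lm_continuous_on m {- a..b} w v"
  unfolding Lm_continuous_on_def
proof (intro conjI ballI)
  fix t assume t: "t \<in> {- a..b}"
  show "(w t, v t) \<in> Lm_space m"
    using t Lm_continuous_onD(1)[OF assms(3), of t] Lm_continuous_onD(1)[OF assms(4), of t] by (cases "0 \<le> t") auto
  show "((\<lambda>s. Lm_norm m (\<lambda>r. w s r - w t r) (\<lambda>r. v s r - v t r)) \<longlongrightarrow> 0) (at t within {- a..b})"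
    by (rule tendsto_split_at_0[OF assms(1,2) Lm_continuous_onD(2)[OF assms(4)] Lm_continuous_onD(2)[OF assms(3)]]) (use t in auto)
qed

lemma has_time_deriv_split:
  assumes "0 \<le> a" "0 \<le> b" "has_time_deriv {- a..0} w v" "has_time_deriv {0..b} w v"
  shows "has_time_deriv {- a..b} w v"
  unfolding has_time_deriv_def
proof (intro allI impI ballI)
  fix \<phi> t assume \<phi>: "radial_test \<phi>" and t: "t \<in> {- a..b}"
  have d: "((\<lambda>t. LINT r:{0<..}|lebesgue. w t r * \<phi> r * r\<^sup>2) has_real_derivative (LINT r:{0<..}|lebesgue. v t r * \<phi> r * r\<^sup>2)) (at t within S)"
    if "has_time_deriv S w v" "t \<in> S" for S
    using that \<phi> unfolding has_time_deriv_def by blast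
  show "((\<lambda>t. LINT r:{0<..}|lebesgue. w t r * \<phi> r * r\<^sup>2) has_real_derivative (LINT r:{0<..}|lebesgue. v t r * \<phi> r * r\<^sup>2)) (at t within {- a..b})"
    unfolding has_field_derivative_iff
    by (rule tendsto_split_at_0[OF assms(1,2) d[OF assms(4), unfolded has_field_derivative_iff] d[OF assms(3), unfolded has_field_derivative_iff]])
      (use t in auto)
qed

lemma Lm_continuous_on_open:
  assumes I: "open I" and loc: "\<And>t. t \<in> I \<Longrightarrow> \<exists>a b. a < t \<and> t < b \<and> Lm_continuous_on m {a..b} w v"
  shows "Lm_continuous_on m I w v"
  unfolding Lm_continuous_on_def
proof (intro conjI ballI)
  fix t assume "t \<in> I"
  from loc[OF this] obtain a b where "a < t" "t < b" "Lm_continuous_on m {a..b} w v" by blast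
  then show "(w t, v t) \<in> Lm_space m" by (intro Lm_continuous_onD(1)) auto
next
  fix t assume t: "t \<in> I"
  from loc[OF this] obtain a b where ab: "a < t" "t < b" "Lm_continuous_on m {a..b} w v" by blast
  then have "((\<lambda>s. Lm_norm m (\<lambda>r. w s r - w t r) (\<lambda>r. v s r - v t r)) \<longlongrightarrow> 0) (at t within {a..b})"
    by (intro Lm_continuous_onD(2)) auto
  moreover have "at t within {a..b} = at t" using ab by (intro at_within_interior) auto
  ultimately show "((\<lambda>s. Lm_norm m (\<lambda>r. w s r - w t r) (\<lambda>r. v s r - v t r)) \<longlongrightarrow> 0) (at t within I)"
    using at_within_open[OF t I] by simp
qed

lemma has_time_deriv_open:
  assumes I: "open I" and loc: "\<And>t. t \<in> I \<Longrightarrow> \<exists>a b. a < t \<and> t < b \<and> has_time_deriv {a..b} w v"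
  shows "has_time_deriv I w v"
  unfolding has_time_deriv_def
proof (intro allI impI ballI)
  fix \<phi> t assume \<phi>: "radial_test \<phi>" and t: "t \<in> I"
  from loc[OF t] obtain a b where ab: "a < t" "t < b" "has_time_deriv {a..b} w v" by blast
  then have "((\<lambda>t. LINT r:{0<..}|lebesgue. w t r * \<phi> r * r\<^sup>2) has_real_derivative (LINT r:{0<..}|lebesgue. v t r * \<phi> r * r\<^sup>2)) (at t within {a..b})"
    using \<phi> by (auto simp: has_time_deriv_def)
  moreover have "at t within {a..b} = at t" using ab by (intro at_within_interior) auto
  ultimately show "((\<lambda>t. LINT r:{0<..}|lebesgue. w t r * \<phi> r * r\<^sup>2) has_real_derivative (LINT r:{0<..}|lebesgue. v t r * \<phi> r * r\<^sup>2)) (at t within I)"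
    using at_within_open[OF t I] by simp
qed

lemma S_norm_split:
  assumes m: "1 < m" and c: "Lm_continuous_on m {- a..0} w v" "Lm_continuous_on m {0..b} w v"
    and fin: "S_norm m {- a..0} w < \<infinity>" "S_norm m {0..b} w < \<infinity>" and sub: "J \<subseteq> {- a..b}"
  shows "S_norm m J w < \<infinity>"
proof -
  let ?l = "box_fun (- a) 0 w" and ?r = "box_fun 0 b w"
  have [measurable]: "joint_borel ?l" "joint_borel ?r"
    by (rule measurable_box_fun[OF m c(1)], rule measurable_box_fun[OF m c(2)])
  have l: "S_int m (\<lambda>t r. ennreal \<bar>?l t r\<bar>) < top" "S_int m (\<lambda>t r. ennreal \<bar>?r t r\<bar>) < top"
    using fin m by (auto simp: S_norm_box_fun snorm_def)
  have "S_int m (\<lambda>t r. ennreal \<bar>w t r\<bar> * indicator J t) \<le> S_int m (\<lambda>t r. ennreal \<bar>?l t r\<bar> + ennreal \<bar>?r t r\<bar>)"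
  proof (intro S_int_mono)
    fix t r :: real assume "0 < r"
    then show "ennreal \<bar>w t r\<bar> * indicator J t \<le> ennreal \<bar>?l t r\<bar> + ennreal \<bar>?r t r\<bar>"
      using sub by (cases "t \<in> J"; cases "0 \<le> t") (auto simp: box_fun_def)
  qed (use m in simp)
  also have "\<dots> \<le> ennreal (4 * 2 powr (2 * m + 1)) * (S_int m (\<lambda>t r. ennreal \<bar>?l t r\<bar>) + S_int m (\<lambda>t r. ennreal \<bar>?r t r\<bar>))"
    by (intro S_int_add m) measurable
  also have "\<dots> < top" using l by (simp add: ennreal_mult_less_top)
  finally show ?thesis by (simp add: S_norm_eq)
qed

context wave
begin

lemma forward_solution:
  assumes f: "Lm_fun m f"
  shows "\<exists>(T::ereal) U. 0 < T \<and> (\<forall>b. 0 \<le> b \<longrightarrow> ereal b < T \<longrightarrow> sol 0 b f (box_fun 0 b U)) \<and>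
    (\<forall>b w. 0 \<le> b \<longrightarrow> sol 0 b f w \<longrightarrow> ereal b < T) \<and> (T < \<infinity> \<longrightarrow> S_norm m {t. 0 \<le> t \<and> ereal t < T} U = \<infinity>)"
proof -
  obtain T :: ereal and U where T: "0 < T" and U: "\<And>b. 0 \<le> b \<Longrightarrow> ereal b < T \<Longrightarrow> sol 0 b f (\<lambda>t r. if 0 \<le> t \<and> t \<le> b then U t r else 0)"
    and max: "\<And>b w. 0 \<le> b \<Longrightarrow> sol 0 b f w \<Longrightarrow> ereal b < T"
    and blow: "T < \<infinity> \<Longrightarrow> S_int m (\<lambda>t r. ennreal \<bar>U t r\<bar> * indicator {t. 0 \<le> t \<and> ereal t < T} t) = top"
    using forward_maximal[OF f] by blast
  have "sol 0 b f (box_fun 0 b U)" if b: "0 \<le> b" "ereal b < T" for b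
  proof -
    have "(\<lambda>t r. if 0 \<le> t \<and> t \<le> b then U t r else 0) = box_fun 0 b U"
    proof (intro ext)
      fix t r
      show "(if 0 \<le> t \<and> t \<le> b then U t r else 0) = box_fun 0 b U t r"
        using solD(3)[OF U[OF b], of t r] by (cases "0 < r") (auto simp: box_fun_def)
    qed
    then show ?thesis using U[OF b] by simp
  qed
  then show ?thesis using T max blow by (intro exI[of _ T] exI[of _ U]) (simp add: S_norm_eq)
qed

text \<open>The past is the forward solution for the reflected profile, read backwards. What has to
  be checked is that the two halves fit at time 0 and that every competitor can be cut into
  one-sided pieces.\<close>

lemma well_posed:
  assumes data: "(u0, u1) \<in> Lm_space m"
  shows "\<exists>Tminus Tplus u. unique_maximal_solution m \<iota> u0 u1 Tminus Tplus u \<and>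
    (Tplus < \<infinity> \<longrightarrow> S_norm m {t. 0 \<le> t \<and> ereal t < Tplus} u = \<infinity>)"
proof -
  obtain f where fp: "profile_of u0 u1 f" and v0: "AE r in lebesgue. 0 < r \<longrightarrow> prf_v f r = u1 r"
    using data_profile[OF data] by (auto simp: profile_of_def)
  define f' where "f' = (\<lambda>y. f (- y))"
  have fp': "profile_of u0 (\<lambda>r. - u1 r) f'" unfolding f'_def by (rule profile_of_reflect[OF fp])
  have f: "Lm_fun m f" and f': "Lm_fun m f'" using fp fp' by (auto simp: profile_of_def)
  obtain Tp Up where Tp: "0 < Tp" and Up: "\<And>b. 0 \<le> b \<Longrightarrow> ereal b < Tp \<Longrightarrow> sol 0 b f (box_fun 0 b Up)"
    and maxp: "\<And>b w. 0 \<le> b \<Longrightarrow> sol 0 b f w \<Longrightarrow> ereal b < Tp"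
    and blow: "Tp < \<infinity> \<Longrightarrow> S_norm m {t. 0 \<le> t \<and> ereal t < Tp} Up = \<infinity>"
    using forward_solution[OF f] by blast
  obtain Tm Um where Tm: "0 < Tm" and Um: "\<And>b. 0 \<le> b \<Longrightarrow> ereal b < Tm \<Longrightarrow> sol 0 b f' (box_fun 0 b Um)"
    and maxm: "\<And>b w. 0 \<le> b \<Longrightarrow> sol 0 b f' w \<Longrightarrow> ereal b < Tm"
    using forward_solution[OF f'] by blast
  define u where "u = (\<lambda>t r. if 0 \<le> t then Up t r else Um (- t) r)"
  define v where "v = (\<lambda>t r. if 0 \<le> t then vel f Up t r else - vel f' Um (- t) r)"
  define I where "I = einterval (- Tm) Tp"
  have start: "Up 0 r = avg f 0 r" "Um 0 r = avg f 0 r" if "0 < r" for r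
    using solD(4)[OF Up[of 0], of 0 r] solD(4)[OF Um[of 0], of 0 r] Tp Tm that avg_reflect[of f 0 r]
    by (auto simp: box_fun_def flow_initial zero_ereal_def f'_def)
  \<comment> \<open>Reflecting the profile reverses the velocity, and so does reading time
    backwards; both halves thus have the same velocity at time 0.\<close>
  have vstart: "vel f' Um 0 r = - vel f Up 0 r" for r
    by (simp add: vel_0 prf_v_def f'_def minus_divide_left)
  have u_0: "u 0 r = u0 r" if "0 < r" for r
  proof -
    have "u 0 r = S_L 0 u0 u1 r" using fp start that by (simp add: u_def profile_of_def)
    also have "\<dots> = u0 r" using that by (simp add: S_L_def wave_profile_def diff_divide_distrib)
    finally show ?thesis .
  qed
  have u_neg: "u (- t) r = Um t r" if "0 \<le> t" "0 < r" for t r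
    using that start by (cases "t = 0") (simp_all add: u_def)
  have v_neg: "- v (- t) r = vel f' Um t r" if "0 \<le> t" for t r
    using that vstart by (cases "t = 0") (simp_all add: v_def)
  have right: "integral_equation m \<iota> {0..b} u0 u1 u" "has_time_deriv {0..b} u v" "Lm_continuous_on m {0..b} u v" "S_norm m {0..b} u < \<infinity>"
    if b: "0 \<le> b" "ereal b < Tp" for b
  proof -
    note s = sol_imp_solution[OF fp Up[OF b]]
    show "integral_equation m \<iota> {0..b} u0 u1 u" by (rule integral_equation_cong[OF _ s(1)]) (simp add: u_def)
    show "has_time_deriv {0..b} u v" by (rule has_time_deriv_cong[OF _ _ s(2)]) (auto simp: u_def v_def)
    show "Lm_continuous_on m {0..b} u v" by (rule Lm_continuous_on_cong[OF _ _ _ s(3)]) (auto simp: u_def v_def)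
    have "box_fun 0 b u = box_fun 0 b Up" by (auto simp: box_fun_def u_def fun_eq_iff)
    then show "S_norm m {0..b} u < \<infinity>" using s(4) by (simp add: S_norm_box_fun[OF m0])
  qed
  have left: "integral_equation m \<iota> {- a..0} u0 u1 u" "has_time_deriv {- a..0} u v" "Lm_continuous_on m {- a..0} u v" "S_norm m {- a..0} u < \<infinity>"
    if a: "0 \<le> a" "ereal a < Tm" for a
  proof -
    note s = sol_imp_solution[OF fp' Um[OF a]]
    have "integral_equation m \<iota> {0..a} u0 (\<lambda>r. - u1 r) (\<lambda>t. u (- t))"
      by (rule integral_equation_cong[OF _ s(1)]) (simp add: u_neg)
    from integral_equation_reflect[OF this] show "integral_equation m \<iota> {- a..0} u0 u1 u" by simp
    have "has_time_deriv {0..a} (\<lambda>t. u (- t)) (\<lambda>t r. - v (- t) r)"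
      by (rule has_time_deriv_cong[OF _ _ s(2)]) (auto simp: u_neg v_neg)
    from has_time_deriv_reflect[OF this] show "has_time_deriv {- a..0} u v" by simp
    have c: "Lm_continuous_on m {0..a} (\<lambda>t. u (- t)) (\<lambda>t r. - v (- t) r)"
      by (rule Lm_continuous_on_cong[OF _ _ _ s(3)]) (auto simp: u_neg v_neg)
    from Lm_continuous_on_reflect[OF this] show "Lm_continuous_on m {- a..0} u v" by simp
    have "box_fun 0 a (\<lambda>t. u (- t)) = box_fun 0 a Um" by (auto simp: box_fun_def u_neg fun_eq_iff)
    then have "S_norm m {0..a} (\<lambda>t. u (- t)) < \<infinity>" using s(4) by (simp add: S_norm_box_fun[OF m0])
    then show "S_norm m {- a..0} u < \<infinity>" using S_norm_reflect[OF m c] by simp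
  qed
  have I: "t \<in> I \<longleftrightarrow> - Tm < ereal t \<and> ereal t < Tp" for t by (simp add: I_def einterval_def)
  \<comment> \<open>Enclosing intervals \<open>[- a, b]\<close> always contain 0, so they split into
    two one-sided ones even when both points lie on the same side.\<close>
  have bounds: "\<exists>a b. 0 \<le> a \<and> ereal a < Tm \<and> 0 \<le> b \<and> ereal b < Tp \<and> - a < s \<and> t < b" if "s \<in> I" "t \<in> I" for s t
  proof -
    have "max 0 (ereal t) < Tp" using that Tp by (simp add: I)
    then obtain b where b: "max 0 (ereal t) < ereal b" "ereal b < Tp" using ereal_dense2 by blast
    have "- Tm < ereal s" using that by (simp add: I)
    then have "ereal (- s) < Tm" by (metis ereal_uminus_less_reorder uminus_ereal.simps(1))
    then have "max 0 (ereal (- s)) < Tm" using Tm by simp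
    then obtain a where a: "max 0 (ereal (- s)) < ereal a" "ereal a < Tm" using ereal_dense2 by blast
    show ?thesis using a b by (intro exI[of _ a] exI[of _ b]) auto
  qed
  have openI: "open I" by (simp add: I_def)
  have sol_u: "solution_on m \<iota> I u0 u1 u"
    unfolding solution_on_def
  proof (intro conjI exI[of _ v] allI impI)
    show "integral_equation m \<iota> I u0 u1 u"
      unfolding integral_equation_def
    proof (intro ballI allI impI)
      fix t r :: real assume t: "t \<in> I" and r: "0 < r"
      obtain a b where ab: "0 \<le> a" "ereal a < Tm" "0 \<le> b" "ereal b < Tp" "- a < t" "t < b" using bounds[OF t t] by blast
      show "u t r = S_L t u0 u1 r + \<iota> * interval_lebesgue_integral lebesgue (ereal 0) (ereal t) (\<lambda>s. S_L (t - s) (\<lambda>\<rho>. 0) (\<lambda>\<rho>. \<bar>u s \<rho>\<bar> powr (2 * m) * u s \<rho>) r)"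
      proof (cases "0 \<le> t")
        case True
        then have "t \<in> {0..b}" using ab by simp
        from right(1)[OF ab(3,4), unfolded integral_equation_def, rule_format, OF this r] show ?thesis .
      next
        case False
        then have "t \<in> {- a..0}" using ab by simp
        from left(1)[OF ab(1,2), unfolded integral_equation_def, rule_format, OF this r] show ?thesis .
      qed
    qed
    show "has_time_deriv I u v"
    proof (rule has_time_deriv_open[OF openI])
      fix t assume "t \<in> I"
      with bounds obtain a b where ab: "0 \<le> a" "ereal a < Tm" "0 \<le> b" "ereal b < Tp" "- a < t" "t < b" by blast
      have "has_time_deriv {- a..b} u v" by (rule has_time_deriv_split[OF ab(1,3) left(2)[OF ab(1,2)] right(2)[OF ab(3,4)]])
      with ab show "\<exists>a b. a < t \<and> t < b \<and> has_time_deriv {a..b} u v" by blast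
    qed
    show "Lm_continuous_on m I u v"
    proof (rule Lm_continuous_on_open[OF openI])
      fix t assume "t \<in> I"
      with bounds obtain a b where ab: "0 \<le> a" "ereal a < Tm" "0 \<le> b" "ereal b < Tp" "- a < t" "t < b" by blast
      have "Lm_continuous_on m {- a..b} u v" by (rule Lm_continuous_on_split[OF ab(1,3) left(3)[OF ab(1,2)] right(3)[OF ab(3,4)]])
      with ab show "\<exists>a b. a < t \<and> t < b \<and> Lm_continuous_on m {a..b} u v" by blast
    qed
    note cont = this
    show "u 0 r = u0 r" if "0 < r" for r by (rule u_0[OF that])
    show "AE r in lebesgue. 0 < r \<longrightarrow> v 0 r = u1 r" using v0 by (simp add: v_def vel_0)
    fix c d assume cd: "{c..d} \<subseteq> I"
    have "continuous_on ({c..d} \<times> {0<..}) (\<lambda>(t, r). u t r)"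
      by (rule continuous_on_subset[OF Lm_continuous_on_joint[OF m cont]]) (use cd in auto)
    moreover have "{c..d} \<times> {0<..} \<in> sets (borel :: (real \<times> real) measure)"
      unfolding borel_prod[symmetric] by (intro pair_measureI) auto
    ultimately have "(\<lambda>(t, r). u t r) \<in> borel_measurable (lebesgue_on ({c..d} \<times> {0<..}))"
      by (intro continuous_imp_measurable_on_sets_lebesgue) auto
    moreover have "S_norm m {c..d} u < \<infinity>"
    proof (cases "c \<le> d")
      case True
      with cd have "c \<in> I" "d \<in> I" by auto
      with bounds obtain a b where ab: "0 \<le> a" "ereal a < Tm" "0 \<le> b" "ereal b < Tp" "- a < c" "d < b" by blast
      show ?thesis
        by (rule S_norm_split[OF m left(3)[OF ab(1,2)] right(3)[OF ab(3,4)] left(4)[OF ab(1,2)] right(4)[OF ab(3,4)]]) (use ab in auto)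
    qed (simp add: S_norm_def)
    ultimately show "u \<in> S_space m {c..d}" by (simp add: S_space_def)
  qed
  \<comment> \<open>A competitor is examined at one time \<open>t\<close> after the other, on the
    interval between 0 and \<open>t\<close>: its mere existence there places \<open>t\<close> below
    the maximal time, and uniqueness gives the values.\<close>
  have unique: "t \<in> I \<and> (\<forall>r>0. w t r = u t r)"
    if J: "is_interval J" "0 \<in> J" and w: "solution_on m \<iota> J u0 u1 w" and t: "t \<in> J" for J w t
  proof -
    obtain k where eq: "integral_equation m \<iota> J u0 u1 w" and k: "Lm_continuous_on m J w k"
      and S: "\<And>a b. {a..b} \<subseteq> J \<Longrightarrow> S_norm m {a..b} w < \<infinity>"
      using w unfolding solution_on_def S_space_def by blast
    show ?thesis
    proof (cases "0 \<le> t")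
      case True
      have sub: "{0..t} \<subseteq> J" by (rule subsetI, rule mem_is_interval_1_I[OF J t]) auto
      have s: "sol 0 t f (box_fun 0 t w)"
        by (rule solution_imp_sol[OF fp integral_equation_subset[OF eq sub] Lm_continuous_on_subset[OF k sub] S[OF sub]])
      have tT: "ereal t < Tp" by (rule maxp[OF True s])
      have eqw: "box_fun 0 t w = box_fun 0 t Up" by (rule sol_unique[OF f s Up[OF True tT] True])
      have "w t r = u t r" if "0 < r" for r
        using fun_cong[OF fun_cong[OF eqw, of t], of r] True that by (simp add: box_fun_def u_def)
      moreover have "- Tm < ereal t" using True Tm by (cases Tm) auto
      ultimately show ?thesis using tT by (simp add: I)
    next
      case False
      have sub: "{t..0} \<subseteq> J" by (rule subsetI, rule mem_is_interval_1_I[OF J(1) t J(2)]) auto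
      note c = Lm_continuous_on_subset[OF k sub]
      have "integral_equation m \<iota> {0..- t} u0 (\<lambda>r. - u1 r) (\<lambda>s. w (- s))"
        using integral_equation_reflect[OF integral_equation_subset[OF eq sub]] by simp
      moreover have "Lm_continuous_on m {0..- t} (\<lambda>s. w (- s)) (\<lambda>s r. - k (- s) r)"
        using Lm_continuous_on_reflect[OF c] by simp
      moreover have "S_norm m {0..- t} (\<lambda>s. w (- s)) < \<infinity>"
        using S_norm_reflect[OF m c] S[OF sub] by simp
      ultimately have s: "sol 0 (- t) f' (box_fun 0 (- t) (\<lambda>s. w (- s)))" by (rule solution_imp_sol[OF fp'])
      have t0: "0 \<le> - t" using False by simp
      have tT: "ereal (- t) < Tm" by (rule maxm[OF t0 s])
      have eqw: "box_fun 0 (- t) (\<lambda>s. w (- s)) = box_fun 0 (- t) Um" by (rule sol_unique[OF f' s Um[OF t0 tT] t0])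
      have "w t r = u t r" if "0 < r" for r
        using fun_cong[OF fun_cong[OF eqw, of "- t"], of r] False that by (simp add: box_fun_def u_def)
      moreover have "- Tm < ereal t" using tT by (metis ereal_uminus_less_reorder uminus_ereal.simps(1))
      moreover have "ereal t < Tp" using False Tp by (cases Tp) auto
      ultimately show ?thesis by (simp add: I)
    qed
  qed
  have "unique_maximal_solution m \<iota> u0 u1 (- Tm) Tp u"
    unfolding unique_maximal_solution_def I_def[symmetric]
  proof (intro conjI allI impI)
    show "- Tm < 0" using Tm by (simp add: ereal_uminus_less_reorder)
    show "J \<subseteq> I" "\<forall>t\<in>J. \<forall>r>0. w t r = u t r" if "is_interval J" "0 \<in> J" "solution_on m \<iota> J u0 u1 w" for J w
      using unique[OF that] by auto
  qed (use Tp sol_u in auto)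
  \<comment> \<open>Blow-up concerns nonnegative times, where the glued function is
    \<open>Up\<close>.\<close>
  moreover have "S_norm m {t. 0 \<le> t \<and> ereal t < Tp} u = S_norm m {t. 0 \<le> t \<and> ereal t < Tp} Up"
  proof -
    have "(\<lambda>t r. ennreal \<bar>u t r\<bar> * indicator {t. 0 \<le> t \<and> ereal t < Tp} t) = (\<lambda>t r. ennreal \<bar>Up t r\<bar> * indicator {t. 0 \<le> t \<and> ereal t < Tp} t)"
      by (auto simp: fun_eq_iff u_def indicator_def)
    then show ?thesis by (simp add: S_norm_eq)
  qed
  ultimately show ?thesis using blow by (intro exI[of _ "- Tm"] exI[of _ Tp] exI[of _ u]) simp
qed

end

theorem theorem2:
  fixes m \<iota> :: real and u0 u1 :: "real \<Rightarrow> real"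
  assumes "m > 1" and "\<iota> \<in> {1, -1}" and "(u0, u1) \<in> Lm_space m"
  shows "\<exists>Tminus Tplus u. unique_maximal_solution m \<iota> u0 u1 Tminus Tplus u \<and>
    (Tplus < \<infinity> \<longrightarrow> S_norm m {t. 0 \<le> t \<and> ereal t < Tplus} u = \<infinity>)"
proof -
  interpret wave m \<iota> using assms by unfold_locales auto
  show ?thesis by (rule well_posed) (fact assms(3))
qed

end
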